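(* Let $\mathfrak g=\mathfrak{sl}(m|n)$ with $m-n>2$. Any two-sided ideal $\mathfrak K$ in $U(\mathfrak g)$ of infinite codimension, with $\tau(\mathfrak K)=\mathfrak K$, such that the graded ideal $gr(\mathfrak K)$ in $\odot\mathfrak g$ satisfies $$(gr(\mathfrak K)\cap\odot^2\mathfrak g)\oplus\mathfrak g\circledcirc\mathfrak g=\odot^2\mathfrak g,$$ is equal to the Joseph ideal $J_{\lambda^c}$, where $\lambda^c=-\frac{1}{8(m-n+1)}$.
   Context: $\mathfrak g=\mathfrak{sl}(m|n)$ is the Lie superalgebra of $(m+n)\times(m+n)$ complex matrices of zero supertrace, with $[\cdot,\cdot]$ the superbracket; $|i|=0$ for $1\le i\le m$ and $|i|=1$ for $m<i\le m+n$. The classical case $n=0$, i.e. $\mathfrak g=\mathfrak{sl}(m)$, is included. The Borel subalgebra consists of the upper triangular matrices in $\mathfrak g$ and the Cartan subalgebra $\mathfrak h$ of the diagonal ones. Elements of $\mathfrak h^*$ are written as combinations of $\epsilon_1,\dots,\epsilon_m,\delta_1,\dots,\delta_n$ with coefficients adding up to zero ($\epsilon_i$, $\delta_j$ pick out the $i$-th and $(m+j)$-th diagonal entry). $L_\lambda$ is the simple module with highest weight $\lambda$. $\odot\mathfrak g=\bigoplus_k\odot^k\mathfrak g$ is the super symmetric algebra of $\mathfrak g$, identified with the associated graded algebra of $U(\mathfrak g)$ for the standard filtration, and $gr(\mathfrak K)$ is the associated graded ideal of $\mathfrak K$; $\odot^2\mathfrak g=\mathfrak g\odot\mathfrak g$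 is identified with the super symmetric tensors in $\mathfrak g\otimes\mathfrak g$. $\tau$ is the canonical antiautomorphism of $U(\mathfrak g)$ (in the super sense, $\tau(ab)=(-1)^{|a||b|}\tau(b)\tau(a)$), defined by $\tau(X)=-X$ for $X\in\mathfrak g$. Cartan product: when $|m-n|>2$ the $\mathfrak g$-module $\mathfrak g\otimes\mathfrak g$ is a direct sum of simple modules in which $L_{2\epsilon_1-\delta_{n-1}-\delta_n}$ occurs exactly once (for $n=1$ this weight is to be read as $2\epsilon_1-\epsilon_m-\delta_1$, and for $n=0$ as $2\epsilon_1-2\epsilon_m$). The Cartan product $\mathfrak g\circledcirc\mathfrak g$ is this direct summand, and $X\circledcirc Y$ denotes the projection of $X\otimes Y$ onto it along the sum of the other simple summands; $\mathfrak g\circledcirc\mathfrak g\subset\mathfrak g\odot\mathfrak g$. Killing form: $\langle A,B\rangle=2(m-n)\sum_{i,j}(-1)^{|i|}A^i{}_jB^j{}_i$ for $A,B\in\mathfrak g$. For $\lambda\in\mathbb C$, $\mathcal J_\lambda$ is the two-sided ideal of the tensor algebra $T(\mathfrak g)$ generated by $\{X\otimes Y-X\circledcirc Y-\tfrac12[X,Y]-\lambda\langle X,Y\rangle\mid X,Y\in\mathfrak g\}$, and $J_\lambda$ is the unique ideal of $U(\mathfrak g)$ with $T(\mathfrak g)/\mathcal J_\lambda\cong U(\mathfrak g)/J_\lambda$, i.e. the image of $\mathcal J_\lambda$ under $T(\mathfrak g)\to U(\mathfrak g)$. The Joseph ideal is $J_{\lambda^c}$. *)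

theory Defs
  imports
    "HOL-Library.Poly_Mapping"
    "HOL-Algebra.Embedded_Algebras"
    "HOL-Algebra.QuotRing"
    "Jordan_Normal_Form.Matrix"
begin

section \<open>The Lie superalgebra \<open>sl(m|n)\<close>\<close>

text \<open>Rows and columns are numbered from 0, so the index \<open>i\<close> has parity 0 iff \<open>i < m\<close>.
  Parities are the natural numbers 0 and 1.\<close>

definition par :: "nat \<Rightarrow> nat \<Rightarrow> nat" where
  "par m i = (if i < m then 0 else 1)"

definition supertrace :: "nat \<Rightarrow> nat \<Rightarrow> complex mat \<Rightarrow> complex" where
  "supertrace m n A = (\<Sum>i<m+n. (-1) ^ par m i * A $$ (i,i))"

definition sl :: "nat \<Rightarrow> nat \<Rightarrow> complex mat set" where
  "sl m n = {A \<in> carrier_mat (m+n) (m+n). supertrace m n A = 0}"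

definition lpar :: "nat \<Rightarrow> nat \<times> nat \<Rightarrow> nat" where
  "lpar m x = (par m (fst x) + par m (snd x)) mod 2"

definition hom_part :: "nat \<Rightarrow> nat \<Rightarrow> nat \<Rightarrow> complex mat \<Rightarrow> complex mat" where
  "hom_part m n p A =
     mat (m+n) (m+n) (\<lambda>(i,j). if lpar m (i,j) = p then A $$ (i,j) else 0)"

definition sl_hom :: "nat \<Rightarrow> nat \<Rightarrow> nat \<Rightarrow> complex mat set" where
  "sl_hom m n p = {A \<in> sl m n. hom_part m n p A = A}"

text \<open>The bilinear extension of \<open>[A,B] = AB - (-1)\<^bsup>|A||B|\<^esup> BA\<close>; see \<open>sbracket_hom\<close> below.
  The exponent is the product of the parities of the matrix positions \<open>(i,k)\<close> and \<open>(k,j)\<close>.\<close>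

definition sbracket :: "nat \<Rightarrow> nat \<Rightarrow> complex mat \<Rightarrow> complex mat \<Rightarrow> complex mat" where
  "sbracket m n A B = mat (m+n) (m+n) (\<lambda>(i,j). \<Sum>k<m+n.
     A $$ (i,k) * B $$ (k,j) - (-1) ^ (lpar m (i,k) * lpar m (k,j)) * (B $$ (i,k) * A $$ (k,j)))"

definition killing :: "nat \<Rightarrow> nat \<Rightarrow> complex mat \<Rightarrow> complex mat \<Rightarrow> complex" where
  "killing m n A B = 2 * (of_nat m - of_nat n) *
     (\<Sum>i<m+n. \<Sum>j<m+n. (-1) ^ par m i * A $$ (i,j) * B $$ (j,i))"

lemma hom_part_entry_zero:
  assumes "A \<in> sl_hom m n p" "i < m+n" "j < m+n" "lpar m (i,j) \<noteq> p"
  shows "A $$ (i,j) = 0"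
proof -
  have "A $$ (i,j) = hom_part m n p A $$ (i,j)" using assms by (simp add: sl_hom_def)
  also have "\<dots> = 0" using assms by (simp add: hom_part_def)
  finally show ?thesis .
qed

lemma sbracket_hom:
  assumes A: "A \<in> sl_hom m n p" and B: "B \<in> sl_hom m n q"
  shows "sbracket m n A B = A * B - (-1) ^ (p * q) \<cdot>\<^sub>m (B * A)"
proof (rule eq_matI)
  have cA: "A \<in> carrier_mat (m+n) (m+n)" and cB: "B \<in> carrier_mat (m+n) (m+n)"
    using A B by (auto simp: sl_hom_def sl_def)
  show "dim_row (sbracket m n A B) = dim_row (A * B - (-1) ^ (p * q) \<cdot>\<^sub>m (B * A))"
       "dim_col (sbracket m n A B) = dim_col (A * B - (-1) ^ (p * q) \<cdot>\<^sub>m (B * A))"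
    using cA cB by (auto simp: sbracket_def)
  fix i j
  assume "i < dim_row (A * B - (-1) ^ (p * q) \<cdot>\<^sub>m (B * A))"
         "j < dim_col (A * B - (-1) ^ (p * q) \<cdot>\<^sub>m (B * A))"
  then have ij: "i < m+n" "j < m+n" using cA cB by auto
  have sgn: "(-1) ^ (lpar m (i,k) * lpar m (k,j)) * (B $$ (i,k) * A $$ (k,j))
      = (-1) ^ (p * q) * (B $$ (i,k) * A $$ (k,j))" if k: "k < m+n" for k
  proof (cases "lpar m (i,k) = q \<and> lpar m (k,j) = p")
    case True then show ?thesis by (simp add: mult.commute)
  next
    case False
    then have "B $$ (i,k) * A $$ (k,j) = 0"
      using hom_part_entry_zero[OF A k ij(2)] hom_part_entry_zero[OF B ij(1) k] by auto
    then show ?thesis by (simp only: mult_zero_right)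
  qed
  have "sbracket m n A B $$ (i,j) = (\<Sum>k<m+n. A $$ (i,k) * B $$ (k,j)
      - (-1) ^ (p * q) * (B $$ (i,k) * A $$ (k,j)))"
    using ij by (simp add: sbracket_def sgn)
  also have "\<dots> = (A * B - (-1) ^ (p * q) \<cdot>\<^sub>m (B * A)) $$ (i,j)"
    using cA cB ij by (simp add: scalar_prod_def sum_subtractf sum_distrib_left lessThan_atLeast0)
  finally show "sbracket m n A B $$ (i,j) = (A * B - (-1) ^ (p * q) \<cdot>\<^sub>m (B * A)) $$ (i,j)" .
qed


section \<open>The tensor algebra\<close>

text \<open>The monoid algebra of the free monoid on the matrix positions \<open>(i,j)\<close> is the tensor algebra
  of the space of all matrices; a matrix \<open>A\<close> is the element \<open>emb m n A\<close> of degree one, and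
  \<open>T(g)\<close> is the subalgebra generated by \<open>g\<close>. Multiplication in it is the tensor product.\<close>

datatype word = Word (letters: "(nat \<times> nat) list")

instantiation word :: monoid_add
begin
definition zero_word :: word where "0 = Word []"
definition plus_word :: "word \<Rightarrow> word \<Rightarrow> word" where "v + w = Word (letters v @ letters w)"
instance by standard (simp_all add: zero_word_def plus_word_def)
end

type_synonym tensor = "word \<Rightarrow>\<^sub>0 complex"

definition tscale :: "complex \<Rightarrow> tensor \<Rightarrow> tensor" where
  "tscale c t = Poly_Mapping.single 0 c * t"

global_interpretation tv: vector_space tscale
  by standard
    (simp_all add: tscale_def distrib_left distrib_right single_add mult.assoc[symmetric] mult_single)

definition lin_ext :: "(word \<Rightarrow> tensor) \<Rightarrow> tensor \<Rightarrow> tensor" where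
  "lin_ext f t = (\<Sum>w\<in>Poly_Mapping.keys t. tscale (Poly_Mapping.lookup t w) (f w))"

definition letter :: "nat \<times> nat \<Rightarrow> tensor" where
  "letter x = Poly_Mapping.single (Word [x]) 1"

definition emb :: "nat \<Rightarrow> nat \<Rightarrow> complex mat \<Rightarrow> tensor" where
  "emb m n A = (\<Sum>i<m+n. \<Sum>j<m+n. tscale (A $$ (i,j)) (letter (i,j)))"

definition tens :: "nat \<Rightarrow> nat \<Rightarrow> nat \<Rightarrow> tensor set" where
  "tens m n k = tv.span {prod_list (map (emb m n) Xs) | Xs. set Xs \<subseteq> sl m n \<and> length Xs = k}"

definition tensor_alg :: "nat \<Rightarrow> nat \<Rightarrow> tensor ring" where
  "tensor_alg m n =
     \<lparr>carrier = tv.span (\<Union>k. tens m n k), monoid.mult = (*), one = 1, zero = 0, add = (+)\<rparr>"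

lemma tscale_mult_right: "x * tscale c y = tscale c (x * y)"
proof -
  have "x * Poly_Mapping.single 0 c = Poly_Mapping.single 0 c * x" for x :: tensor
  proof (induction x rule: update_induct)
    case const then show ?case by simp
  next
    case (update f a b)
    have "Poly_Mapping.update a b f = f + Poly_Mapping.single a b"
      using update(1)
      by (intro poly_mapping_eqI) (auto simp: lookup_update lookup_add lookup_single in_keys_iff)
    then show ?case using update(3)
      by (simp add: mult_single distrib_left distrib_right mult.commute)
  qed
  then show ?thesis by (simp add: tscale_def mult.assoc[symmetric])
qed

lemma tensor_alg_carrier:
  "carrier (tensor_alg m n) = tv.span {prod_list (map (emb m n) Xs) | Xs. set Xs \<subseteq> sl m n}"
    (is "_ = tv.span ?P")
proof -
  have "tens m n k \<subseteq> tv.span ?P" for k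
    unfolding tens_def by (rule tv.span_mono) auto
  then have "tv.span (\<Union>k. tens m n k) \<subseteq> tv.span ?P"
    by (intro tv.span_minimal tv.subspace_span) auto
  moreover have "x \<in> (\<Union>k. tens m n k)" if "x \<in> ?P" for x
    using that unfolding tens_def by (blast intro: tv.span_base)
  then have "tv.span ?P \<subseteq> tv.span (\<Union>k. tens m n k)"
    by (intro tv.span_mono) blast
  ultimately show ?thesis by (simp add: tensor_alg_def)
qed

lemma tensor_alg_ring: "ring (tensor_alg m n)"
proof -
  let ?P = "{prod_list (map (emb m n) Xs) | Xs. set Xs \<subseteq> sl m n}"
  let ?C = "carrier (tensor_alg m n)"
  have C: "?C = tv.span ?P" by (rule tensor_alg_carrier)
  have one: "1 \<in> ?C"
    unfolding C by (rule tv.span_base) (auto intro!: exI[of _ "[]"])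
  have base: "x * y \<in> ?C" if x: "x \<in> ?P" and y: "y \<in> ?P" for x y
  proof -
    obtain Xs where "x = prod_list (map (emb m n) Xs)" "set Xs \<subseteq> sl m n"
      using x by auto
    moreover obtain Ys where "y = prod_list (map (emb m n) Ys)" "set Ys \<subseteq> sl m n"
      using y by auto
    ultimately show ?thesis
      unfolding C by (intro tv.span_base) (auto intro!: exI[of _ "Xs @ Ys"])
  qed
  have mult: "x * y \<in> ?C" if x: "x \<in> ?C" and y: "y \<in> ?C" for x y
  proof -
    have 1: "x * y \<in> ?C" if x: "x \<in> ?P" for x
      using y[unfolded C]
    proof (induction rule: tv.span_induct_alt)
      case base then show ?case by (simp add: C tv.span_zero)
    next
      case (step c u v)
      then show ?case using \<open>\<And>x y. x \<in> ?P \<Longrightarrow> y \<in> ?P \<Longrightarrow> x * y \<in> ?C\<close>[OF x step(1)]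
        by (simp add: C distrib_left tscale_mult_right tv.span_add tv.span_scale)
    qed
    show ?thesis
      using x[unfolded C]
    proof (induction rule: tv.span_induct_alt)
      case base then show ?case by (simp add: C tv.span_zero)
    next
      case (step c u v)
      have "tscale c u * y = tscale c (u * y)" by (simp add: tscale_def mult.assoc)
      then show ?case using step 1[OF step(1)]
        by (simp add: C distrib_right tv.span_add tv.span_scale)
    qed
  qed
  have add: "x + y \<in> ?C" if "x \<in> ?C" "y \<in> ?C" for x y
    using that by (simp add: C tv.span_add)
  have neg: "- x \<in> ?C" if "x \<in> ?C" for x
    using that by (simp add: C tv.span_neg)
  have zero: "0 \<in> ?C" by (simp add: C tv.span_zero)
  have ops: "x \<otimes>\<^bsub>tensor_alg m n\<^esub> y = x * y" "x \<oplus>\<^bsub>tensor_alg m n\<^esub> y = x + y"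
      "\<one>\<^bsub>tensor_alg m n\<^esub> = 1" "\<zero>\<^bsub>tensor_alg m n\<^esub> = 0" for x y
    by (simp_all add: tensor_alg_def)
  show ?thesis
  proof (rule ringI)
    show "abelian_group (tensor_alg m n)"
    proof (rule abelian_groupI)
      fix x assume "x \<in> ?C"
      then show "\<exists>y\<in>?C. y \<oplus>\<^bsub>tensor_alg m n\<^esub> x = \<zero>\<^bsub>tensor_alg m n\<^esub>"
        using neg by (intro bexI[of _ "- x"]) (simp_all add: ops)
    qed (simp_all add: ops add zero algebra_simps)
    show "monoid (tensor_alg m n)"
      by (rule monoidI) (simp_all add: ops one mult algebra_simps)
  qed (simp_all add: ops algebra_simps)
qed


section \<open>The enveloping algebra and the super symmetric algebra\<close>

definition env_rel :: "nat \<Rightarrow> nat \<Rightarrow> tensor set" where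
  "env_rel m n = {emb m n X * emb m n Y - tscale ((-1) ^ (p * q)) (emb m n Y * emb m n X)
       - emb m n (sbracket m n X Y) | X Y p q.
     p < 2 \<and> q < 2 \<and> X \<in> sl_hom m n p \<and> Y \<in> sl_hom m n q}"

definition sym_rel :: "nat \<Rightarrow> nat \<Rightarrow> tensor set" where
  "sym_rel m n = {emb m n X * emb m n Y - tscale ((-1) ^ (p * q)) (emb m n Y * emb m n X) | X Y p q.
     p < 2 \<and> q < 2 \<and> X \<in> sl_hom m n p \<and> Y \<in> sl_hom m n q}"

definition env_ideal :: "nat \<Rightarrow> nat \<Rightarrow> tensor set" where
  "env_ideal m n = Idl\<^bsub>tensor_alg m n\<^esub> (env_rel m n)"

definition sym_ideal :: "nat \<Rightarrow> nat \<Rightarrow> tensor set" where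
  "sym_ideal m n = Idl\<^bsub>tensor_alg m n\<^esub> (sym_rel m n)"

definition env_alg :: "nat \<Rightarrow> nat \<Rightarrow> tensor set ring" where
  "env_alg m n = tensor_alg m n Quot env_ideal m n"

definition sym_alg :: "nat \<Rightarrow> nat \<Rightarrow> tensor set ring" where
  "sym_alg m n = tensor_alg m n Quot sym_ideal m n"

definition to_env :: "nat \<Rightarrow> nat \<Rightarrow> tensor \<Rightarrow> tensor set" where
  "to_env m n t = env_ideal m n +>\<^bsub>tensor_alg m n\<^esub> t"

definition to_sym :: "nat \<Rightarrow> nat \<Rightarrow> tensor \<Rightarrow> tensor set" where
  "to_sym m n t = sym_ideal m n +>\<^bsub>tensor_alg m n\<^esub> t"

definition sym_pow :: "nat \<Rightarrow> nat \<Rightarrow> nat \<Rightarrow> tensor set set" where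
  "sym_pow m n k = to_sym m n ` tens m n k"

text \<open>The dimension of the complex algebra \<open>U(g)/K\<close> is taken over its subring of scalars.\<close>

definition infinite_codim :: "nat \<Rightarrow> nat \<Rightarrow> tensor set set \<Rightarrow> bool" where
  "infinite_codim m n K \<longleftrightarrow>
     \<not> ring.finite_dimension (env_alg m n Quot K)
         {K +>\<^bsub>env_alg m n\<^esub> to_env m n (tscale c 1) | c. True}
         (carrier (env_alg m n Quot K))"


section \<open>The canonical antiautomorphism\<close>

text \<open>On words this is the recursion \<open>\<tau>(x v) = (-1)\<^bsup>|x||v|\<^esup> \<tau>(v) \<tau>(x)\<close>,
  \<open>\<tau>(x) = - x\<close> for a letter \<open>x\<close>.\<close>

definition wpar :: "nat \<Rightarrow> (nat \<times> nat) list \<Rightarrow> nat" where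
  "wpar m xs = (\<Sum>x\<leftarrow>xs. lpar m x)"

fun tau_word :: "nat \<Rightarrow> (nat \<times> nat) list \<Rightarrow> tensor" where
  "tau_word m [] = 1"
| "tau_word m (x # xs) = tscale ((-1) ^ (lpar m x * wpar m xs)) (tau_word m xs * (- letter x))"

definition tau_tensor :: "nat \<Rightarrow> tensor \<Rightarrow> tensor" where
  "tau_tensor m = lin_ext (\<lambda>w. tau_word m (letters w))"

text \<open>Since \<open>\<tau>\<close> maps \<open>env_ideal m n\<close> onto itself, the image of the coset of \<open>t\<close>
  is the coset of \<open>\<tau>(t)\<close>.\<close>

definition tau :: "nat \<Rightarrow> tensor set \<Rightarrow> tensor set" where
  "tau m u = tau_tensor m ` u"

lemma tau_word_append:
  "tau_word m (xs @ ys) = tscale ((-1) ^ (wpar m xs * wpar m ys)) (tau_word m ys * tau_word m xs)"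
proof (induction xs)
  case Nil then show ?case by (simp add: wpar_def)
next
  case (Cons x xs)
  have l: "tscale c u * v = tscale c (u * v)" for c u v by (simp add: tscale_def mult.assoc)
  show ?case
    by (simp add: Cons l tscale_mult_right mult.assoc wpar_def algebra_simps power_add)
qed


section \<open>The associated graded ideal\<close>

text \<open>\<open>env_below m n k\<close> is the filtration step \<open>U\<^bsub>k-1\<^esub>\<close>, which is zero for \<open>k = 0\<close>.\<close>

definition env_below :: "nat \<Rightarrow> nat \<Rightarrow> nat \<Rightarrow> tensor set set" where
  "env_below m n k = to_env m n ` tv.span (\<Union>j<k. tens m n j)"

text \<open>The identification of the degree \<open>k\<close> part of the super symmetric algebra with
  \<open>U\<^bsub>k\<^esub>/U\<^bsub>k-1\<^esub>\<close> sends the class of \<open>t \<in> \<otimes>\<^sup>k g\<close> to that of its image in \<open>U(g)\<close>.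
  Hence \<open>t\<close> represents an element of \<open>gr(K)\<close> iff its image lies in
  \<open>(K \<inter> U\<^bsub>k\<^esub>) + U\<^bsub>k-1\<^esub>\<close>.\<close>

definition gr_rep :: "nat \<Rightarrow> nat \<Rightarrow> tensor set set \<Rightarrow> nat \<Rightarrow> tensor set" where
  "gr_rep m n K k = {t \<in> tens m n k.
     to_env m n t \<in> (K \<inter> env_below m n (Suc k)) <+>\<^bsub>env_alg m n\<^esub> env_below m n k}"

definition gr :: "nat \<Rightarrow> nat \<Rightarrow> tensor set set \<Rightarrow> tensor set set" where
  "gr m n K = to_sym m n ` tv.span (\<Union>k. gr_rep m n K k)"


section \<open>The Cartan product\<close>

text \<open>The adjoint action on tensors; \<open>act_word m n p A\<close> is the superderivation extending
  \<open>[A, _]\<close> for \<open>A\<close> homogeneous of parity \<open>p\<close>.\<close>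

definition unit_mat :: "nat \<Rightarrow> nat \<Rightarrow> nat \<times> nat \<Rightarrow> complex mat" where
  "unit_mat m n x = mat (m+n) (m+n) (\<lambda>y. if y = x then 1 else 0)"

fun act_word :: "nat \<Rightarrow> nat \<Rightarrow> nat \<Rightarrow> complex mat \<Rightarrow> (nat \<times> nat) list \<Rightarrow> tensor" where
  "act_word m n p A [] = 0"
| "act_word m n p A (x # xs) =
     emb m n (sbracket m n A (unit_mat m n x)) * Poly_Mapping.single (Word xs) 1
     + tscale ((-1) ^ (p * lpar m x)) (letter x * act_word m n p A xs)"

definition act :: "nat \<Rightarrow> nat \<Rightarrow> complex mat \<Rightarrow> tensor \<Rightarrow> tensor" where
  "act m n A t = (\<Sum>p<2. lin_ext (\<lambda>w. act_word m n p (hom_part m n p A) (letters w)) t)"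

definition submodule2 :: "nat \<Rightarrow> nat \<Rightarrow> tensor set \<Rightarrow> bool" where
  "submodule2 m n M \<longleftrightarrow> M \<subseteq> tens m n 2 \<and> tv.subspace M \<and> (\<forall>A\<in>sl m n. act m n A ` M \<subseteq> M)"

definition simple_submodule2 :: "nat \<Rightarrow> nat \<Rightarrow> tensor set \<Rightarrow> bool" where
  "simple_submodule2 m n M \<longleftrightarrow> submodule2 m n M \<and> M \<noteq> {0} \<and>
     (\<forall>N. submodule2 m n N \<and> N \<subseteq> M \<longrightarrow> N = {0} \<or> N = M)"

definition has_highest_weight ::
    "nat \<Rightarrow> nat \<Rightarrow> (complex mat \<Rightarrow> complex) \<Rightarrow> tensor set \<Rightarrow> bool" where
  "has_highest_weight m n wt M \<longleftrightarrow> (\<exists>v\<in>M. v \<noteq> 0 \<and>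
     (\<forall>H\<in>sl m n. diagonal_mat H \<longrightarrow> act m n H v = tscale (wt H) v) \<and>
     (\<forall>A\<in>sl m n. (\<forall>i<m+n. \<forall>j\<le>i. A $$ (i,j) = 0) \<longrightarrow> act m n A v = 0))"

text \<open>\<open>\<epsilon>\<^sub>i\<close> and \<open>\<delta>\<^sub>j\<close> are numbered from 1.\<close>

definition eps :: "nat \<Rightarrow> complex mat \<Rightarrow> complex" where
  "eps i H = H $$ (i - 1, i - 1)"

definition delta :: "nat \<Rightarrow> nat \<Rightarrow> complex mat \<Rightarrow> complex" where
  "delta m j H = H $$ (m + j - 1, m + j - 1)"

definition cartan_weight :: "nat \<Rightarrow> nat \<Rightarrow> complex mat \<Rightarrow> complex" where
  "cartan_weight m n H =
     (if n = 0 then 2 * eps 1 H - 2 * eps m H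
      else if n = 1 then 2 * eps 1 H - eps m H - delta m 1 H
      else 2 * eps 1 H - delta m (n - 1) H - delta m n H)"

text \<open>For \<open>|m - n| > 2\<close> the module \<open>g \<otimes> g\<close> is semisimple and the simple module of highest weight
  \<open>cartan_weight m n\<close> occurs once in it. The submodule below is therefore unique, and the sum of
  the other simple summands is the sum of all other simple submodules.\<close>

definition cartan_square :: "nat \<Rightarrow> nat \<Rightarrow> tensor set" where
  "cartan_square m n =
     (THE M. simple_submodule2 m n M \<and> has_highest_weight m n (cartan_weight m n) M)"

definition cartan_complement :: "nat \<Rightarrow> nat \<Rightarrow> tensor set" where
  "cartan_complement m n = tv.span (\<Union>{M. simple_submodule2 m n M \<and> M \<noteq> cartan_square m n})"

definition cartan_product :: "nat \<Rightarrow> nat \<Rightarrow> complex mat \<Rightarrow> complex mat \<Rightarrow> tensor" where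
  "cartan_product m n X Y =
     (THE t. t \<in> cartan_square m n \<and> emb m n X * emb m n Y - t \<in> cartan_complement m n)"


section \<open>The ideals \<open>J\<^sub>\<lambda>\<close>\<close>

definition J_tensor :: "nat \<Rightarrow> nat \<Rightarrow> complex \<Rightarrow> tensor set" where
  "J_tensor m n l = Idl\<^bsub>tensor_alg m n\<^esub>
     {emb m n X * emb m n Y - cartan_product m n X Y - tscale (1/2) (emb m n (sbracket m n X Y))
        - tscale (l * killing m n X Y) 1 | X Y. X \<in> sl m n \<and> Y \<in> sl m n}"

definition J_env :: "nat \<Rightarrow> nat \<Rightarrow> complex \<Rightarrow> tensor set set" where
  "J_env m n l = to_env m n ` J_tensor m n l"

definition lambda_c :: "nat \<Rightarrow> nat \<Rightarrow> complex" where
  "lambda_c m n = - 1 / (8 * (of_nat m - of_nat n + 1))"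

end

theory Submission
  imports Defs
begin

text \<open>
  Write \<open>e\<^sub>i\<^sub>j\<close> for the traceless part of the matrix unit \<open>E\<^sub>i\<^sub>j\<close> and pull \<open>K\<close> back to a
  two-sided ideal \<open>Kt\<close> of the tensor algebra. Modulo \<open>Kt\<close> a tensor of degree two in the complement of the
  Cartan square is of lower degree; invariance under \<open>\<tau>\<close> removes the part of degree one of the
  symmetric ones, and what remains is an invariant form, hence a multiple \<open>\<lambda>\<close> of the Killing form.
  So \<open>J\<^sub>\<lambda> \<subseteq> K\<close>, and reducing a cubic monomial in two ways forces \<open>\<lambda> = \<lambda>\<^sup>c\<close>, as \<open>K\<close> would otherwise
  contain \<open>g\<close>. If \<open>K\<close> were larger than \<open>J\<^sub>\<lambda>\<close>, the leading term of an element of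
  \<open>K - J\<^sub>\<lambda>\<close>, moved by the adjoint action, would put every power \<open>e\<^sub>a\<^sub>b\<^sup>k\<close>
  with \<open>a \<noteq> b\<close> even into \<open>K\<close> up to lower degree. All long words then are of lower degree modulo \<open>K\<close>,
  so that \<open>K\<close> would have finite codimension.\<close>

section \<open>Linear maps on tensors\<close>

text \<open>Finite-dimensional modules over sl(m|n) need not be completely reducible, so the
  splitting of the tensor square into Cartan square and complement has to be proved. A bilinear form
  for which opposite matrix units are adjoint takes the place of unitarity. As it is complex
  bilinear, vectors may be isotropic; nondegeneracy on submodules is recovered from weight spaces
  whose coordinates all agree up to sign. The hypothesis m - n > 2 enters in three ways: m - n and
  its neighbours up to distance 2 are divided by, three even indices are available, and m > n forces
  an odd index to repeat whenever all even weights are negative. The Cartan square is symmetric, in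
  the super sense, in its upper and in its lower indices. Modulo lower degree a word therefore
  depends, up to a scalar, only on its two multisets of indices, and a repeated odd upper or lower
  index makes it zero. This is why powers with even indices suffice and why the last step is a
  pigeonhole argument. No Poincare-Birkhoff-Witt basis is used: everything is measured by the length
  of words modulo the ideal.\<close>

lemma tscale_mult_left: "tscale c x * y = tscale c (x * y)"
  by (simp add: tscale_def mult.assoc)

lemma lookup_tscale [simp]: "Poly_Mapping.lookup (tscale c t) w = c * Poly_Mapping.lookup t w"
proof (induction t rule: update_induct)
  case const then show ?case by (simp add: tscale_def)
next
  case (update f a b)
  have u: "Poly_Mapping.update a b f = f + Poly_Mapping.single a b"
    using update(1)
    by (intro poly_mapping_eqI) (auto simp: lookup_update lookup_add lookup_single in_keys_iff)
  show ?case using update(3)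
    unfolding u by (simp add: tv.scale_right_distrib lookup_add distrib_left)
      (simp add: tscale_def mult_single lookup_single when_def)
qed

definition tlin :: "(tensor \<Rightarrow> tensor) \<Rightarrow> bool" where
  "tlin f \<longleftrightarrow> (\<forall>x y. f (x + y) = f x + f y) \<and> (\<forall>c x. f (tscale c x) = tscale c (f x))"

lemma tlinI: "(\<And>x y. f (x + y) = f x + f y) \<Longrightarrow> (\<And>c x. f (tscale c x) = tscale c (f x)) \<Longrightarrow> tlin f"
  by (simp add: tlin_def)

lemma tlin_add: "tlin f \<Longrightarrow> f (x + y) = f x + f y"
  and tlin_scale: "tlin f \<Longrightarrow> f (tscale c x) = tscale c (f x)"
  by (simp_all add: tlin_def)

lemma tlin_0: "tlin f \<Longrightarrow> f 0 = 0"
  using tlin_scale[of f 0 0] by simp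

lemma tlin_neg: "tlin f \<Longrightarrow> f (- x) = - f x"
  using tlin_scale[of f "-1" x] by simp

lemma tlin_diff: "tlin f \<Longrightarrow> f (x - y) = f x - f y"
  using tlin_add[of f x "- y"] tlin_neg[of f y] by simp

lemma tlin_sum: "tlin f \<Longrightarrow> f (sum g A) = (\<Sum>a\<in>A. f (g a))"
  by (induction A rule: infinite_finite_induct) (simp_all add: tlin_0 tlin_add)

lemma tlin_span:
  assumes "tlin f" "tv.subspace V" "x \<in> tv.span S" "\<And>y. y \<in> S \<Longrightarrow> f y \<in> V"
  shows "f x \<in> V"
  using assms(3)
proof (induction rule: tv.span_induct_alt)
  case base then show ?case using assms by (simp add: tlin_0 tv.subspace_0)
next
  case (step c u v)
  then show ?case using assms
    by (simp add: tlin_add tlin_scale tv.subspace_add tv.subspace_scale)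
qed

lemma tlin_mult_left: "tlin (\<lambda>x. a * x)"
  by (rule tlinI) (simp_all add: distrib_left tscale_mult_right)

lemma tlin_mult_right: "tlin (\<lambda>x. x * a)"
  by (rule tlinI) (simp_all add: distrib_right tscale_mult_left)

lemma tlin_comp: "tlin f \<Longrightarrow> tlin g \<Longrightarrow> tlin (\<lambda>x. f (g x))"
  by (simp add: tlin_def)

lemma tlin_plus: "tlin f \<Longrightarrow> tlin g \<Longrightarrow> tlin (\<lambda>x. f x + g x)"
  by (simp add: tlin_def algebra_simps tv.scale_right_distrib)

lemma tlin_minus: "tlin f \<Longrightarrow> tlin g \<Longrightarrow> tlin (\<lambda>x. f x - g x)"
  by (simp add: tlin_def algebra_simps tv.scale_right_diff_distrib)

lemma tlin_cmul: "tlin f \<Longrightarrow> tlin (\<lambda>x. tscale c (f x))"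
  by (simp add: tlin_def algebra_simps tv.scale_right_distrib)

lemma tlin_id: "tlin (\<lambda>x. x)"
  by (simp add: tlin_def)

lemma subspace_vimage: "tlin f \<Longrightarrow> tv.subspace V \<Longrightarrow> tv.subspace {x. f x \<in> V}"
  by (auto simp: tv.subspace_def tlin_0 tlin_add tlin_scale)

lemma subspace_image: "tlin f \<Longrightarrow> tv.subspace V \<Longrightarrow> tv.subspace (f ` V)"
  unfolding tv.subspace_def
proof (intro conjI ballI allI)
  assume f: "tlin f" and V: "0 \<in> V \<and> (\<forall>x\<in>V. \<forall>y\<in>V. x + y \<in> V) \<and> (\<forall>c. \<forall>x\<in>V. tscale c x \<in> V)"
  show "0 \<in> f ` V" using f V tlin_0 by (metis image_eqI)
  show "x + y \<in> f ` V" if "x \<in> f ` V" "y \<in> f ` V" for x y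
    using that f V by (auto simp: tlin_add[symmetric])
  show "tscale c x \<in> f ` V" if "x \<in> f ` V" for x c
    using that f V by (auto simp: tlin_scale[symmetric])
qed

text \<open>Serves the reduction arguments: since the tensors reducible to \<open>A\<close> modulo
  \<open>B\<close> form a subspace, only generators have to be reduced.\<close>

lemma subspace_mod: assumes "tv.subspace A" "tv.subspace B" shows "tv.subspace {t. \<exists>u\<in>A. t - u \<in> B}"
proof -
  have "{t. \<exists>u\<in>A. t - u \<in> B} = {u + b | u b. u \<in> A \<and> b \<in> B}"
  proof (intro equalityI subsetI)
    fix t assume "t \<in> {t. \<exists>u\<in>A. t - u \<in> B}"
    then obtain u where "u \<in> A" "t - u \<in> B" by blast
    then show "t \<in> {u + b | u b. u \<in> A \<and> b \<in> B}" by (intro CollectI exI[of _ u] exI[of _ "t - u"]) simp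
  next
    fix t assume "t \<in> {u + b | u b. u \<in> A \<and> b \<in> B}"
    then obtain u b where "t = u + b" "u \<in> A" "b \<in> B" by blast
    then show "t \<in> {t. \<exists>u\<in>A. t - u \<in> B}" by (intro CollectI bexI[of _ u]) simp_all
  qed
  then show ?thesis using tv.subspace_sums[OF assms] by simp
qed

lemma tlin_eq_span:
  assumes "tlin f" "tlin g" "x \<in> tv.span S" "\<And>y. y \<in> S \<Longrightarrow> f y = g y"
  shows "f x = g x"
  using tlin_span[of "\<lambda>x. f x - g x" "{0}" x S] assms by (simp add: tlin_minus tv.subspace_def)

lemma lin_ext_sup:
  assumes "finite A" "Poly_Mapping.keys t \<subseteq> A"
  shows "lin_ext f t = (\<Sum>w\<in>A. tscale (Poly_Mapping.lookup t w) (f w))"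
  unfolding lin_ext_def using assms
  by (intro sum.mono_neutral_left) (auto simp: in_keys_iff)

lemma tlin_lin_ext: "tlin (lin_ext f)"
proof (rule tlinI)
  fix x y :: tensor
  let ?A = "Poly_Mapping.keys x \<union> Poly_Mapping.keys y"
  have "lin_ext f z = (\<Sum>w\<in>?A. tscale (Poly_Mapping.lookup z w) (f w))"
    if "z \<in> {x, y, x + y}" for z
    using that Poly_Mapping.keys_add[of x y] by (intro lin_ext_sup) auto
  then show "lin_ext f (x + y) = lin_ext f x + lin_ext f y"
    by (simp add: lookup_add tv.scale_left_distrib sum.distrib)
next
  fix c :: complex and x :: tensor
  have "Poly_Mapping.keys (tscale c x) \<subseteq> Poly_Mapping.keys x" by (auto simp: in_keys_iff)
  then have "lin_ext f (tscale c x)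
      = (\<Sum>w\<in>Poly_Mapping.keys x. tscale (Poly_Mapping.lookup (tscale c x) w) (f w))"
    by (intro lin_ext_sup) auto
  then show "lin_ext f (tscale c x) = tscale c (lin_ext f x)"
    by (simp add: lin_ext_def tv.scale_sum_right)
qed

section \<open>Words as a spanning set with known coefficients\<close>

definition wd :: "(nat \<times> nat) list \<Rightarrow> tensor" where
  "wd w = Poly_Mapping.single (Word w) 1"

lemma lin_ext_wd [simp]: "lin_ext f (wd w) = f (Word w)"
  by (simp add: lin_ext_def wd_def)

lemma wd_Nil: "wd [] = 1"
  by (simp add: wd_def zero_word_def[symmetric])

lemma wd_append: "wd (u @ v) = wd u * wd v"
  by (simp add: wd_def mult_single plus_word_def)

lemma wd_Cons: "wd (x # w) = letter x * wd w"
  using wd_append[of "[x]" w] by (simp add: wd_def letter_def)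

lemma letter_wd: "letter x = wd [x]"
  by (simp add: wd_def letter_def)

lemma lookup_wd: "Poly_Mapping.lookup (wd v) (Word w) = (if v = w then 1 else 0)"
  by (auto simp: wd_def lookup_single when_def)

lemma tensor_span_wd: "t \<in> tv.span (range wd)"
proof (induction t rule: update_induct)
  case const then show ?case by (simp add: tv.span_zero)
next
  case (update f a b)
  have u: "Poly_Mapping.update a b f = f + tscale b (wd (letters a))"
    using update(1)
    by (intro poly_mapping_eqI) (auto simp: lookup_update lookup_add lookup_single in_keys_iff wd_def when_def)
  show ?case unfolding u using update
    by (intro tv.span_add tv.span_scale) (auto intro: tv.span_base)
qed

lemma tlin_eq_wd: "tlin f \<Longrightarrow> tlin g \<Longrightarrow> (\<And>w. f (wd w) = g (wd w)) \<Longrightarrow> f t = g t"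
  using tlin_eq_span[OF _ _ tensor_span_wd] by blast

text \<open>Applying \<open>D - u\<close> kills the component for \<open>u\<close> and multiplies
  the others by the nonzero numbers \<open>v - u\<close>, so the components can be peeled off by
  induction on the number of eigenvalues. Every weight argument rests on this.\<close>

lemma eigen_components:
  assumes "tv.subspace S" "tlin D" "\<And>x. x \<in> S \<Longrightarrow> D x \<in> S" "finite V"
    and "(\<Sum>v\<in>V. x v) \<in> S" "\<And>v. v \<in> V \<Longrightarrow> D (x v) = tscale v (x v)" "v \<in> V"
  shows "x v \<in> S"
  using assms(4-)
proof (induction V arbitrary: x v rule: finite_induct)
  case empty then show ?case by simp
next
  case (insert u V)
  have "D (sum x (insert u V)) - tscale u (sum x (insert u V))
      = (\<Sum>v\<in>insert u V. tscale (v - u) (x v))"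
    using insert.prems(2) assms(2)
    by (simp add: tlin_sum tv.scale_sum_right tv.scale_left_diff_distrib sum_subtractf del: sum.insert)
  also have "\<dots> = (\<Sum>v\<in>V. tscale (v - u) (x v))" using insert.hyps by simp
  finally have "(\<Sum>v\<in>V. tscale (v - u) (x v)) \<in> S"
    using insert.prems(1) assms(1,3) by (metis tv.subspace_diff tv.subspace_scale)
  then have "tscale (v - u) (x v) \<in> S" if "v \<in> V" for v
    using insert.IH[of "\<lambda>v. tscale (v - u) (x v)" v] insert.prems(2) that assms(2)
    by (simp add: tlin_scale mult.commute)
  then have "tscale (inverse (v - u)) (tscale (v - u) (x v)) \<in> S" if "v \<in> V" for v
    using that assms(1) tv.subspace_scale by blast
  then have V: "x v \<in> S" if "v \<in> V" for v
  proof -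
    have "v \<noteq> u" using that insert.hyps(2) by auto
    then show ?thesis using \<open>\<And>v. v \<in> V \<Longrightarrow> tscale (inverse (v - u)) (tscale (v - u) (x v)) \<in> S\<close>[OF that]
      by simp
  qed
  have "x u = sum x (insert u V) - sum x V" using insert.hyps by simp
  then have "x u \<in> S"
    using insert.prems(1) V assms(1) by (metis tv.subspace_diff tv.subspace_sum)
  then show ?case using V insert.prems(3) by auto
qed

section \<open>Generators of the tensor algebra\<close>

locale sl_super =
  fixes m n :: nat
  assumes mn: "m > n + 2"
begin

abbreviation d :: nat where "d \<equiv> m + n"

text \<open>The superdimension of the natural module, that is, the supertrace of the identity
  (\<open>sum_s\<close>).\<close>

definition N :: complex where "N = of_nat m - of_nat n"

definition s :: "nat \<Rightarrow> complex" where "s i = (if i < m then 1 else -1)"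

text \<open>The Koszul sign (-1)^(|i||j|) for exchanging two basis vectors of the natural module; on
  the diagonal it is \<open>s i\<close>, so odd indices anticommute with themselves.\<close>

definition chi :: "nat \<Rightarrow> nat \<Rightarrow> complex" where "chi i j = (if i < m \<or> j < m then 1 else -1)"

lemma N_nat: "N = of_nat (m - n)" "m - n > 2"
  using mn by (simp_all add: N_def of_nat_diff)

text \<open>These are the denominators to come: \<open>N\<close> for removing the identity,
  \<open>N\<close> with a shift by 0, 1 or 2 for removing contractions, and \<open>N + 1\<close> for
  the critical parameter. With \<open>m - n = k + 3\<close> each of them is a positive natural
  number.\<close>

lemma N_nz: "N \<noteq> 0" "N + 1 \<noteq> 0" "N - 1 \<noteq> 0" "N + 2 \<noteq> 0" "N - 2 \<noteq> 0"
proof -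
  obtain k where k: "m - n = k + 3" using N_nat(2) by (metis add.commute less_eqE numeral_3_eq_3 Suc_leI numeral_2_eq_2)
  then have N: "N = of_nat k + 3" using N_nat(1) by simp
  have "(of_nat k + 3 :: complex) = of_nat (k + 3)" "(of_nat k + 3 + 1 :: complex) = of_nat (k + 4)"
    "(of_nat k + 3 - 1 :: complex) = of_nat (k + 2)" "(of_nat k + 3 + 2 :: complex) = of_nat (k + 5)"
    "(of_nat k + 3 - 2 :: complex) = of_nat (k + 1)" by simp_all
  then show "N \<noteq> 0" "N + 1 \<noteq> 0" "N - 1 \<noteq> 0" "N + 2 \<noteq> 0" "N - 2 \<noteq> 0"
    unfolding N by (simp_all only: of_nat_eq_0_iff)
qed

lemma s_par: "(-1) ^ par m i = s i" by (simp add: par_def s_def)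
lemma s_sq [simp]: "s i * s i = 1" "s i * (s i * z) = z" by (simp_all add: s_def)
lemma s_nz [simp]: "s i \<noteq> 0" by (simp add: s_def)
lemma chi_sq [simp]: "chi i j * chi i j = 1" "chi i j * (chi i j * z) = z" by (simp_all add: chi_def)
lemma chi_nz [simp]: "chi i j \<noteq> 0" by (simp add: chi_def)
lemma chi_sym: "chi i j = chi j i" by (auto simp: chi_def)
lemma chi_self [simp]: "chi i i = s i" by (simp add: chi_def s_def)

lemma sum_s: "(\<Sum>i<d. s i) = N"
proof -
  have "(\<Sum>i<d. s i) = (\<Sum>i\<in>{..<m}. s i) + (\<Sum>i\<in>{m..<d}. s i)"
    by (subst sum.union_disjoint[symmetric]) (auto intro: sum.cong)
  also have "\<dots> = (\<Sum>i\<in>{..<m}. 1) + (\<Sum>i\<in>{m..<d}. -1)"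
    by (intro arg_cong2[where f="(+)"] sum.cong) (auto simp: s_def)
  finally show ?thesis by (simp add: N_def)
qed

definition idt :: tensor where "idt = (\<Sum>p<d. letter (p, p))"

text \<open>The subtracted multiple of the identity has supertrace \<open>s (fst x)\<close>, that of
  the matrix unit. The family spans sl(m|n) with the relation \<open>sum_e_diag\<close>; a basis is
  avoided in order to keep all indices on the same footing.\<close>

definition e :: "nat \<times> nat \<Rightarrow> tensor" where
  "e x = letter x - (if fst x = snd x then tscale (s (fst x) / N) idt else 0)"

definition ew :: "(nat \<times> nat) list \<Rightarrow> tensor" where "ew w = prod_list (map e w)"

definition I2 :: "(nat \<times> nat) set" where "I2 = {..<d} \<times> {..<d}"

definition emat :: "nat \<times> nat \<Rightarrow> complex mat" where
  "emat x = mat d d (\<lambda>y. (if y = x then 1 else 0) -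
     (if fst x = snd x \<and> fst y = snd y then s (fst x) / N else 0))"

lemma ew_Nil [simp]: "ew [] = 1" and ew_Cons: "ew (x # w) = e x * ew w"
  and ew_append: "ew (u @ v) = ew u * ew v"
  by (simp_all add: ew_def)

lemma finite_I2 [simp]: "finite I2" by (simp add: I2_def)

lemma supertrace_s: "supertrace m n A = (\<Sum>i<d. s i * A $$ (i, i))"
  by (simp add: supertrace_def s_par)

lemma emat_sl: assumes "x \<in> I2" shows "emat x \<in> sl m n"
proof (cases "fst x = snd x")
  case True
  then obtain i where x: "x = (i, i)" by (metis prod.collapse)
  then have i: "i < d" using assms by (simp add: I2_def)
  have "supertrace m n (emat x) = (\<Sum>j<d. (if j = i then s i else 0) - s i / N * s j)"
    unfolding supertrace_s by (rule sum.cong) (auto simp: emat_def x algebra_simps)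
  also have "\<dots> = s i - s i / N * N"
    using i by (simp only: sum_subtractf sum_distrib_left[symmetric] sum_s) simp
  finally show ?thesis using N_nz by (simp add: sl_def emat_def)
next
  case False
  then have "supertrace m n (emat x) = 0"
    unfolding supertrace_s by (intro sum.neutral) (auto simp: emat_def)
  then show ?thesis by (simp add: sl_def emat_def)
qed

lemma emb_zero_outside: "emb m n A = (\<Sum>x\<in>I2. tscale (A $$ x) (letter x))"
  by (simp add: emb_def I2_def sum.cartesian_product)

lemma emb_emat: assumes "x \<in> I2" shows "emb m n (emat x) = e x"
proof -
  have "emb m n (emat x) = (\<Sum>y\<in>I2. tscale (if y = x then 1 else 0) (letter y) -
     tscale (if fst x = snd x \<and> fst y = snd y then s (fst x) / N else 0) (letter y))"
    unfolding emb_zero_outside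
    by (rule sum.cong) (auto simp: emat_def I2_def tv.scale_left_diff_distrib)
  also have "\<dots> = (\<Sum>y\<in>I2. if y = x then letter y else 0)
     - (\<Sum>y\<in>I2. tscale (if fst x = snd x \<and> fst y = snd y then s (fst x) / N else 0) (letter y))"
    unfolding sum_subtractf by (intro arg_cong2[where f="(-)"] sum.cong) auto
  also have "(\<Sum>y\<in>I2. if y = x then letter y else 0) = letter x" using assms by simp
  also have "(\<Sum>y\<in>I2. tscale (if fst x = snd x \<and> fst y = snd y then s (fst x) / N else 0) (letter y))
      = (if fst x = snd x then tscale (s (fst x) / N) idt else 0)"
  proof -
    have "(\<Sum>y\<in>I2. tscale (if fst y = snd y then c else 0) (letter y)) = tscale c idt" for c
    proof -
      have "(\<Sum>y\<in>I2. tscale (if fst y = snd y then c else 0) (letter y))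
        = (\<Sum>i<d. \<Sum>j<d. if j = i then tscale c (letter (i, i)) else 0)"
        unfolding I2_def sum.cartesian_product by (rule sum.cong) auto
      then show ?thesis by (simp add: idt_def tv.scale_sum_right)
    qed
    then show ?thesis by (cases "fst x = snd x") simp_all
  qed
  finally show ?thesis by (simp add: e_def)
qed

text \<open>The identity corrections add up to the supertrace of \<open>A\<close> divided by
  \<open>N\<close>, hence cancel: the matrix entries serve as coordinates for the redundant family
  \<open>e\<close> too.\<close>

lemma emb_sl: assumes "A \<in> sl m n" shows "emb m n A = (\<Sum>x\<in>I2. tscale (A $$ x) (e x))"
proof -
  have "(\<Sum>x\<in>I2. tscale (A $$ x) (e x)) = emb m n A
     - (\<Sum>x\<in>I2. if fst x = snd x then tscale (A $$ x * s (fst x) / N) idt else 0)"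
    unfolding emb_zero_outside e_def
    by (simp add: sum_subtractf tv.scale_right_diff_distrib if_distrib[of "tscale _"] cong: if_cong)
  also have "(\<Sum>x\<in>I2. if fst x = snd x then tscale (A $$ x * s (fst x) / N) idt else 0)
     = (\<Sum>i<d. \<Sum>j<d. if j = i then tscale (A $$ (i, i) * s i / N) idt else 0)"
    unfolding I2_def sum.cartesian_product by (rule sum.cong) auto
  also have "\<dots> = (\<Sum>i<d. tscale (A $$ (i, i) * s i / N) idt)" by simp
  also have "\<dots> = tscale (supertrace m n A / N) idt"
    by (simp add: supertrace_s tv.scale_sum_left sum_divide_distrib mult.commute)
  finally show ?thesis using assms by (simp add: sl_def)
qed

lemma sum_e_diag: "(\<Sum>p<d. e (p, p)) = 0"
proof -
  have "(\<Sum>p<d. e (p, p)) = idt - tscale (\<Sum>p<d. s p / N) idt"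
    by (simp add: e_def sum_subtractf idt_def[symmetric] tv.scale_sum_left)
  also have "(\<Sum>p<d. s p / N) = 1"
    using N_nz by (simp add: sum_divide_distrib[symmetric] sum_s)
  finally show ?thesis by simp
qed

lemma emb_in_span_e: "A \<in> sl m n \<Longrightarrow> emb m n A \<in> tv.span (e ` I2)"
  by (auto simp: emb_sl intro!: tv.span_sum tv.span_scale intro: tv.span_base)

lemma tens_ew: "tens m n k = tv.span {ew w | w. set w \<subseteq> I2 \<and> length w = k}" (is "_ = tv.span ?E")
proof
  have "prod_list (map (emb m n) Xs) \<in> tv.span {ew w | w. set w \<subseteq> I2 \<and> length w = length Xs}"
    if "set Xs \<subseteq> sl m n" for Xs
    using that
  proof (induction Xs)
    case Nil then show ?case by (auto intro!: tv.span_base exI[of _ "[]"])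
  next
    case (Cons X Xs)
    let ?S = "tv.span {ew w | w. set w \<subseteq> I2 \<and> length w = length (X # Xs)}"
    have 1: "e x * t \<in> ?S" if x: "x \<in> I2"
      and t: "t \<in> tv.span {ew w | w. set w \<subseteq> I2 \<and> length w = length Xs}" for x t
      by (rule tlin_span[OF tlin_mult_left tv.subspace_span t])
        (use x in \<open>auto simp: ew_Cons[symmetric] intro!: tv.span_base, metis length_Cons set_ConsD subsetD subsetI\<close>)
    have "emb m n X * prod_list (map (emb m n) Xs) \<in> ?S"
      by (rule tlin_span[OF tlin_mult_right tv.subspace_span emb_in_span_e])
        (use Cons 1 in auto)
    then show ?case by simp
  qed
  then show "tens m n k \<subseteq> tv.span ?E"
    unfolding tens_def by (intro tv.span_minimal tv.subspace_span) auto
  have "ew w \<in> {prod_list (map (emb m n) Xs) |Xs. set Xs \<subseteq> sl m n \<and> length Xs = length w}"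
    if "set w \<subseteq> I2" for w
  proof -
    have "map (emb m n) (map emat w) = map e w" using that by (auto simp: emb_emat)
    then have "ew w = prod_list (map (emb m n) (map emat w))" by (simp only: ew_def)
    moreover have "set (map emat w) \<subseteq> sl m n" using that emat_sl by auto
    ultimately show ?thesis by (metis (mono_tags, lifting) length_map mem_Collect_eq)
  qed
  then show "tv.span ?E \<subseteq> tens m n k"
    unfolding tens_def by (intro tv.span_mono) auto
qed

lemma ew_tens: "set w \<subseteq> I2 \<Longrightarrow> ew w \<in> tens m n (length w)"
  unfolding tens_ew by (rule tv.span_base) blast

definition TT :: "tensor set" where "TT = tv.span {ew w | w. set w \<subseteq> I2}"

lemma TT_carrier: "carrier (tensor_alg m n) = TT"
proof -
  have "tv.span (\<Union>k. tens m n k) = TT"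
  proof
    have "tens m n k \<subseteq> TT" for k unfolding tens_ew TT_def by (rule tv.span_mono) auto
    then show "tv.span (\<Union>k. tens m n k) \<subseteq> TT"
      by (intro tv.span_minimal) (auto simp: TT_def)
    show "TT \<subseteq> tv.span (\<Union>k. tens m n k)"
      unfolding TT_def by (rule tv.span_mono) (use ew_tens in blast)
  qed
  then show ?thesis by (simp add: tensor_alg_def)
qed

lemma subspace_TT: "tv.subspace TT" by (simp add: TT_def)

lemma tens_subset_TT: "tens m n k \<subseteq> TT"
  unfolding tens_ew TT_def by (rule tv.span_mono) auto

lemma ew_TT: "set w \<subseteq> I2 \<Longrightarrow> ew w \<in> TT"
  unfolding TT_def by (rule tv.span_base) auto

lemma e_TT: "x \<in> I2 \<Longrightarrow> e x \<in> TT"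
  using ew_TT[of "[x]"] by (simp add: ew_Cons)

lemma TT_mult: assumes "x \<in> TT" "y \<in> TT" shows "x * y \<in> TT"
  using ring.ring_simprules(5)[OF tensor_alg_ring[of m n], of x y] assms
  by (simp add: TT_carrier) (simp add: tensor_alg_def)

lemma one_TT: "1 \<in> TT" using ew_TT[of "[]"] by simp

end

section \<open>The adjoint action\<close>

context sl_super
begin

text \<open>The sign met when a matrix unit with indices \<open>a\<close>, \<open>b\<close> passes
  an index \<open>i\<close>; passing both indices of another unit gives \<open>psg\<close>.\<close>

definition X :: "nat \<Rightarrow> nat \<Rightarrow> nat \<Rightarrow> complex" where "X a b i = chi a i * chi b i"

definition psg :: "nat \<times> nat \<Rightarrow> nat \<times> nat \<Rightarrow> complex" where
  "psg x y = X (fst x) (snd x) (fst y) * X (fst x) (snd x) (snd y)"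

lemma psg_lpar: "(-1) ^ (lpar m x * lpar m y) = psg x y"
  by (simp add: lpar_def par_def psg_def X_def chi_def)

lemma psg_sym: "psg x y = psg y x"
  by (simp add: psg_def X_def chi_sym mult_ac)

lemma X_sq [simp]: "X a b i * X a b i = 1" "X a b i * (X a b i * z) = z" by (simp_all add: X_def chi_def)
lemma X_nz [simp]: "X a b i \<noteq> 0" by (simp add: X_def)

definition brl :: "nat \<times> nat \<Rightarrow> nat \<times> nat \<Rightarrow> tensor" where
  "brl x y = (if snd x = fst y then letter (fst x, snd y) else 0)
     - (if snd y = fst x then tscale (psg x y) (letter (fst y, snd x)) else 0)"

text \<open>The action of a full matrix unit, although diagonal units are not in sl(m|n). The
  identity acts as zero on \<open>TT\<close> (\<open>D_ident_TT\<close>), so there this is the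
  action of \<open>emat x\<close> (\<open>act_emat\<close>), with formulas free of
  corrections.\<close>

definition D :: "nat \<times> nat \<Rightarrow> tensor \<Rightarrow> tensor" where
  "D x = act m n (unit_mat m n x)"

lemma emb_delta: "(a, b) \<in> I2 \<Longrightarrow>
   (\<Sum>i<d. \<Sum>j<d. tscale (if i = a \<and> j = b then c else 0) (letter (i, j))) = tscale c (letter (a, b))"
proof -
  assume ab: "(a, b) \<in> I2"
  have "(\<Sum>i<d. \<Sum>j<d. tscale (if i = a \<and> j = b then c else 0) (letter (i, j)))
    = (\<Sum>i<d. if i = a then (\<Sum>j<d. if j = b then tscale c (letter (i, j)) else 0) else 0)"
    by (intro sum.cong refl) (simp add: if_distrib[of "\<lambda>c. tscale c _"] cong: if_cong)
  then show ?thesis using ab by (simp add: I2_def)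
qed

lemma emb_bracket_units:
  assumes "x \<in> I2" "y \<in> I2"
  shows "emb m n (sbracket m n (unit_mat m n x) (unit_mat m n y)) = brl x y"
proof -
  obtain a b p q where xy: "x = (a, b)" "y = (p, q)" by (metis surj_pair)
  have r: "a < d" "b < d" "p < d" "q < d" using assms by (auto simp: xy I2_def)
  have ent: "sbracket m n (unit_mat m n x) (unit_mat m n y) $$ (i, j) =
      (if i = a \<and> j = q then (if b = p then 1 else 0) else 0) -
      (if i = p \<and> j = b then (if q = a then psg x y else 0) else 0)" if "i < d" "j < d" for i j
  proof -
    have "unit_mat m n x $$ (i, k) * unit_mat m n y $$ (k, j) -
          psg (i, k) (k, j) * (unit_mat m n y $$ (i, k) * unit_mat m n x $$ (k, j)) =
       (if k = b then (if i = a \<and> b = p \<and> j = q then 1 else 0) else 0) -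
       (if k = q then (if i = p \<and> q = a \<and> j = b then psg x y else 0) else 0)" if "k < d" for k
    proof -
      have 1: "unit_mat m n x $$ (i, k) * unit_mat m n y $$ (k, j)
          = (if k = b then (if i = a \<and> b = p \<and> j = q then 1 else 0) else 0)"
        using that \<open>i < d\<close> \<open>j < d\<close> by (auto simp: xy unit_mat_def)
      have 2: "psg (i, k) (k, j) * (unit_mat m n y $$ (i, k) * unit_mat m n x $$ (k, j))
          = (if k = q then (if i = p \<and> q = a \<and> j = b then psg y x else 0) else 0)"
        using that \<open>i < d\<close> \<open>j < d\<close> by (auto simp: xy unit_mat_def)
      show ?thesis by (simp only: 1 2 psg_sym[of x y])
    qed
    then have "sbracket m n (unit_mat m n x) (unit_mat m n y) $$ (i, j) = (\<Sum>k<d.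
       (if k = b then (if i = a \<and> b = p \<and> j = q then 1 else 0) else 0) -
       (if k = q then (if i = p \<and> q = a \<and> j = b then psg x y else 0) else 0))"
      using that unfolding sbracket_def psg_lpar by simp
    also have "\<dots> = (if i = a \<and> b = p \<and> j = q then 1 else 0) - (if i = p \<and> q = a \<and> j = b then psg x y else 0)"
      using r by (simp add: sum_subtractf)
    finally show ?thesis by auto
  qed
  have "emb m n (sbracket m n (unit_mat m n x) (unit_mat m n y))
     = (\<Sum>i<d. \<Sum>j<d. tscale (if i = a \<and> j = q then (if b = p then 1 else 0) else 0) (letter (i, j)))
     - (\<Sum>i<d. \<Sum>j<d. tscale (if i = p \<and> j = b then (if q = a then psg x y else 0) else 0) (letter (i, j)))"
    unfolding emb_def sum_subtractf[symmetric] tv.scale_left_diff_distrib[symmetric]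
    by (intro sum.cong refl) (simp add: ent)
  then show ?thesis using r by (simp add: emb_delta I2_def brl_def xy)
qed

lemma hom_part_unit: "x \<in> I2 \<Longrightarrow> hom_part m n p (unit_mat m n x) = (if lpar m x = p then unit_mat m n x else 0\<^sub>m d d)"
  by (rule eq_matI) (auto simp: hom_part_def unit_mat_def)

lemma emb_bracket_zero: "emb m n (sbracket m n (0\<^sub>m d d) B) = 0"
  by (simp add: emb_def sbracket_def)

lemma act_word_zero: "act_word m n p (0\<^sub>m d d) w = 0"
  by (induction w) (simp_all add: emb_bracket_zero)

lemma lpar_less: "lpar m x < 2"
  by (simp add: lpar_def)

lemma D_wd: assumes "x \<in> I2" shows "D x (wd w) = act_word m n (lpar m x) (unit_mat m n x) w"
proof -
  have "D x (wd w) = (\<Sum>p<2. if p = lpar m x then act_word m n p (unit_mat m n x) w else 0)"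
    unfolding D_def act_def by (intro sum.cong) (auto simp: hom_part_unit[OF assms] act_word_zero)
  then show ?thesis using lpar_less by simp
qed

lemma tlin_act: "tlin (act m n A)"
  unfolding act_def
  by (rule tlinI) (simp_all add: tlin_add[OF tlin_lin_ext] tlin_scale[OF tlin_lin_ext] sum.distrib tv.scale_sum_right)

lemma tlin_D: "tlin (D x)"
  by (simp add: D_def tlin_act)

lemma D_one: "x \<in> I2 \<Longrightarrow> D x 1 = 0"
  using D_wd[of x "[]"] by (simp add: wd_Nil)

lemma D_letter_mult:
  assumes "x \<in> I2" "y \<in> I2"
  shows "D x (letter y * t) = brl x y * t + tscale (psg x y) (letter y * D x t)"
proof (rule tlin_eq_wd[of "\<lambda>t. D x (letter y * t)"])
  show "tlin (\<lambda>t. D x (letter y * t))" by (rule tlin_comp[OF tlin_D tlin_mult_left])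
  show "tlin (\<lambda>t. brl x y * t + tscale (psg x y) (letter y * D x t))"
    by (intro tlin_plus tlin_cmul tlin_mult_left tlin_comp[OF tlin_mult_left tlin_D])
  fix w
  have w: "letter y * wd w = wd (y # w)" by (simp add: wd_Cons)
  show "D x (letter y * wd w) = brl x y * wd w + tscale (psg x y) (letter y * D x (wd w))"
    unfolding w D_wd[OF assms(1)]
    by (simp add: emb_bracket_units[OF assms] psg_lpar) (simp add: wd_def)
qed

lemma sbracket_hom_linear:
  assumes "i < d" "j < d"
  shows "sbracket m n (hom_part m n p A) B $$ (i, j)
    = (\<Sum>x\<in>I2. A $$ x * sbracket m n (hom_part m n p (unit_mat m n x)) B $$ (i, j))"
proof -
  have h: "hom_part m n p A $$ (u, v) = (\<Sum>x\<in>I2. A $$ x * hom_part m n p (unit_mat m n x) $$ (u, v))"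
    if "u < d" "v < d" for u v
  proof -
    have "(\<Sum>x\<in>I2. A $$ x * hom_part m n p (unit_mat m n x) $$ (u, v))
      = (\<Sum>x\<in>I2. if x = (u, v) then hom_part m n p A $$ (u, v) else 0)"
      using that by (intro sum.cong) (auto simp: hom_part_def unit_mat_def)
    also have "\<dots> = hom_part m n p A $$ (u, v)" using that by (subst sum.delta) (auto simp: I2_def)
    finally show ?thesis by simp
  qed
  have "sbracket m n (hom_part m n p A) B $$ (i, j) = (\<Sum>k<d. \<Sum>x\<in>I2. A $$ x *
     (hom_part m n p (unit_mat m n x) $$ (i, k) * B $$ (k, j) - (-1) ^ (lpar m (i,k) * lpar m (k,j)) *
       (B $$ (i, k) * hom_part m n p (unit_mat m n x) $$ (k, j))))"
    using assms unfolding sbracket_def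
    by (simp add: h sum_distrib_left sum_distrib_right sum_subtractf right_diff_distrib mult_ac)
  also have "\<dots> = (\<Sum>x\<in>I2. \<Sum>k<d. A $$ x *
     (hom_part m n p (unit_mat m n x) $$ (i, k) * B $$ (k, j) - (-1) ^ (lpar m (i,k) * lpar m (k,j)) *
       (B $$ (i, k) * hom_part m n p (unit_mat m n x) $$ (k, j))))"
    by (rule sum.swap)
  finally show ?thesis using assms by (simp add: sbracket_def sum_distrib_left)
qed

lemma act_word_linear:
  "act_word m n p (hom_part m n p A) w
     = (\<Sum>x\<in>I2. tscale (A $$ x) (act_word m n p (hom_part m n p (unit_mat m n x)) w))"
proof (induction w)
  case Nil then show ?case by simp
next
  case (Cons y w)
  have "emb m n (sbracket m n (hom_part m n p A) B)
     = (\<Sum>x\<in>I2. tscale (A $$ x) (emb m n (sbracket m n (hom_part m n p (unit_mat m n x)) B)))" for B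
  proof -
    have "emb m n (sbracket m n (hom_part m n p A) B) = (\<Sum>y\<in>I2. \<Sum>x\<in>I2.
       tscale (A $$ x * sbracket m n (hom_part m n p (unit_mat m n x)) B $$ y) (letter y))"
      unfolding emb_zero_outside
      by (intro sum.cong refl) (auto simp: I2_def sbracket_hom_linear[unfolded I2_def] tv.scale_sum_left)
    also have "\<dots> = (\<Sum>x\<in>I2. \<Sum>y\<in>I2.
       tscale (A $$ x * sbracket m n (hom_part m n p (unit_mat m n x)) B $$ y) (letter y))"
      by (rule sum.swap)
    finally show ?thesis by (simp add: emb_zero_outside tv.scale_sum_right)
  qed
  then show ?case
    by (simp add: Cons sum_distrib_left sum_distrib_right tscale_mult_left tscale_mult_right
      tv.scale_right_distrib tv.scale_sum_right sum.distrib mult.commute)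
qed

lemma act_D: "act m n A t = (\<Sum>x\<in>I2. tscale (A $$ x) (D x t))"
proof (rule tlin_eq_wd[of "act m n A"])
  show "tlin (\<lambda>t. \<Sum>x\<in>I2. tscale (A $$ x) (D x t))"
    by (rule tlinI) (simp_all add: tlin_add[OF tlin_D] tlin_scale[OF tlin_D] sum.distrib
        tv.scale_right_distrib tv.scale_sum_right mult.commute)
  fix w
  have "act m n A (wd w) = (\<Sum>p<2. \<Sum>x\<in>I2. tscale (A $$ x) (act_word m n p (hom_part m n p (unit_mat m n x)) w))"
    unfolding act_def by (simp add: act_word_linear[of _ A])
  also have "\<dots> = (\<Sum>x\<in>I2. \<Sum>p<2. tscale (A $$ x) (act_word m n p (hom_part m n p (unit_mat m n x)) w))"
    by (rule sum.swap)
  finally show "act m n A (wd w) = (\<Sum>x\<in>I2. tscale (A $$ x) (D x (wd w)))"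
    by (simp add: D_def act_def tv.scale_sum_right)
qed (rule tlin_act)

lemma D_idt: "x \<in> I2 \<Longrightarrow> D x (idt * t) = idt * D x t"
proof -
  assume x: "x \<in> I2"
  obtain a b where ab: "x = (a, b)" "a < d" "b < d" using x by (auto simp: I2_def)
  have "D x (idt * t) = (\<Sum>p<d. brl x (p, p) * t + letter (p, p) * D x t)"
    unfolding idt_def sum_distrib_right tlin_sum[OF tlin_D]
    by (intro sum.cong refl) (auto simp: D_letter_mult[OF x] I2_def psg_def)
  also have "\<dots> = (\<Sum>p<d. brl x (p, p)) * t + idt * D x t"
    by (simp add: sum.distrib sum_distrib_right idt_def)
  also have "(\<Sum>p<d. brl x (p, p)) = (\<Sum>p<d. if p = b then letter (a, b) else 0) - (\<Sum>p<d. if p = a then letter (a, b) else 0)"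
    unfolding sum_subtractf[symmetric] by (intro sum.cong) (auto simp: brl_def ab psg_def)
  also have "\<dots> = 0" using ab by simp
  finally show ?thesis by simp
qed

definition br :: "nat \<times> nat \<Rightarrow> nat \<times> nat \<Rightarrow> tensor" where
  "br x y = (if snd x = fst y then e (fst x, snd y) else 0)
     - (if snd y = fst x then tscale (psg x y) (e (fst y, snd x)) else 0)"

text \<open>A superbracket of matrix units has supertrace zero, so the identity corrections of its
  two diagonal terms cancel.\<close>

lemma br_brl: "br x y = brl x y"
proof (cases "snd x = fst y \<and> snd y = fst x")
  case True
  then obtain a b where "x = (a, b)" "y = (b, a)" by (metis prod.collapse)
  moreover have "psg (a, b) (b, a) * s b = s a"
    by (simp add: psg_def X_def chi_def s_def)
  ultimately show ?thesis
    by (simp add: br_def brl_def e_def tv.scale_right_diff_distrib)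
next
  case False
  then show ?thesis by (auto simp: br_def brl_def e_def)
qed

lemma D_e_mult:
  assumes "x \<in> I2" "y \<in> I2"
  shows "D x (e y * t) = br x y * t + tscale (psg x y) (e y * D x t)"
  using assms
  by (auto simp: e_def left_diff_distrib tscale_mult_left tlin_diff[OF tlin_D] tlin_scale[OF tlin_D] D_idt
    D_letter_mult br_brl tv.scale_right_diff_distrib psg_def tlin_0[OF tlin_D])

lemma D_e: "x \<in> I2 \<Longrightarrow> y \<in> I2 \<Longrightarrow> D x (e y) = br x y"
  using D_e_mult[of x y 1] by (simp add: D_one)

lemma D_ew_Cons: "x \<in> I2 \<Longrightarrow> y \<in> I2 \<Longrightarrow> D x (ew (y # w)) = br x y * ew w + tscale (psg x y) (e y * D x (ew w))"
  by (simp add: ew_Cons D_e_mult)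

lemma br_span: "x \<in> I2 \<Longrightarrow> y \<in> I2 \<Longrightarrow> br x y \<in> tv.span (e ` I2)"
proof -
  assume "x \<in> I2" "y \<in> I2"
  then have "(fst x, snd y) \<in> I2" "(fst y, snd x) \<in> I2" by (auto simp: I2_def)
  then show ?thesis unfolding br_def
    by (intro tv.span_diff) (auto intro: tv.span_base tv.span_zero tv.span_scale)
qed

lemma tens_Suc_mult: "x \<in> tv.span (e ` I2) \<Longrightarrow> t \<in> tens m n k \<Longrightarrow> x * t \<in> tens m n (Suc k)"
proof -
  assume x: "x \<in> tv.span (e ` I2)" and t: "t \<in> tens m n k"
  have 1: "e y * t \<in> tens m n (Suc k)" if "y \<in> I2" for y
    by (rule tlin_span[OF tlin_mult_left _ t[unfolded tens_ew]])
      (use that ew_tens[of "y # _"] in \<open>auto simp: ew_Cons tens_ew[symmetric] tens_def\<close>)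
  show ?thesis
    by (rule tlin_span[OF tlin_mult_right _ x]) (use 1 in \<open>auto simp: tens_def\<close>)
qed

lemma subspace_tens: "tv.subspace (tens m n k)" by (simp add: tens_def)

lemma D_ew_tens: "x \<in> I2 \<Longrightarrow> set w \<subseteq> I2 \<Longrightarrow> D x (ew w) \<in> tens m n (length w)"
proof (induction w)
  case Nil then show ?case by (simp add: D_one tv.subspace_0[OF subspace_tens])
next
  case (Cons y w)
  then show ?case
    by (simp add: D_ew_Cons) (intro tv.subspace_add[OF subspace_tens] tv.subspace_scale[OF subspace_tens]
       tens_Suc_mult br_span ew_tens; auto intro: tv.span_base)
qed

lemma D_tens: "x \<in> I2 \<Longrightarrow> t \<in> tens m n k \<Longrightarrow> D x t \<in> tens m n k"
  by (rule tlin_span[OF tlin_D subspace_tens, of t "{ew w | w. set w \<subseteq> I2 \<and> length w = k}"])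
    (auto simp: tens_ew[symmetric] D_ew_tens)

definition gmod :: "tensor set \<Rightarrow> bool" where
  "gmod S \<longleftrightarrow> tv.subspace S \<and> (\<forall>x\<in>I2. \<forall>t\<in>S. D x t \<in> S)"

lemma D_ident: "(\<Sum>p<d. D (p, p) (ew w)) = 0" if "set w \<subseteq> I2"
  using that
proof (induction w)
  case Nil then show ?case by (simp add: D_one I2_def)
next
  case (Cons y w)
  obtain a b where y: "y = (a, b)" "a < d" "b < d" using Cons.prems by (auto simp: I2_def)
  have "(\<Sum>p<d. D (p, p) (ew (y # w))) = (\<Sum>p<d. br (p, p) y * ew w + e y * D (p, p) (ew w))"
    using Cons.prems by (intro sum.cong) (auto simp: D_ew_Cons I2_def psg_def X_def)
  also have "\<dots> = (\<Sum>p<d. br (p, p) y) * ew w + e y * (\<Sum>p<d. D (p, p) (ew w))"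
    by (simp add: sum.distrib sum_distrib_right sum_distrib_left)
  also have "(\<Sum>p<d. br (p, p) y) = (\<Sum>p<d. if p = a then e y else 0) - (\<Sum>p<d. if p = b then e y else 0)"
    unfolding sum_subtractf[symmetric] by (intro sum.cong) (auto simp: br_def y psg_def X_def)
  also have "\<dots> = 0" using y by simp
  finally show ?case using Cons by simp
qed

lemma D_ident_TT: "t \<in> TT \<Longrightarrow> (\<Sum>p<d. D (p, p) t) = 0"
proof -
  assume t: "t \<in> TT"
  have "tlin (\<lambda>t. \<Sum>p<d. D (p, p) t)"
    by (rule tlinI) (simp_all add: tlin_add[OF tlin_D] tlin_scale[OF tlin_D] sum.distrib tv.scale_sum_right)
  then show ?thesis
    using tlin_span[of "\<lambda>t. \<Sum>p<d. D (p, p) t" "{0}" t] t D_ident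
    by (auto simp: TT_def tv.subspace_def)
qed

lemma act_emat: assumes "x \<in> I2" "t \<in> TT" shows "act m n (emat x) t = D x t"
proof -
  have "act m n (emat x) t = (\<Sum>y\<in>I2. (if y = x then D y t else 0) -
     (if fst y = snd y then tscale (if fst x = snd x then s (fst x) / N else 0) (D y t) else 0))"
    unfolding act_D by (intro sum.cong) (auto simp: emat_def I2_def tv.scale_left_diff_distrib)
  also have "\<dots> = D x t - (\<Sum>y\<in>I2. (if fst y = snd y then tscale (if fst x = snd x then s (fst x) / N else 0) (D y t) else 0))"
    using assms by (simp add: sum_subtractf)
  also have "(\<Sum>y\<in>I2. (if fst y = snd y then tscale (if fst x = snd x then s (fst x) / N else 0) (D y t) else 0))
     = (\<Sum>i<d. \<Sum>j<d. if j = i then tscale (if fst x = snd x then s (fst x) / N else 0) (D (i, i) t) else 0)"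
    unfolding I2_def sum.cartesian_product by (rule sum.cong) auto
  also have "\<dots> = tscale (if fst x = snd x then s (fst x) / N else 0) (\<Sum>i<d. D (i, i) t)"
    by (simp add: tv.scale_sum_right)
  also have "\<dots> = 0" using assms by (simp add: D_ident_TT)
  finally show ?thesis by simp
qed

lemma submodule2_gmod: "submodule2 m n S \<longleftrightarrow> S \<subseteq> tens m n 2 \<and> gmod S"
proof
  assume S: "submodule2 m n S"
  have "D x t \<in> S" if "x \<in> I2" "t \<in> S" for x t
  proof -
    have "act m n (emat x) ` S \<subseteq> S" using S emat_sl[OF that(1)] by (simp add: submodule2_def)
    then have "act m n (emat x) t \<in> S" using that by auto
    moreover have "t \<in> TT" using S that tens_subset_TT by (auto simp: submodule2_def)
    ultimately show ?thesis using that by (simp add: act_emat)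
  qed
  then show "S \<subseteq> tens m n 2 \<and> gmod S" using S by (simp add: submodule2_def gmod_def)
next
  assume S: "S \<subseteq> tens m n 2 \<and> gmod S"
  then show "submodule2 m n S"
    unfolding submodule2_def gmod_def
    by (auto simp: act_D intro!: tv.subspace_sum tv.subspace_scale)
qed

end

section \<open>Coordinates on tensors of degree two\<close>

context sl_super
begin

text \<open>The tensor \<open>E\<^sub>i\<^sub>j \<otimes> E\<^sub>k\<^sub>l\<close> of matrix units is, up to the sign \<open>chi j k\<close>, the element
  \<open>v\<^sub>i v\<^sub>k v\<^sup>j v\<^sup>l\<close> with upper and lower indices collected; the indices of \<open>co t\<close> are in this order.\<close>

definition co :: "tensor \<Rightarrow> nat \<Rightarrow> nat \<Rightarrow> nat \<Rightarrow> nat \<Rightarrow> complex" where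
  "co t i k j l = chi j k * Poly_Mapping.lookup t (Word [(i, j), (k, l)])"

definition mk :: "(nat \<Rightarrow> nat \<Rightarrow> nat \<Rightarrow> nat \<Rightarrow> complex) \<Rightarrow> tensor" where
  "mk f = (\<Sum>i<d. \<Sum>k<d. \<Sum>j<d. \<Sum>l<d. tscale (chi j k * f i k j l) (wd [(i, j), (k, l)]))"

text \<open>Degree two over all matrices. Exchanging only the upper or only the lower indices
  preserves this space but not the tensor square of sl(m|n), which \<open>tens2I\<close> cuts out by
  two supertrace conditions.\<close>

definition F2 :: "tensor set" where
  "F2 = tv.span {wd [x, y] | x y. x \<in> I2 \<and> y \<in> I2}"

lemma co_add [simp]: "co (t + u) i k j l = co t i k j l + co u i k j l"
  and co_diff [simp]: "co (t - u) i k j l = co t i k j l - co u i k j l"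
  and co_scale [simp]: "co (tscale c t) i k j l = c * co t i k j l"
  and co_zero [simp]: "co 0 i k j l = 0"
  by (simp_all add: co_def lookup_add lookup_minus distrib_left right_diff_distrib)

lemma co_sum: "co (sum g A) i k j l = (\<Sum>a\<in>A. co (g a) i k j l)"
  by (induction A rule: infinite_finite_induct) simp_all

lemma co_wd: "co (wd [(p, q), (r, u)]) i k j l = (if i = p \<and> j = q \<and> k = r \<and> l = u then chi j k else 0)"
  by (auto simp: co_def lookup_wd)

lemma delta_and: "finite A \<Longrightarrow> (\<Sum>u\<in>A. if P \<and> l = u then G u else 0)
    = (if P then if l \<in> A then G l else 0 else (0::'a::comm_monoid_add))"
  by (cases P) simp_all

lemma delta4: "(\<Sum>p<d. \<Sum>r<d. \<Sum>q<d. \<Sum>u<d. if i = p \<and> j = q \<and> k = r \<and> l = u then F p r q u else 0)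
   = (if i < d \<and> k < d \<and> j < d \<and> l < d then F i k j l else (0::'a::comm_monoid_add))"
proof -
  have "(\<Sum>p<d. \<Sum>r<d. \<Sum>q<d. \<Sum>u<d. if i = p \<and> j = q \<and> k = r \<and> l = u then F p r q u else 0)
    = (\<Sum>p<d. \<Sum>r<d. \<Sum>q<d. \<Sum>u<d. if (((True \<and> i = p) \<and> k = r) \<and> j = q) \<and> l = u then F p r q u else 0)"
    by (intro sum.cong refl) auto
  then show ?thesis by (simp only: delta_and finite_lessThan) simp
qed

lemma co_mk: "co (mk f) i k j l = (if i < d \<and> k < d \<and> j < d \<and> l < d then f i k j l else 0)"
proof -
  have "co (mk f) i k j l = (\<Sum>p<d. \<Sum>r<d. \<Sum>q<d. \<Sum>u<d.
      if i = p \<and> j = q \<and> k = r \<and> l = u then f p r q u else 0)"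
    unfolding mk_def co_sum by (intro sum.cong refl) (simp add: co_wd)
  then show ?thesis by (simp add: delta4)
qed

lemma subspace_F2: "tv.subspace F2" by (simp add: F2_def)

lemma wd_F2: "x \<in> I2 \<Longrightarrow> y \<in> I2 \<Longrightarrow> wd [x, y] \<in> F2"
  unfolding F2_def by (rule tv.span_base) blast

lemma mk_F2: "mk f \<in> F2"
  unfolding mk_def
  by (intro tv.subspace_sum[OF subspace_F2] tv.subspace_scale[OF subspace_F2] wd_F2) (auto simp: I2_def)

lemma tlin_mk_co: "tlin (\<lambda>t. mk (co t))"
  by (rule tlinI) (simp_all add: mk_def distrib_left tv.scale_left_distrib sum.distrib
     tv.scale_sum_right mult.left_commute)

lemma mk_co: "t \<in> F2 \<Longrightarrow> mk (co t) = t"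
proof -
  have 1: "mk (co (wd [(p, q), (r, u)])) = wd [(p, q), (r, u)]" if "p < d" "q < d" "r < d" "u < d" for p q r u
  proof -
    have "mk (co (wd [(p, q), (r, u)])) = (\<Sum>i<d. \<Sum>k<d. \<Sum>j<d. \<Sum>l<d.
        if p = i \<and> q = j \<and> r = k \<and> u = l then wd [(i, j), (k, l)] else 0)"
      unfolding mk_def co_wd by (intro sum.cong refl) auto
    then show ?thesis using that by (simp add: delta4)
  qed
  assume "t \<in> F2"
  then show ?thesis
    unfolding F2_def by (rule tlin_eq_span[OF tlin_mk_co tlin_id]) (auto simp: I2_def 1)
qed

lemma co_outside: "t \<in> F2 \<Longrightarrow> \<not> (i < d \<and> k < d \<and> j < d \<and> l < d) \<Longrightarrow> co t i k j l = 0"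
  using co_mk[of "co t"] mk_co[of t] by metis

lemma F2_eqI:
  assumes "t \<in> F2" "u \<in> F2" "\<And>i k j l. i < d \<Longrightarrow> k < d \<Longrightarrow> j < d \<Longrightarrow> l < d \<Longrightarrow> co t i k j l = co u i k j l"
  shows "t = u"
proof -
  have "co t = co u" using assms co_outside by (intro ext) metis
  then show ?thesis using mk_co assms by metis
qed

text \<open>The matrix unit \<open>(a, b)\<close> acting in coordinates as a superderivation: one
  term for each of the four slots, the lower ones dual to the upper ones, with the signs
  \<open>X a b\<close> of the slots passed before.\<close>

definition opf :: "nat \<Rightarrow> nat \<Rightarrow> (nat \<Rightarrow> nat \<Rightarrow> nat \<Rightarrow> nat \<Rightarrow> complex) \<Rightarrow> nat \<Rightarrow> nat \<Rightarrow> nat \<Rightarrow> nat \<Rightarrow> complex" where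
  "opf a b f i k j l = (if i = a then f b k j l else 0) + (if k = a then X a b i * f i b j l else 0)
     - (if j = b then X a b i * X a b k * X a b a * f i k a l else 0)
     - (if l = b then X a b i * X a b k * X a b j * X a b a * f i k j a else 0)"

lemma opf_add: "opf a b (co (t + u)) i k j l = opf a b (co t) i k j l + opf a b (co u) i k j l"
  and opf_scale: "opf a b (co (tscale c t)) i k j l = c * opf a b (co t) i k j l"
  and opf_zero: "opf a b (co 0) i k j l = 0"
  unfolding opf_def by (simp_all add: algebra_simps)

lemma D_wd2:
  assumes "x \<in> I2" "y \<in> I2" "z \<in> I2"
  shows "D x (wd [y, z]) = brl x y * wd [z] + tscale (psg x y) (letter y * brl x z)"
  using D_letter_mult[OF assms(1,2), of "letter z"] D_letter_mult[OF assms(1,3), of 1] assms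
  by (simp add: wd_Cons[symmetric] wd_Nil[symmetric] letter_wd D_one[unfolded wd_Nil[symmetric]] wd_append[symmetric])
    (simp add: wd_Nil D_one)

lemma co_D: assumes "(a, b) \<in> I2" "t \<in> F2" shows "co (D (a, b) t) i k j l = opf a b (co t) i k j l"
proof -
  have basis: "co (D (a, b) (wd [(p, q), (r, u)])) i k j l = opf a b (co (wd [(p, q), (r, u)])) i k j l"
    if "(p, q) \<in> I2" "(r, u) \<in> I2" for p q r u
  proof -
    have D: "D (a, b) (wd [(p, q), (r, u)]) =
      (if b = p then wd [(a, q), (r, u)] else 0) - (if q = a then tscale (psg (a, b) (p, q)) (wd [(p, b), (r, u)]) else 0)
      + (if b = r then tscale (psg (a, b) (p, q)) (wd [(p, q), (a, u)]) else 0)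
      - (if u = a then tscale (psg (a, b) (p, q) * psg (a, b) (r, u)) (wd [(p, q), (r, b)]) else 0)"
      unfolding D_wd2[OF assms(1) that] brl_def
      by (auto simp: letter_wd left_diff_distrib right_diff_distrib tscale_mult_left tscale_mult_right
        wd_append[symmetric] tv.scale_right_diff_distrib)
    have 1: "co (if b = p then wd [(a, q), (r, u)] else 0) i k j l
        = (if i = a then co (wd [(p, q), (r, u)]) b k j l else 0)"
      by (auto simp: co_wd)
    have 2: "co (if q = a then tscale (psg (a, b) (p, q)) (wd [(p, b), (r, u)]) else 0) i k j l
        = (if j = b then X a b i * X a b k * X a b a * co (wd [(p, q), (r, u)]) i k a l else 0)"
      by (auto simp: co_wd psg_def X_def chi_def)
    have 3: "co (if b = r then tscale (psg (a, b) (p, q)) (wd [(p, q), (a, u)]) else 0) i k j l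
        = (if k = a then X a b i * co (wd [(p, q), (r, u)]) i b j l else 0)"
      by (auto simp: co_wd psg_def X_def chi_def)
    have 4: "co (if u = a then tscale (psg (a, b) (p, q) * psg (a, b) (r, u)) (wd [(p, q), (r, b)]) else 0) i k j l
        = (if l = b then X a b i * X a b k * X a b j * X a b a * co (wd [(p, q), (r, u)]) i k j a else 0)"
      by (auto simp: co_wd psg_def)
    show ?thesis unfolding D opf_def co_add co_diff 1 2 3 4 by simp
  qed
  have "tv.subspace {t. co (D (a, b) t) i k j l = opf a b (co t) i k j l}"
    unfolding tv.subspace_def mem_Collect_eq
      tlin_0[OF tlin_D] tlin_add[OF tlin_D] tlin_scale[OF tlin_D] co_add co_scale co_zero opf_add opf_scale opf_zero
    by simp
  then have "F2 \<subseteq> {t. co (D (a, b) t) i k j l = opf a b (co t) i k j l}"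
    unfolding F2_def by (intro tv.span_minimal) (auto simp: basis)
  then show ?thesis using assms by blast
qed

lemma D_F2: assumes "x \<in> I2" "t \<in> F2" shows "D x t \<in> F2"
proof (rule tlin_span[OF tlin_D subspace_F2 assms(2)[unfolded F2_def]])
  have b: "brl x y \<in> tv.span (letter ` I2)" if "y \<in> I2" for y
  proof -
    have "(fst x, snd y) \<in> I2" "(fst y, snd x) \<in> I2" using assms that by (auto simp: I2_def)
    then show ?thesis unfolding brl_def
      by (intro tv.span_diff) (auto intro: tv.span_base tv.span_zero tv.span_scale)
  qed
  have 1: "v * wd [z] \<in> F2" if "v \<in> tv.span (letter ` I2)" "z \<in> I2" for v z
    by (rule tlin_span[OF tlin_mult_right subspace_F2 that(1)])
      (use that in \<open>auto simp: letter_wd wd_append[symmetric] intro: wd_F2\<close>)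
  have 2: "letter z * v \<in> F2" if "v \<in> tv.span (letter ` I2)" "z \<in> I2" for v z
    by (rule tlin_span[OF tlin_mult_left subspace_F2 that(1)])
      (use that in \<open>auto simp: letter_wd wd_append[symmetric] intro: wd_F2\<close>)
  fix t assume "t \<in> {wd [x, y] |x y. x \<in> I2 \<and> y \<in> I2}"
  then show "D x t \<in> F2"
    using assms(1) by (auto simp: D_wd2 intro!: tv.subspace_add[OF subspace_F2] tv.subspace_scale[OF subspace_F2] 1 2 b)
qed

text \<open>Contracts the second upper with the first lower index; on tensors of degree two this
  multiplies the two matrix factors. Composed with \<open>fU\<close> and \<open>fL\<close> it yields
  the other contractions, among them the supertraces of the two factors (\<open>tr_fU\<close>,
  \<open>tr_fL\<close>).\<close>

definition tr :: "(nat \<Rightarrow> nat \<Rightarrow> nat \<Rightarrow> nat \<Rightarrow> complex) \<Rightarrow> nat \<Rightarrow> nat \<Rightarrow> complex" where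
  "tr f i l = (\<Sum>p<d. s p * f i p p l)"

definition fU :: "(nat \<Rightarrow> nat \<Rightarrow> nat \<Rightarrow> nat \<Rightarrow> complex) \<Rightarrow> nat \<Rightarrow> nat \<Rightarrow> nat \<Rightarrow> nat \<Rightarrow> complex" where
  "fU f i k j l = chi i k * f k i j l"

definition fL :: "(nat \<Rightarrow> nat \<Rightarrow> nat \<Rightarrow> nat \<Rightarrow> complex) \<Rightarrow> nat \<Rightarrow> nat \<Rightarrow> nat \<Rightarrow> nat \<Rightarrow> complex" where
  "fL f i k j l = chi j l * f i k l j"

lemma fU_fU [simp]: "fU (fU f) = f" and fL_fL [simp]: "fL (fL f) = f"
  and fL_fU: "fL (fU f) = fU (fL f)"
  by (auto simp: fU_def fL_def fun_eq_iff chi_sym mult.left_commute)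

lemma tr_fU: "tr (fU (co t)) i l = (\<Sum>p<d. s p * Poly_Mapping.lookup t (Word [(p, p), (i, l)]))"
  unfolding tr_def fU_def co_def by (simp add: chi_sym[of i])

lemma tr_fL: "tr (fL (co t)) i l = (\<Sum>p<d. s p * Poly_Mapping.lookup t (Word [(i, l), (p, p)]))"
  unfolding tr_def fL_def co_def by (simp add: chi_sym[of l])

lemma opf_fU: "opf a b (fU f) i k j l = fU (opf a b f) i k j l"
  by (auto simp: opf_def fU_def X_def chi_def s_def)

lemma opf_fL: "opf a b (fL f) i k j l = fL (opf a b f) i k j l"
  by (auto simp: opf_def fL_def X_def chi_def s_def)

text \<open>Contraction is equivariant: the terms that act on the contracted pair of slots cancel,
  thanks to the sign \<open>s p\<close> in \<open>tr\<close>.\<close>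

lemma tr_opf:
  assumes "a < d" "b < d"
  shows "tr (opf a b f) i l = (if i = a then tr f b l else 0) - (if l = b then X a b i * X a b a * tr f i a else 0)"
proof -
  have "tr (opf a b f) i l = (\<Sum>p<d. (if i = a then s p * f b p p l else 0)
     + (if p = a then s a * X a b i * f i b a l else 0)
     - (if p = b then s b * X a b i * X a b b * X a b a * f i b a l else 0)
     - (if l = b then X a b i * X a b a * (s p * f i p p a) else 0))"
    unfolding tr_def opf_def
    by (intro sum.cong refl) (auto simp: algebra_simps)
  also have "\<dots> = (\<Sum>p<d. (if i = a then s p * f b p p l else 0))
     + s a * X a b i * f i b a l - s b * X a b i * X a b b * X a b a * f i b a l
     - (\<Sum>p<d. if l = b then X a b i * X a b a * (s p * f i p p a) else 0)"
    using assms by (simp only: sum.distrib sum_subtractf sum.delta finite_lessThan lessThan_iff if_True)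
  also have "s b * X a b i * X a b b * X a b a * f i b a l = s a * X a b i * f i b a l"
    by (simp add: s_def X_def chi_def)
  finally show ?thesis by (simp add: tr_def sum_distrib_left)
qed

section \<open>A bilinear form for which opposite matrix units are adjoint\<close>

definition Bf :: "(nat \<Rightarrow> nat \<Rightarrow> nat \<Rightarrow> nat \<Rightarrow> complex) \<Rightarrow> (nat \<Rightarrow> nat \<Rightarrow> nat \<Rightarrow> nat \<Rightarrow> complex) \<Rightarrow> complex" where
  "Bf f g = (\<Sum>i<d. \<Sum>k<d. \<Sum>j<d. \<Sum>l<d. s j * s l * (f i k j l * g i k j l))"

definition B :: "tensor \<Rightarrow> tensor \<Rightarrow> complex" where "B x y = Bf (co x) (co y)"

lemma Bf_add: "Bf (\<lambda>i k j l. f i k j l + g i k j l) h = Bf f h + Bf g h"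
  and Bf_diff: "Bf (\<lambda>i k j l. f i k j l - g i k j l) h = Bf f h - Bf g h"
  and Bf_cmul: "Bf (\<lambda>i k j l. c * f i k j l) h = c * Bf f h"
  and Bf_cmul_right: "Bf f (\<lambda>i k j l. c * h i k j l) = c * Bf f h"
  by (simp_all add: Bf_def algebra_simps sum.distrib sum_subtractf sum_distrib_left)

lemma B_add [simp]: "B (x + y) z = B x z + B y z"
  and B_diff [simp]: "B (x - y) z = B x z - B y z"
  and B_scale [simp]: "B (tscale c x) z = c * B x z"
  and B_add_r [simp]: "B z (x + y) = B z x + B z y"
  and B_diff_r [simp]: "B z (x - y) = B z x - B z y"
  and B_scale_r [simp]: "B z (tscale c x) = c * B z x"
  and B_0 [simp]: "B 0 z = 0" "B z 0 = 0"
  by (simp_all add: B_def Bf_def algebra_simps sum.distrib sum_subtractf sum_distrib_left)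

lemma B_sym: "B x y = B y x"
  by (simp add: B_def Bf_def mult_ac)

lemma Bf_fU: "Bf (fU f) g = Bf f (fU g)"
proof -
  have "Bf (fU f) g = (\<Sum>k<d. \<Sum>i<d. \<Sum>j<d. \<Sum>l<d. s j * s l * (fU f i k j l * g i k j l))"
    unfolding Bf_def by (rule sum.swap)
  then show ?thesis by (simp add: Bf_def fU_def chi_sym mult_ac)
qed

lemma Bf_fL: "Bf (fL f) g = Bf f (fL g)"
proof -
  have "Bf (fL f) g = (\<Sum>i<d. \<Sum>k<d. \<Sum>l<d. \<Sum>j<d. s j * s l * (fL f i k j l * g i k j l))"
    unfolding Bf_def by (intro sum.cong refl sum.swap)
  then show ?thesis by (simp add: Bf_def fL_def chi_sym mult_ac)
qed

text \<open>On upper slots the two sides match after renaming. On lower slots the signs differ by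
  \<open>s b * X a b a\<close> against \<open>s a * X a b b\<close>, which are equal; this is what
  the weights \<open>s j * s l\<close> in \<open>Bf\<close> are for.\<close>

lemma Bf_opf:
  assumes "a < d" "b < d"
  shows "Bf (opf a b f) g = Bf f (opf b a g)"
proof -
  have sd: "(\<Sum>i<d. if i = c then h i else 0) = h c" if "c < d" for c and h :: "nat \<Rightarrow> complex"
    using that by simp
  have L: "Bf (opf a b f) g =
     (\<Sum>k<d. \<Sum>j<d. \<Sum>l<d. s j * s l * (f b k j l * g a k j l))
   + (\<Sum>i<d. \<Sum>j<d. \<Sum>l<d. s j * s l * (X a b i * f i b j l * g i a j l))
   - (\<Sum>i<d. \<Sum>k<d. \<Sum>l<d. s b * s l * (X a b i * X a b k * X a b a * f i k a l * g i k b l))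
   - (\<Sum>i<d. \<Sum>k<d. \<Sum>j<d. s j * s b * (X a b i * X a b k * X a b j * X a b a * f i k j a * g i k j b))"
    if ab: "a < d" "b < d" for a b f g
  proof -
    have "Bf (opf a b f) g =
     (\<Sum>i<d. \<Sum>k<d. \<Sum>j<d. \<Sum>l<d. if i = a then s j * s l * (f b k j l * g i k j l) else 0)
   + (\<Sum>i<d. \<Sum>k<d. \<Sum>j<d. \<Sum>l<d. if k = a then s j * s l * (X a b i * f i b j l * g i k j l) else 0)
   - (\<Sum>i<d. \<Sum>k<d. \<Sum>j<d. \<Sum>l<d. if j = b then s j * s l * (X a b i * X a b k * X a b a * f i k a l * g i k j l) else 0)
   - (\<Sum>i<d. \<Sum>k<d. \<Sum>j<d. \<Sum>l<d. if l = b then s j * s l * (X a b i * X a b k * X a b j * X a b a * f i k j a * g i k j l) else 0)"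
      unfolding Bf_def sum.distrib[symmetric] sum_subtractf[symmetric] opf_def
      by (intro sum.cong refl) (simp add: algebra_simps)
    also have "(\<Sum>i<d. \<Sum>k<d. \<Sum>j<d. \<Sum>l<d. if i = a then s j * s l * (f b k j l * g i k j l) else 0)
       = (\<Sum>i<d. if i = a then (\<Sum>k<d. \<Sum>j<d. \<Sum>l<d. s j * s l * (f b k j l * g i k j l)) else 0)"
      by (intro sum.cong refl) simp
    also have "(\<Sum>i<d. \<Sum>k<d. \<Sum>j<d. \<Sum>l<d. if k = a then s j * s l * (X a b i * f i b j l * g i k j l) else 0)
       = (\<Sum>i<d. \<Sum>k<d. if k = a then (\<Sum>j<d. \<Sum>l<d. s j * s l * (X a b i * f i b j l * g i k j l)) else 0)"
      by (intro sum.cong refl) simp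
    also have "(\<Sum>i<d. \<Sum>k<d. \<Sum>j<d. \<Sum>l<d. if j = b then s j * s l * (X a b i * X a b k * X a b a * f i k a l * g i k j l) else 0)
       = (\<Sum>i<d. \<Sum>k<d. \<Sum>j<d. if j = b then (\<Sum>l<d. s j * s l * (X a b i * X a b k * X a b a * f i k a l * g i k j l)) else 0)"
      by (intro sum.cong refl) simp
    finally show ?thesis using ab by (simp only: sd)
  qed
  have R: "Bf f (opf b a g) = Bf (opf b a g) f"
    by (simp add: Bf_def mult_ac)
  have X: "X b a = X a b" by (simp add: X_def fun_eq_iff mult.commute)
  have 3: "s b * s l * (X a b i * X a b k * X a b a * z) = s a * s l * (X a b i * X a b k * X a b b * z)" for i k l z
    by (simp add: s_def X_def chi_def)
  have 4: "s j * s b * (X a b i * X a b k * X a b j * X a b a * z) = s j * s a * (X a b i * X a b k * X a b j * X a b b * z)" for i k j z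
    by (simp add: s_def X_def chi_def)
  show ?thesis unfolding R L[OF assms] L[OF assms(2,1)] X
    by (intro arg_cong2[where f="(+)"] arg_cong2[where f="(-)"] sum.cong refl)
      (use 3 4 in \<open>simp_all add: mult_ac\<close>)
qed

lemma B_contra: "(a, b) \<in> I2 \<Longrightarrow> x \<in> F2 \<Longrightarrow> y \<in> F2 \<Longrightarrow> B (D (a, b) x) y = B x (D (b, a) y)"
proof -
  assume as: "(a, b) \<in> I2" "x \<in> F2" "y \<in> F2"
  then have "co (D (a, b) x) = opf a b (co x)" "co (D (b, a) y) = opf b a (co y)"
    by (auto simp: fun_eq_iff co_D I2_def)
  then show ?thesis using as by (simp add: B_def Bf_opf I2_def)
qed

lemma B_wd: "(p, q) \<in> I2 \<Longrightarrow> (r, u) \<in> I2 \<Longrightarrow> B (wd [(p, q), (r, u)]) y = s q * s u * chi q r * co y p r q u"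
proof -
  assume as: "(p, q) \<in> I2" "(r, u) \<in> I2"
  have "B (wd [(p, q), (r, u)]) y = (\<Sum>i<d. \<Sum>k<d. \<Sum>j<d. \<Sum>l<d.
     if p = i \<and> q = j \<and> r = k \<and> u = l then s j * s l * chi j k * co y i k j l else 0)"
    unfolding B_def Bf_def co_wd by (intro sum.cong refl) auto
  then show ?thesis using as by (simp add: delta4 I2_def)
qed

lemma B_nondeg: assumes "y \<in> F2" "\<And>x. x \<in> F2 \<Longrightarrow> B x y = 0" shows "y = 0"
proof (rule F2_eqI[OF assms(1) tv.subspace_0[OF subspace_F2]])
  fix i k j l assume "i < d" "k < d" "j < d" "l < d"
  then have "B (wd [(i, j), (k, l)]) y = s j * s l * chi j k * co y i k j l" "wd [(i, j), (k, l)] \<in> F2"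
    by (auto intro!: B_wd wd_F2 simp: I2_def)
  then show "co y i k j l = co 0 i k j l" using assms(2) by auto
qed

lemma e_wd: "x \<in> I2 \<Longrightarrow> e x \<in> tv.span (letter ` I2)"
proof -
  assume "x \<in> I2"
  moreover have "idt \<in> tv.span (letter ` I2)"
    unfolding idt_def by (auto intro!: tv.span_sum intro: tv.span_base simp: I2_def)
  ultimately show ?thesis unfolding e_def
    by (intro tv.span_diff) (auto intro: tv.span_base tv.span_scale tv.span_zero)
qed

lemma tens2_F2: "tens m n 2 \<subseteq> F2"
proof -
  have 1: "letter z * v \<in> F2" if "v \<in> tv.span (letter ` I2)" "z \<in> I2" for v z
    by (rule tlin_span[OF tlin_mult_left subspace_F2 that(1)])
      (use that in \<open>auto simp: letter_wd wd_append[symmetric] intro: wd_F2\<close>)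
  have "u * v \<in> F2" if "v \<in> tv.span (letter ` I2)" "u \<in> tv.span (letter ` I2)" for u v
    by (rule tlin_span[OF tlin_mult_right subspace_F2 that(2)]) (use that 1 in auto)
  then have "ew [x, y] \<in> F2" if "x \<in> I2" "y \<in> I2" for x y
    using that e_wd by (simp add: ew_def)
  then show ?thesis
    unfolding tens_ew by (intro tv.span_minimal subspace_F2) (auto simp: length_Suc_conv numeral_2_eq_2)
qed

lemma lookup_e2:
  assumes "x \<in> I2" "(i, l) \<in> I2"
  shows "(\<Sum>p<d. s p * Poly_Mapping.lookup (e x * letter y) (Word [(p, p), (i, l)])) = 0"
    and "(\<Sum>p<d. s p * Poly_Mapping.lookup (letter y * e x) (Word [(i, l), (p, p)])) = 0"
proof -
  obtain a b where x: "x = (a, b)" "a < d" "b < d" using assms by (auto simp: I2_def)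
  have z: "(\<Sum>p<d. s p * ((if p = a \<and> p = b then z else 0) - (if a = b then s a / N * z else 0))) = 0" for z
  proof (cases "a = b")
    case True
    have "(\<Sum>p<d. s p * ((if p = a \<and> p = b then z else 0) - (if a = b then s a / N * z else 0)))
      = (\<Sum>p<d. (if p = a then s p * z else 0) - s p * (s a / N * z))"
      by (intro sum.cong refl) (simp add: True[symmetric] right_diff_distrib del: s_sq)
    also have "\<dots> = s a * z - N * (s a / N * z)"
      using x by (simp only: sum_subtractf sum_distrib_right[symmetric] sum_s) simp
    finally show ?thesis using N_nz by simp
  next
    case False
    then have "(if p = a \<and> p = b then z else 0) - (if a = b then s a / N * z else 0) = 0" for p by auto
    then show ?thesis by (simp only: mult_zero_right sum.neutral_const)
  qed
  have i: "(\<Sum>q<d. if q = p then z else 0) = z" if "p < d" for p and z :: complex using that by simp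
  have "Poly_Mapping.lookup (e x * letter y) (Word [(p, p), (i, l)]) =
     (if p = a \<and> p = b then if y = (i, l) then 1 else 0 else 0) - (if a = b then s a / N * (if y = (i, l) then 1 else 0) else 0)"
    if p: "p < d" for p
  proof -
    have "Poly_Mapping.lookup (idt * letter y) (Word [(p, p), (i, l)]) = (\<Sum>q<d. if q = p then if y = (i, l) then 1 else 0 else 0)"
      unfolding idt_def sum_distrib_right lookup_sum
      by (intro sum.cong) (auto simp: letter_wd wd_append[symmetric] lookup_wd)
    then have "Poly_Mapping.lookup (idt * letter y) (Word [(p, p), (i, l)]) = (if y = (i, l) then 1 else 0)"
      unfolding i[OF p] .
    then show ?thesis
      by (auto simp: e_def x left_diff_distrib lookup_minus tscale_mult_left letter_wd wd_append[symmetric] lookup_wd)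
  qed
  then show "(\<Sum>p<d. s p * Poly_Mapping.lookup (e x * letter y) (Word [(p, p), (i, l)])) = 0"
    using z by simp
  have "Poly_Mapping.lookup (letter y * e x) (Word [(i, l), (p, p)]) =
     (if p = a \<and> p = b then if y = (i, l) then 1 else 0 else 0) - (if a = b then s a / N * (if y = (i, l) then 1 else 0) else 0)"
    if p: "p < d" for p
  proof -
    have "Poly_Mapping.lookup (letter y * idt) (Word [(i, l), (p, p)]) = (\<Sum>q<d. if q = p then if y = (i, l) then 1 else 0 else 0)"
      unfolding idt_def sum_distrib_left lookup_sum
      by (intro sum.cong) (auto simp: letter_wd wd_append[symmetric] lookup_wd)
    then have "Poly_Mapping.lookup (letter y * idt) (Word [(i, l), (p, p)]) = (if y = (i, l) then 1 else 0)"
      unfolding i[OF p] .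
    then show ?thesis
      by (auto simp: e_def x right_diff_distrib lookup_minus tscale_mult_right letter_wd wd_append[symmetric] lookup_wd)
  qed
  then show "(\<Sum>p<d. s p * Poly_Mapping.lookup (letter y * e x) (Word [(i, l), (p, p)])) = 0"
    using z by simp
qed

lemma tens2_tr:
  assumes t: "t \<in> tens m n 2" and il: "(i, l) \<in> I2"
  shows "tr (fU (co t)) i l = 0" "tr (fL (co t)) i l = 0"
proof -
  have sub: "tv.subspace {t. (\<Sum>p<d. s p * Poly_Mapping.lookup t (W p)) = 0}" for W
    unfolding tv.subspace_def by (auto simp: lookup_add distrib_left sum.distrib mult.left_commute[of _ "_::complex"] sum_distrib_left[symmetric])
  have ee: "e x * e y \<in> V" if "tv.subspace V" "y \<in> I2" "\<And>z. z \<in> I2 \<Longrightarrow> e x * letter z \<in> V" for x y V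
    by (rule tlin_span[OF tlin_mult_left that(1) e_wd[OF that(2)]]) (use that in auto)
  have ee': "e x * e y \<in> V" if "tv.subspace V" "x \<in> I2" "\<And>z. z \<in> I2 \<Longrightarrow> letter z * e y \<in> V" for x y V
    by (rule tlin_span[OF tlin_mult_right that(1) e_wd[OF that(2)]]) (use that in auto)
  have "tens m n 2 \<subseteq> {t. (\<Sum>p<d. s p * Poly_Mapping.lookup t (Word [(p, p), (i, l)])) = 0}"
    unfolding tens_ew
    by (intro tv.span_minimal sub) (auto simp: length_Suc_conv numeral_2_eq_2 ew_def intro!: ee[OF sub, simplified] lookup_e2(1) il)
  then show "tr (fU (co t)) i l = 0" using t unfolding tr_fU by blast
  have "tens m n 2 \<subseteq> {t. (\<Sum>p<d. s p * Poly_Mapping.lookup t (Word [(i, l), (p, p)])) = 0}"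
    unfolding tens_ew
    by (intro tv.span_minimal sub) (auto simp: length_Suc_conv numeral_2_eq_2 ew_def intro!: ee'[OF sub, simplified] lookup_e2(2) il)
  then show "tr (fL (co t)) i l = 0" using t unfolding tr_fL by blast
qed

lemma sum_I2: "(\<Sum>x\<in>I2. F x) = (\<Sum>i<d. \<Sum>j<d. F (i, j))"
  unfolding I2_def sum.cartesian_product by (rule sum.cong) auto

text \<open>If a factor has supertrace zero, each \<open>letter\<close> in it may be replaced by
  \<open>e\<close>, because the corrections sum to a multiple of that supertrace
  (\<open>red\<close>). This is done for the second factor and then for the first.\<close>

lemma tens2I:
  assumes t: "t \<in> F2" and U: "\<And>i l. (i, l) \<in> I2 \<Longrightarrow> tr (fU (co t)) i l = 0"
    and L: "\<And>i l. (i, l) \<in> I2 \<Longrightarrow> tr (fL (co t)) i l = 0"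
  shows "t \<in> tens m n 2"
proof -
  let ?c = "\<lambda>x y. Poly_Mapping.lookup t (Word [x, y])"
  have diag: "(\<Sum>x\<in>I2. if fst x = snd x then tscale (h x * (s (fst x) / N)) idt else 0)
      = tscale ((\<Sum>p<d. s p * h (p, p)) / N) idt" for h
  proof -
    have "(\<Sum>x\<in>I2. if fst x = snd x then tscale (h x * (s (fst x) / N)) idt else 0)
      = (\<Sum>i<d. \<Sum>j<d. if j = i then tscale (h (i, i) * (s i / N)) idt else 0)"
      unfolding I2_def sum.cartesian_product by (rule sum.cong) auto
    then show ?thesis by (simp add: tv.scale_sum_left sum_divide_distrib mult.commute)
  qed
  have red: "(\<Sum>x\<in>I2. tscale (h x) (letter x)) = (\<Sum>x\<in>I2. tscale (h x) (e x))"
    if "(\<Sum>p<d. s p * h (p, p)) = 0" for h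
    using diag[of h] that
    by (simp add: e_def tv.scale_right_diff_distrib sum_subtractf if_distrib[of "tscale _"] cong: if_cong)
  have "t = (\<Sum>x\<in>I2. \<Sum>y\<in>I2. tscale (?c x y) (letter x * letter y))"
  proof -
    have "t = (\<Sum>i<d. \<Sum>k<d. \<Sum>j<d. \<Sum>l<d. tscale (?c (i, j) (k, l)) (letter (i, j) * letter (k, l)))"
      by (subst mk_co[OF t, symmetric])
        (simp add: mk_def co_def letter_wd wd_append[symmetric])
    also have "\<dots> = (\<Sum>i<d. \<Sum>j<d. \<Sum>k<d. \<Sum>l<d. tscale (?c (i, j) (k, l)) (letter (i, j) * letter (k, l)))"
      by (intro sum.cong refl sum.swap)
    finally show ?thesis by (simp add: sum_I2)
  qed
  also have "\<dots> = (\<Sum>x\<in>I2. letter x * (\<Sum>y\<in>I2. tscale (?c x y) (letter y)))"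
    by (simp add: sum_distrib_left tscale_mult_right)
  also have "\<dots> = (\<Sum>x\<in>I2. letter x * (\<Sum>y\<in>I2. tscale (?c x y) (e y)))"
    by (intro sum.cong refl arg_cong2[where f="(*)"] red) (use L[unfolded tr_fL] in auto)
  also have "\<dots> = (\<Sum>y\<in>I2. (\<Sum>x\<in>I2. tscale (?c x y) (letter x)) * e y)"
    unfolding sum_distrib_left sum_distrib_right tscale_mult_right tscale_mult_left by (rule sum.swap)
  also have "\<dots> = (\<Sum>y\<in>I2. (\<Sum>x\<in>I2. tscale (?c x y) (e x)) * e y)"
    by (intro sum.cong refl arg_cong2[where f="(*)"] red) (use U[unfolded tr_fU] in auto)
  also have "\<dots> = (\<Sum>y\<in>I2. \<Sum>x\<in>I2. tscale (?c x y) (ew [x, y]))"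
    by (simp add: sum_distrib_right tscale_mult_left ew_def)
  also have "\<dots> \<in> tens m n 2"
    using ew_tens[of "[_, _]"]
    by (intro tv.subspace_sum[OF subspace_tens] tv.subspace_scale[OF subspace_tens])
      (auto simp: numeral_2_eq_2)
  finally show ?thesis .
qed

end

section \<open>Traceless tensors of given symmetry\<close>

text \<open>A separating linear functional in disguise: the values are tensors so that
  \<open>tlin\<close> applies, and \<open>perp_nonzero\<close> reads off the scalar as the
  coefficient of the empty word.\<close>

lemma separating_map:
  assumes "tv.subspace S" "x \<notin> S"
  shows "\<exists>g. tlin g \<and> (\<forall>y\<in>S. g y = 0) \<and> g x = 1"
proof -
  obtain C where C: "C \<subseteq> S" "tv.independent C" "S \<subseteq> tv.span C"
    by (rule tv.basis_exists[of S])
  have "tv.span C \<subseteq> S" using C assms by (intro tv.span_minimal)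
  then have "tv.independent (insert x C)"
    using assms C by (intro tv.independent_insertI) auto
  then obtain g where g: "Vector_Spaces.linear tscale tscale g" "\<forall>y\<in>insert x C. g y = (if y = x then 1 else 0)"
    using vector_space_pair.linear_independent_extend[OF vector_space_pair.intro[OF tv.vector_space_axioms tv.vector_space_axioms],
       of "insert x C" "\<lambda>y. if y = x then 1 else 0"] by blast
  have l: "tlin g"
    using g(1) by (simp add: tlin_def Vector_Spaces.linear_iff)
  have "g y = 0" if "y \<in> S" for y
  proof -
    have "g z = 0" if "z \<in> C" for z using that C(1) g(2) assms(2) by auto
    then show ?thesis using tlin_span[OF l, of "{0}" y C] that C(3) by (auto simp: tv.subspace_def)
  qed
  then show ?thesis using l g(2) by auto
qed

context sl_super
begin

text \<open>The traceless tensors with symmetry type \<open>sg\<close> in the upper and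
  \<open>sg'\<close> in the lower indices, in the super sense. Given the symmetries, one vanishing
  contraction implies the others. The Cartan square will be \<open>T 1 1\<close>.\<close>

definition T :: "complex \<Rightarrow> complex \<Rightarrow> tensor set" where
  "T sg sg' = {t \<in> F2. (\<forall>i k j l. chi i k * co t k i j l = sg * co t i k j l) \<and>
     (\<forall>i k j l. chi j l * co t i k l j = sg' * co t i k j l) \<and> (\<forall>i l. tr (co t) i l = 0)}"

text \<open>The identity, inserted into one upper and one lower slot next to \<open>z\<close>, then
  symmetrised according to the two signs: the general trace part of that symmetry type.\<close>

definition Y :: "complex \<Rightarrow> complex \<Rightarrow> (nat \<Rightarrow> nat \<Rightarrow> complex) \<Rightarrow> nat \<Rightarrow> nat \<Rightarrow> nat \<Rightarrow> nat \<Rightarrow> complex" where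
  "Y sg sg' z i k j l = (if k = j then z i l else 0) + sg * (if i = j then chi i k * z k l else 0)
    + sg' * (if k = l then chi j l * z i j else 0) + sg * sg' * (if i = l then chi i k * chi j l * z k j else 0)"

lemma subspace_T: "tv.subspace (T sg sg')"
  unfolding tv.subspace_def T_def
  using tv.subspace_0[OF subspace_F2] tv.subspace_add[OF subspace_F2] tv.subspace_scale[OF subspace_F2]
  by (auto simp: tr_def algebra_simps sum.distrib sum_distrib_left[symmetric])

lemma T_gmod: "gmod (T sg sg')"
  unfolding gmod_def
proof (intro conjI subspace_T ballI)
  fix x t assume x: "x \<in> I2" and t: "t \<in> T sg sg'"
  obtain a b where ab: "x = (a, b)" "a < d" "b < d" using x by (auto simp: I2_def)
  have F: "t \<in> F2" using t by (simp add: T_def)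
  have co: "co (D x t) = opf a b (co t)" using co_D[of a b t] x F by (auto simp: ab fun_eq_iff)
  have U: "fU (co t) = (\<lambda>i k j l. sg * co t i k j l)" and L: "fL (co t) = (\<lambda>i k j l. sg' * co t i k j l)"
    using t by (simp_all add: T_def fU_def fL_def fun_eq_iff)
  have sc: "opf a b (\<lambda>i k j l. c * f i k j l) i k j l = c * opf a b f i k j l" for c f i k j l
    by (simp add: opf_def algebra_simps)
  have "fU (opf a b (co t)) i k j l = sg * opf a b (co t) i k j l" for i k j l
    unfolding opf_fU[symmetric] U by (rule sc)
  moreover have "fL (opf a b (co t)) i k j l = sg' * opf a b (co t) i k j l" for i k j l
    unfolding opf_fL[symmetric] L by (rule sc)
  moreover have "tr (opf a b (co t)) i l = 0" for i l
    using t ab by (simp add: tr_opf T_def)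
  ultimately show "D x t \<in> T sg sg'"
    using D_F2[OF x F] by (simp add: T_def co fU_def fL_def)
qed

lemma tr_Y:
  assumes "i < d" "l < d"
  shows "tr (Y sg sg' z) i l = (N + sg + sg') * z i l + sg * sg' * (if i = l then (\<Sum>p<d. s p * z p p) else 0)"
proof -
  have "tr (Y sg sg' z) i l = (\<Sum>p<d. s p * z i l + (if p = i then sg * z i l else 0)
     + (if p = l then sg' * z i l else 0) + (if i = l then sg * sg' * (s p * z p p) else 0))"
    unfolding tr_def Y_def
    by (intro sum.cong refl) (auto simp: algebra_simps s_def chi_def)
  also have "\<dots> = (N + sg + sg') * z i l + sg * sg' * (if i = l then (\<Sum>p<d. s p * z p p) else 0)"
    using assms by (simp add: sum.distrib sum_distrib_right[symmetric] sum_s sum_distrib_left[symmetric] distrib_right)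
  finally show ?thesis .
qed

lemma Y_sym: assumes "sg * sg = 1" "sg' * sg' = 1"
  shows "fU (Y sg sg' z) i k j l = sg * Y sg sg' z i k j l" "fL (Y sg sg' z) i k j l = sg' * Y sg sg' z i k j l"
proof -
  have a: "sg * (sg * x) = x" "sg' * (sg' * x) = x" for x
    using assms by (simp_all add: mult.assoc[symmetric])
  show "fU (Y sg sg' z) i k j l = sg * Y sg sg' z i k j l" "fL (Y sg sg' z) i k j l = sg' * Y sg sg' z i k j l"
    unfolding fU_def fL_def Y_def
    by (auto simp: distrib_left a mult_ac chi_sym)
qed

text \<open>Pairing with an inserted identity contracts the other argument.\<close>

lemma Bf_insert: assumes "\<And>i l. tr g i l = 0"
  shows "Bf (\<lambda>i k j l. if k = j then z i l else 0) g = 0"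
proof -
  have "Bf (\<lambda>i k j l. if k = j then z i l else 0) g
      = (\<Sum>i<d. \<Sum>k<d. \<Sum>j<d. if j = k then (\<Sum>l<d. s j * s l * (z i l * g i k j l)) else 0)"
    unfolding Bf_def by (intro sum.cong refl) auto
  also have "\<dots> = (\<Sum>i<d. \<Sum>k<d. \<Sum>l<d. s k * s l * (z i l * g i k k l))" by simp
  also have "\<dots> = (\<Sum>i<d. \<Sum>l<d. \<Sum>k<d. s k * s l * (z i l * g i k k l))"
    by (intro sum.cong refl sum.swap)
  also have "\<dots> = (\<Sum>i<d. \<Sum>l<d. s l * z i l * tr g i l)"
    by (simp add: tr_def sum_distrib_left mult_ac)
  finally show ?thesis using assms by simp
qed

lemma Bf_Y:
  assumes t: "t \<in> T sg sg'" and sg: "sg * sg = 1" "sg' * sg' = 1"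
  shows "Bf (Y sg sg' z) (co t) = 0"
proof -
  let ?i = "\<lambda>i k j l. if k = j then z i l else 0"
  have U: "fU (co t) = (\<lambda>i k j l. sg * co t i k j l)" and L: "fL (co t) = (\<lambda>i k j l. sg' * co t i k j l)"
    using t by (simp_all add: T_def fU_def fL_def fun_eq_iff)
  have "Y sg sg' z = (\<lambda>i k j l. ((?i i k j l + sg * fU ?i i k j l) + sg' * fL ?i i k j l) + (sg * sg') * fU (fL ?i) i k j l)"
    by (auto simp: Y_def fun_eq_iff fU_def fL_def)
  then have "Bf (Y sg sg' z) (co t) = Bf ?i (co t) + sg * Bf (fU ?i) (co t) + sg' * Bf (fL ?i) (co t) + sg * sg' * Bf (fU (fL ?i)) (co t)"
    by (simp only: Bf_add Bf_cmul)
  also have "Bf ?i (co t) = 0" using t by (intro Bf_insert) (simp add: T_def)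
  finally show ?thesis
    unfolding Bf_fU U Bf_fL Bf_cmul_right L by (simp add: \<open>Bf ?i (co t) = 0\<close>)
qed

section \<open>Orthogonal projection onto the traceless tensors\<close>

definition sym :: "complex \<Rightarrow> complex \<Rightarrow> (nat \<Rightarrow> nat \<Rightarrow> nat \<Rightarrow> nat \<Rightarrow> complex) \<Rightarrow> nat \<Rightarrow> nat \<Rightarrow> nat \<Rightarrow> nat \<Rightarrow> complex" where
  "sym sg sg' f i k j l = (1/4) * (((f i k j l + sg * fU f i k j l) + sg' * fL f i k j l) + (sg * sg') * fU (fL f) i k j l)"

lemma sym_sym:
  assumes "sg * sg = 1" "sg' * sg' = 1"
  shows "chi i k * sym sg sg' f k i j l = sg * sym sg sg' f i k j l"
    "chi j l * sym sg sg' f i k l j = sg' * sym sg sg' f i k j l"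
proof -
  have a: "sg * (sg * x) = x" "sg' * (sg' * x) = x" for x
    using assms by (simp_all add: mult.assoc[symmetric])
  show "chi i k * sym sg sg' f k i j l = sg * sym sg sg' f i k j l"
    "chi j l * sym sg sg' f i k l j = sg' * sym sg sg' f i k j l"
    unfolding sym_def fU_def fL_def
    by (simp_all add: distrib_left a mult_ac chi_sym add_ac)
qed

lemma Bf_sym:
  assumes t: "t \<in> T sg sg'" and sg: "sg * sg = 1" "sg' * sg' = 1"
  shows "Bf (sym sg sg' f) (co t) = Bf f (co t)"
proof -
  have U: "fU (co t) = (\<lambda>i k j l. sg * co t i k j l)" and L: "fL (co t) = (\<lambda>i k j l. sg' * co t i k j l)"
    using t by (simp_all add: T_def fU_def fL_def fun_eq_iff)
  have "Bf (sym sg sg' f) (co t) = (1/4) * (Bf f (co t) + sg * Bf (fU f) (co t) + sg' * Bf (fL f) (co t) + sg * sg' * Bf (fU (fL f)) (co t))"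
    unfolding sym_def by (simp only: Bf_add Bf_cmul)
  also have "\<dots> = (1/4) * (Bf f (co t) + (sg * sg) * Bf f (co t) + (sg' * sg') * Bf f (co t) + (sg * sg) * (sg' * sg') * Bf f (co t))"
    unfolding Bf_fU U Bf_fL Bf_cmul_right L by (simp add: mult_ac)
  finally show ?thesis using sg by simp
qed

lemma sign_cases: "sg * sg = 1 \<longleftrightarrow> sg = 1 \<or> sg = (-1::complex)"
  by (metis mult_minus1_right square_eq_1_iff power2_eq_square mult_1_left minus_minus)

lemma sign_nz:
  assumes "sg * sg = 1" "sg' * sg' = 1"
  shows "N + sg + sg' \<noteq> 0" "N + sg \<noteq> 0"
  using assms N_nz unfolding sign_cases by (auto simp: algebra_simps)

text \<open>By \<open>tr_Y\<close> the equation for \<open>z\<close> is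
  \<open>tr h = (N + sg + sg') * z\<close> plus a scalar matrix that involves the supertrace of
  \<open>z\<close>. Dividing by \<open>N + sg + sg'\<close> settles it up to one unknown scalar
  \<open>xi\<close>.\<close>

lemma trace_part:
  assumes sg: "sg * sg = 1" "sg' * sg' = 1"
    and h: "\<And>i k j l. chi i k * h k i j l = sg * h i k j l" "\<And>i k j l. chi j l * h i k l j = sg' * h i k j l"
  shows "\<exists>z. \<forall>i<d. \<forall>l<d. tr h i l = tr (Y sg sg' z) i l"
proof -
  define S where "S = (\<Sum>i<d. s i * tr h i i)"
  have S: "S = sg * sg' * S"
  proof -
    have hh: "h i p p i = sg * sg' * h p i i p" for i p
    proof -
      have "h i p p i = sg * (chi i p * h p i p i)" using h(1)[of i p p i] sg by (simp add: mult.assoc[symmetric])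
      also have "h p i p i = sg' * (chi p i * h p i i p)" using h(2)[of p i p i] sg by (simp add: mult.assoc[symmetric])
      finally show ?thesis by (simp add: chi_sym[of i p] mult.left_commute)
    qed
    have "S = (\<Sum>i<d. \<Sum>p<d. s i * s p * h i p p i)"
      unfolding S_def tr_def by (simp add: sum_distrib_left mult.assoc)
    also have "\<dots> = (\<Sum>i<d. \<Sum>p<d. sg * sg' * (s i * s p * h p i i p))"
      by (subst hh) (simp add: mult_ac)
    also have "\<dots> = sg * sg' * (\<Sum>p<d. \<Sum>i<d. s i * s p * h p i i p)"
      by (subst sum.swap) (simp add: sum_distrib_left)
    also have "(\<Sum>p<d. \<Sum>i<d. s i * s p * h p i i p) = S"
      unfolding S_def tr_def by (simp add: sum_distrib_left mult_ac)
    finally show ?thesis .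
  qed
  define M where "M = N + sg + sg'"
  have M: "M \<noteq> 0" using sign_nz[OF sg] by (simp add: M_def)
  \<comment> \<open>For equal signs, taking supertraces gives
    \<open>S - N * xi = (N + 2 * sg) * xi\<close>, whence this value. For opposite signs the
    symmetries of \<open>h\<close> force \<open>S = 0\<close>, and the same formula gives
    \<open>xi = 0\<close>.\<close>
  define xi where "xi = S / (2 * (N + sg))"
  define z where "z = (\<lambda>i l. (tr h i l - (if i = l then xi else 0)) / M)"
  have str: "(\<Sum>p<d. s p * z p p) = (S - N * xi) / M"
  proof -
    have "(\<Sum>p<d. s p * z p p) = (\<Sum>p<d. s p * tr h p p - s p * xi) / M"
      unfolding sum_divide_distrib by (intro sum.cong refl) (simp add: z_def right_diff_distrib)
    then show ?thesis by (simp add: sum_subtractf sum_distrib_right[symmetric] sum_s S_def)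
  qed

  have xi: "sg * sg' * (S - N * xi) = M * xi"
  proof (cases "sg * sg' = 1")
    case True
    then have "sg' = sg" using sg unfolding sign_cases by auto
    moreover have "2 * (N + sg) * xi = S" using sign_nz(2)[OF sg] by (simp only: xi_def) (simp del: distrib_left_numeral)
    ultimately show ?thesis using sg by (simp add: M_def algebra_simps)
  next
    case False
    then have "sg' = - sg" using sg unfolding sign_cases by auto
    then have "S = - S" using S sg by simp
    then have "S = 0" by simp
    then show ?thesis by (simp add: xi_def)
  qed
  have "tr h i l = tr (Y sg sg' z) i l" if "i < d" "l < d" for i l
  proof -
    have "tr (Y sg sg' z) i l = M * z i l + (if i = l then sg * sg' * ((S - N * xi) / M) else 0)"
      using that by (simp add: tr_Y M_def str)
    also have "sg * sg' * ((S - N * xi) / M) = xi"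
      using xi M by (simp add: field_simps)
    also have "M * z i l = tr h i l - (if i = l then xi else 0)" using M by (simp add: z_def)
    finally show ?thesis by simp
  qed
  then show ?thesis by blast
qed

lemma sym_trace_part:
  assumes sg: "sg * sg = 1" "sg' * sg' = 1"
  shows "\<exists>z. mk (\<lambda>i k j l. sym sg sg' f i k j l - Y sg sg' z i k j l) \<in> T sg sg'"
proof -
  obtain z where z: "\<forall>i<d. \<forall>l<d. tr (sym sg sg' f) i l = tr (Y sg sg' z) i l"
    using trace_part[OF sg sym_sym[OF sg]] by blast
  let ?t = "mk (\<lambda>i k j l. sym sg sg' f i k j l - Y sg sg' z i k j l)"
  have "tr (co ?t) i l = 0" for i l
  proof (cases "i < d \<and> l < d")
    case True
    then have "tr (co ?t) i l = tr (sym sg sg' f) i l - tr (Y sg sg' z) i l"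
      unfolding tr_def sum_subtractf[symmetric] by (intro sum.cong refl) (auto simp: co_mk right_diff_distrib)
    then show ?thesis using z True by simp
  next
    case False
    then show ?thesis by (auto simp: tr_def co_mk)
  qed
  moreover have "chi i k * co ?t k i j l = sg * co ?t i k j l" "chi j l * co ?t i k l j = sg' * co ?t i k j l" for i k j l
    using sym_sym[OF sg, of i k f j l] Y_sym[OF sg, of z i k j l]
      sym_sym(2)[OF sg, of j l f i k]
    by (auto simp: co_mk right_diff_distrib fU_def fL_def)
  ultimately have "?t \<in> T sg sg'" unfolding T_def using mk_F2 by blast
  then show ?thesis by blast
qed

text \<open>Symmetrising does not change the pairing with \<open>T sg sg'\<close>
  (\<open>Bf_sym\<close>), and the trace part is orthogonal to it (\<open>Bf_Y\<close>), so
  symmetrising and subtracting the trace part projects orthogonally.\<close>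

lemma T_projection:
  assumes sg: "sg * sg = 1" "sg' * sg' = 1" and y: "y \<in> F2"
  shows "\<exists>t\<in>T sg sg'. \<forall>u\<in>T sg sg'. B (y - t) u = 0"
proof -
  obtain z where z: "mk (\<lambda>i k j l. sym sg sg' (co y) i k j l - Y sg sg' z i k j l) \<in> T sg sg'" (is "?t \<in> _")
    using sym_trace_part[OF sg] by blast
  have "B (y - ?t) u = 0" if u: "u \<in> T sg sg'" for u
  proof -
    have "B ?t u = Bf (\<lambda>i k j l. sym sg sg' (co y) i k j l - Y sg sg' z i k j l) (co u)"
      unfolding B_def Bf_def by (intro sum.cong refl) (simp add: co_mk)
    also have "\<dots> = B y u" unfolding Bf_diff Bf_sym[OF u sg] Bf_Y[OF u sg] by (simp add: B_def)
    finally show ?thesis by simp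
  qed
  then show ?thesis using z by blast
qed

lemma T_F2: "t \<in> T sg sg' \<Longrightarrow> t \<in> F2" by (simp add: T_def)

lemma T_nondeg:
  assumes sg: "sg * sg = 1" "sg' * sg' = 1" and u: "u \<in> T sg sg'" and "\<And>v. v \<in> T sg sg' \<Longrightarrow> B v u = 0"
  shows "u = 0"
proof (rule B_nondeg)
  fix x assume "x \<in> F2"
  then obtain t where t: "t \<in> T sg sg'" "B (x - t) u = 0" using T_projection[OF sg] u by blast
  then show "B x u = 0" using assms by simp
qed (use u in \<open>simp add: T_F2\<close>)

definition pj :: "complex \<Rightarrow> complex \<Rightarrow> tensor \<Rightarrow> tensor" where
  "pj sg sg' y = (SOME t. t \<in> T sg sg' \<and> (\<forall>u\<in>T sg sg'. B (y - t) u = 0))"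

lemma pj:
  assumes sg: "sg * sg = 1" "sg' * sg' = 1" and y: "y \<in> F2"
  shows pj_T: "pj sg sg' y \<in> T sg sg'" and pj_B: "u \<in> T sg sg' \<Longrightarrow> B (pj sg sg' y) u = B y u"
proof -
  have "pj sg sg' y \<in> T sg sg' \<and> (\<forall>u\<in>T sg sg'. B (y - pj sg sg' y) u = 0)"
    unfolding pj_def using T_projection[OF assms] by (rule_tac someI_ex) blast
  then show "pj sg sg' y \<in> T sg sg'" "u \<in> T sg sg' \<Longrightarrow> B (pj sg sg' y) u = B y u" by auto
qed

lemma pj_unique:
  assumes sg: "sg * sg = 1" "sg' * sg' = 1" and y: "y \<in> F2"
    and t: "t \<in> T sg sg'" "\<And>u. u \<in> T sg sg' \<Longrightarrow> B t u = B y u"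
  shows "pj sg sg' y = t"
proof -
  have "pj sg sg' y - t \<in> T sg sg'" using pj_T[OF sg y] t tv.subspace_diff[OF subspace_T] by blast
  moreover have "B v (pj sg sg' y - t) = 0" if "v \<in> T sg sg'" for v
    using pj_B[OF sg y that] t(2)[OF that] by (simp add: B_sym[of v])
  ultimately have "pj sg sg' y - t = 0" using T_nondeg[OF sg] by blast
  then show ?thesis by simp
qed

lemma pj_id: "sg * sg = 1 \<Longrightarrow> sg' * sg' = 1 \<Longrightarrow> t \<in> T sg sg' \<Longrightarrow> pj sg sg' t = t"
  by (rule pj_unique) (auto simp: T_F2)

lemma pj_add:
  assumes "sg * sg = 1" "sg' * sg' = 1" "x \<in> F2" "y \<in> F2"
  shows "pj sg sg' (x + y) = pj sg sg' x + pj sg sg' y"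
  using assms by (intro pj_unique) (auto simp: pj_B intro!: tv.subspace_add[OF subspace_T] pj_T tv.subspace_add[OF subspace_F2])

lemma pj_scale:
  assumes "sg * sg = 1" "sg' * sg' = 1" "x \<in> F2"
  shows "pj sg sg' (tscale c x) = tscale c (pj sg sg' x)"
  using assms by (intro pj_unique) (auto simp: pj_B intro!: tv.subspace_scale[OF subspace_T] pj_T tv.subspace_scale[OF subspace_F2])

text \<open>Equivariance comes from adjointness: testing \<open>D (a, b)\<close> against
  \<open>T sg sg'\<close> moves it to \<open>D (b, a)\<close>, which preserves
  \<open>T sg sg'\<close>.\<close>

lemma pj_D:
  assumes "sg * sg = 1" "sg' * sg' = 1" "x \<in> I2" "y \<in> F2"
  shows "pj sg sg' (D x y) = D x (pj sg sg' y)"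
proof (rule pj_unique[OF assms(1,2)])
  obtain a b where x: "x = (a, b)" by (cases x)
  have ba: "(b, a) \<in> I2" "(a, b) \<in> I2" using assms x by (auto simp: I2_def)
  show "D x y \<in> F2" using assms by (simp add: D_F2)
  show "D x (pj sg sg' y) \<in> T sg sg'" using T_gmod assms pj_T by (auto simp: gmod_def)
  fix u assume u: "u \<in> T sg sg'"
  then have "D (b, a) u \<in> T sg sg'" using T_gmod ba by (auto simp: gmod_def)
  then show "B (D x (pj sg sg' y)) u = B (D x y) u"
  proof -
    have F: "pj sg sg' y \<in> F2" "u \<in> F2" using u assms pj_T T_F2 by blast+
    have "B (D (a, b) (pj sg sg' y)) u = B (pj sg sg' y) (D (b, a) u)" using B_contra ba F by blast
    also have "\<dots> = B y (D (b, a) u)" using pj_B[OF assms(1,2,4) \<open>D (b, a) u \<in> T sg sg'\<close>] .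
    also have "\<dots> = B (D (a, b) y) u" using B_contra ba F assms by metis
    finally show ?thesis by (simp add: x)
  qed
qed

lemma perp_gmod:
  assumes S: "gmod S" "S \<subseteq> F2" and R: "gmod R" "R \<subseteq> F2"
  shows "gmod {u \<in> R. \<forall>v\<in>S. B v u = 0}"
  unfolding gmod_def
proof (intro conjI ballI)
  show "tv.subspace {u \<in> R. \<forall>v\<in>S. B v u = 0}"
    using R by (auto simp: tv.subspace_def gmod_def)
  fix x u assume x: "x \<in> I2" and u: "u \<in> {u \<in> R. \<forall>v\<in>S. B v u = 0}"
  obtain a b where ab: "x = (a, b)" by (cases x)
  have ba: "(b, a) \<in> I2" using x ab by (auto simp: I2_def)
  have "B v (D x u) = 0" if "v \<in> S" for v
  proof -
    have "v \<in> F2" "u \<in> F2" using that u S R by blast+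
    then have "B v (D x u) = B (D (b, a) v) u" using B_contra[OF ba, of v u] by (simp add: ab)
    moreover have "D (b, a) v \<in> S" using S that ba by (auto simp: gmod_def)
    ultimately show ?thesis using u by auto
  qed
  then show "D x u \<in> {u \<in> R. \<forall>v\<in>S. B v u = 0}" using u R x by (auto simp: gmod_def)
qed

text \<open>Replaces a dimension count: a functional that vanishes on \<open>S\<close> but not on
  \<open>T sg sg'\<close> is represented by a vector through \<open>B\<close>, and the projection of
  this vector is the element sought.\<close>

lemma perp_nonzero:
  assumes sg: "sg * sg = 1" "sg' * sg' = 1" and S: "tv.subspace S" "S \<subseteq> T sg sg'" "S \<noteq> T sg sg'"
  shows "\<exists>u\<in>T sg sg'. u \<noteq> 0 \<and> (\<forall>v\<in>S. B v u = 0)"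
proof -
  obtain x where x: "x \<in> T sg sg'" "x \<notin> S" using S by blast
  then obtain g where g: "tlin g" "\<forall>y\<in>S. g y = 0" "g x = 1" using separating_map S by blast
  define phi where "phi = (\<lambda>t. Poly_Mapping.lookup (g t) 0)"
  \<comment> \<open>The vector representing \<open>phi\<close>: its coordinates are the values of
    \<open>phi\<close> on the coordinate basis, and the factor \<open>s j * s l\<close>, being its
    own inverse, undoes the weights of \<open>Bf\<close>.\<close>
  define y where "y = mk (\<lambda>i k j l. s j * s l * (chi j k * phi (wd [(i, j), (k, l)])))"
  have y: "y \<in> F2" by (simp add: y_def mk_F2)
  have phi_sum: "phi (sum h A) = (\<Sum>a\<in>A. phi (h a))" for h and A :: "nat set"
    by (simp add: phi_def tlin_sum[OF g(1)] lookup_sum)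
  have B: "B t y = phi t" if "t \<in> F2" for t
  proof -
    have "phi t = phi (mk (co t))" using that by (simp add: mk_co)
    also have "\<dots> = (\<Sum>i<d. \<Sum>k<d. \<Sum>j<d. \<Sum>l<d. chi j k * co t i k j l * phi (wd [(i, j), (k, l)]))"
      unfolding mk_def phi_sum by (simp add: phi_def tlin_scale[OF g(1)])
    also have "\<dots> = B t y"
      unfolding B_def Bf_def by (intro sum.cong refl) (simp add: y_def co_mk mult_ac)
    finally show ?thesis by simp
  qed
  let ?u = "pj sg sg' y"
  have u: "?u \<in> T sg sg'" using pj_T[OF sg y] .
  have Bu: "B v ?u = phi v" if "v \<in> T sg sg'" for v
    using pj_B[OF sg y that] B[OF T_F2[OF that]] by (simp add: B_sym)
  have "B x ?u \<noteq> 0" using Bu[OF x(1)] g(3) by (simp add: phi_def)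
  then have "?u \<noteq> 0" by auto
  moreover have "B v ?u = 0" if "v \<in> S" for v
    using Bu[of v] that S g(2) by (auto simp: phi_def)
  ultimately show ?thesis using u by blast
qed

text \<open>A submodule of \<open>T sg sg'\<close> is detected by the coordinates whose upper indices differ from
  their lower indices: the others are, through the action of the matrix units, determined by
  contractions, which vanish.\<close>

lemma type2_zero:
  assumes sg: "sg * sg = 1" "sg' * sg' = 1" and S: "gmod S" "S \<subseteq> T sg sg'"
    and z: "\<And>t i k j l. t \<in> S \<Longrightarrow> i < d \<Longrightarrow> k < d \<Longrightarrow> j < d \<Longrightarrow> l < d \<Longrightarrow> i \<noteq> j \<Longrightarrow> i \<noteq> l \<Longrightarrow> k \<noteq> j \<Longrightarrow> k \<noteq> l \<Longrightarrow> co t i k j l = 0"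
    and t: "t \<in> S"
  shows "t = 0"
proof -
  have d3: "d \<ge> 3" using mn by simp
  have other: "\<exists>r<d. r \<noteq> p \<and> r \<noteq> q" for p q :: nat
  proof -
    have "r < d" if "r \<in> {0, 1, 2}" for r using that d3 by auto
    moreover have "\<exists>r\<in>{0, 1, 2}. r \<noteq> p \<and> r \<noteq> q" by auto
    ultimately show ?thesis by blast
  qed
  have ss: "sg * (sg * x) = x" "sg' * (sg' * x) = x" for x
    using sg by (simp_all add: mult.assoc[symmetric])
  have F: "u \<in> F2" if "u \<in> S" for u using that S T_F2 by blast
  have U: "co u k i j l = sg * chi i k * co u i k j l" if "u \<in> S" for u i k j l
  proof -
    have "u \<in> T sg sg'" using that S by blast
    then have "chi i k * co u k i j l = sg * co u i k j l" by (simp add: T_def)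
    then have "chi i k * (chi i k * co u k i j l) = chi i k * (sg * co u i k j l)" by (simp only:)
    then show ?thesis by (simp add: mult_ac)
  qed
  have L: "co u i k l j = sg' * chi j l * co u i k j l" if "u \<in> S" for u i k j l
  proof -
    have "u \<in> T sg sg'" using that S by blast
    then have "chi j l * co u i k l j = sg' * co u i k j l" by (simp add: T_def)
    then have "chi j l * (chi j l * co u i k l j) = chi j l * (sg' * co u i k j l)" by (simp only:)
    then show ?thesis by (simp add: mult_ac)
  qed
  have T0: "(\<Sum>p<d. s p * co u i p p l) = 0" if "u \<in> S" for u i l
    using that S by (auto simp: T_def tr_def)
  have Dc: "co (D (a, b) u) i k j l = opf a b (co u) i k j l \<and> D (a, b) u \<in> S" if "u \<in> S" "a < d" "b < d" for u a b i k j l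
    using that S F by (auto simp: co_D I2_def gmod_def)
  \<comment> \<open>The coordinate \<open>i a b l\<close> of \<open>D (a, b) u\<close> vanishes by
    \<open>z\<close>, which relates the entries \<open>co u i q q l\<close> for different
    \<open>q\<close>: they are equal up to extra terms at \<open>q = i\<close> and
    \<open>q = l\<close>. The vanishing contraction then becomes
    \<open>(N + sg + sg') * co u i c c l = 0\<close>.\<close>
  have step1: "co u i p p l = 0" if u: "u \<in> S" and il: "i \<noteq> l" "i < d" "l < d" and p: "p < d" for u i l p
  proof -
    obtain c where c: "c < d" "c \<noteq> i" "c \<noteq> l" using other by blast
    have 0: "opf a b (co u) i a b l = 0" if "a < d" "b < d" "i \<noteq> b" "a \<noteq> b" "a \<noteq> l" for a b
      using Dc[OF u that(1,2)] z[of "D (a, b) u" i a b l] that il by simp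
    have g1: "co u i q q l = co u i c c l" if "q < d" "q \<noteq> i" "q \<noteq> l" for q
    proof (cases "q = c")
      case False
      then show ?thesis using 0[of c q] that c by (simp add: opf_def)
    qed simp
    have g2: "co u i i i l = (1 + sg * s i) * co u i c c l"
    proof -
      have "co u c i c l + X i c i * co u i c c l - X i c i * co u i i i l = 0"
        using 0[of i c] c il by (simp add: opf_def)
      moreover have "X i c i = chi i c * s i" by (simp add: X_def chi_sym)
      moreover have "co u c i c l = chi i c * (sg * co u i c c l)" using U[OF u, of c i c l] by (simp add: mult_ac)
      ultimately have "chi i c * (sg * co u i c c l + s i * co u i c c l - s i * co u i i i l) = 0"
        by (simp add: algebra_simps)
      then have "s i * (sg * co u i c c l + s i * co u i c c l - s i * co u i i i l) = 0" by simp
      then show ?thesis by (simp add: algebra_simps)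
    qed
    have g3: "co u i l l l = (1 + sg' * s l) * co u i c c l"
    proof -
      have "X c l i * co u i l l l - X c l i * co u i c c l - X c l i * X c l l * co u i c l c = 0"
        using 0[of c l] c il by (simp add: opf_def mult_ac)
      then have "X c l i * (co u i l l l - co u i c c l - X c l l * co u i c l c) = 0" by (simp add: algebra_simps)
      moreover have "X c l l = chi c l * s l" by (simp add: X_def)
      moreover have "co u i c l c = chi c l * (sg' * co u i c c l)" using L[OF u, of i c l c] by (simp add: mult_ac)
      ultimately have "co u i l l l - co u i c c l - chi c l * s l * (chi c l * (sg' * co u i c c l)) = 0" by simp
      then show ?thesis by (simp add: algebra_simps)
    qed
    have "(\<Sum>q<d. s q * co u i q q l) = (\<Sum>q<d. s q * co u i c c l + (if q = i then sg * co u i c c l else 0) + (if q = l then sg' * co u i c c l else 0))"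
      by (intro sum.cong refl) (use il g1 g2 g3 in \<open>auto simp: algebra_simps\<close>)
    also have "\<dots> = (N + sg + sg') * co u i c c l"
      using il by (simp add: sum.distrib sum_distrib_right[symmetric] sum_s distrib_right)
    finally have "co u i c c l = 0" using T0[OF u] sign_nz[OF sg] by simp
    then show ?thesis using g1 g2 g3 p by (cases "p = i"; cases "p = l") auto
  qed
  \<comment> \<open>The same comparison for \<open>i = l\<close>, where the vanishing coordinates
    come from \<open>step1\<close> applied to \<open>D (a, b) u\<close>. Now only one extra term
    appears, so the factor is \<open>N + sg\<close>.\<close>
  have step2: "co u p q q p = 0" if u: "u \<in> S" and pq: "p < d" "q < d" for u p q
  proof -
    let ?h = "\<lambda>p q. co u p q q p"
    have 0: "opf a b (co u) a q q b = 0" if "a < d" "b < d" "a \<noteq> b" "q < d" for a b q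
      using step1[of "D (a, b) u" a b q] Dc[OF u that(1,2)] that by simp
    have h1: "?h b q = ?h a q" if "a < d" "b < d" "a \<noteq> b" "q < d" "q \<noteq> a" "q \<noteq> b" for a b q
      using 0[of a b q] that by (simp add: opf_def mult_ac)
    have h2: "?h a a = (1 + sg * s a) * ?h b a" if "a < d" "b < d" "a \<noteq> b" for a b
    proof -
      have "co u b a a b + X a b a * co u a b a b - co u a a a a = 0"
        using 0[of a b a] that by (simp add: opf_def mult_ac)
      moreover have "X a b a = chi b a * s a" by (simp add: X_def)
      moreover have "co u a b a b = chi b a * (sg * co u b a a b)" using U[OF u, of a b a b] by (simp add: mult_ac)
      ultimately show ?thesis by (simp add: algebra_simps)
    qed
    have h3: "?h p q = sg * sg' * ?h q p" for p q
      using U[OF u, of p q q p] L[OF u, of q p q p] by (simp add: chi_sym mult_ac)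
    have c0: "?h p q = 0" if pq: "p < d" "q < d" "p \<noteq> q" for p q
    proof -
      have con: "?h p r = ?h p q \<and> sg * sg' * ?h p q = ?h p q" if r: "r < d" "r \<noteq> p" "r \<noteq> q" for r
      proof -
        have "?h p q = sg * sg' * ?h q p" by (rule h3)
        also have "?h q p = ?h r p" using h1[of r q p] pq r by simp
        also have "?h r p = sg * sg' * ?h p r" by (rule h3)
        finally have 1: "?h p q = ?h p r" by (simp add: mult_ac ss)
        have "?h p r = ?h q r" using h1[of q p r] pq r by simp
        also have "?h q r = sg * sg' * ?h r q" by (rule h3)
        also have "?h r q = ?h p q" using h1[of p r q] pq r by simp
        finally show ?thesis using 1 by simp
      qed
      obtain r where r: "r < d" "r \<noteq> p" "r \<noteq> q" using other by blast
      have qp: "?h q p = ?h p q" using h3[of q p] con[OF r] by simp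
      have pp: "?h p p = (1 + sg * s p) * ?h p q" using h2[of p q] pq qp by simp
      have "(\<Sum>r<d. s r * ?h p r) = (\<Sum>r<d. s r * ?h p q + (if r = p then sg * ?h p q else 0))"
      proof (intro sum.cong refl)
        fix r assume "r \<in> {..<d}"
        then show "s r * ?h p r = s r * ?h p q + (if r = p then sg * ?h p q else 0)"
        proof (cases "r = p")
          case True
          then show ?thesis unfolding True pp by (simp add: algebra_simps)
        next
          case False
          have "?h p r = ?h p q"
          proof (cases "r = q")
            case True then show ?thesis by simp
          next
            case False
            then show ?thesis using con[of r] \<open>r \<noteq> p\<close> \<open>r \<in> {..<d}\<close> by blast
          qed
          then show ?thesis using False by simp
        qed
      qed
      also have "\<dots> = (N + sg) * ?h p q"
        using pq by (simp add: sum.distrib sum_distrib_right[symmetric] sum_s distrib_right)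
      finally show ?thesis using T0[OF u, of p p] sign_nz[OF sg] by simp
    qed
    obtain r where "r < d" "r \<noteq> p" using other by blast
    then show ?thesis using c0 h2[of p r] pq by (cases "p = q") auto
  qed
  have k: "co u i p p l = 0" if "u \<in> S" "i < d" "p < d" "l < d" for u i p l
    using step1 step2 that by (cases "i = l") auto
  show ?thesis
  proof (rule F2_eqI[OF F[OF t] tv.subspace_0[OF subspace_F2]])
    fix i k' j l assume r: "i < d" "k' < d" "j < d" "l < d"
    consider "i \<noteq> j" "i \<noteq> l" "k' \<noteq> j" "k' \<noteq> l" | "k' = j" | "i = j" | "k' = l" | "i = l" by blast
    then show "co t i k' j l = co 0 i k' j l"
    proof cases
      case 1 then show ?thesis using z t r by simp
    next
      case 2 then show ?thesis using k t r by simp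
    next
      case 3 then show ?thesis using k[OF t] r U[OF t, of i k' j l] by simp
    next
      case 4 then show ?thesis using k[OF t] r L[OF t, of i k' j l] by simp
    next
      case 5 then show ?thesis using k[OF t] r L[OF t, of i k' j l] U[OF t, of i k' l j] by simp
    qed
  qed
qed

end

section \<open>Simple submodules\<close>

context sl_super
begin

definition wt :: "nat \<Rightarrow> nat \<Rightarrow> nat \<Rightarrow> nat \<Rightarrow> nat \<Rightarrow> int" where
  "wt a i k j l = (if i = a then 1 else 0) + (if k = a then 1 else 0) - (if j = a then 1 else 0) - (if l = a then 1 else 0)"

lemma X_same [simp]: "X a a i = 1" by (simp add: X_def)

lemma opf_diag: "opf a a f i k j l = of_int (wt a i k j l) * f i k j l"
  by (auto simp: opf_def wt_def)

text \<open>As no upper index equals a lower one, nothing cancels in the weight, and both pairs of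
  indices can be read off from it up to order.\<close>

lemma wt_type2:
  assumes eq: "\<And>a. a \<in> {i, k, j, l, i', k', j', l'} \<Longrightarrow> wt a i' k' j' l' = wt a i k j l"
    and ne: "i \<noteq> j" "i \<noteq> l" "k \<noteq> j" "k \<noteq> l"
  shows "(i' = i \<and> k' = k \<or> i' = k \<and> k' = i) \<and> (j' = j \<and> l' = l \<or> j' = l \<and> l' = j)"
proof -
  have up: "i' = c \<or> k' = c" "i = k \<Longrightarrow> i' = i \<and> k' = i" if "c = i \<or> c = k" for c
  proof -
    have "wt c i' k' j' l' \<le> (if i' = c then 1 else 0) + (if k' = c then 1 else 0)" by (simp add: wt_def)
    moreover have "wt c i k j l = (if i = c then 1 else 0) + (if k = c then 1 else 0)"
      using that ne by (auto simp: wt_def)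
    moreover have "wt c i' k' j' l' = wt c i k j l" using eq that by auto
    ultimately have *: "(if i = c then 1 else 0) + (if k = c then 1 else 0)
       \<le> (if i' = c then 1 else 0) + (if k' = c then 1 else (0::int))" by (simp only:)
    show "i' = c \<or> k' = c" using * that by (cases "i' = c"; cases "k' = c") (simp_all split: if_splits)
    show "i = k \<Longrightarrow> i' = i \<and> k' = i" using * that by (cases "i' = c"; cases "k' = c") simp_all
  qed
  have low: "j' = c \<or> l' = c" "j = l \<Longrightarrow> j' = j \<and> l' = j" if "c = j \<or> c = l" for c
  proof -
    have "- wt c i' k' j' l' \<le> (if j' = c then 1 else 0) + (if l' = c then 1 else 0)" by (simp add: wt_def)
    moreover have "- wt c i k j l = (if j = c then 1 else 0) + (if l = c then 1 else 0)"
      using that ne by (auto simp: wt_def)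
    moreover have "wt c i' k' j' l' = wt c i k j l" using eq that by auto
    ultimately have *: "(if j = c then 1 else 0) + (if l = c then 1 else 0)
       \<le> (if j' = c then 1 else 0) + (if l' = c then 1 else (0::int))" by (simp only:)
    show "j' = c \<or> l' = c" using * that by (cases "j' = c"; cases "l' = c") (simp_all split: if_splits)
    show "j = l \<Longrightarrow> j' = j \<and> l' = j" using * that by (cases "j' = c"; cases "l' = c") simp_all
  qed
  show ?thesis using up[of i] up[of k] low[of j] low[of l] by metis
qed

definition res :: "(nat \<Rightarrow> nat \<Rightarrow> nat \<Rightarrow> nat \<Rightarrow> bool) \<Rightarrow> tensor \<Rightarrow> tensor" where
  "res P t = mk (\<lambda>i k j l. if P i k j l then co t i k j l else 0)"

lemma res_F2: "res P t \<in> F2" by (simp add: res_def mk_F2)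

lemma co_res: "t \<in> F2 \<Longrightarrow> co (res P t) i k j l = (if P i k j l then co t i k j l else 0)"
  using co_outside[of t i k j l] by (auto simp: res_def co_mk)

lemma res_weight:
  assumes S: "gmod S" "S \<subseteq> F2" and t: "t \<in> S" and a: "a < d"
  shows "res (\<lambda>i k j l. wt a i k j l = v) t \<in> S"
proof (cases "v \<in> {-2..2}")
  case True
  \<comment> \<open>Weights in degree two lie between -2 and 2, so this finite set contains all
    eigenvalues of \<open>D (a, a)\<close> that occur.\<close>
  obtain V :: "complex set" where V: "finite V" "\<And>w. w \<in> {-2..2} \<Longrightarrow> of_int w \<in> V"
    by (rule that[of "of_int ` {-2..2}"]) auto
  have wV: "of_int (wt a i k j l) \<in> V" for i k j l by (rule V(2)) (auto simp: wt_def)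
  let ?x = "\<lambda>v::complex. res (\<lambda>i k j l. of_int (wt a i k j l) = v) t"
  have F: "t \<in> F2" using S t by blast
  have "(\<Sum>v\<in>V. ?x v) = t"
  proof (rule F2_eqI)
    fix i k j l
    show "co (\<Sum>v\<in>V. ?x v) i k j l = co t i k j l"
      using V(1) wV by (simp add: co_sum co_res[OF F])
  qed (auto intro: tv.subspace_sum[OF subspace_F2] simp: res_F2 F)
  moreover have "D (a, a) (?x v) = tscale v (?x v)" for v
    by (rule F2_eqI) (use a in \<open>auto simp: co_D co_res[OF F] opf_diag res_F2 I2_def intro!: D_F2 tv.subspace_scale[OF subspace_F2]\<close>)
  ultimately have "?x (of_int v) \<in> S"
    using S t a V(2)[OF True]
    by (intro eigen_components[of S "D (a, a)" V ?x]) (simp_all add: gmod_def tlin_D I2_def V(1))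
  then show ?thesis by simp
next
  case False
  have "t \<in> F2" using S t by blast
  moreover have "wt a i k j l \<noteq> v" for i k j l using False by (auto simp: wt_def)
  ultimately have "res (\<lambda>i k j l. wt a i k j l = v) t = 0"
    by (intro F2_eqI) (auto simp: co_res res_F2 tv.subspace_0[OF subspace_F2])
  then show ?thesis using S by (simp add: gmod_def tv.subspace_0)
qed

lemma res_weights:
  assumes S: "gmod S" "S \<subseteq> F2" and t: "t \<in> S"
  shows "q \<le> d \<Longrightarrow> res (\<lambda>i k j l. \<forall>a<q. wt a i k j l = v a) t \<in> S"
proof (induction q)
  case 0
  have "t \<in> F2" using S t by blast
  then have "res (\<lambda>i k j l. True) t = t" by (intro F2_eqI) (auto simp: co_res res_F2)
  then show ?case using t by simp
next
  case (Suc q)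
  let ?t = "res (\<lambda>i k j l. \<forall>a<q. wt a i k j l = v a) t"
  have "t \<in> F2" using S t by blast
  then have "res (\<lambda>i k j l. \<forall>a<Suc q. wt a i k j l = v a) t = res (\<lambda>i k j l. wt q i k j l = v q) ?t"
    by (intro F2_eqI) (auto simp: co_res res_F2 less_Suc_eq)
  then show ?case using res_weight[OF S, of ?t q "v q"] Suc by simp
qed

lemma square_eq:
  fixes x y :: complex
  assumes "a * x = b * y" "a * a = 1" "b * b = 1"
  shows "x * x = y * y"
proof -
  have "x * x = (a * a) * (x * x)" using assms(2) by (simp only: mult_1_left)
  also have "\<dots> = (a * x) * (a * x)" by (simp only: mult_ac)
  also have "\<dots> = (b * b) * (y * y)" unfolding assms(1) by (simp only: mult_ac)
  finally show ?thesis by (simp only: assms(3) mult_1_left)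
qed

text \<open>The radical of \<open>B\<close> on \<open>S\<close> is a submodule. Pair an element of
  it with its own component of a weight whose upper and lower indices are disjoint: all coordinates
  there agree up to sign, so the result is, up to sign, a positive integer times the square of one
  coordinate. Hence these coordinates vanish and \<open>type2_zero\<close> applies.\<close>

lemma T_orth:
  assumes sg: "sg * sg = 1" "sg' * sg' = 1" and S: "gmod S" "S \<subseteq> T sg sg'"
    and u: "u \<in> S" "\<And>v. v \<in> S \<Longrightarrow> B v u = 0"
  shows "u = 0"
proof -
  have F: "S \<subseteq> F2" using S T_F2 by blast
  let ?R = "{u \<in> S. \<forall>v\<in>S. B v u = 0}"
  have R: "gmod ?R" by (rule perp_gmod[OF S(1) F S(1) F])
  have "co t i k j l = 0" if t: "t \<in> ?R" and r: "i < d" "k < d" "j < d" "l < d" and ne: "i \<noteq> j" "i \<noteq> l" "k \<noteq> j" "k \<noteq> l"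
    for t i k j l
  proof -
    let ?P = "\<lambda>i' k' j' l'. \<forall>a<d. wt a i' k' j' l' = wt a i k j l"
    let ?v = "res ?P t"
    define c where "c = s j * s l * (co t i k j l * co t i k j l)"
    define g where "g = (\<lambda>i' k' j' l'. if ?P i' k' j' l' then 1 else (0::nat))"
    define G where "G = (\<Sum>i'<d. \<Sum>k'<d. \<Sum>j'<d. \<Sum>l'<d. g i' k' j' l')"
    have tS: "t \<in> S" "t \<in> F2" using t F by auto
    have "?v \<in> S" using res_weights[OF S(1) F tS(1), of d "\<lambda>a. wt a i k j l"] by simp
    then have "0 = B ?v t" using t by simp
    also have "B ?v t = (\<Sum>i'<d. \<Sum>k'<d. \<Sum>j'<d. \<Sum>l'<d. c * of_nat (g i' k' j' l'))"
      unfolding B_def Bf_def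
    proof (intro sum.cong refl)
      fix i' k' j' l' assume r': "i' \<in> {..<d}" "k' \<in> {..<d}" "j' \<in> {..<d}" "l' \<in> {..<d}"
      show "s j' * s l' * (co ?v i' k' j' l' * co t i' k' j' l')
         = c * of_nat (g i' k' j' l')"
      proof (cases "?P i' k' j' l'")
        case True
        have w: "(i' = i \<and> k' = k \<or> i' = k \<and> k' = i) \<and> (j' = j \<and> l' = l \<or> j' = l \<and> l' = j)"
          by (rule wt_type2[OF _ ne]) (use True r r' in auto)
        have tT: "t \<in> T sg sg'" using tS S by blast
        have sq: "co t k i j l * co t k i j l = co t i k j l * co t i k j l" for i k j l
        proof -
          have "chi i k * co t k i j l = sg * co t i k j l" using tT by (simp add: T_def)
          then show ?thesis using square_eq[OF _ chi_sq(1) sg(1)] by blast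
        qed
        have sq': "co t i k l j * co t i k l j = co t i k j l * co t i k j l" for i k j l
        proof -
          have "chi j l * co t i k l j = sg' * co t i k j l" using tT by (simp add: T_def)
          then show ?thesis using square_eq[OF _ chi_sq(1) sg(2)] by blast
        qed
        have "co t i' k' j' l' * co t i' k' j' l' = co t i k j l * co t i k j l"
          using w
        proof (elim conjE disjE)
          assume a: "i' = k" "k' = i" "j' = l" "l' = j"
          show ?thesis unfolding a sq[of k i l j] by (rule sq')
        qed (auto simp: sq sq')
        moreover have "s j' * s l' = s j * s l" using w by (auto simp: mult.commute)
        moreover have "g i' k' j' l' = 1" unfolding g_def using True by (rule if_P)
        moreover have "co ?v i' k' j' l' = co t i' k' j' l'" unfolding co_res[OF tS(2)] using True by (rule if_P)
        ultimately show ?thesis by (simp add: c_def)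
      next
        case False
        then have "g i' k' j' l' = 0" unfolding g_def by (rule if_not_P)
        moreover have "co ?v i' k' j' l' = 0" unfolding co_res[OF tS(2)] using False by (rule if_not_P)
        ultimately show ?thesis by simp
      qed
    qed
    also have "\<dots> = c * of_nat G"
      unfolding of_nat_sum sum_distrib_left G_def by (rule refl)
    finally have "0 = c * of_nat G" .
    moreover have "G \<noteq> 0"
    proof
      assume "G = 0"
      then have "g i k j l = 0" using r unfolding G_def by simp
      then show False by (simp add: g_def)
    qed
    ultimately have "c = 0" by simp
    then show ?thesis by (simp add: c_def)
  qed
  then have "t = 0" if "t \<in> ?R" for t
    by (intro type2_zero[OF sg R]) (use S that in auto)
  then show ?thesis using u by blast
qed

section \<open>Complete reducibility of the traceless tensors\<close>

definition simp_mod :: "tensor set \<Rightarrow> bool" where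
  "simp_mod S \<longleftrightarrow> gmod S \<and> S \<noteq> {0} \<and> (\<forall>R. gmod R \<and> R \<subseteq> S \<longrightarrow> R = {0} \<or> R = S)"

lemma simple_submodule2_iff: "simple_submodule2 m n S \<longleftrightarrow> S \<subseteq> tens m n 2 \<and> simp_mod S"
  by (auto simp: simple_submodule2_def submodule2_gmod simp_mod_def)

lemma gmod_span:
  assumes "\<And>x t. x \<in> I2 \<Longrightarrow> t \<in> A \<Longrightarrow> D x t \<in> tv.span A"
  shows "gmod (tv.span A)"
  unfolding gmod_def
proof (intro conjI tv.subspace_span ballI)
  fix x t assume x: "x \<in> I2" and t: "t \<in> tv.span A"
  show "D x t \<in> tv.span A"
    by (rule tlin_span[OF tlin_D tv.subspace_span t]) (rule assms[OF x])
qed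

lemma gmod_Int: "gmod R \<Longrightarrow> gmod S \<Longrightarrow> gmod (R \<inter> S)"
  by (auto simp: gmod_def tv.subspace_inter)

lemma gmod_0: "gmod S \<Longrightarrow> 0 \<in> S"
  by (simp add: gmod_def tv.subspace_0)

lemma finite_wd2: "finite {wd [x, y] | x y. x \<in> I2 \<and> y \<in> I2}"
  by (rule finite_image_set2) simp_all

lemma dim_less:
  assumes "tv.subspace R" "R \<subseteq> S" "R \<noteq> S" "S \<subseteq> F2"
  shows "tv.dim R < tv.dim S"
proof -
  obtain C where C: "C \<subseteq> R" "tv.independent C" "R \<subseteq> tv.span C" "card C = tv.dim R"
    by (rule tv.basis_exists[of R])
  obtain x where x: "x \<in> S" "x \<notin> R" using assms by blast
  have "tv.span C \<subseteq> R" using C assms by (intro tv.span_minimal)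
  then have i: "tv.independent (insert x C)" using x C by (intro tv.independent_insertI) auto
  obtain C' where C': "insert x C \<subseteq> C'" "C' \<subseteq> S" "tv.independent C'" "S \<subseteq> tv.span C'"
  proof -
    have "insert x C \<subseteq> S" using x C assms by blast
    then show thesis by (rule tv.maximal_independent_subset_extend[OF _ i]) (rule that)
  qed
  have "finite C'"
  proof -
    have "C' \<subseteq> F2" using C'(2) assms(4) by (rule order_trans)
    then have "C' \<subseteq> tv.span {wd [x, y] | x y. x \<in> I2 \<and> y \<in> I2}" by (simp only: F2_def)
    from tv.independent_span_bound[OF finite_wd2 C'(3) this] show ?thesis by (rule conjunct1)
  qed
  moreover have "x \<notin> C" using x C by blast
  moreover have "card C' = tv.dim S" by (rule tv.basis_card_eq_dim[OF C'(2,4,3)])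
  ultimately show ?thesis
  proof -
    assume a: "finite C'" "x \<notin> C" "card C' = tv.dim S"
    have "finite C" by (rule finite_subset[OF _ a(1)]) (use C'(1) in blast)
    then have "card (insert x C) = Suc (card C)" using a(2) by simp
    then show ?thesis using card_mono[OF a(1) C'(1)] a(3) C(4) by simp
  qed
qed

lemma simple_exists:
  "gmod S \<Longrightarrow> S \<subseteq> F2 \<Longrightarrow> S \<noteq> {0} \<Longrightarrow> \<exists>L\<subseteq>S. simp_mod L"
proof (induction "tv.dim S" arbitrary: S rule: less_induct)
  case less
  show ?case
  proof (cases "simp_mod S")
    case False
    then obtain R where R: "gmod R" "R \<subseteq> S" "R \<noteq> {0}" "R \<noteq> S" using less.prems by (auto simp: simp_mod_def)
    then have "tv.dim R < tv.dim S" using less.prems by (intro dim_less) (auto simp: gmod_def)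
    then show ?thesis using less.hyps[of R] R less.prems by blast
  qed blast
qed

text \<open>If the sum of the simple submodules were proper, its orthogonal complement in
  \<open>T sg sg'\<close> would contain a simple module, which would lie in that sum as well and so
  be orthogonal to itself. This contradicts \<open>T_orth\<close>.\<close>

lemma T_semisimple:
  assumes sg: "sg * sg = 1" "sg' * sg' = 1"
  shows "T sg sg' \<subseteq> tv.span (\<Union>{L. simp_mod L \<and> L \<subseteq> T sg sg'})"
proof (rule ccontr)
  let ?A = "\<Union>{L. simp_mod L \<and> L \<subseteq> T sg sg'}"
  let ?S = "tv.span ?A"
  assume n: "\<not> T sg sg' \<subseteq> ?S"
  have S: "gmod ?S"
  proof (rule gmod_span)
    fix x t assume x: "x \<in> I2" and "t \<in> ?A"
    then obtain L where L: "t \<in> L" "simp_mod L" "L \<subseteq> T sg sg'" by (elim UnionE CollectE conjE)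
    then have "D x t \<in> L" using x by (simp add: simp_mod_def gmod_def)
    then have "D x t \<in> ?A" using L by blast
    then show "D x t \<in> ?S" by (rule tv.span_base)
  qed
  have ST: "?S \<subseteq> T sg sg'" by (rule tv.span_minimal[OF _ subspace_T]) blast
  have F: "T sg sg' \<subseteq> F2" using T_F2 by blast
  let ?R = "{u \<in> T sg sg'. \<forall>v\<in>?S. B v u = 0}"
  have R: "gmod ?R" using perp_gmod[OF S _ T_gmod F] ST F by blast
  have "?R \<noteq> {0}" using perp_nonzero[OF sg tv.subspace_span ST] n ST by blast
  then obtain L where L: "L \<subseteq> ?R" "simp_mod L" using simple_exists[OF R] F by blast
  have LS: "L \<subseteq> ?S" using L tv.span_superset[of ?A] by blast
  have "u = 0" if "u \<in> L" for u
    by (rule T_orth[OF sg, of L]) (use L LS that in \<open>auto simp: simp_mod_def\<close>)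
  then show False using L gmod_0[of L] by (auto simp: simp_mod_def)
qed

section \<open>Simplicity of the Cartan square\<close>

definition v0 :: tensor where "v0 = wd [(0, 1), (0, 1)]"

lemma idx: "0 < d" "1 < d" "2 < d" "0 < m" "Suc 0 < m" "1 < m" "2 < m" "Suc 0 < d"
  using mn by simp_all

lemma v0_F2: "v0 \<in> F2" unfolding v0_def by (rule wd_F2) (use idx in \<open>auto simp: I2_def\<close>)

lemma co_v0: "co v0 i k j l = (if i = 0 \<and> k = 0 \<and> j = 1 \<and> l = 1 then 1 else 0)"
  using idx by (auto simp: v0_def co_wd chi_def)

lemma v0_T: "v0 \<in> T 1 1"
  using v0_F2 idx by (auto simp: T_def co_v0 tr_def chi_def intro!: sum.neutral)

lemma v0_nz: "v0 \<noteq> 0" using co_v0[of 0 0 1 1] by auto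

lemma B_v0: "B v0 v0 = 1"
  unfolding v0_def using B_wd[of 0 1 0 1 v0] co_v0[of 0 0 1 1] idx by (simp add: I2_def v0_def s_def chi_def)

text \<open>The weight of \<open>v0\<close>, twice \<open>\<epsilon>\<^sub>1\<close> minus twice
  \<open>\<epsilon>\<^sub>2\<close>, has disjoint repeated indices, hence multiplicity one by
  \<open>wt_type2\<close>. It is used instead of the highest weight since it involves even indices
  only and has the same shape for all \<open>n\<close>.\<close>

lemma weight_v0:
  assumes u: "u \<in> F2" and w: "\<And>a i k j l. a < d \<Longrightarrow> co u i k j l \<noteq> 0 \<Longrightarrow> wt a i k j l = wt a 0 0 1 1"
  shows "u = tscale (co u 0 0 1 1) v0"
proof (rule F2_eqI[OF u])
  show "tscale (co u 0 0 1 1) v0 \<in> F2" by (intro tv.subspace_scale[OF subspace_F2] v0_F2)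
  fix i k j l assume r: "i < d" "k < d" "j < d" "l < d"
  show "co u i k j l = co (tscale (co u 0 0 1 1) v0) i k j l"
  proof (cases "co u i k j l = 0")
    case False
    then have "(i = 0 \<and> k = 0 \<or> i = 0 \<and> k = 0) \<and> (j = 1 \<and> l = 1 \<or> j = 1 \<and> l = 1)"
      by (intro wt_type2) (use w r idx in auto)
    then show ?thesis by (auto simp: co_v0)
  qed (auto simp: co_v0)
qed

lemma double_zero: "x + c * y = 0 \<Longrightarrow> c = 1 \<Longrightarrow> y = x \<Longrightarrow> x = (0::complex)"
proof -
  assume a: "x + c * y = 0" "c = 1" "y = x"
  have "2 * x = 0" using a(1) unfolding a(2,3) mult_1_left mult_2 .
  then show ?thesis by (rule disjE[OF iffD1[OF mult_eq_0_iff]]) (simp_all only: zero_neq_numeral[symmetric])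
qed

lemma low_zero:
  assumes "- (p * q * r * x) - p * q * c * r * y = 0" "p \<noteq> 0" "q \<noteq> 0" "r \<noteq> 0"
  shows "x + c * y = (0::complex)"
proof -
  have "p * q * r * (x + c * y) = - (- (p * q * r * x) - p * q * c * r * y)"
    by (simp add: algebra_simps)
  also have "\<dots> = 0" by (simp only: assms(1) minus_zero)
  finally show ?thesis by (simp only: mult_eq_0_iff assms(2-) simp_thms)
qed

text \<open>If one coordinate vanishes on all of \<open>S\<close>, so do its images under the
  action. Starting from \<open>0 0 1 1\<close> the vanishing spreads to every coordinate with
  disjoint upper and lower indices, and \<open>type2_zero\<close> finishes.\<close>

lemma T11_zero:
  assumes S: "gmod S" "S \<subseteq> T 1 1" and z: "\<And>t. t \<in> S \<Longrightarrow> co t 0 0 1 1 = 0" and t: "t \<in> S"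
  shows "t = 0"
proof -
  have F: "u \<in> F2" if "u \<in> S" for u using that S T_F2 by blast
  have U: "co u k i j l = chi i k * co u i k j l" if "u \<in> S" for u i k j l
  proof -
    have "u \<in> T 1 1" using that S by blast
    then have "chi i k * co u k i j l = 1 * co u i k j l" by (simp add: T_def)
    then have "chi i k * (chi i k * co u k i j l) = chi i k * (1 * co u i k j l)" by (simp only:)
    then show ?thesis by simp
  qed
  have L: "co u i k l j = chi j l * co u i k j l" if "u \<in> S" for u i k j l
  proof -
    have "u \<in> T 1 1" using that S by blast
    then have "chi j l * co u i k l j = 1 * co u i k j l" by (simp add: T_def)
    then have "chi j l * (chi j l * co u i k l j) = chi j l * (1 * co u i k j l)" by (simp only:)
    then show ?thesis by simp
  qed
  define V where "V = (\<lambda>i k j l. \<forall>u\<in>S. co u i k j l = 0)"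
  have op: "opf a b (co u) i k j l = 0" if "V i k j l" "u \<in> S" "a < d" "b < d" for a b u i k j l
  proof -
    have "D (a, b) u \<in> S" using S that by (auto simp: gmod_def I2_def)
    then have "co (D (a, b) u) i k j l = 0" using that by (simp add: V_def)
    then show ?thesis using that F by (simp add: co_D I2_def)
  qed
  \<comment> \<open>The coordinate \<open>a a j l\<close> of \<open>D (a, b) u\<close> is the sum of
    the two coordinates in which one \<open>a\<close> has become \<open>b\<close>. These are equal
    because \<open>a\<close> is even, so each is zero; with \<open>D (a, i)\<close> the remaining
    \<open>a\<close> is replaced as well.\<close>
  have up: "V i k j l" if "V a a j l" "a < m" "i < d" "k < d" "i \<noteq> j" "i \<noteq> l" "k \<noteq> j" "k \<noteq> l" for a i k j l
  proof -
    have 1: "V b a j l" if b: "b < d" "b \<noteq> j" "b \<noteq> l" for b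
      unfolding V_def
    proof
      fix u assume u: "u \<in> S"
      show "co u b a j l = 0"
      proof (cases "b = a")
        case True then show ?thesis using \<open>V a a j l\<close> u by (simp add: V_def)
      next
        case False
        have "opf a b (co u) a a j l = 0" using op[OF \<open>V a a j l\<close> u] b \<open>a < m\<close> by simp
        then have 0: "co u b a j l + X a b a * co u a b j l = 0" using b by (simp add: opf_def)
        have 1: "co u a b j l = co u b a j l" using U[OF u, of a b j l] \<open>a < m\<close> by (simp add: chi_def)
        have 2: "X a b a = 1" using \<open>a < m\<close> by (simp add: X_def chi_def s_def)
        show ?thesis by (rule double_zero[OF 0 2 1])
      qed
    qed
    have 2: "V a b j l" if b: "b < d" "b \<noteq> j" "b \<noteq> l" for b
      unfolding V_def
    proof
      fix u assume u: "u \<in> S"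
      have "co u b a j l = 0" by (rule bspec[OF 1[OF b, unfolded V_def] u])
      then show "co u a b j l = 0" unfolding U[OF u, of a b j l] by (simp only: mult_zero_right)
    qed
    show ?thesis
    proof (cases "i = a \<or> k = a")
      case True then show ?thesis using 1[of i] 2[of k] that by blast
    next
      case False
      show ?thesis unfolding V_def
      proof
        fix u assume u: "u \<in> S"
        have "V a k j l" by (rule 2) (use that in simp_all)
        then have "opf a i (co u) a k j l = 0" by (rule op[OF _ u]) (use that in simp_all)
        then show "co u i k j l = 0" using that False unfolding opf_def by simp
      qed
    qed
  qed
  have low: "V i k j l" if "V i k b b" "b < m" "j < d" "l < d" "i \<noteq> j" "i \<noteq> l" "k \<noteq> j" "k \<noteq> l" for b i k j l
  proof -
    have 1: "V i k a b" if a: "a < d" "a \<noteq> i" "a \<noteq> k" for a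
      unfolding V_def
    proof
      fix u assume u: "u \<in> S"
      show "co u i k a b = 0"
      proof (cases "b = a")
        case True then show ?thesis using \<open>V i k b b\<close> u by (simp add: V_def)
      next
        case False
        have "opf a b (co u) i k b b = 0" using op[OF \<open>V i k b b\<close> u] a \<open>b < m\<close> by simp
        then have 0: "- (X a b i * X a b k * X a b a * co u i k a b) - X a b i * X a b k * X a b b * X a b a * co u i k b a = 0"
          using a by (simp add: opf_def)
        have 1: "co u i k b a = co u i k a b" using L[OF u, of i k b a] \<open>b < m\<close> by (simp add: chi_def)
        have 2: "X a b b = 1" using \<open>b < m\<close> by (simp add: X_def chi_def s_def)
        have "co u i k a b + X a b b * co u i k b a = 0"
          by (rule low_zero[OF 0 X_nz X_nz X_nz])
        then show ?thesis by (rule double_zero[OF _ 2 1])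
      qed
    qed
    have 2: "V i k b a" if a: "a < d" "a \<noteq> i" "a \<noteq> k" for a
      unfolding V_def
    proof
      fix u assume u: "u \<in> S"
      have "co u i k a b = 0" by (rule bspec[OF 1[OF a, unfolded V_def] u])
      then show "co u i k b a = 0" unfolding L[OF u, of i k b a] by (simp only: mult_zero_right)
    qed
    show ?thesis
    proof (cases "j = b \<or> l = b")
      case True then show ?thesis using 1[of j] 2[of l] that by blast
    next
      case False
      show ?thesis unfolding V_def
      proof
        fix u assume u: "u \<in> S"
        have "V i k j b" by (rule 1) (use that in simp_all)
        then have "opf l b (co u) i k j b = 0" by (rule op[OF _ u]) (use that in simp_all)
        then show "co u i k j l = 0" using that False unfolding opf_def by simp
      qed
    qed
  qed
  have V0: "V 0 0 1 1" using z by (simp add: V_def)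
  have V1: "V i k j l" if "i < d" "k < d" "j < d" "l < d" "i \<noteq> 1" "k \<noteq> 1" "i \<noteq> j" "i \<noteq> l" "k \<noteq> j" "k \<noteq> l" for i k j l
    using low[OF up[OF V0, of i k], of j l] that idx by simp
  \<comment> \<open>The upper index 1 is out of reach while 1 is a lower index. The detour first
    moves the lower indices to 0, which frees 1; it needs a third even index.\<close>
  have "V 2 2 0 0" using V1[of 2 2 0 0] idx by simp
  then have V2: "V 1 1 0 0" using up[of 2 0 0 1 1] idx by simp
  have V3: "V a a j l" if "a \<in> {0, 1, 2}" "j < d" "l < d" "a \<noteq> j" "a \<noteq> l" for a j l
    using that V1[of a a j l] low[OF V2, of j l] idx by auto
  have "V i k j l" if r: "i < d" "k < d" "j < d" "l < d" "i \<noteq> j" "i \<noteq> l" "k \<noteq> j" "k \<noteq> l" for i k j l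
  proof -
    have "\<exists>a\<in>{0, 1, 2}. a \<noteq> j \<and> a \<noteq> l" by auto
    then obtain a where a: "a \<in> {0, 1, 2}" "a \<noteq> j" "a \<noteq> l" by blast
    moreover have "a < m" using a(1) idx by auto
    ultimately show ?thesis using up[OF V3[of a j l]] r by simp
  qed
  then show ?thesis
    by (intro type2_zero[of 1 1 S]) (use S t in \<open>auto simp: V_def\<close>)
qed

lemma v0_mem:
  assumes S: "gmod S" "S \<subseteq> T 1 1" "S \<noteq> {0}"
  shows "v0 \<in> S"
proof -
  obtain t where t: "t \<in> S" "co t 0 0 1 1 \<noteq> 0"
    using T11_zero[OF S(1,2)] S gmod_0[of S] by blast
  have F: "S \<subseteq> F2" using S T_F2 by blast
  let ?u = "res (\<lambda>i k j l. \<forall>a<d. wt a i k j l = wt a 0 0 1 1) t"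
  have u: "?u \<in> S" using res_weights[OF S(1) F t(1), of d "\<lambda>a. wt a 0 0 1 1"] by simp
  have tF: "t \<in> F2" using t F by blast
  have "?u = tscale (co ?u 0 0 1 1) v0"
    by (rule weight_v0) (auto simp: res_F2 co_res[OF tF] split: if_splits)
  then have "?u = tscale (co t 0 0 1 1) v0" by (simp add: co_res[OF tF])
  then have "tscale (1 / co t 0 0 1 1) ?u = tscale (1 / co t 0 0 1 1) (tscale (co t 0 0 1 1) v0)" by (rule arg_cong)
  also have "\<dots> = v0" using t(2) by simp
  finally have "tscale (1 / co t 0 0 1 1) ?u = v0" .
  moreover have "tv.subspace S" using S(1) by (simp add: gmod_def)
  then have "tscale (1 / co t 0 0 1 1) ?u \<in> S" by (rule tv.subspace_scale[OF _ u])
  ultimately show ?thesis by (simp only:)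
qed

text \<open>A proper nonzero submodule and its orthogonal complement would both contain
  \<open>v0\<close>, although \<open>B v0 v0 = 1\<close>.\<close>

lemma T11_simple: "simp_mod (T 1 1)"
  unfolding simp_mod_def
proof (intro conjI allI impI)
  show "gmod (T 1 1)" by (rule T_gmod)
  show "T 1 1 \<noteq> {0}" using v0_T v0_nz by blast
  fix R assume R: "gmod R \<and> R \<subseteq> T 1 1"
  show "R = {0} \<or> R = T 1 1"
  proof (rule ccontr)
    assume n: "\<not> (R = {0} \<or> R = T 1 1)"
    have F: "T 1 1 \<subseteq> F2" using T_F2 by blast
    let ?P = "{u \<in> T 1 1. \<forall>v\<in>R. B v u = 0}"
    have "gmod ?P" using perp_gmod[of R "T 1 1"] R F T_gmod by blast
    moreover have "?P \<noteq> {0}" using perp_nonzero[of 1 1 R] R n by (auto simp: gmod_def)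
    ultimately have "v0 \<in> ?P" using v0_mem by blast
    moreover have "v0 \<in> R" using v0_mem R n by blast
    ultimately show False using B_v0 by auto
  qed
qed

text \<open>The weight of \<open>v0\<close> has multiplicity one, so the simple module \<open>T 1 1\<close> has no second copy.\<close>

lemma hom_to_T11:
  assumes L: "simp_mod L" "L \<subseteq> F2" and Q: "gmod Q" "Q \<inter> T 1 1 = {0}"
    and LQ: "\<And>x. x \<in> L \<Longrightarrow> \<exists>y\<in>T 1 1. x - y \<in> Q"
  shows "L \<subseteq> Q \<or> L = T 1 1"
proof (cases "L \<inter> Q = {0}")
  case False
  then have "L \<inter> Q = L" using L gmod_Int[of L Q] Q by (auto simp: simp_mod_def)
  then show ?thesis by blast
next
  case True
  have Lg: "gmod L" and Qs: "tv.subspace Q" and Ls: "tv.subspace L" using L Q by (auto simp: simp_mod_def gmod_def)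
  \<comment> \<open>The image of \<open>L\<close> under the projection to \<open>T 1 1\<close> along
    \<open>Q\<close>. It is a nonzero submodule, hence contains \<open>v0\<close>.\<close>
  let ?P = "{y \<in> T 1 1. \<exists>x\<in>L. x - y \<in> Q}"
  have P: "gmod ?P"
    unfolding gmod_def
  proof (intro conjI ballI)
    show "tv.subspace ?P"
      unfolding tv.subspace_def
    proof (intro conjI ballI allI)
      show "0 \<in> ?P" using tv.subspace_0[OF subspace_T] tv.subspace_0[OF Ls] tv.subspace_0[OF Qs] by force
      fix x y assume "x \<in> ?P" "y \<in> ?P"
      then obtain a b where ab: "x \<in> T 1 1" "y \<in> T 1 1" "a \<in> L" "b \<in> L" "a - x \<in> Q" "b - y \<in> Q" by blast
      have "(a + b) - (x + y) = (a - x) + (b - y)" by simp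
      then have "(a + b) - (x + y) \<in> Q" using ab tv.subspace_add[OF Qs] by metis
      then show "x + y \<in> ?P" using ab tv.subspace_add[OF Ls] tv.subspace_add[OF subspace_T] by blast
    next
      fix c x assume "x \<in> ?P"
      then obtain a where a: "x \<in> T 1 1" "a \<in> L" "a - x \<in> Q" by blast
      then have "tscale c a - tscale c x \<in> Q" using tv.subspace_scale[OF Qs] by (metis tv.scale_right_diff_distrib)
      then show "tscale c x \<in> ?P" using a tv.subspace_scale[OF Ls] tv.subspace_scale[OF subspace_T] by blast
    qed
    fix x t assume x: "x \<in> I2" and "t \<in> ?P"
    then obtain a where a: "t \<in> T 1 1" "a \<in> L" "a - t \<in> Q" by blast
    then have "D x a - D x t \<in> Q" using Q x by (metis gmod_def tlin_D tlin_diff)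
    then show "D x t \<in> ?P" using a Lg x T_gmod[of 1 1] by (auto simp: gmod_def)
  qed
  have "?P \<noteq> {0}"
  proof
    assume e: "?P = {0}"
    obtain x where x: "x \<in> L" "x \<noteq> 0" using L gmod_0[OF Lg] by (auto simp: simp_mod_def)
    then obtain y where "y \<in> T 1 1" "x - y \<in> Q" using LQ by blast
    then have "y = 0" "x - y \<in> Q" using e x by blast+
    then show False using True x by auto
  qed
  then have "v0 \<in> ?P" using v0_mem[OF P] by blast
  then obtain u where u: "u \<in> L" "u - v0 \<in> Q" by blast
  have uF: "u \<in> F2" using u L by blast
  \<comment> \<open>The deviation of \<open>u\<close> from having the weight of \<open>v0\<close>
    lies in \<open>L\<close>, and also in \<open>Q\<close> because \<open>v0\<close> has that weight
    exactly. As \<open>L\<close> and \<open>Q\<close> meet in zero, \<open>u\<close> is a weight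
    vector and so a multiple of \<open>v0\<close>.\<close>
  have w: "D (a, a) u = tscale (of_int (wt a 0 0 1 1)) u" if a: "a < d" for a
  proof -
    let ?c = "of_int (wt a 0 0 1 1) :: complex"
    have aI: "(a, a) \<in> I2" using a by (simp add: I2_def)
    have "D (a, a) v0 = tscale ?c v0"
      by (rule F2_eqI) (use aI in \<open>auto simp: co_D v0_F2 opf_diag co_v0 intro!: D_F2 tv.subspace_scale[OF subspace_F2]\<close>)
    then have "D (a, a) u - tscale ?c u = D (a, a) (u - v0) - tscale ?c (u - v0)"
      by (simp add: tlin_diff[OF tlin_D] tv.scale_right_diff_distrib)
    also have "\<dots> \<in> Q"
      by (rule tv.subspace_diff[OF Qs _ tv.subspace_scale[OF Qs u(2)]]) (use Q(1) u(2) aI in \<open>simp add: gmod_def\<close>)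
    finally have "D (a, a) u - tscale ?c u \<in> Q" .
    moreover have "D (a, a) u - tscale ?c u \<in> L"
      by (rule tv.subspace_diff[OF Ls _ tv.subspace_scale[OF Ls u(1)]]) (use Lg u(1) aI in \<open>simp add: gmod_def\<close>)
    ultimately have "D (a, a) u - tscale ?c u = 0" using True by blast
    then show ?thesis by (simp only: right_minus_eq)
  qed
  have "wt a i k j l = wt a 0 0 1 1" if "a < d" "co u i k j l \<noteq> 0" for a i k j l
  proof -
    have "co (D (a, a) u) i k j l = of_int (wt a i k j l) * co u i k j l"
      using that uF by (simp add: co_D opf_diag I2_def)
    then have "of_int (wt a 0 0 1 1) * co u i k j l = of_int (wt a i k j l) * co u i k j l"
      unfolding w[OF that(1)] co_scale .
    then show ?thesis using that(2) by (simp only: mult_cancel_right of_int_eq_iff simp_thms)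
  qed
  then have uv: "u = tscale (co u 0 0 1 1) v0" by (rule weight_v0[OF uF])
  have c: "co u 0 0 1 1 \<noteq> 0"
  proof
    assume "co u 0 0 1 1 = 0"
    then have "tscale (co u 0 0 1 1) v0 = 0" by simp
    then have "u = 0" using uv by (simp only:)
    then have "- v0 \<in> Q" using u(2) by simp
    then have "- (- v0) \<in> Q" by (rule tv.subspace_neg[OF Qs])
    then show False using Q v0_T v0_nz by auto
  qed
  have "tscale (1 / co u 0 0 1 1) u = tscale (1 / co u 0 0 1 1) (tscale (co u 0 0 1 1) v0)" using uv by (rule arg_cong)
  also have "\<dots> = v0" using c by simp
  finally have "tscale (1 / co u 0 0 1 1) u = v0" .
  moreover have "tscale (1 / co u 0 0 1 1) u \<in> L" by (rule tv.subspace_scale[OF Ls u(1)])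
  ultimately have "v0 \<in> L" by (simp only:)
  then have "L \<inter> T 1 1 \<noteq> {0}" using v0_T v0_nz by blast
  then have "L \<inter> T 1 1 = L" "L \<inter> T 1 1 = T 1 1"
    using L T11_simple gmod_Int[OF Lg T_gmod] unfolding simp_mod_def by (metis inf_le1, metis inf_le2)
  then show ?thesis by blast
qed

end

section \<open>The decomposition of the tensor square\<close>

context sl_super
begin

definition wtw :: "nat \<Rightarrow> (nat \<times> nat) list \<Rightarrow> int" where
  "wtw a w = (\<Sum>x\<leftarrow>w. (if fst x = a then 1 else 0) - (if snd x = a then 1 else 0))"

lemma D_diag_ew: "a < d \<Longrightarrow> set w \<subseteq> I2 \<Longrightarrow> D (a, a) (ew w) = tscale (of_int (wtw a w)) (ew w)"
proof (induction w)
  case Nil then show ?case by (simp add: D_one I2_def wtw_def)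
next
  case (Cons y w)
  have aI: "(a, a) \<in> I2" using Cons.prems by (simp add: I2_def)
  have "br (a, a) y = tscale (of_int ((if fst y = a then 1 else 0) - (if snd y = a then 1 else 0))) (e y)"
    by (cases y) (auto simp: br_def psg_def)
  then show ?case
  proof -
    assume b: "br (a, a) y = tscale (of_int ((if fst y = a then 1 else 0) - (if snd y = a then 1 else 0))) (e y)"
    have y: "y \<in> I2" "set w \<subseteq> I2" using Cons.prems by auto
    have IH: "D (a, a) (ew w) = tscale (of_int (wtw a w)) (ew w)" using Cons.IH Cons.prems(1) y by blast
    have "wtw a (y # w) = ((if fst y = a then 1 else 0) - (if snd y = a then 1 else 0)) + wtw a w" by (simp add: wtw_def)
    moreover have "psg (a, a) y = 1" by (simp add: psg_def)
    ultimately show ?thesis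
      by (simp only: ew_Cons D_e_mult[OF aI y(1)] b IH tscale_mult_left tscale_mult_right
         of_int_add tv.scale_left_distrib tv.scale_one)
  qed
qed

text \<open>The counterpart of \<open>res_weight\<close> for words of any length. Words in
  \<open>e\<close> are linearly dependent, so the component is taken of the formal sum; each of its
  parts is still an eigenvector.\<close>

lemma weight_split:
  assumes F: "finite F" "\<And>w. w \<in> F \<Longrightarrow> set w \<subseteq> I2" and S: "tv.subspace S" "\<And>t. t \<in> S \<Longrightarrow> D (a, a) t \<in> S"
    and a: "a < d" and t: "(\<Sum>w\<in>F. tscale (c w) (ew w)) \<in> S"
  shows "(\<Sum>w\<in>{w\<in>F. wtw a w = v}. tscale (c w) (ew w)) \<in> S"
proof (cases "v \<in> wtw a ` F")
  case False
  then have e: "{w\<in>F. wtw a w = v} = {}" by auto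
  show ?thesis unfolding e using S by (simp add: tv.subspace_0)
next
  case True
  let ?V = "(\<lambda>w. of_int (wtw a w) :: complex) ` F"
  let ?x = "\<lambda>v::complex. \<Sum>w\<in>{w\<in>F. of_int (wtw a w) = v}. tscale (c w) (ew w)"
  have "(\<Sum>v\<in>?V. ?x v) = (\<Sum>w\<in>F. tscale (c w) (ew w))"
    by (rule sum.image_gen[symmetric]) (rule F(1))
  moreover have "D (a, a) (?x v) = tscale v (?x v)" for v
    unfolding tlin_sum[OF tlin_D] tv.scale_sum_right
    by (intro sum.cong refl) (use F(2) a in \<open>auto simp: tlin_scale[OF tlin_D] D_diag_ew mult.commute\<close>)
  moreover have "of_int v \<in> ?V" using True by auto
  ultimately have "?x (of_int v) \<in> S"
    using S t F(1) by (intro eigen_components[of S "D (a, a)" ?V ?x]) (simp_all add: tlin_D)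
  then show ?thesis by simp
qed

lemma weights_split:
  assumes F: "finite F" "\<And>w. w \<in> F \<Longrightarrow> set w \<subseteq> I2" and S: "tv.subspace S" "\<And>t a. t \<in> S \<Longrightarrow> a < d \<Longrightarrow> D (a, a) t \<in> S"
    and t: "(\<Sum>w\<in>F. tscale (c w) (ew w)) \<in> S"
  shows "q \<le> d \<Longrightarrow> (\<Sum>w\<in>{w\<in>F. \<forall>a<q. wtw a w = v a}. tscale (c w) (ew w)) \<in> S"
proof (induction q)
  case 0 then show ?case using t by simp
next
  case (Suc q)
  have e: "{w\<in>F. \<forall>a<Suc q. wtw a w = v a} = {w \<in> {w\<in>F. \<forall>a<q. wtw a w = v a}. wtw q w = v q}"
    by (auto simp: less_Suc_eq)
  show ?case unfolding e
    by (rule weight_split) (use F S Suc in auto)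
qed

lemma other_index: "\<exists>r<d. r \<noteq> p \<and> r \<noteq> q"
proof -
  have "r < d" if "r \<in> {0, 1, 2}" for r using that idx by auto
  moreover have "\<exists>r\<in>{0, 1, 2}. r \<noteq> p \<and> r \<noteq> q" by auto
  ultimately show ?thesis by blast
qed

lemma tens1: "tens m n 1 = tv.span (e ` I2)"
proof -
  have "{ew w | w. set w \<subseteq> I2 \<and> length w = 1} = e ` I2"
  proof
    show "{ew w | w. set w \<subseteq> I2 \<and> length w = 1} \<subseteq> e ` I2"
      by (auto simp: length_Suc_conv ew_Cons)
    have "e x \<in> {ew w | w. set w \<subseteq> I2 \<and> length w = 1}" if "x \<in> I2" for x
      using that by (intro CollectI exI[of _ "[x]"]) (simp add: ew_Cons)
    then show "e ` I2 \<subseteq> {ew w | w. set w \<subseteq> I2 \<and> length w = 1}" by blast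
  qed
  then show ?thesis unfolding tens_ew by (simp only:)
qed

lemma span_e_sum: assumes "x \<in> tv.span (e ` I2)" shows "\<exists>c. x = (\<Sum>y\<in>I2. tscale (c y) (e y))"
  using assms
proof (induction rule: tv.span_induct_alt)
  case base show ?case by (rule exI[of _ "\<lambda>_. 0"]) simp
next
  case (step r u v)
  obtain z where z: "z \<in> I2" "u = e z" using step by blast
  obtain c where c: "v = (\<Sum>y\<in>I2. tscale (c y) (e y))" using step by blast
  have "tscale r u + v = (\<Sum>y\<in>I2. tscale (c y + (if y = z then r else 0)) (e y))"
    using z by (simp add: tv.scale_left_distrib sum.distrib c if_distrib[of "\<lambda>c. tscale c _"] cong: if_cong)
  then show ?case by (rule exI[of _ "\<lambda>y. c y + (if y = z then r else 0)"])
qed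

section \<open>Simplicity of the adjoint module\<close>

lemma sl_generated:
  assumes I: "gmod I" and ab: "(a, b) \<in> I2" "a \<noteq> b" "e (a, b) \<in> I"
  shows "x \<in> I2 \<Longrightarrow> e x \<in> I"
proof -
  have Is: "tv.subspace I" and DI: "\<And>x y. x \<in> I2 \<Longrightarrow> y \<in> I2 \<Longrightarrow> e y \<in> I \<Longrightarrow> br x y \<in> I"
    using I D_e by (auto simp: gmod_def) metis
  have r: "a < d" "b < d" using ab by (auto simp: I2_def)
  have 1: "e (c, b) \<in> I" if "c < d" "c \<noteq> b" for c
  proof (cases "c = a")
    case False
    have "br (c, a) (a, b) \<in> I" using that r ab by (intro DI) (auto simp: I2_def)
    then show ?thesis using that by (simp add: br_def)
  qed (use ab in simp)
  have 2: "e (c, f) \<in> I" if "c < d" "c \<noteq> b" "f < d" "f \<noteq> c" for c f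
  proof (cases "f = b")
    case False
    have "br (b, f) (c, b) \<in> I" using that r 1 by (intro DI) (auto simp: I2_def)
    then have "- tscale (psg (b, f) (c, b)) (e (c, f)) \<in> I" using that by (simp add: br_def)
    then have "tscale (- psg (b, f) (c, b)) (- tscale (psg (b, f) (c, b)) (e (c, f))) \<in> I"
      by (rule tv.subspace_scale[OF Is])
    then show ?thesis by (simp add: psg_def mult_ac)
  qed (use 1 that in simp)
  have 3: "e (c, f) \<in> I" if "c < d" "f < d" "f \<noteq> c" for c f
  proof (cases "c = b")
    case True
    obtain g where g: "g < d" "g \<noteq> b" "g \<noteq> f" using other_index by blast
    have "br (b, g) (g, f) \<in> I" using g that r 2[of g f] by (intro DI) (auto simp: I2_def)
    then show ?thesis using g that True by (simp add: br_def)
  qed (use 2 that in simp)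
  \<comment> \<open>Brackets of opposite off-diagonal generators give only differences. In their sum
    over \<open>f\<close> the terms \<open>e (f, f)\<close> cancel by \<open>sum_e_diag\<close> and
    the multiple \<open>- N * s c\<close> of \<open>e (c, c)\<close> is left.\<close>
  have 4: "e (c, c) \<in> I" if c: "c < d" for c
  proof -
    have "e (f, f) - tscale (s f * s c) (e (c, c)) \<in> I" if f: "f < d" for f
    proof (cases "f = c")
      case True then show ?thesis using Is by (simp add: tv.subspace_0)
    next
      case False
      have "br (f, c) (c, f) \<in> I" using 3[of c f] False c f by (intro DI) (auto simp: I2_def)
      moreover have "psg (f, c) (c, f) = s f * s c" by (simp add: psg_def X_def s_def chi_def)
      ultimately show ?thesis by (simp add: br_def)
    qed
    then have "(\<Sum>f<d. e (f, f) - tscale (s f * s c) (e (c, c))) \<in> I"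
      by (intro tv.subspace_sum[OF Is]) simp
    then have "- tscale (N * s c) (e (c, c)) \<in> I"
      by (simp add: sum_subtractf sum_e_diag tv.scale_sum_left[symmetric] sum_distrib_right[symmetric] sum_s)
    then have "tscale (- (s c / N)) (- tscale (N * s c) (e (c, c))) \<in> I" by (rule tv.subspace_scale[OF Is])
    then show ?thesis using N_nz by simp
  qed
  assume "x \<in> I2"
  then show ?thesis using 3[of "fst x" "snd x"] 4[of "fst x"] by (cases x) (auto simp: I2_def)
qed

text \<open>A nonzero element either has an off-diagonal entry, isolated by its weight, or is
  diagonal with two different coefficients, and then the bracket with \<open>e (p, q)\<close>
  produces \<open>e (p, q)\<close>. One off-diagonal generator generates everything.\<close>

lemma sl_simple:
  assumes I: "gmod I" "I \<subseteq> tens m n 1" "I \<noteq> {0}"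
  shows "I = tens m n 1"
proof -
  have Is: "tv.subspace I" using I by (simp add: gmod_def)
  obtain x where x: "x \<in> I" "x \<noteq> 0" using I gmod_0 by blast
  then obtain c where c: "x = (\<Sum>y\<in>I2. tscale (c y) (e y))"
    using span_e_sum I tens1 by blast
  have "\<exists>a b. (a, b) \<in> I2 \<and> a \<noteq> b \<and> e (a, b) \<in> I"
  proof (cases "\<exists>a b. (a, b) \<in> I2 \<and> a \<noteq> b \<and> c (a, b) \<noteq> 0")
    case True
    then obtain a b where ab: "(a, b) \<in> I2" "a \<noteq> b" "c (a, b) \<noteq> 0" by blast
    let ?F = "(\<lambda>y. [y]) ` I2"
    have "(\<Sum>w\<in>?F. tscale (c (hd w)) (ew w)) = x"
      unfolding c by (subst sum.reindex) (auto simp: inj_on_def ew_Cons)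
    then have s: "(\<Sum>w\<in>?F. tscale (c (hd w)) (ew w)) \<in> I" using x by simp
    have "(\<Sum>w\<in>{w\<in>?F. \<forall>q<d. wtw q w = wtw q [(a, b)]}. tscale (c (hd w)) (ew w)) \<in> I"
      by (rule weights_split[OF _ _ Is _ s]) (use I in \<open>auto simp: gmod_def I2_def\<close>)
    also have "{w\<in>?F. \<forall>q<d. wtw q w = wtw q [(a, b)]} = {[(a, b)]}"
    proof -
      have "p = a \<and> q = b" if "\<forall>r<d. wtw r [(p, q)] = wtw r [(a, b)]" for p q
      proof -
        have "wtw a [(p, q)] = wtw a [(a, b)]" "wtw b [(p, q)] = wtw b [(a, b)]" using that ab by (auto simp: I2_def)
        then show ?thesis using ab(2) by (simp add: wtw_def split: if_splits)
      qed
      then show ?thesis using ab by auto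
    qed
    finally have "tscale (c (a, b)) (e (a, b)) \<in> I" by (simp add: ew_Cons)
    then have "tscale (1 / c (a, b)) (tscale (c (a, b)) (e (a, b))) \<in> I" by (rule tv.subspace_scale[OF Is])
    then have "e (a, b) \<in> I" using ab by simp
    then show ?thesis using ab by blast
  next
    case False
    have xd: "x = (\<Sum>p<d. tscale (c (p, p)) (e (p, p)))"
    proof -
      have "x = (\<Sum>p<d. \<Sum>q<d. if q = p then tscale (c (p, p)) (e (p, p)) else 0)"
        unfolding c sum_I2 by (intro sum.cong refl) (use False in \<open>auto simp: I2_def\<close>)
      then show ?thesis by simp
    qed
    have "\<exists>p q. p < d \<and> q < d \<and> c (p, p) \<noteq> c (q, q)"
    proof (rule ccontr)
      assume "\<not> ?thesis"
      then have "x = (\<Sum>p<d. tscale (c (0, 0)) (e (p, p)))"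
        unfolding xd using idx(1) by (intro sum.cong refl) (metis lessThan_iff)
      then show False using x by (simp add: tv.scale_sum_right[symmetric] sum_e_diag)
    qed
    then obtain p q where pq: "p < d" "q < d" "c (p, p) \<noteq> c (q, q)" by blast
    then have ne: "p \<noteq> q" by auto
    have "D (p, q) x = (\<Sum>r<d. (if r = q then tscale (c (q, q)) (e (p, q)) else 0) - (if r = p then tscale (c (p, p)) (e (p, q)) else 0))"
      unfolding xd tlin_sum[OF tlin_D]
      by (intro sum.cong refl) (use pq in \<open>auto simp: tlin_scale[OF tlin_D] D_e I2_def br_def psg_def tv.scale_right_diff_distrib\<close>)
    also have "\<dots> = tscale (c (q, q) - c (p, p)) (e (p, q))"
      using pq by (simp add: sum_subtractf tv.scale_left_diff_distrib)
    finally have eq: "D (p, q) x = tscale (c (q, q) - c (p, p)) (e (p, q))" .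
    have "D (p, q) x \<in> I" using I(1) x(1) pq by (simp add: gmod_def I2_def)
    then have "tscale (c (q, q) - c (p, p)) (e (p, q)) \<in> I" by (simp only: eq)
    then have "tscale (1 / (c (q, q) - c (p, p))) (tscale (c (q, q) - c (p, p)) (e (p, q))) \<in> I"
      by (rule tv.subspace_scale[OF Is])
    then have "e (p, q) \<in> I" using pq by simp
    then show ?thesis using pq ne by (auto simp: I2_def)
  qed
  then have "e ` I2 \<subseteq> I" using sl_generated[OF I(1)] by blast
  then have "tv.span (e ` I2) \<subseteq> I" by (rule tv.span_minimal[OF _ Is])
  then show ?thesis using I tens1 by blast
qed

section \<open>Adjoint and trivial submodules of the tensor square\<close>

definition c1 :: "tensor \<Rightarrow> nat \<Rightarrow> nat \<Rightarrow> complex" where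
  "c1 x i l = Poly_Mapping.lookup x (Word [(i, l)])"

definition op1 :: "nat \<Rightarrow> nat \<Rightarrow> (nat \<Rightarrow> nat \<Rightarrow> complex) \<Rightarrow> nat \<Rightarrow> nat \<Rightarrow> complex" where
  "op1 a b z i l = (if i = a then z b l else 0) - (if l = b then X a b i * X a b a * z i a else 0)"

lemma c1_add: "c1 (x + y) i l = c1 x i l + c1 y i l"
  and c1_scale: "c1 (tscale c x) i l = c * c1 x i l"
  and c1_zero: "c1 0 i l = 0"
  by (simp_all add: c1_def lookup_add)

lemma op1_add: "op1 a b (c1 (x + y)) i l = op1 a b (c1 x) i l + op1 a b (c1 y) i l"
  and op1_scale: "op1 a b (c1 (tscale c x)) i l = c * op1 a b (c1 x) i l"
  and op1_zero: "op1 a b (c1 0) i l = 0"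
  by (simp_all add: op1_def c1_add c1_scale c1_zero algebra_simps)

lemma c1_D:
  assumes "(a, b) \<in> I2" "x \<in> tens m n 1"
  shows "c1 (D (a, b) x) i l = op1 a b (c1 x) i l"
proof -
  have "c1 (D (a, b) (letter (p, q))) i l = op1 a b (c1 (letter (p, q))) i l" if "(p, q) \<in> I2" for p q
    using D_letter_mult[OF assms(1) that, of 1] assms(1)
    by (auto simp: D_one c1_def op1_def brl_def lookup_minus letter_wd lookup_wd psg_def)
  moreover have "tv.subspace {x. c1 (D (a, b) x) i l = op1 a b (c1 x) i l}"
    unfolding tv.subspace_def mem_Collect_eq tlin_0[OF tlin_D] tlin_add[OF tlin_D] tlin_scale[OF tlin_D]
      c1_add c1_scale c1_zero op1_add op1_scale op1_zero by simp
  ultimately have "tv.span (letter ` I2) \<subseteq> {x. c1 (D (a, b) x) i l = op1 a b (c1 x) i l}"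
    by (intro tv.span_minimal) auto
  moreover have "x \<in> tv.span (letter ` I2)"
    by (rule tlin_span[OF tlin_id tv.subspace_span assms(2)[unfolded tens1]]) (use e_wd in auto)
  ultimately show ?thesis by blast
qed

lemma c1_str: assumes "x \<in> tens m n 1" shows "(\<Sum>p<d. s p * c1 x p p) = 0"
proof -
  have "tv.subspace {x. (\<Sum>p<d. s p * c1 x p p) = 0}"
    unfolding tv.subspace_def by (auto simp: c1_def lookup_add distrib_left sum.distrib mult.left_commute[of _ "_::complex"] sum_distrib_left[symmetric])
  moreover have "(\<Sum>p<d. s p * c1 (e (a, b)) p p) = 0" if ab: "(a, b) \<in> I2" for a b
  proof -
    have i: "c1 idt p p = 1" if "p < d" for p
    proof -
      have "c1 idt p p = (\<Sum>q<d. if q = p then 1 else 0)"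
        unfolding c1_def idt_def lookup_sum by (intro sum.cong refl) (auto simp: letter_wd lookup_wd)
      then show ?thesis using that by simp
    qed
    have "(\<Sum>p<d. s p * c1 (e (a, b)) p p) = (\<Sum>p<d. (if p = a then if a = b then s a else 0 else 0) - s p * (if a = b then s a / N else 0))"
      by (intro sum.cong refl) (use i in \<open>auto simp: e_def c1_def lookup_minus letter_wd lookup_wd right_diff_distrib\<close>)
    then show ?thesis using ab N_nz by (simp add: sum_subtractf sum_distrib_right[symmetric] sum_s I2_def)
  qed
  ultimately have "tv.span (e ` I2) \<subseteq> {x. (\<Sum>p<d. s p * c1 x p p) = 0}"
    by (intro tv.span_minimal) auto
  then show ?thesis using assms tens1 by blast
qed

lemma c1_exists:
  assumes "(\<Sum>p<d. s p * z p p) = 0"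
  shows "\<exists>x\<in>tens m n 1. \<forall>i<d. \<forall>l<d. c1 x i l = z i l"
proof -
  let ?x = "\<Sum>y\<in>I2. tscale (z (fst y) (snd y)) (letter y)"
  have "?x = emb m n (mat d d (\<lambda>(i, l). z i l))"
    unfolding emb_zero_outside by (intro sum.cong refl) (auto simp: I2_def)
  moreover have "mat d d (\<lambda>(i, l). z i l) \<in> sl m n"
    using assms by (simp add: sl_def supertrace_s)
  ultimately have "?x \<in> tens m n 1" using emb_in_span_e tens1 by metis
  moreover have "c1 ?x i l = z i l" if "i < d" "l < d" for i l
  proof -
    have "c1 ?x i l = (\<Sum>y\<in>I2. if y = (i, l) then z i l else 0)"
      unfolding c1_def lookup_sum by (intro sum.cong refl) (auto simp: letter_wd lookup_wd)
    then show ?thesis using that by (simp add: I2_def)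
  qed
  ultimately show ?thesis by blast
qed

definition ins :: "(nat \<Rightarrow> nat \<Rightarrow> complex) \<Rightarrow> nat \<Rightarrow> nat \<Rightarrow> nat \<Rightarrow> nat \<Rightarrow> complex" where
  "ins z i k j l = (if k = j then z i l else 0)"

text \<open>The two copies of the adjoint module in the tensor square are the images of \<open>mk \<circ> Gf\<close> and
  \<open>mk \<circ> fU \<circ> fL \<circ> Gf\<close>.\<close>

definition Gf :: "(nat \<Rightarrow> nat \<Rightarrow> complex) \<Rightarrow> nat \<Rightarrow> nat \<Rightarrow> nat \<Rightarrow> nat \<Rightarrow> complex" where
  "Gf z i k j l = ins z i k j l - (1 / N) * (fU (ins z) i k j l + fL (ins z) i k j l)"

lemma opf_ins: "opf a b (ins z) i k j l = ins (op1 a b z) i k j l"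
  by (auto simp: opf_def ins_def op1_def mult_ac)

lemma opf_lin: "opf a b (\<lambda>i k j l. f i k j l - c * (g i k j l + h i k j l)) i k j l
   = opf a b f i k j l - c * (opf a b g i k j l + opf a b h i k j l)"
  by (simp add: opf_def algebra_simps)

lemma opf_Gf: "opf a b (Gf z) i k j l = Gf (op1 a b z) i k j l"
proof -
  have e: "opf a b (ins z) = ins (op1 a b z)" by (simp add: fun_eq_iff opf_ins)
  have "opf a b (Gf z) i k j l = opf a b (\<lambda>i k j l. ins z i k j l - (1 / N) * (fU (ins z) i k j l + fL (ins z) i k j l)) i k j l"
    by (simp add: Gf_def opf_def)
  then show ?thesis unfolding opf_lin opf_fU opf_fL e Gf_def .
qed

lemma tr_ins:
  assumes "i < d" "l < d"
  shows "tr (ins z) i l = N * z i l" "tr (fU (ins z)) i l = z i l" "tr (fL (ins z)) i l = z i l"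
    "tr (fU (fL (ins z))) i l = (if i = l then (\<Sum>p<d. s p * z p p) else 0)"
proof -
  show "tr (ins z) i l = N * z i l"
    by (simp add: tr_def ins_def sum_distrib_right[symmetric] sum_s)
  have "tr (fU (ins z)) i l = (\<Sum>p<d. if p = i then z i l else 0)"
    unfolding tr_def by (intro sum.cong refl) (auto simp: fU_def ins_def)
  then show "tr (fU (ins z)) i l = z i l" using assms by simp
  have "tr (fL (ins z)) i l = (\<Sum>p<d. if p = l then z i l else 0)"
    unfolding tr_def by (intro sum.cong refl) (auto simp: fL_def ins_def)
  then show "tr (fL (ins z)) i l = z i l" using assms by simp
  show "tr (fU (fL (ins z))) i l = (if i = l then (\<Sum>p<d. s p * z p p) else 0)"
    by (auto simp: tr_def fU_def fL_def ins_def chi_sym intro!: sum.cong)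
qed

lemma tr_lin: "tr (\<lambda>i k j l. f i k j l - c * (g i k j l + h i k j l)) i l = tr f i l - c * (tr g i l + tr h i l)"
  by (simp add: tr_def algebra_simps sum.distrib sum_subtractf sum_distrib_left)

lemma tr_mk: "i < d \<Longrightarrow> l < d \<Longrightarrow> tr (fU (co (mk f))) i l = tr (fU f) i l \<and> tr (fL (co (mk f))) i l = tr (fL f) i l"
  unfolding tr_def fU_def fL_def by (auto simp: co_mk intro!: sum.cong)

definition G :: "tensor \<Rightarrow> tensor" where "G x = mk (Gf (c1 x))"
definition G' :: "tensor \<Rightarrow> tensor" where "G' x = mk (fU (fL (Gf (c1 x))))"
text \<open>The Casimir tensor, spanning the trivial submodule. One correction term suffices because
  \<open>fU\<close> and \<open>fL\<close> agree on the inserted identity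
  (\<open>ins_delta\<close>).\<close>

definition G0 :: tensor where "G0 = mk (\<lambda>i k j l. ins (\<lambda>i l. if i = l then 1 else 0) i k j l - (1 / N) * fU (ins (\<lambda>i l. if i = l then 1 else 0)) i k j l)"

text \<open>Either supertrace sees \<open>z\<close> once from \<open>ins z\<close> and
  \<open>N * z\<close> from one of the corrections, whence the coefficient \<open>1 / N\<close> in
  \<open>Gf\<close>; the other correction contributes the supertrace of \<open>z\<close>, which is
  zero.\<close>

lemma Gf_traces:
  assumes "(\<Sum>p<d. s p * z p p) = 0" "i < d" "l < d"
  shows "tr (fU (Gf z)) i l = 0" "tr (fL (Gf z)) i l = 0"
proof -
  have U: "fU (Gf z) = (\<lambda>i k j l. fU (ins z) i k j l - (1 / N) * (ins z i k j l + fU (fL (ins z)) i k j l))"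
    by (simp add: fun_eq_iff Gf_def fU_def fL_def ins_def right_diff_distrib distrib_left chi_sym mult_ac)
  have L: "fL (Gf z) = (\<lambda>i k j l. fL (ins z) i k j l - (1 / N) * (ins z i k j l + fU (fL (ins z)) i k j l))"
    by (simp add: fun_eq_iff Gf_def fU_def fL_def ins_def right_diff_distrib distrib_left chi_sym mult_ac)
  show "tr (fU (Gf z)) i l = 0" "tr (fL (Gf z)) i l = 0"
    unfolding U L tr_lin using assms N_nz by (simp_all add: tr_ins)
qed

lemma G_tens2: "x \<in> tens m n 1 \<Longrightarrow> G x \<in> tens m n 2 \<and> G' x \<in> tens m n 2"
proof -
  assume "x \<in> tens m n 1"
  then have t: "(\<Sum>p<d. s p * c1 x p p) = 0" by (rule c1_str)
  have "fU (fU (fL (Gf (c1 x)))) = fL (Gf (c1 x))" "fL (fU (fL (Gf (c1 x)))) = fU (Gf (c1 x))"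
    by (simp_all add: fL_fU)
  then show ?thesis
    using Gf_traces[where z = "c1 x", OF t] unfolding G_def G'_def
    by (intro conjI tens2I mk_F2) (auto simp: tr_mk I2_def)
qed

lemma tlin_G: "tlin G" "tlin G'"
proof -
  have a: "Gf (c1 (x + y)) i k j l = Gf (c1 x) i k j l + Gf (c1 y) i k j l"
    and c: "Gf (c1 (tscale c x)) i k j l = c * Gf (c1 x) i k j l" for x y c i k j l
    by (simp_all add: Gf_def fU_def fL_def ins_def c1_add c1_scale algebra_simps add_divide_distrib)
  show "tlin G" "tlin G'"
    unfolding G_def G'_def
    by (rule tlinI; rule F2_eqI;
        (intro mk_F2 tv.subspace_add[OF subspace_F2] tv.subspace_scale[OF subspace_F2])?;
        simp add: co_mk fU_def fL_def a c algebra_simps)+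
qed

lemma G_D:
  assumes "y \<in> I2" "x \<in> tens m n 1"
  shows "D y (G x) = G (D y x)" "D y (G' x) = G' (D y x)"
proof -
  obtain a b where y: "y = (a, b)" "a < d" "b < d" using assms by (auto simp: I2_def)
  have c: "c1 (D y x) = op1 a b (c1 x)" using c1_D assms by (auto simp: fun_eq_iff y)
  have mk_opf: "D y (mk f) = mk (opf a b f)" for f
  proof (rule F2_eqI)
    show "D y (mk f) \<in> F2" using assms by (intro D_F2 mk_F2)
    fix i k j l assume "i < d" "k < d" "j < d" "l < d"
    then show "co (D y (mk f)) i k j l = co (mk (opf a b f)) i k j l"
      using assms y by (simp add: co_D mk_F2 co_mk) (auto simp: opf_def co_mk)
  qed (rule mk_F2)
  have e: "opf a b (Gf z) = Gf (op1 a b z)" for z by (simp add: fun_eq_iff opf_Gf)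
  have hU: "opf a b (fU f) = fU (opf a b f)" and hL: "opf a b (fL f) = fL (opf a b f)" for f
    by (simp_all add: fun_eq_iff opf_fU opf_fL)
  show "D y (G x) = G (D y x)" "D y (G' x) = G' (D y x)"
    unfolding G_def G'_def c by (simp_all add: mk_opf e hU hL)
qed

lemma G0_D: assumes "y \<in> I2" shows "D y G0 = 0"
proof -
  obtain a b where y: "y = (a, b)" "a < d" "b < d" using assms by (auto simp: I2_def)
  let ?z = "\<lambda>i l. if i = l then 1 else (0::complex)"
  have z: "op1 a b ?z = (\<lambda>i l. 0)" by (auto simp: op1_def fun_eq_iff)
  have i0: "ins (\<lambda>i l. 0) = (\<lambda>i k j l. 0)" by (simp add: ins_def fun_eq_iff)
  have e: "opf a b (ins ?z) = (\<lambda>i k j l. 0)" unfolding fun_eq_iff opf_ins z i0 by simp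
  have "co (D y G0) i k j l = 0" if r: "i < d" "k < d" "j < d" "l < d" for i k j l
  proof -
    have "co (D y G0) i k j l = opf a b (\<lambda>i k j l. ins ?z i k j l - (1 / N) * (fU (ins ?z) i k j l + 0)) i k j l"
      using assms y r by (simp add: G0_def co_D mk_F2) (auto simp: opf_def co_mk)
    then show ?thesis unfolding opf_lin opf_fU e by (simp add: opf_def fU_def)
  qed
  then show ?thesis using assms by (intro F2_eqI D_F2) (auto simp: G0_def mk_F2 tv.subspace_0[OF subspace_F2])
qed

text \<open>The half of Schur's lemma that is needed: a submodule of the image pulls back to a
  submodule of \<open>L\<close>.\<close>

lemma simple_image:
  assumes f: "tlin f" "\<And>x t. x \<in> I2 \<Longrightarrow> t \<in> L \<Longrightarrow> f (D x t) = D x (f t)"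
    and L: "gmod L" "\<And>R. gmod R \<Longrightarrow> R \<subseteq> L \<Longrightarrow> R \<noteq> {0} \<Longrightarrow> R = L"
  shows "f ` L = {0} \<or> simp_mod (f ` L)"
proof -
  have Ls: "tv.subspace L" using L by (simp add: gmod_def)
  have g: "gmod (f ` L)"
    unfolding gmod_def
  proof (intro conjI ballI subspace_image f Ls)
    fix x t assume x: "x \<in> I2" and "t \<in> f ` L"
    then obtain u where u: "u \<in> L" "t = f u" by blast
    then have "D x t = f (D x u)" "D x u \<in> L" using f(2)[OF x u(1)] L x by (auto simp: gmod_def)
    then show "D x t \<in> f ` L" by blast
  qed
  moreover have "R = {0} \<or> R = f ` L" if R: "gmod R" "R \<subseteq> f ` L" for R
  proof -
    let ?P = "{t \<in> L. f t \<in> R}"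
    have "gmod ?P"
      unfolding gmod_def
    proof (intro conjI ballI)
      have "?P = L \<inter> {t. f t \<in> R}" by blast
      then show "tv.subspace ?P"
        using tv.subspace_inter[OF Ls subspace_vimage[OF f(1), of R]] R by (simp add: gmod_def)
      fix x t assume "x \<in> I2" "t \<in> ?P"
      then show "D x t \<in> ?P" using f(2)[of x t] L R by (auto simp: gmod_def)
    qed
    then have "?P = {0} \<or> ?P = L" using L(2)[of ?P] by blast
    then show ?thesis
    proof
      assume "?P = {0}"
      have "t = 0" if t: "t \<in> R" for t
      proof -
        obtain u where u: "u \<in> L" "t = f u" using t R(2) by blast
        then have "u \<in> ?P" using t by simp
        then have "u = 0" using \<open>?P = {0}\<close> by simp
        then show ?thesis using u(2) tlin_0[OF f(1)] by simp
      qed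
      then have "R \<subseteq> {0}" by blast
      then show ?thesis using gmod_0[OF R(1)] by blast
    next
      assume "?P = L"
      then have "f ` L \<subseteq> R" by blast
      then show ?thesis using R by blast
    qed
  qed
  ultimately show ?thesis by (auto simp: simp_mod_def)
qed

lemma gmod_tens: "gmod (tens m n k)"
  by (simp add: gmod_def subspace_tens D_tens)

lemma T_tens2: "T sg sg' \<subseteq> tens m n 2"
proof
  fix t assume t: "t \<in> T sg sg'"
  then have "fU (co t) = (\<lambda>i k j l. sg * co t i k j l)" "fL (co t) = (\<lambda>i k j l. sg' * co t i k j l)"
    by (simp_all add: T_def fU_def fL_def fun_eq_iff)
  moreover have "tr (\<lambda>i k j l. c * f i k j l) i l = c * tr f i l" for c f i l
    by (simp add: tr_def sum_distrib_left mult.left_commute)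
  ultimately show "t \<in> tens m n 2" using t by (intro tens2I) (auto simp: T_def)
qed

end

section \<open>The Cartan square and its complement\<close>

context sl_super
begin

text \<open>The socle of the tensor square; \<open>tens2_semisimple\<close> shows that it is the
  whole module.\<close>

definition Soc :: "tensor set" where "Soc = tv.span (\<Union>{L. simp_mod L \<and> L \<subseteq> tens m n 2})"

lemma simple_Soc: "simp_mod L \<Longrightarrow> L \<subseteq> tens m n 2 \<Longrightarrow> L \<subseteq> Soc"
  unfolding Soc_def using tv.span_superset[of "\<Union>{L. simp_mod L \<and> L \<subseteq> tens m n 2}"] by auto

lemma subspace_Soc: "tv.subspace Soc" by (simp add: Soc_def)

lemma T_Soc:
  assumes sg: "sg * sg = 1" "sg' * sg' = 1"
  shows "T sg sg' \<subseteq> Soc"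
proof -
  have "\<Union>{L. simp_mod L \<and> L \<subseteq> T sg sg'} \<subseteq> Soc"
    using simple_Soc T_tens2[of sg sg'] by (intro Union_least) auto
  then have "tv.span (\<Union>{L. simp_mod L \<and> L \<subseteq> T sg sg'}) \<subseteq> Soc"
    by (rule tv.span_minimal[OF _ subspace_Soc])
  then show ?thesis using T_semisimple[OF sg] by (rule order_trans[rotated])
qed

lemma G_Soc: assumes "x \<in> tens m n 1" shows "G x \<in> Soc" "G' x \<in> Soc"
proof -
  have s: "\<And>R. gmod R \<Longrightarrow> R \<subseteq> tens m n 1 \<Longrightarrow> R \<noteq> {0} \<Longrightarrow> R = tens m n 1" by (rule sl_simple)
  have z: "0 \<in> Soc" by (rule tv.subspace_0[OF subspace_Soc])
  have "G ` tens m n 1 = {0} \<or> simp_mod (G ` tens m n 1)"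
    by (rule simple_image[OF tlin_G(1) _ gmod_tens s]) (simp_all add: G_D)
  moreover have "G ` tens m n 1 \<subseteq> tens m n 2" using G_tens2 by blast
  ultimately have "G ` tens m n 1 \<subseteq> Soc"
  proof (elim disjE)
    assume "G ` tens m n 1 = {0}"
    then show ?thesis using z by (simp only: singleton_iff subset_iff) blast
  qed (rule simple_Soc)
  then show "G x \<in> Soc" using assms by blast
  have "G' ` tens m n 1 = {0} \<or> simp_mod (G' ` tens m n 1)"
    by (rule simple_image[OF tlin_G(2) _ gmod_tens s]) (simp_all add: G_D)
  moreover have "G' ` tens m n 1 \<subseteq> tens m n 2" using G_tens2 by blast
  ultimately have "G' ` tens m n 1 \<subseteq> Soc"
  proof (elim disjE)
    assume "G' ` tens m n 1 = {0}"
    then show ?thesis using z by (simp only: singleton_iff subset_iff) blast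
  qed (rule simple_Soc)
  then show "G' x \<in> Soc" using assms by blast
qed

lemma ins_delta:
  "ins (\<lambda>i l. if i = l then 1 else 0) i k j l = (if k = j \<and> i = l then 1 else 0)"
  "fU (ins (\<lambda>i l. if i = l then 1 else 0)) i k j l = (if i = j \<and> k = l then chi i k else 0)"
  "fL (ins (\<lambda>i l. if i = l then 1 else 0)) i k j l = (if i = j \<and> k = l then chi i k else 0)"
  by (auto simp: ins_def fU_def fL_def)

lemma G0_Soc: "G0 \<in> Soc"
proof (cases "G0 = 0")
  case True then show ?thesis by (simp add: tv.subspace_0[OF subspace_Soc])
next
  case False
  let ?z = "\<lambda>i l. if i = l then 1 else (0::complex)"
  let ?f = "\<lambda>i k j l. ins ?z i k j l - (1 / N) * fU (ins ?z) i k j l"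
  have f: "fU ?f = (\<lambda>i k j l. fU (ins ?z) i k j l - (1 / N) * (ins ?z i k j l + 0))"
    "fL ?f = (\<lambda>i k j l. fL (ins ?z) i k j l - (1 / N) * (ins ?z i k j l + 0))"
    by (auto simp: fun_eq_iff fU_def fL_def ins_def right_diff_distrib chi_sym)
  have t0: "tr (\<lambda>i k j l. 0) i l = 0" for i l by (simp add: tr_def)
  have "G0 \<in> tens m n 2"
    unfolding G0_def
  proof (rule tens2I[OF mk_F2])
    fix i l assume "(i, l) \<in> I2"
    then have r: "i < d" "l < d" by (auto simp: I2_def)
    have "tr (fU ?f) i l = 0" unfolding f tr_lin t0 using r N_nz by (simp add: tr_ins)
    then show "tr (fU (co (mk ?f))) i l = 0" using tr_mk[OF r] by simp
    have "tr (fL ?f) i l = 0" unfolding f tr_lin t0 using r N_nz by (simp add: tr_ins)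
    then show "tr (fL (co (mk ?f))) i l = 0" using tr_mk[OF r] by simp
  qed
  then have sub: "tv.span {G0} \<subseteq> tens m n 2" by (intro tv.span_minimal subspace_tens) simp
  have g: "gmod (tv.span {G0})" by (rule gmod_span) (simp add: G0_D tv.span_zero)
  have "R = {0} \<or> R = tv.span {G0}" if R: "gmod R" "R \<subseteq> tv.span {G0}" for R
  proof (cases "R = {0}")
    case False
    then obtain u where u: "u \<in> R" "u \<noteq> 0" using gmod_0[OF R(1)] by blast
    then obtain c where c: "u = tscale c G0" using R(2) by (auto simp: tv.span_singleton)
    have Rs: "tv.subspace R" using R(1) by (simp add: gmod_def)
    have "tscale (1 / c) u \<in> R" by (rule tv.subspace_scale[OF Rs u(1)])
    moreover have "c \<noteq> 0" using u(2) c by auto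
    ultimately have "G0 \<in> R" by (simp add: c)
    then have "tv.span {G0} \<subseteq> R" by (intro tv.span_minimal Rs) simp
    then show ?thesis using R(2) by blast
  qed blast
  moreover have "tv.span {G0} \<noteq> {0}" using False tv.span_base[of G0 "{G0}"] by auto
  ultimately have "simp_mod (tv.span {G0})" using g by (simp add: simp_mod_def)
  then have "tv.span {G0} \<subseteq> Soc" by (rule simple_Soc[OF _ sub])
  then show ?thesis using tv.span_base[of G0 "{G0}"] by blast
qed

lemma Gf_shift: "Gf (\<lambda>i l. z i l - c * (if i = l then 1 else 0)) i k j l
   = Gf z i k j l - c * Gf (\<lambda>i l. if i = l then 1 else 0) i k j l"
  by (simp add: Gf_def ins_def fU_def fL_def right_diff_distrib distrib_left algebra_simps
      add_divide_distrib diff_divide_distrib)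

lemma Gf_delta: "Gf (\<lambda>i l. if i = l then 1 else 0) i k j l
    = (if k = j \<and> i = l then 1 else 0) - (2 / N) * (if i = j \<and> k = l then chi i k else 0)"
  unfolding Gf_def ins_delta by (simp add: field_simps)

lemma solve_linear:
  fixes a b x c z y :: complex
  shows "a + x + z + b = 0 \<Longrightarrow> x = - (a + b) - z" "a + z + x + b = 0 \<Longrightarrow> x = - (a + b) - z"
    "c \<noteq> 0 \<Longrightarrow> c * x = - y - z \<Longrightarrow> x = - (1 / c) * y - z / c"
    "a + c * x + c * z + b = 0 \<Longrightarrow> c \<noteq> 0 \<Longrightarrow> x + z = - ((a + b) / c)"
proof -
  have r: "x = (a + x + z + b) - (a + b) - z" "x = (a + z + x + b) - (a + b) - z" by simp_all
  { assume "a + x + z + b = 0" then show "x = - (a + b) - z" using r(1) by simp }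
  { assume "a + z + x + b = 0" then show "x = - (a + b) - z" using r(2) by simp }
  assume c: "c \<noteq> 0"
  { assume e: "c * x = - y - z"
    have "x = (c * x) / c" using c by simp
    then show "x = - (1 / c) * y - z / c" unfolding e by (simp add: diff_divide_distrib) }
  { assume e: "a + c * x + c * z + b = 0"
    have "x + z = (c * (x + z)) / c" using c by simp
    also have "c * (x + z) = (a + c * x + c * z + b) - (a + b)" by (simp add: algebra_simps)
    also have "\<dots> = - (a + b)" unfolding e by simp
    finally show "x + z = - ((a + b) / c)" by (simp only: minus_divide_left) }
qed

lemma collect_terms:
  fixes b :: complex
  assumes "b * t2 = v2" "c * t1 = v1"
  shows "A + b * (- u * (x + y) - t2) + c * (- u * (z + w) - t1) + E
     = (A - u * (b * x + c * z)) + (E - u * (b * y + c * w)) - (v1 + v2)"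
  unfolding assms[symmetric] by (simp add: algebra_simps)

text \<open>Vanishing supertraces of the two factors are linear equations (\<open>U\<close>,
  \<open>L\<close>) that express \<open>Z1\<close> and \<open>Z2\<close> by \<open>Z3 + Z4\<close>
  up to scalars. Only two adjoint parts and one scalar stay free, and they are matched by
  \<open>G\<close>, \<open>G'\<close> and \<open>G0\<close>.\<close>

lemma trace_part_Soc:
  assumes r: "r \<in> tens m n 2"
    and co: "\<And>i k j l. i < d \<Longrightarrow> k < d \<Longrightarrow> j < d \<Longrightarrow> l < d \<Longrightarrow> co r i k j l =
      ins Z3 i k j l + fU (ins Z1) i k j l + fL (ins Z2) i k j l + fU (fL (ins Z4)) i k j l"
  shows "r \<in> Soc"
proof -
  define str where "str = (\<lambda>z::nat \<Rightarrow> nat \<Rightarrow> complex. \<Sum>p<d. s p * z p p)"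
  have U: "Z3 i l + N * Z1 i l + (if i = l then str Z2 else 0) + Z4 i l = 0"
    and L: "Z3 i l + (if i = l then str Z1 else 0) + N * Z2 i l + Z4 i l = 0" if il: "i < d" "l < d" for i l
  proof -
    have I: "(i, l) \<in> I2" using il by (simp add: I2_def)
    have "0 = tr (fU (co r)) i l" using tens2_tr(1)[OF r I] by simp
    also have "\<dots> = (\<Sum>p<d. s p * (fU (ins Z3) i p p l + ins Z1 i p p l + fU (fL (ins Z2)) i p p l + fL (ins Z4) i p p l))"
      unfolding tr_def by (intro sum.cong refl) (use il in \<open>simp add: co fU_def fL_def distrib_left chi_sym mult_ac\<close>)
    also have "\<dots> = tr (fU (ins Z3)) i l + tr (ins Z1) i l + tr (fU (fL (ins Z2))) i l + tr (fL (ins Z4)) i l"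
      by (simp add: tr_def distrib_left sum.distrib)
    also have "\<dots> = Z3 i l + N * Z1 i l + (if i = l then str Z2 else 0) + Z4 i l"
      by (simp only: tr_ins[OF il] str_def)
    finally show "Z3 i l + N * Z1 i l + (if i = l then str Z2 else 0) + Z4 i l = 0" by simp
    have "0 = tr (fL (co r)) i l" using tens2_tr(2)[OF r I] by simp
    also have "\<dots> = (\<Sum>p<d. s p * (fL (ins Z3) i p p l + fU (fL (ins Z1)) i p p l + ins Z2 i p p l + fU (ins Z4) i p p l))"
      unfolding tr_def by (intro sum.cong refl) (use il in \<open>simp add: co fU_def fL_def distrib_left chi_sym mult_ac\<close>)
    also have "\<dots> = tr (fL (ins Z3)) i l + tr (fU (fL (ins Z1))) i l + tr (ins Z2) i l + tr (fU (ins Z4)) i l"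
      by (simp add: tr_def distrib_left sum.distrib)
    also have "\<dots> = Z3 i l + (if i = l then str Z1 else 0) + N * Z2 i l + Z4 i l"
      by (simp only: tr_ins[OF il] str_def)
    finally show "Z3 i l + (if i = l then str Z1 else 0) + N * Z2 i l + Z4 i l = 0" by simp
  qed
  have st: "str Z3 + N * str Z1 + N * str Z2 + str Z4 = 0"
  proof -
    have "0 = (\<Sum>p<d. s p * (Z3 p p + N * Z1 p p + (if p = p then str Z2 else 0) + Z4 p p))"
    proof (rule sum.neutral[symmetric], rule ballI)
      fix p assume "p \<in> {..<d}"
      then have "Z3 p p + N * Z1 p p + (if p = p then str Z2 else 0) + Z4 p p = 0" by (intro U) auto
      then show "s p * (Z3 p p + N * Z1 p p + (if p = p then str Z2 else 0) + Z4 p p) = 0" by (simp only: mult_zero_right)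
    qed
    also have "\<dots> = (\<Sum>p<d. s p * Z3 p p) + N * (\<Sum>p<d. s p * Z1 p p) + (\<Sum>p<d. s p) * str Z2 + (\<Sum>p<d. s p * Z4 p p)"
      by (simp add: distrib_left sum.distrib sum_distrib_left sum_distrib_right mult_ac)
    also have "\<dots> = str Z3 + N * str Z1 + N * str Z2 + str Z4" by (simp add: sum_s str_def)
    finally show ?thesis by simp
  qed
  let ?sh = "\<lambda>z i l. z i l - str z / N * (if i = l then 1 else 0)"
  have shs: "(\<Sum>p<d. s p * ?sh z p p) = 0" for z
  proof -
    have "(\<Sum>p<d. s p * ?sh z p p) = (\<Sum>p<d. s p * z p p - s p * (str z / N))"
      by (intro sum.cong refl) (simp add: right_diff_distrib)
    also have "\<dots> = str z - (\<Sum>p<d. s p) * (str z / N)"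
      unfolding sum_subtractf sum_distrib_right by (simp only: str_def)
    finally show ?thesis using N_nz by (simp add: sum_s)
  qed
  obtain x3 where x3: "x3 \<in> tens m n 1" "\<forall>i<d. \<forall>l<d. c1 x3 i l = ?sh Z3 i l" using c1_exists[where z = "?sh Z3", OF shs[of Z3]] by blast
  obtain x4 where x4: "x4 \<in> tens m n 1" "\<forall>i<d. \<forall>l<d. c1 x4 i l = ?sh Z4 i l" using c1_exists[where z = "?sh Z4", OF shs[of Z4]] by blast
  \<comment> \<open>\<open>G\<close> and \<open>G'\<close> are applied to matrices of supertrace
    zero, so the scalar part \<open>str z / N\<close> was removed from \<open>Z3\<close> and from
    \<open>Z4\<close>; the sum of the two is restored through \<open>G0\<close>. The supertrace of
    the equation \<open>U\<close>, stated in \<open>st\<close>, makes the remaining coefficients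
    fit.\<close>
  define c where "c = (str Z3 + str Z4) / N"
  have "r = G x3 + G' x4 + tscale c G0"
  proof (rule F2_eqI)
    show "r \<in> F2" using r tens2_F2 by blast
    show "G x3 + G' x4 + tscale c G0 \<in> F2"
      unfolding G_def G'_def G0_def
      by (intro tv.subspace_add[OF subspace_F2] tv.subspace_scale[OF subspace_F2] mk_F2)
    fix i k j l assume r4: "i < d" "k < d" "j < d" "l < d"
    let ?P = "if i = j \<and> k = l then chi i k else 0"
    let ?Q = "if k = j \<and> i = l then 1 else (0::complex)"
    have g3: "Gf (c1 x3) i k j l = Gf Z3 i k j l - str Z3 / N * (?Q - 2 / N * ?P)"
    proof -
      have "Gf (c1 x3) i k j l = Gf (?sh Z3) i k j l"
        using x3(2) r4 by (simp add: Gf_def ins_def fU_def fL_def)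
      then show ?thesis unfolding Gf_shift Gf_delta .
    qed
    have g4: "fU (fL (Gf (c1 x4))) i k j l = fU (fL (Gf Z4)) i k j l - str Z4 / N * (?Q - 2 / N * ?P)"
    proof -
      have 1: "fU (fL (Gf (c1 x4))) i k j l = chi i k * (chi j l * Gf (?sh Z4) k i l j)"
        using x4(2) r4 by (simp add: Gf_def ins_def fU_def fL_def)
      have 2: "chi i k * (chi j l * (if i = l \<and> k = j then 1 else 0)) = ?Q"
        "chi i k * (chi j l * (if k = l \<and> i = j then chi k i else 0)) = ?P"
        by (auto simp: chi_sym)
      have 3: "p * (q * (A - t * (x - r * y))) = p * (q * A) - t * (p * (q * x) - r * (p * (q * y)))" for p q A t x r y :: complex
        by (simp add: algebra_simps)
      show ?thesis unfolding 1 unfolding Gf_shift Gf_delta unfolding 3 unfolding 2 unfolding fU_def fL_def ..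
    qed
    let ?b = "if i = j then chi i k else 0" and ?c = "if k = l then chi j l else 0"
    have z1: "Z1 k l = - (1 / N) * (Z3 k l + Z4 k l) - (if k = l then str Z2 else 0) / N"
      by (rule solve_linear(3)[OF N_nz(1) solve_linear(1)[OF U[OF r4(2,4)]]])
    have z2: "Z2 i j = - (1 / N) * (Z3 i j + Z4 i j) - (if i = j then str Z1 else 0) / N"
      by (rule solve_linear(3)[OF N_nz(1) solve_linear(2)[OF L[OF r4(1,3)]]])
    have "co r i k j l = ins Z3 i k j l + ?b * Z1 k l + ?c * Z2 i j + fU (fL (ins Z4)) i k j l"
      unfolding co[OF r4] by (simp add: ins_def fU_def fL_def)
    also have "\<dots> = (ins Z3 i k j l - (1 / N) * (?b * Z3 k l + ?c * Z3 i j))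
        + (fU (fL (ins Z4)) i k j l - (1 / N) * (?b * Z4 k l + ?c * Z4 i j)) - ((str Z1 / N) * ?P + (str Z2 / N) * ?P)"
      unfolding z1 z2 by (rule collect_terms) auto
    also have "ins Z3 i k j l - (1 / N) * (?b * Z3 k l + ?c * Z3 i j) = Gf Z3 i k j l"
      by (simp add: Gf_def ins_def fU_def fL_def)
    also have "fU (fL (ins Z4)) i k j l - (1 / N) * (?b * Z4 k l + ?c * Z4 i j) = fU (fL (Gf Z4)) i k j l"
    proof -
      have "p * (q * (A - t * (x + y))) = p * (q * A) - t * (p * (q * y) + p * (q * x))" for p q A t x y :: complex
        by (simp add: algebra_simps)
      moreover have "chi i k * (chi j l * fU (ins Z4) k i l j) = ?c * Z4 i j" "chi i k * (chi j l * fL (ins Z4) k i l j) = ?b * Z4 k l"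
        by (auto simp: fU_def fL_def ins_def chi_sym mult_ac)
      ultimately show ?thesis by (simp only: fU_def[of "fL _"] fL_def[of "Gf _"] fL_def[of "ins Z4" i] fL_def[of "ins Z4" k _ j] fL_def[of "ins Z4" k _ l] Gf_def)
    qed
    also have "(str Z1 / N) * ?P + (str Z2 / N) * ?P = ((str Z1 + str Z2) / N) * ?P" by (simp only: add_divide_distrib distrib_right)
    finally have "co r i k j l = Gf Z3 i k j l + fU (fL (Gf Z4)) i k j l - ((str Z1 + str Z2) / N) * ?P" .
    moreover have cc: "str Z1 + str Z2 = - c"
      unfolding c_def by (rule solve_linear(4)[OF st N_nz(1)])
    moreover have "co (G x3 + G' x4 + tscale c G0) i k j l =
       Gf Z3 i k j l - str Z3 / N * (?Q - 2 / N * ?P) + (fU (fL (Gf Z4)) i k j l - str Z4 / N * (?Q - 2 / N * ?P))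
       + c * (?Q - (1 / N) * ?P)"
    proof -
      have "co (G x3) i k j l = Gf (c1 x3) i k j l" "co (G' x4) i k j l = fU (fL (Gf (c1 x4))) i k j l"
        "co G0 i k j l = ?Q - (1 / N) * ?P"
        using r4 by (auto simp only: G_def G'_def G0_def co_mk ins_delta simp_thms if_True)
      then show ?thesis unfolding co_add co_scale g3 g4 by (simp only:)
    qed
    moreover have "A - x / N * (q - 2 / N * p) + (A' - y / N * (q - 2 / N * p)) + (x + y) / N * (q - (1 / N) * p)
       = A + A' - (- ((x + y) / N) / N) * p" for A A' x y q p :: complex
      by (simp add: algebra_simps add_divide_distrib diff_divide_distrib)
    ultimately show "co r i k j l = co (G x3 + G' x4 + tscale c G0) i k j l"
      unfolding c_def by (simp only: cc[unfolded c_def])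
  qed
  then show ?thesis
    using G_Soc x3 x4 G0_Soc
    by (simp only:) (intro tv.subspace_add[OF subspace_Soc] tv.subspace_scale[OF subspace_Soc]; simp)
qed

text \<open>The four symmetrisers add up to the identity. After subtracting the four traceless
  parts, only inserted identities remain.\<close>

lemma tens2_semisimple: "tens m n 2 \<subseteq> Soc"
proof
  fix t assume t: "t \<in> tens m n 2"
  have one: "(1::complex) * 1 = 1" "(-1::complex) * -1 = 1" by simp_all
  obtain a where a: "mk (\<lambda>i k j l. sym 1 1 (co t) i k j l - Y 1 1 a i k j l) \<in> T 1 1" (is "?a \<in> _") using sym_trace_part[OF one(1) one(1)] by blast
  obtain b where b: "mk (\<lambda>i k j l. sym 1 (-1) (co t) i k j l - Y 1 (-1) b i k j l) \<in> T 1 (-1)" (is "?b \<in> _") using sym_trace_part[OF one(1) one(2)] by blast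
  obtain c where c: "mk (\<lambda>i k j l. sym (-1) 1 (co t) i k j l - Y (-1) 1 c i k j l) \<in> T (-1) 1" (is "?c \<in> _") using sym_trace_part[OF one(2) one(1)] by blast
  obtain f where f: "mk (\<lambda>i k j l. sym (-1) (-1) (co t) i k j l - Y (-1) (-1) f i k j l) \<in> T (-1) (-1)" (is "?f \<in> _") using sym_trace_part[OF one(2) one(2)] by blast
  have Tt: "?a \<in> tens m n 2" "?b \<in> tens m n 2" "?c \<in> tens m n 2" "?f \<in> tens m n 2" using a b c f T_tens2 by blast+
  have TS: "?a \<in> Soc" "?b \<in> Soc" "?c \<in> Soc" "?f \<in> Soc" using a b c f T_Soc[OF one(1) one(1)] T_Soc[OF one(1) one(2)] T_Soc[OF one(2) one(1)] T_Soc[OF one(2) one(2)] by blast+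
  let ?r = "t - ?a - ?b - ?c - ?f"
  have "?r \<in> Soc"
  proof (rule trace_part_Soc)
    show "?r \<in> tens m n 2" using t Tt by (intro tv.subspace_diff[OF subspace_tens])
    fix i k j l assume "i < d" "k < d" "j < d" "l < d"
    then show "co ?r i k j l = ins (\<lambda>i l. a i l + b i l + c i l + f i l) i k j l
       + fU (ins (\<lambda>i l. a i l + b i l - c i l - f i l)) i k j l
       + fL (ins (\<lambda>i l. a i l - b i l + c i l - f i l)) i k j l
       + fU (fL (ins (\<lambda>i l. a i l - b i l - c i l + f i l))) i k j l"
      by (simp add: co_mk sym_def Y_def ins_def fU_def fL_def algebra_simps)
  qed
  then have "?r + ?f + ?c + ?b + ?a \<in> Soc" using TS by (intro tv.subspace_add[OF subspace_Soc])
  then show "t \<in> Soc" by simp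
qed

text \<open>With \<open>hq\<close>, the zero-based positions of the two lower indices of the highest
  weight. An odd lower index cannot repeat in \<open>T 1 1\<close>, as exchanging it with itself
  gives a sign, so for positive \<open>n\<close> the last two positions are taken; for
  \<open>n = 0\<close> the last one is taken twice.\<close>

definition hp :: nat where "hp = (if n = 0 then d - 1 else d - 2)"
definition hq :: nat where "hq = d - 1"

definition hv :: tensor where
  "hv = mk (\<lambda>i k j l. if i = 0 \<and> k = 0 then (if j = hp \<and> l = hq then 1 else 0) + (if j = hq \<and> l = hp then chi hp hq else 0) else 0)"

lemma hpq: "hp < d" "hq < d" "hp \<noteq> 0" "hq \<noteq> 0" "n = 0 \<Longrightarrow> hp = hq" "n \<noteq> 0 \<Longrightarrow> hp < hq" "n \<noteq> 0 \<Longrightarrow> s hq = -1" "n = 0 \<Longrightarrow> chi hp hq = 1"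
  unfolding hp_def hq_def s_def chi_def using mn by auto

lemma hv_F2: "hv \<in> F2" by (simp add: hv_def mk_F2)

lemma co_hv: "co hv i k j l = (if i = 0 \<and> k = 0 then (if j = hp \<and> l = hq then 1 else 0) + (if j = hq \<and> l = hp then chi hp hq else 0) else 0)"
  using hpq idx by (auto simp: hv_def co_mk)

lemma co_hv_zero: "\<not> (i = 0 \<and> k = 0 \<and> (j = hp \<and> l = hq \<or> j = hq \<and> l = hp)) \<Longrightarrow> co hv i k j l = 0"
proof -
  assume a: "\<not> (i = 0 \<and> k = 0 \<and> (j = hp \<and> l = hq \<or> j = hq \<and> l = hp))"
  show ?thesis
  proof (cases "i = 0 \<and> k = 0")
    case True
    then have "\<not> (j = hp \<and> l = hq)" "\<not> (j = hq \<and> l = hp)" using a by blast+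
    then show ?thesis unfolding co_hv by (simp only: if_False add_0 if_cancel)
  next
    case False
    then show ?thesis unfolding co_hv by (simp only: if_False)
  qed
qed

lemma hv_sym: "chi j l * co hv i k l j = co hv i k j l"
proof (cases "i = 0 \<and> k = 0")
  case True
  have 1: "chi j l * (if l = hp \<and> j = hq then 1 else 0) = (if j = hq \<and> l = hp then chi hp hq else 0)"
    by (cases "l = hp \<and> j = hq") (simp_all add: chi_sym[of hq hp] del: chi_self)
  have 2: "chi j l * (if l = hq \<and> j = hp then chi hp hq else 0) = (if j = hp \<and> l = hq then 1 else 0)"
    by (cases "l = hq \<and> j = hp") simp_all
  show ?thesis unfolding co_hv using True by (simp only: simp_thms if_True distrib_left 1 2 add.commute)
next
  case False
  then show ?thesis unfolding co_hv by (simp only: if_False mult_zero_right)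
qed

lemma hv_T: "hv \<in> T 1 1"
proof -
  have c: "chi 0 0 = 1" unfolding chi_def using idx by simp
  moreover have "chi j l * co hv i k l j = 1 * co hv i k j l" for i k j l
    by (simp only: hv_sym mult_1_left)
  moreover have "tr (co hv) i l = 0" for i l
    unfolding tr_def
  proof (rule sum.neutral, rule ballI)
    fix p
    have "co hv i p p l = 0" by (rule co_hv_zero) (use hpq in metis)
    then show "s p * co hv i p p l = 0" by (simp only: mult_zero_right)
  qed
  moreover have "chi i k * co hv k i j l = 1 * co hv i k j l" for i k j l
  proof (cases "i = 0 \<and> k = 0")
    case True
    then have "i = 0" "k = 0" by blast+
    then show ?thesis by (simp only: c)
  next
    case False
    then have "co hv i k j l = 0" "co hv k i j l = 0" by (auto intro: co_hv_zero)
    then show ?thesis by (simp only: mult_zero_right)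
  qed
  ultimately show ?thesis unfolding T_def using hv_F2 by blast
qed

lemma hv_nz: "co hv 0 0 hp hq \<noteq> 0"
proof (cases "hp = hq")
  case True
  then have "n = 0" using hpq(6) by (rule_tac ccontr) simp
  then show ?thesis unfolding co_hv using hpq(8) True by simp
next
  case False
  then show ?thesis by (simp add: co_hv)
qed

lemma hv_weight: "a < d \<Longrightarrow> D (a, a) hv = tscale (of_int (wt a 0 0 hp hq)) hv"
proof (rule F2_eqI)
  assume a: "a < d"
  show "D (a, a) hv \<in> F2" using a by (intro D_F2 hv_F2) (simp add: I2_def)
  show "tscale (of_int (wt a 0 0 hp hq)) hv \<in> F2" by (intro tv.subspace_scale[OF subspace_F2] hv_F2)
  have "wt a 0 0 hq hp = wt a 0 0 hp hq" by (simp add: wt_def)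
  then show "co (D (a, a) hv) i k j l = co (tscale (of_int (wt a 0 0 hp hq)) hv) i k j l" for i k j l
    using a hv_F2 by (auto simp: co_D I2_def opf_diag co_hv)
qed

lemma cartan_weight_eq: "cartan_weight m n H = 2 * H $$ (0, 0) - H $$ (hp, hp) - H $$ (hq, hq)"
  unfolding cartan_weight_def eps_def delta_def hp_def hq_def using mn by (auto simp: numeral_2_eq_2)

text \<open>Only the matrix unit \<open>(hp, hq)\<close> could act nontrivially. It produces the
  lower pair \<open>hq hq\<close> from both terms of \<open>hv\<close>, and these contributions
  cancel because \<open>hq\<close> is odd.\<close>

lemma hv_singular: assumes "a < b" "b < d" shows "D (a, b) hv = 0"
proof -
  have I: "(a, b) \<in> I2" using assms by (simp add: I2_def)
  have "opf a b (co hv) i k j l = 0" for i k j l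
  proof -
    have 1: "co hv b k j l = 0" "co hv i b j l = 0" for i k j l using assms by (simp_all add: co_hv)
    have "X a b i * X a b k * X a b a * ((if j = b then co hv i k a l else 0) + (if l = b then X a b j * co hv i k j a else 0)) = 0"
    proof (cases "a = hp \<and> b = hq \<and> n \<noteq> 0")
      case True
      have s: "X a b b = - chi hp hq" using True hpq by (simp add: X_def)
      have ne: "hp \<noteq> hq" using hpq True by simp
      have "(if j = b then co hv i k a l else 0) + (if l = b then X a b j * co hv i k j a else 0) = 0"
        using True ne s by (auto simp: co_hv)
      then show ?thesis by simp
    next
      case False
      have "b \<le> hq" using assms by (simp add: hq_def)
      then have "a \<noteq> hq" "a = hp \<Longrightarrow> b \<noteq> hq \<or> n = 0" using assms False by auto
      moreover have "a = hp \<Longrightarrow> n \<noteq> 0" using hpq(5) \<open>a \<noteq> hq\<close> by metis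
      moreover have "b = hq" if "a = hp"
      proof -
        have "n \<noteq> 0" using that \<open>a = hp \<Longrightarrow> n \<noteq> 0\<close> by simp
        then have "hp = d - 2" "hq = d - 1" unfolding hp_def hq_def by simp_all
        then show ?thesis using assms \<open>b \<le> hq\<close> mn that by linarith
      qed
      ultimately have "a \<noteq> hp" "a \<noteq> hq" by blast+
      then show ?thesis by (auto simp: co_hv)
    qed
    then show ?thesis unfolding opf_def 1 by (simp add: algebra_simps split: if_splits)
  qed
  then show ?thesis
    using I hv_F2 by (intro F2_eqI) (auto simp: co_D D_F2 tv.subspace_0[OF subspace_F2])
qed

lemma act_diag: "diagonal_mat H \<Longrightarrow> H \<in> sl m n \<Longrightarrow> act m n H t = (\<Sum>p<d. tscale (H $$ (p, p)) (D (p, p) t))"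
proof -
  assume H: "diagonal_mat H" "H \<in> sl m n"
  have "act m n H t = (\<Sum>p<d. \<Sum>q<d. if q = p then tscale (H $$ (p, p)) (D (p, p) t) else 0)"
    unfolding act_D sum_I2 by (intro sum.cong refl) (use H in \<open>auto simp: diagonal_mat_def sl_def\<close>)
  then show ?thesis by simp
qed

lemma T11_highest_weight: "has_highest_weight m n (cartan_weight m n) (T 1 1)"
  unfolding has_highest_weight_def
proof (intro bexI[OF _ hv_T] conjI ballI impI)
  show "hv \<noteq> 0" using hv_nz by auto
  fix H assume H: "H \<in> sl m n" "diagonal_mat H"
  have "act m n H hv = tscale (\<Sum>p<d. H $$ (p, p) * of_int (wt p 0 0 hp hq)) hv"
    unfolding act_diag[OF H(2,1)] tv.scale_sum_left by (intro sum.cong refl) (simp add: hv_weight)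
  also have "(\<Sum>p<d. H $$ (p, p) * of_int (wt p 0 0 hp hq))
     = (\<Sum>p<d. (if p = 0 then 2 * H $$ (0, 0) else 0) - (if p = hp then H $$ (hp, hp) else 0) - (if p = hq then H $$ (hq, hq) else 0))"
    by (intro sum.cong refl) (auto simp: wt_def)
  also have "\<dots> = cartan_weight m n H"
    using hpq idx by (simp add: sum_subtractf cartan_weight_eq)
  finally show "act m n H hv = tscale (cartan_weight m n H) hv" .
next
  fix A assume A: "A \<in> sl m n" "\<forall>i<m + n. \<forall>j\<le>i. A $$ (i, j) = 0"
  show "act m n A hv = 0"
    unfolding act_D
  proof (rule sum.neutral, rule ballI)
    fix x assume "x \<in> I2"
    then obtain a b where x: "x = (a, b)" "a < d" "b < d" by (auto simp: I2_def)
    show "tscale (A $$ x) (D x hv) = 0"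
      using A x hv_singular[of a b] by (cases "a < b") auto
  qed
qed

text \<open>For positive \<open>n\<close> the weight space has two coordinates, and annihilation by
  the matrix unit \<open>(hp, hq)\<close> fixes their ratio; for \<open>n = 0\<close> there is only
  one. So the highest weight vector of \<open>M\<close> is a multiple of \<open>hv\<close>, and two
  simple modules that meet are equal.\<close>

lemma highest_weight_T11:
  assumes M: "simple_submodule2 m n M" "has_highest_weight m n (cartan_weight m n) M"
  shows "M = T 1 1"
proof -
  obtain v where v: "v \<in> M" "v \<noteq> 0" and w: "\<And>H. H \<in> sl m n \<Longrightarrow> diagonal_mat H \<Longrightarrow> act m n H v = tscale (cartan_weight m n H) v"
    and sing: "\<And>A. A \<in> sl m n \<Longrightarrow> (\<forall>i<m + n. \<forall>j\<le>i. A $$ (i, j) = 0) \<Longrightarrow> act m n A v = 0"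
    using M(2) unfolding has_highest_weight_def by blast
  have Ms: "simp_mod M" "M \<subseteq> tens m n 2" using M(1) by (simp_all add: simple_submodule2_iff)
  then have vt: "v \<in> tens m n 2" "v \<in> F2" "v \<in> TT" using v tens2_F2 tens_subset_TT by blast+
  have wv: "D (a, a) v = tscale (of_int (wt a 0 0 hp hq)) v" if a: "a < d" for a
  proof -
    have aI: "(a, a) \<in> I2" using a by (simp add: I2_def)
    have "diagonal_mat (emat (a, a))" by (simp add: diagonal_mat_def emat_def)
    then have "D (a, a) v = tscale (cartan_weight m n (emat (a, a))) v"
      using w[OF emat_sl[OF aI]] act_emat[OF aI vt(3)] by simp
    moreover have "cartan_weight m n (emat (a, a)) = of_int (wt a 0 0 hp hq)"
      unfolding cartan_weight_eq using hpq idx by (auto simp: emat_def wt_def)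
    ultimately show ?thesis by simp
  qed
  have supp: "i = 0 \<and> k = 0 \<and> (j = hp \<and> l = hq \<or> j = hq \<and> l = hp)" if nz: "co v i k j l \<noteq> 0" for i k j l
  proof -
    have r: "i < d" "k < d" "j < d" "l < d" using nz co_outside[OF vt(2)] by blast+
    have "wt a i k j l = wt a 0 0 hp hq" if a: "a < d" for a
    proof -
      have "co (D (a, a) v) i k j l = of_int (wt a i k j l) * co v i k j l"
        using a vt(2) by (simp add: co_D opf_diag I2_def)
      then have "of_int (wt a 0 0 hp hq) * co v i k j l = of_int (wt a i k j l) * co v i k j l"
        unfolding wv[OF a] co_scale .
      then show ?thesis using nz by (simp only: mult_cancel_right of_int_eq_iff simp_thms)
    qed
    then have "(i = 0 \<and> k = 0 \<or> i = 0 \<and> k = 0) \<and> (j = hp \<and> l = hq \<or> j = hq \<and> l = hp)"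
      by (intro wt_type2) (use r hpq idx in auto)
    then show ?thesis by blast
  qed
  have sy: "co v 0 0 hp hq = chi hp hq * co v 0 0 hq hp"
  proof (cases "n = 0")
    case True then show ?thesis using hpq by simp
  next
    case False
    have I: "(hp, hq) \<in> I2" using hpq by (simp add: I2_def)
    have "D (hp, hq) v = 0"
      using sing[OF emat_sl[OF I]] act_emat[OF I vt(3)] hpq(6)[OF False] hpq by (auto simp: emat_def)
    then have "opf hp hq (co v) 0 0 hq hq = 0" using co_D[OF I vt(2), of 0 0 hq hq] by simp
    then have "- (X hp hq 0 * X hp hq 0 * X hp hq hp * co v 0 0 hp hq) - X hp hq 0 * X hp hq 0 * X hp hq hq * X hp hq hp * co v 0 0 hq hp = 0"
      using hpq by (simp add: opf_def)
    then have "co v 0 0 hp hq + X hp hq hq * co v 0 0 hq hp = 0" by (rule low_zero[OF _ X_nz X_nz X_nz])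
    moreover have "X hp hq hq = - chi hp hq" using hpq False by (simp add: X_def)
    ultimately show ?thesis by simp
  qed
  define c where "c = co v 0 0 hp hq / co hv 0 0 hp hq"
  have vc: "v = tscale c hv"
  proof (rule F2_eqI[OF vt(2)])
    show "tscale c hv \<in> F2" by (intro tv.subspace_scale[OF subspace_F2] hv_F2)
    fix i k j l
    have e1: "co v 0 0 hp hq = c * co hv 0 0 hp hq" using hv_nz by (simp add: c_def)
    have "chi hp hq * co hv 0 0 hq hp = co hv 0 0 hp hq" by (rule hv_sym)
    then have "chi hp hq * co v 0 0 hq hp = chi hp hq * (c * co hv 0 0 hq hp)"
      using e1 sy by (simp add: mult_ac)
    then have e2: "co v 0 0 hq hp = c * co hv 0 0 hq hp" by simp
    show "co v i k j l = co (tscale c hv) i k j l"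
    proof (cases "i = 0 \<and> k = 0 \<and> (j = hp \<and> l = hq \<or> j = hq \<and> l = hp)")
      case True then show ?thesis using e1 e2 by auto
    next
      case False
      then have "co v i k j l = 0" using supp by blast
      moreover have "co hv i k j l = 0" by (rule co_hv_zero[OF False])
      ultimately show ?thesis by (simp only: co_scale mult_zero_right)
    qed
  qed
  have "v \<in> T 1 1" unfolding vc by (intro tv.subspace_scale[OF subspace_T] hv_T)
  then have "M \<inter> T 1 1 \<noteq> {0}" using v by blast
  moreover have "gmod (M \<inter> T 1 1)" using Ms T_gmod by (intro gmod_Int) (simp_all add: simp_mod_def)
  ultimately have "M \<inter> T 1 1 = M" "M \<inter> T 1 1 = T 1 1"
    using Ms(1) T11_simple unfolding simp_mod_def by (metis inf_le1, metis inf_le2)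
  then show ?thesis by blast
qed

lemma cartan_square_eq: "cartan_square m n = T 1 1"
  unfolding cartan_square_def
  by (rule the_equality) (use T11_highest_weight T11_simple T_tens2 highest_weight_T11 in \<open>auto simp: simple_submodule2_iff\<close>)

section \<open>The complement of the Cartan square and the Cartan product\<close>

definition W :: "tensor set" where "W = {t \<in> tens m n 2. pj 1 1 t = 0}"

lemma pj11: "y \<in> F2 \<Longrightarrow> pj 1 1 y \<in> T 1 1" "x \<in> F2 \<Longrightarrow> y \<in> F2 \<Longrightarrow> pj 1 1 (x + y) = pj 1 1 x + pj 1 1 y"
  "x \<in> F2 \<Longrightarrow> pj 1 1 (tscale c x) = tscale c (pj 1 1 x)" "t \<in> T 1 1 \<Longrightarrow> pj 1 1 t = t"
  "i \<in> I2 \<Longrightarrow> y \<in> F2 \<Longrightarrow> pj 1 1 (D i y) = D i (pj 1 1 y)"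
  by (simp_all add: pj_T pj_add pj_scale pj_id pj_D)

lemma pj11_zero: "pj 1 1 0 = 0"
  using pj11(4)[OF tv.subspace_0[OF subspace_T]] .

lemma pj11_diff: "x \<in> F2 \<Longrightarrow> y \<in> F2 \<Longrightarrow> pj 1 1 (x - y) = pj 1 1 x - pj 1 1 y"
proof -
  assume xy: "x \<in> F2" "y \<in> F2"
  have "pj 1 1 ((x - y) + y) = pj 1 1 (x - y) + pj 1 1 y"
    using xy by (intro pj11(2) tv.subspace_diff[OF subspace_F2])
  then show ?thesis by simp
qed

lemma W_gmod: "gmod W"
  unfolding gmod_def
proof (intro conjI ballI)
  have F: "t \<in> F2" if "t \<in> tens m n 2" for t using that tens2_F2 by blast
  show "tv.subspace W"
    unfolding tv.subspace_def W_def
    using tv.subspace_0[OF subspace_tens] tv.subspace_add[OF subspace_tens] tv.subspace_scale[OF subspace_tens] F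
    by (auto simp: pj11_zero pj11)
  fix x t assume "x \<in> I2" "t \<in> W"
  then show "D x t \<in> W" using F by (auto simp: W_def D_tens pj11(5) tlin_0[OF tlin_D])
qed

lemma W_T11: "W \<inter> T 1 1 = {0}"
  using gmod_0[OF W_gmod] gmod_0[OF T_gmod] by (auto simp: W_def pj11)

lemma diff_pj_W: "t \<in> tens m n 2 \<Longrightarrow> t - pj 1 1 t \<in> W"
proof -
  assume t: "t \<in> tens m n 2"
  have F: "t \<in> F2" using t tens2_F2 by blast
  have p: "pj 1 1 t \<in> T 1 1" using pj11(1)[OF F] .
  have "pj 1 1 (t - pj 1 1 t) = pj 1 1 t - pj 1 1 (pj 1 1 t)" using F p T_F2 by (intro pj11_diff)
  then have "pj 1 1 (t - pj 1 1 t) = 0" using pj11(4)[OF p] by simp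
  then show ?thesis using t p T_tens2[of 1 1] tv.subspace_diff[OF subspace_tens] by (auto simp: W_def)
qed

text \<open>A simple submodule other than \<open>T 1 1\<close> lies in \<open>W\<close> by
  \<open>hom_to_T11\<close>. Conversely, complete reducibility shows that these submodules span
  \<open>W\<close>.\<close>

lemma cartan_complement_eq: "cartan_complement m n = W"
proof
  let ?U = "\<Union>{M. simple_submodule2 m n M \<and> M \<noteq> T 1 1}"
  have CC: "cartan_complement m n = tv.span ?U" by (simp add: cartan_complement_def cartan_square_eq)
  have LW: "L \<subseteq> W" if L: "simp_mod L" "L \<subseteq> tens m n 2" "L \<noteq> T 1 1" for L
  proof -
    have F: "L \<subseteq> F2" using L tens2_F2 by blast
    have "\<exists>y\<in>T 1 1. x - y \<in> W" if "x \<in> L" for x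
      using that L F diff_pj_W[of x] pj11(1)[of x] by blast
    then show ?thesis using hom_to_T11[OF L(1) F W_gmod W_T11] L(3) by blast
  qed
  have Ws: "tv.subspace W" using W_gmod by (simp add: gmod_def)
  have "?U \<subseteq> W" using LW by (intro Union_least) (auto simp: simple_submodule2_iff)
  then show "cartan_complement m n \<subseteq> W" unfolding CC by (rule tv.span_minimal[OF _ Ws])
  \<comment> \<open>The tensors that are congruent to their projection modulo the span of the other
    simple submodules. All simple submodules lie in it, hence the socle does.\<close>
  let ?V = "{t \<in> F2. t - pj 1 1 t \<in> tv.span ?U}"
  have "tv.subspace ?V"
    unfolding tv.subspace_def
  proof (intro conjI ballI allI)
    show "0 \<in> ?V" by (simp add: pj11_zero tv.subspace_0[OF subspace_F2] tv.span_zero)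
    fix x y assume x: "x \<in> ?V" and y: "y \<in> ?V"
    have "(x + y) - pj 1 1 (x + y) = (x - pj 1 1 x) + (y - pj 1 1 y)" using x y by (simp add: pj11)
    moreover have "(x - pj 1 1 x) + (y - pj 1 1 y) \<in> tv.span ?U" using x y by (intro tv.span_add) blast+
    moreover have "x + y \<in> F2" using x y by (intro tv.subspace_add[OF subspace_F2]) blast+
    ultimately show "x + y \<in> ?V" by (simp only: mem_Collect_eq simp_thms)
  next
    fix c x assume x: "x \<in> ?V"
    have "tscale c x - pj 1 1 (tscale c x) = tscale c (x - pj 1 1 x)"
      using x by (simp add: pj11 tv.scale_right_diff_distrib)
    moreover have "tscale c (x - pj 1 1 x) \<in> tv.span ?U" using x by (intro tv.span_scale) blast
    moreover have "tscale c x \<in> F2" using x by (intro tv.subspace_scale[OF subspace_F2]) blast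
    ultimately show "tscale c x \<in> ?V" by (simp only: mem_Collect_eq simp_thms)
  qed
  moreover have "\<Union>{L. simp_mod L \<and> L \<subseteq> tens m n 2} \<subseteq> ?V"
  proof
    fix u assume "u \<in> \<Union>{L. simp_mod L \<and> L \<subseteq> tens m n 2}"
    then obtain L where L: "u \<in> L" "simp_mod L" "L \<subseteq> tens m n 2" by (elim UnionE CollectE conjE)
    have F: "u \<in> F2" using L tens2_F2 by blast
    show "u \<in> ?V"
    proof (cases "L = T 1 1")
      case True then show ?thesis using L F pj11(4)[of u] by (simp add: tv.span_zero)
    next
      case False
      then have "u \<in> W" using LW L by blast
      then have "pj 1 1 u = 0" by (simp add: W_def)
      moreover have "L \<in> {M. simple_submodule2 m n M \<and> M \<noteq> T 1 1}" using L False by (simp add: simple_submodule2_iff)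
      then have "u \<in> ?U" using L(1) by (rule UnionI)
      then have "u \<in> tv.span ?U" by (rule tv.span_base)
      ultimately show ?thesis using F by simp
    qed
  qed
  ultimately have "Soc \<subseteq> ?V" unfolding Soc_def by (intro tv.span_minimal)
  then have "tens m n 2 \<subseteq> ?V" using tens2_semisimple by blast
  then show "W \<subseteq> cartan_complement m n" unfolding CC by (auto simp: W_def)
qed

lemma emb_mult_tens2: "A \<in> sl m n \<Longrightarrow> A' \<in> sl m n \<Longrightarrow> emb m n A * emb m n A' \<in> tens m n 2"
  unfolding tens_def by (rule tv.span_base) (auto intro!: exI[of _ "[A, A']"])

lemma cartan_product_eq:
  assumes "A \<in> sl m n" "A' \<in> sl m n"
  shows "cartan_product m n A A' = pj 1 1 (emb m n A * emb m n A')"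
  unfolding cartan_product_def cartan_square_eq cartan_complement_eq
proof (rule the_equality)
  have t: "emb m n A * emb m n A' \<in> tens m n 2" using assms by (rule emb_mult_tens2)
  then have F: "emb m n A * emb m n A' \<in> F2" using tens2_F2 by blast
  show "pj 1 1 (emb m n A * emb m n A') \<in> T 1 1 \<and> emb m n A * emb m n A' - pj 1 1 (emb m n A * emb m n A') \<in> W"
    using pj11(1)[OF F] diff_pj_W[OF t] by blast
  fix u assume u: "u \<in> T 1 1 \<and> emb m n A * emb m n A' - u \<in> W"
  then have "pj 1 1 (emb m n A * emb m n A' - u) = 0" by (simp add: W_def)
  moreover have "pj 1 1 (emb m n A * emb m n A' - u) = pj 1 1 (emb m n A * emb m n A') - pj 1 1 u"
    using u F T_F2 by (intro pj11_diff) auto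
  ultimately show "u = pj 1 1 (emb m n A * emb m n A')" using u pj11(4)[of u] by simp
qed

text \<open>Since \<open>T 1 1\<close> occurs once, every other simple submodule lies in any
  invariant complement \<open>P\<close>, so \<open>W\<close> is contained in \<open>P\<close>;
  elements of \<open>P\<close> then have projection zero. This will identify the degree two part of
  the graded ideal.\<close>

lemma complement_unique:
  assumes P: "gmod P" "P \<subseteq> tens m n 2" "P \<inter> T 1 1 = {0}"
    and sum: "\<And>t. t \<in> tens m n 2 \<Longrightarrow> \<exists>y\<in>T 1 1. t - y \<in> P"
  shows "P = W"
proof -
  have Ps: "tv.subspace P" using P by (simp add: gmod_def)
  have "L \<subseteq> P" if L: "simp_mod L" "L \<subseteq> tens m n 2" "L \<noteq> T 1 1" for L
    using hom_to_T11[OF L(1) _ P(1,3)] sum L tens2_F2 by blast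
  then have "\<Union>{M. simple_submodule2 m n M \<and> M \<noteq> T 1 1} \<subseteq> P"
    by (intro Union_least) (auto simp: simple_submodule2_iff)
  then have "tv.span (\<Union>{M. simple_submodule2 m n M \<and> M \<noteq> T 1 1}) \<subseteq> P" by (rule tv.span_minimal[OF _ Ps])
  then have WP: "W \<subseteq> P" unfolding cartan_complement_eq[symmetric] cartan_complement_def cartan_square_eq .
  have "x \<in> W" if x: "x \<in> P" for x
  proof -
    have t: "x \<in> tens m n 2" "x \<in> F2" using x P tens2_F2 by blast+
    have "x - pj 1 1 x \<in> P" using diff_pj_W[OF t(1)] WP by blast
    then have "x - (x - pj 1 1 x) \<in> P" by (rule tv.subspace_diff[OF Ps x])
    then have "pj 1 1 x \<in> P \<inter> T 1 1" using pj11(1)[OF t(2)] by simp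
    then show ?thesis using P(3) t(1) by (simp add: W_def)
  qed
  then show ?thesis using WP by blast
qed

end

section \<open>Ideals of the tensor algebra\<close>

context sl_super
begin

abbreviation TA :: "tensor ring" where "TA \<equiv> tensor_alg m n"

lemma TA_simps: "x \<otimes>\<^bsub>TA\<^esub> y = x * y" "x \<oplus>\<^bsub>TA\<^esub> y = x + y" "\<one>\<^bsub>TA\<^esub> = 1" "\<zero>\<^bsub>TA\<^esub> = 0" "carrier TA = TT"
  by (simp_all add: TT_carrier) (simp_all add: tensor_alg_def)

definition tideal :: "tensor set \<Rightarrow> bool" where
  "tideal I \<longleftrightarrow> I \<subseteq> TT \<and> tv.subspace I \<and> (\<forall>a\<in>TT. \<forall>t\<in>I. a * t \<in> I \<and> t * a \<in> I)"

lemma scalar_TT: "tscale c 1 \<in> TT"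
  using tv.subspace_scale[OF subspace_TT one_TT] .

lemma tideal_ideal: assumes "ideal I TA" shows "tideal I"
proof -
  interpret ideal I TA by (rule assms)
  have mult: "a * t \<in> I \<and> t * a \<in> I" if "a \<in> TT" "t \<in> I" for a t
    using I_l_closed[of t a] I_r_closed[of t a] that by (simp add: TA_simps)
  have "tscale c t \<in> I" if "t \<in> I" for c t
    using mult[OF scalar_TT that, of c] by (simp add: tscale_mult_left)
  then have "tv.subspace I"
    unfolding tv.subspace_def
    using additive_subgroup.zero_closed[OF is_additive_subgroup] additive_subgroup.a_closed[OF is_additive_subgroup]
    by (simp add: TA_simps)
  then show ?thesis using mult a_subset by (simp add: tideal_def TA_simps)
qed

lemma coset_mem: assumes "tideal I" shows "u \<in> I +>\<^bsub>TA\<^esub> t \<longleftrightarrow> u - t \<in> I"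
proof -
  have "u \<in> I +>\<^bsub>TA\<^esub> t \<longleftrightarrow> (\<exists>h\<in>I. u = h + t)"
    by (simp add: a_r_coset_def' TA_simps)
  then show ?thesis by (metis add_diff_cancel_right' diff_add_cancel)
qed

lemma coset_eq: assumes "tideal I" shows "I +>\<^bsub>TA\<^esub> t = I +>\<^bsub>TA\<^esub> u \<longleftrightarrow> t - u \<in> I"
proof
  have s: "tv.subspace I" using assms by (simp add: tideal_def)
  assume "I +>\<^bsub>TA\<^esub> t = I +>\<^bsub>TA\<^esub> u"
  moreover have "t \<in> I +>\<^bsub>TA\<^esub> t" using coset_mem[OF assms] tv.subspace_0[OF s] by simp
  ultimately show "t - u \<in> I" using coset_mem[OF assms] by simp
next
  have s: "tv.subspace I" using assms by (simp add: tideal_def)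
  assume tu: "t - u \<in> I"
  have "v - t \<in> I \<longleftrightarrow> v - u \<in> I" for v
  proof -
    have "v - u = (v - t) + (t - u)" "v - t = (v - u) - (t - u)" by simp_all
    then show ?thesis using tu tv.subspace_add[OF s] tv.subspace_diff[OF s] by metis
  qed
  then show "I +>\<^bsub>TA\<^esub> t = I +>\<^bsub>TA\<^esub> u" using coset_mem[OF assms] by blast
qed

lemma emb_hom_expand:
  assumes "A \<in> sl_hom m n p" "A' \<in> sl_hom m n q"
  shows "emb m n A * emb m n A' - tscale ((-1) ^ (p * q)) (emb m n A' * emb m n A)
    = (\<Sum>x\<in>I2. \<Sum>y\<in>I2. tscale (A $$ x * A' $$ y) (e x * e y - tscale (psg x y) (e y * e x)))"
proof -
  have sl: "A \<in> sl m n" "A' \<in> sl m n" using assms by (simp_all add: sl_hom_def)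
  have ps: "A $$ x * A' $$ y * psg x y = A $$ x * A' $$ y * (-1) ^ (p * q)" if "x \<in> I2" "y \<in> I2" for x y
  proof (cases "lpar m x = p \<and> lpar m y = q")
    case True then show ?thesis using psg_lpar[of x y] by auto
  next
    case False
    then have "A $$ x = 0 \<or> A' $$ y = 0"
      using hom_part_entry_zero[OF assms(1), of "fst x" "snd x"] hom_part_entry_zero[OF assms(2), of "fst y" "snd y"] that
      by (auto simp: I2_def)
    then show ?thesis by auto
  qed
  have "tscale ((-1) ^ (p * q)) (emb m n A' * emb m n A) = (\<Sum>x\<in>I2. \<Sum>y\<in>I2. tscale ((-1) ^ (p * q) * (A $$ x * A' $$ y)) (e y * e x))"
    unfolding emb_sl[OF sl(1)] emb_sl[OF sl(2)]
    by (simp add: sum_distrib_left sum_distrib_right tscale_mult_left tscale_mult_right tv.scale_sum_right mult_ac)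
  also have "\<dots> = (\<Sum>x\<in>I2. \<Sum>y\<in>I2. tscale (A $$ x * A' $$ y * psg x y) (e y * e x))"
  proof (intro sum.cong refl)
    fix x y assume "x \<in> I2" "y \<in> I2"
    then have "(-1) ^ (p * q) * (A $$ x * A' $$ y) = A $$ x * A' $$ y * psg x y"
      by (subst ps) (simp_all only: mult.commute)
    then show "tscale ((-1) ^ (p * q) * (A $$ x * A' $$ y)) (e y * e x) = tscale (A $$ x * A' $$ y * psg x y) (e y * e x)"
      by (simp only:)
  qed
  finally have 1: "tscale ((-1) ^ (p * q)) (emb m n A' * emb m n A)
     = (\<Sum>x\<in>I2. \<Sum>y\<in>I2. tscale (A $$ x * A' $$ y * psg x y) (e y * e x))" .
  have 2: "emb m n A * emb m n A' = (\<Sum>x\<in>I2. \<Sum>y\<in>I2. tscale (A $$ x * A' $$ y) (e x * e y))"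
    unfolding emb_sl[OF sl(1)] emb_sl[OF sl(2)]
    by (simp add: sum_distrib_left sum_distrib_right tscale_mult_left tscale_mult_right tv.scale_sum_right mult_ac)
      (rule sum.swap)
  show ?thesis unfolding 1 2 sum_subtractf[symmetric] by (simp add: tv.scale_right_diff_distrib)
qed

lemma sl_hom_emat: "x \<in> I2 \<Longrightarrow> emat x \<in> sl_hom m n (lpar m x)"
proof -
  assume x: "x \<in> I2"
  have "hom_part m n (lpar m x) (emat x) = emat x"
    by (rule eq_matI) (auto simp: hom_part_def emat_def lpar_def)
  then show ?thesis using emat_sl[OF x] by (simp add: sl_hom_def)
qed

lemma emb_TT: "A \<in> sl m n \<Longrightarrow> emb m n A \<in> TT"
proof -
  assume A: "A \<in> sl m n"
  show ?thesis unfolding emb_sl[OF A]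
    by (intro tv.subspace_sum[OF subspace_TT] tv.subspace_scale[OF subspace_TT] e_TT)
qed

text \<open>The identity drops out of superbrackets because diagonal positions are even.\<close>

lemma sbracket_sl: assumes "x \<in> I2" "y \<in> I2" shows "emb m n (sbracket m n (emat x) (emat y)) = br x y"
proof -
  have em: "emat z $$ (i, j) = unit_mat m n z $$ (i, j) - (if fst z = snd z \<and> i = j then s (fst z) / N else 0)"
    if "i < d" "j < d" for z i j using that by (simp add: emat_def unit_mat_def)
  have par0: "(-1::complex) ^ (lpar m (i, i) * q) = 1" "(-1::complex) ^ (q * lpar m (i, i)) = 1" for i q by (simp_all add: lpar_def)
  have "sbracket m n (emat x) (emat y) = sbracket m n (unit_mat m n x) (unit_mat m n y)"
  proof (rule eq_matI)
    fix i j assume "i < dim_row (sbracket m n (unit_mat m n x) (unit_mat m n y))" "j < dim_col (sbracket m n (unit_mat m n x) (unit_mat m n y))"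
    then have r: "i < d" "j < d" by (simp_all add: sbracket_def)
    let ?a = "if fst x = snd x then s (fst x) / N else 0" and ?b = "if fst y = snd y then s (fst y) / N else 0"
    let ?u = "\<lambda>z i j. unit_mat m n z $$ (i, j)"
    have t: "emat x $$ (i,k) * emat y $$ (k,j) - (-1) ^ (lpar m (i,k) * lpar m (k,j)) * (emat y $$ (i,k) * emat x $$ (k,j))
      = (?u x i k * ?u y k j - (-1) ^ (lpar m (i,k) * lpar m (k,j)) * (?u y i k * ?u x k j))
       - (if k = j then ?u x i j * ?b else 0) + (if k = i then ?u x i j * ?b else 0)
       - (if k = i then ?a * ?u y i j else 0) + (if k = j then ?a * ?u y i j else 0)" if k: "k < d" for k
      unfolding em[OF r(1) k] em[OF k r(2)]
      by (cases "k = i"; cases "k = j") (auto simp: par0 algebra_simps)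
    show "sbracket m n (emat x) (emat y) $$ (i, j) = sbracket m n (unit_mat m n x) (unit_mat m n y) $$ (i, j)"
    proof -
      have "sbracket m n (emat x) (emat y) $$ (i, j) = (\<Sum>k<d. (?u x i k * ?u y k j - (-1) ^ (lpar m (i,k) * lpar m (k,j)) * (?u y i k * ?u x k j))
       - (if k = j then ?u x i j * ?b else 0) + (if k = i then ?u x i j * ?b else 0)
       - (if k = i then ?a * ?u y i j else 0) + (if k = j then ?a * ?u y i j else 0))"
        unfolding sbracket_def using r by (simp only: index_mat case_prod_conv) (intro sum.cong refl t, simp)
      also have "\<dots> = (\<Sum>k<d. ?u x i k * ?u y k j - (-1) ^ (lpar m (i,k) * lpar m (k,j)) * (?u y i k * ?u x k j))"
        unfolding sum.distrib sum_subtractf[of "\<lambda>k. _ k - _ k + _ k"] sum_subtractf[of _ "\<lambda>k. if k = _ then _ else _"] using r by simp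
      finally show ?thesis unfolding sbracket_def using r by simp
    qed
  qed (simp_all add: sbracket_def)
  then show ?thesis by (simp add: emb_bracket_units[OF assms] br_brl)
qed

lemma env_rel_TT: "env_rel m n \<subseteq> TT"
proof
  fix t assume "t \<in> env_rel m n"
  then obtain A A' p q where A: "A \<in> sl_hom m n p" "A' \<in> sl_hom m n q"
    and t: "t = emb m n A * emb m n A' - tscale ((-1) ^ (p * q)) (emb m n A' * emb m n A) - emb m n (sbracket m n A A')"
    unfolding env_rel_def by blast
  have sl: "A \<in> sl m n" "A' \<in> sl m n" using A by (simp_all add: sl_hom_def)
  have "emb m n (sbracket m n A A') \<in> TT"
  proof -

    have "supertrace m n (sbracket m n A A') = (\<Sum>i<d. \<Sum>k<d. s i * (A $$ (i,k) * A' $$ (k,i) - psg (i,k) (k,i) * (A' $$ (i,k) * A $$ (k,i))))"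
      unfolding supertrace_s sbracket_def by (intro sum.cong refl) (simp add: psg_lpar sum_distrib_left)
    also have "\<dots> = (\<Sum>i<d. \<Sum>k<d. s i * (A $$ (i,k) * A' $$ (k,i))) - (\<Sum>i<d. \<Sum>k<d. s k * (A' $$ (i,k) * A $$ (k,i)))"
      unfolding sum_subtractf[symmetric]
      by (intro sum.cong refl) (simp add: right_diff_distrib psg_def X_def s_def chi_def)
    also have "(\<Sum>i<d. \<Sum>k<d. s k * (A' $$ (i,k) * A $$ (k,i))) = (\<Sum>i<d. \<Sum>k<d. s i * (A $$ (i,k) * A' $$ (k,i)))"
      by (subst sum.swap) (simp add: mult_ac)
    finally have "sbracket m n A A' \<in> sl m n" by (simp add: sl_def sbracket_def)
    then show ?thesis by (rule emb_TT)
  qed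
  moreover have "emb m n A * emb m n A' \<in> TT" "emb m n A' * emb m n A \<in> TT"
    using TT_mult emb_TT sl by blast+
  ultimately show "t \<in> TT" unfolding t
    by (intro tv.subspace_diff[OF subspace_TT] tv.subspace_scale[OF subspace_TT])
qed

section \<open>The enveloping algebra as a quotient of the tensor algebra\<close>

definition EI :: "tensor set" where "EI = env_ideal m n"

lemma EI_ideal: "ideal EI TA"
  unfolding EI_def env_ideal_def
  by (rule ring.genideal_ideal[OF tensor_alg_ring]) (simp add: TA_simps env_rel_TT)

lemma EI: "tideal EI" by (rule tideal_ideal[OF EI_ideal])

lemma EI_s: "tv.subspace EI" and EI_mult: "a \<in> TT \<Longrightarrow> t \<in> EI \<Longrightarrow> a * t \<in> EI" "a \<in> TT \<Longrightarrow> t \<in> EI \<Longrightarrow> t * a \<in> EI"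
  and EI_TT: "EI \<subseteq> TT"
  using EI by (auto simp: tideal_def)

lemma EI_rel: "x \<in> I2 \<Longrightarrow> y \<in> I2 \<Longrightarrow> e x * e y - tscale (psg x y) (e y * e x) - br x y \<in> EI"
proof -
  assume xy: "x \<in> I2" "y \<in> I2"
  have "e x * e y - tscale (psg x y) (e y * e x) - br x y \<in> env_rel m n"
    unfolding env_rel_def
    by (rule CollectI, rule exI[of _ "emat x"], rule exI[of _ "emat y"], rule exI[of _ "lpar m x"], rule exI[of _ "lpar m y"])
      (simp add: xy emb_emat sl_hom_emat sbracket_sl lpar_less psg_lpar)
  moreover have "env_rel m n \<subseteq> EI"
    unfolding EI_def env_ideal_def
    by (rule ring.genideal_self[OF tensor_alg_ring]) (simp add: TA_simps env_rel_TT)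
  ultimately show ?thesis by blast
qed

lemma to_env_coset: "to_env m n t = EI +>\<^bsub>TA\<^esub> t" by (simp add: to_env_def EI_def)

lemma to_env_eq: "to_env m n t = to_env m n u \<longleftrightarrow> t - u \<in> EI"
  unfolding to_env_coset by (rule coset_eq[OF EI])

lemma to_env_mem: "u \<in> to_env m n t \<longleftrightarrow> u - t \<in> EI"
  unfolding to_env_coset by (rule coset_mem[OF EI])

lemma to_env_hom: "to_env m n \<in> Ring.ring_hom TA (env_alg m n)"
proof -
  have "to_env m n = a_r_coset TA EI" by (simp add: fun_eq_iff to_env_coset)
  then show ?thesis using ideal.rcos_ring_hom[OF EI_ideal] by (simp add: env_alg_def EI_def)
qed

lemma env_carrier: "carrier (env_alg m n) = to_env m n ` TT"
  unfolding env_alg_def FactRing_def EI_def[symmetric]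
  by (auto simp: A_RCOSETS_def' to_env_coset TA_simps)

lemma env_ring: "ring (env_alg m n)"
  unfolding env_alg_def EI_def[symmetric] by (rule ideal.quotient_is_ring[OF EI_ideal])

lemma to_env_add: "t \<in> TT \<Longrightarrow> u \<in> TT \<Longrightarrow> to_env m n t \<oplus>\<^bsub>env_alg m n\<^esub> to_env m n u = to_env m n (t + u)"
  and to_env_mult: "t \<in> TT \<Longrightarrow> u \<in> TT \<Longrightarrow> to_env m n t \<otimes>\<^bsub>env_alg m n\<^esub> to_env m n u = to_env m n (t * u)"
  using ring_hom_add[OF to_env_hom, of t u] ring_hom_mult[OF to_env_hom, of t u] by (simp_all add: TA_simps)

lemma to_env_zero: "\<zero>\<^bsub>env_alg m n\<^esub> = to_env m n 0"
  using ring_hom_zero[OF to_env_hom tensor_alg_ring env_ring] by (simp add: TA_simps)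

text \<open>Degrees strictly below \<open>k\<close>, in keeping with \<open>env_below\<close>:
  \<open>Vb 2\<close> consists of the scalars and the Lie superalgebra.\<close>

definition Vb :: "nat \<Rightarrow> tensor set" where "Vb k = tv.span (\<Union>j<k. tens m n j)"

lemma subspace_Vb: "tv.subspace (Vb k)" by (simp add: Vb_def)

lemma Vb_TT: "Vb k \<subseteq> TT"
  unfolding Vb_def by (intro tv.span_minimal subspace_TT) (use tens_subset_TT in blast)

lemma tens_Vb: "j < k \<Longrightarrow> tens m n j \<subseteq> Vb k"
  unfolding Vb_def using tv.span_superset[of "\<Union>j<k. tens m n j"] by blast

lemma Vb_mono: "j \<le> k \<Longrightarrow> Vb j \<subseteq> Vb k"
  unfolding Vb_def by (intro tv.span_mono UN_mono) auto

lemma D_Vb: "x \<in> I2 \<Longrightarrow> t \<in> Vb k \<Longrightarrow> D x t \<in> Vb k"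
proof -
  assume x: "x \<in> I2" and t: "t \<in> Vb k"
  have "D x y \<in> Vb k" if y: "y \<in> (\<Union>j<k. tens m n j)" for y
  proof -
    obtain j where "j < k" "y \<in> tens m n j" using y by blast
    then show ?thesis using D_tens[OF x] tens_Vb by blast
  qed
  then show ?thesis using tlin_span[OF tlin_D subspace_Vb t[unfolded Vb_def]] by blast
qed

section \<open>Parity and the antiautomorphism\<close>

definition sgm :: "nat \<Rightarrow> tensor \<Rightarrow> tensor" where
  "sgm p = lin_ext (\<lambda>w. tscale ((-1) ^ (p * wpar m (letters w))) (wd (letters w)))"

lemma tlin_sgm: "tlin (sgm p)" by (simp add: sgm_def tlin_lin_ext)

lemma sgm_wd: "sgm p (wd w) = tscale ((-1) ^ (p * wpar m w)) (wd w)" by (simp add: sgm_def)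

lemma wpar_append: "wpar m (u @ v) = wpar m u + wpar m v" by (simp add: wpar_def)

lemma sgm_mult: "sgm p (t * u) = sgm p t * sgm p u"
proof (rule tlin_eq_wd[of "\<lambda>t. sgm p (t * u)"])
  show "tlin (\<lambda>t. sgm p (t * u))" by (rule tlin_comp[OF tlin_sgm tlin_mult_right])
  show "tlin (\<lambda>t. sgm p t * sgm p u)" by (rule tlin_comp[OF tlin_mult_right tlin_sgm])
  fix v
  show "sgm p (wd v * u) = sgm p (wd v) * sgm p u"
  proof (rule tlin_eq_wd[of "\<lambda>u. sgm p (wd v * u)"])
    show "tlin (\<lambda>u. sgm p (wd v * u))" by (rule tlin_comp[OF tlin_sgm tlin_mult_left])
    show "tlin (\<lambda>u. sgm p (wd v) * sgm p u)" by (rule tlin_comp[OF tlin_mult_left tlin_sgm])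
    show "sgm p (wd v * wd w) = sgm p (wd v) * sgm p (wd w)" for w
      by (simp add: wd_append[symmetric] sgm_wd wpar_append tscale_mult_left tscale_mult_right
        distrib_left power_add mult.commute)
  qed
qed

lemma sgm_letter: "sgm (lpar m x) (letter y) = tscale (psg x y) (letter y)"
  by (simp add: letter_wd sgm_wd wpar_def psg_lpar)

lemma sgm_e: "y \<in> I2 \<Longrightarrow> sgm (lpar m x) (e y) = tscale (psg x y) (e y)"
proof -
  have "sgm (lpar m x) idt = idt"
    unfolding idt_def tlin_sum[OF tlin_sgm] by (intro sum.cong refl) (simp add: sgm_letter psg_def)
  then show ?thesis
    by (auto simp: e_def tlin_diff[OF tlin_sgm] tlin_scale[OF tlin_sgm] sgm_letter tv.scale_right_diff_distrib psg_def
      tlin_0[OF tlin_sgm])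
qed

lemma sgm_one: "sgm p 1 = 1"
  using sgm_wd[of p "[]"] by (simp add: wd_Nil wpar_def)

lemma sgm_diag: "sgm (lpar m (a, a)) t = t"
  by (rule tlin_eq_wd[OF tlin_sgm tlin_id]) (simp add: sgm_wd lpar_def)

text \<open>In the enveloping algebra the adjoint action is the supercommutator. Along a word each
  letter contributes one defining relation, and \<open>sgm\<close> supplies the sign even if
  \<open>t\<close> is not homogeneous.\<close>

lemma D_commutator:
  assumes x: "x \<in> I2" and t: "t \<in> TT"
  shows "D x t - (e x * t - sgm (lpar m x) t * e x) \<in> EI"
proof -
  have "D x (ew w) - (e x * ew w - sgm (lpar m x) (ew w) * e x) \<in> EI" if "set w \<subseteq> I2" for w
    using that
  proof (induction w)
    case Nil then show ?case by (simp add: D_one[OF x] sgm_one tv.subspace_0[OF EI_s])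
  next
    case (Cons y w)
    then have y: "y \<in> I2" "set w \<subseteq> I2" by auto
    let ?R = "D x (ew w) - (e x * ew w - sgm (lpar m x) (ew w) * e x)"
    let ?E = "e x * e y - tscale (psg x y) (e y * e x) - br x y"
    have "D x (ew (y # w)) - (e x * ew (y # w) - sgm (lpar m x) (ew (y # w)) * e x)
      = tscale (psg x y) (e y * ?R) - ?E * ew w"
      by (simp add: D_e_mult[OF x y(1)] ew_Cons sgm_mult sgm_e[OF y(1)] tscale_mult_left tscale_mult_right
        algebra_simps tv.scale_right_diff_distrib tv.scale_right_distrib)
    moreover have "?R \<in> EI" using Cons y by blast
    ultimately show ?case
      using EI_mult EI_rel[OF x y(1)] ew_TT[OF y(2)] e_TT[OF y(1)]
      by (simp only:) (intro tv.subspace_diff[OF EI_s] tv.subspace_scale[OF EI_s]; blast)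
  qed
  moreover have "tlin (\<lambda>t. D x t - (e x * t - sgm (lpar m x) t * e x))"
    by (intro tlin_minus tlin_D tlin_mult_left tlin_comp[OF tlin_mult_right tlin_sgm])
  ultimately show ?thesis
    using tlin_span[of "\<lambda>t. D x t - (e x * t - sgm (lpar m x) t * e x)" EI t "{ew w | w. set w \<subseteq> I2}"] EI_s t
    by (auto simp: TT_def)
qed

lemma tlin_tau: "tlin (tau_tensor m)" by (simp add: tau_tensor_def tlin_lin_ext)

lemma tau_wd: "tau_tensor m (wd w) = tau_word m w" by (simp add: tau_tensor_def)

lemma sgm_tau_word: "sgm p (tau_word m w) = tscale ((-1) ^ (p * wpar m w)) (tau_word m w)"
proof (induction w)
  case Nil then show ?case by (simp add: sgm_one wpar_def)
next
  case (Cons x w)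
  have "sgm p (letter x) = tscale ((-1) ^ (p * lpar m x)) (letter x)"
    by (simp add: letter_wd sgm_wd wpar_def)
  then show ?case
    using Cons by (simp add: tlin_scale[OF tlin_sgm] tlin_neg[OF tlin_sgm] sgm_mult tscale_mult_left tscale_mult_right wpar_def
      distrib_left power_add mult_ac)
qed

lemma tau_letter_mult: "tau_tensor m (letter x * t) = - (sgm (lpar m x) (tau_tensor m t) * letter x)"
proof (rule tlin_eq_wd[of "\<lambda>t. tau_tensor m (letter x * t)"])
  show "tlin (\<lambda>t. tau_tensor m (letter x * t))" by (rule tlin_comp[OF tlin_tau tlin_mult_left])
  have "tlin (\<lambda>t. tscale (-1) (sgm (lpar m x) (tau_tensor m t) * letter x))"
    by (intro tlin_cmul tlin_comp[OF tlin_mult_right] tlin_comp[OF tlin_sgm tlin_tau])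
  then show "tlin (\<lambda>t. - (sgm (lpar m x) (tau_tensor m t) * letter x))" by simp
  fix w
  show "tau_tensor m (letter x * wd w) = - (sgm (lpar m x) (tau_tensor m (wd w)) * letter x)"
    unfolding wd_Cons[symmetric] tau_wd sgm_tau_word by (simp add: tscale_mult_left)
qed

text \<open>The antiautomorphism turns left multiplication by \<open>e x\<close> into right
  multiplication with a parity twist, exactly the second term of the supercommutator;
  \<open>Kt_D\<close> depends on this.\<close>

lemma tau_e_mult: "x \<in> I2 \<Longrightarrow> tau_tensor m (e x * t) = - (sgm (lpar m x) (tau_tensor m t) * e x)"
proof -
  assume x: "x \<in> I2"
  show ?thesis
  proof (cases "fst x = snd x")
    case True
    then obtain a where a: "x = (a, a)" by (metis prod.collapse)
    have "tau_tensor m (idt * t) = - (tau_tensor m t * idt)"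
      unfolding idt_def sum_distrib_left sum_distrib_right tlin_sum[OF tlin_tau] tau_letter_mult sgm_diag
      by (simp add: sum_negf)
    then show ?thesis
      by (simp add: a e_def left_diff_distrib right_diff_distrib tscale_mult_left tscale_mult_right
        tlin_diff[OF tlin_tau] tlin_scale[OF tlin_tau] tau_letter_mult sgm_diag)
  qed (simp add: e_def tau_letter_mult)
qed

lemma tau_one: "tau_tensor m 1 = 1" using tau_wd[of "[]"] by (simp add: wd_Nil)

lemma tau_e: "x \<in> I2 \<Longrightarrow> tau_tensor m (e x) = - e x"
  using tau_e_mult[of x 1] by (simp add: tau_one sgm_one)

lemma tau_ee: "x \<in> I2 \<Longrightarrow> y \<in> I2 \<Longrightarrow> tau_tensor m (e x * e y) = tscale (psg x y) (e y * e x)"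
  by (simp add: tau_e_mult tau_e tlin_neg[OF tlin_sgm] sgm_e tscale_mult_left)

end

section \<open>The associated graded ideal in degree two\<close>

context sl_super
begin

text \<open>The identity corrections in \<open>e\<close> pair with \<open>u\<close> to contractions
  of \<open>u\<close>, all of which vanish.\<close>

lemma B_ee:
  assumes ij: "(i, j) \<in> I2" and kl: "(k, l) \<in> I2" and sg: "sg * sg = 1" "sg' * sg' = 1" and u: "u \<in> T sg sg'"
  shows "B (e (i, j) * e (k, l)) u = s j * s l * chi j k * co u i k j l"
proof -
  have r: "i < d" "j < d" "k < d" "l < d" using ij kl by (auto simp: I2_def)
  have tr0: "(\<Sum>p<d. s p * co u i p p l) = 0" for i l using u by (simp add: T_def tr_def)
  have Bs: "B (sum f A) u = (\<Sum>p\<in>A. B (f p) u)" for f :: "nat \<Rightarrow> tensor" and A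
    by (induction A rule: infinite_finite_induct) simp_all
  have wds: "letter x * letter y = wd [x, y]" for x y by (simp add: letter_wd wd_append[symmetric])
  have L: "co u i p j p = sg' * chi j p * co u i p p j" for i j p
  proof -
    have "chi j p * co u i p p j = sg' * co u i p j p" using u by (simp add: T_def)
    then have "sg' * (chi j p * co u i p p j) = (sg' * sg') * co u i p j p" by simp
    then show ?thesis using sg by (simp add: mult.assoc)
  qed
  have U: "co u p k p l = sg * chi p k * co u k p p l" for p k l
  proof -
    have "chi p k * co u k p p l = sg * co u p k p l" using u by (simp add: T_def)
    then have "sg * (chi p k * co u k p p l) = (sg * sg) * co u p k p l" by simp
    then show ?thesis using sg by (simp add: mult.assoc)
  qed
  have a: "B (letter (i, j) * idt) u = 0" if "i < d" "j < d" for i j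
  proof -
    have "B (letter (i, j) * idt) u = (\<Sum>p<d. s j * s p * chi j p * co u i p j p)"
      unfolding idt_def sum_distrib_left Bs wds by (intro sum.cong refl B_wd) (use that in \<open>auto simp: I2_def\<close>)
    also have "\<dots> = sg' * s j * (\<Sum>p<d. s p * co u i p p j)"
      unfolding sum_distrib_left by (intro sum.cong refl) (simp add: L mult_ac)
    finally show ?thesis by (simp add: tr0)
  qed
  have b: "B (idt * letter (k, l)) u = 0" if "k < d" "l < d" for k l
  proof -
    have "B (idt * letter (k, l)) u = (\<Sum>p<d. s p * s l * chi p k * co u p k p l)"
      unfolding idt_def sum_distrib_right Bs wds by (intro sum.cong refl B_wd) (use that in \<open>auto simp: I2_def\<close>)
    also have "\<dots> = sg * s l * (\<Sum>p<d. s p * co u k p p l)"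
      unfolding sum_distrib_left by (intro sum.cong refl) (simp add: U mult_ac)
    finally show ?thesis by (simp add: tr0)
  qed
  have c: "B (idt * idt) u = 0"
  proof -
    have "B (idt * idt) u = (\<Sum>p<d. B (letter (p, p) * idt) u)"
      unfolding idt_def[of] sum_distrib_right Bs ..
    then show ?thesis using a by simp
  qed
  have "B (letter (i, j) * letter (k, l)) u = s j * s l * chi j k * co u i k j l"
    unfolding wds by (rule B_wd[OF ij kl])
  moreover have "e (i, j) = letter (i, j) - tscale (if i = j then s i / N else 0) idt" for i j
    by (simp add: e_def)
  ultimately show ?thesis
    by (simp only: left_diff_distrib right_diff_distrib tscale_mult_left tscale_mult_right B_diff B_scale
        a[OF r(1,2)] b[OF r(3,4)] c) simp
qed

lemma ee_tens2: "x \<in> I2 \<Longrightarrow> y \<in> I2 \<Longrightarrow> e x * e y \<in> tens m n 2"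
  using ew_tens[of "[x, y]"] by (simp add: ew_Cons numeral_2_eq_2)

lemma ee_F2: "x \<in> I2 \<Longrightarrow> y \<in> I2 \<Longrightarrow> e x * e y \<in> F2"
  using ee_tens2 tens2_F2 by blast

lemma pj_zeroI: assumes "t \<in> F2" "\<And>u. u \<in> T 1 1 \<Longrightarrow> B t u = 0" shows "pj 1 1 t = 0"
  using assms by (intro pj_unique) (simp_all add: tv.subspace_0[OF subspace_T])

lemma T11_flip: assumes "u \<in> T 1 1"
  shows "co u k i j l = chi i k * co u i k j l" "co u i k l j = chi j l * co u i k j l"
proof -
  have "chi i k * co u k i j l = co u i k j l" "chi j l * co u i k l j = co u i k j l" using assms by (auto simp: T_def)
  then have "chi i k * (chi i k * co u k i j l) = chi i k * co u i k j l"
    "chi j l * (chi j l * co u i k l j) = chi j l * co u i k j l" by (simp_all only:)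
  then show "co u k i j l = chi i k * co u i k j l" "co u i k l j = chi j l * co u i k j l" by simp_all
qed

lemma pj_skew:
  assumes "x \<in> I2" "y \<in> I2"
  shows "pj 1 1 (e x * e y - tscale (psg x y) (e y * e x)) = 0"
proof (rule pj_zeroI)
  show "e x * e y - tscale (psg x y) (e y * e x) \<in> F2"
    using assms by (intro tv.subspace_diff[OF subspace_F2] tv.subspace_scale[OF subspace_F2] ee_F2)
  fix u assume u: "u \<in> T 1 1"
  obtain i j k l where xy: "x = (i, j)" "y = (k, l)" by (metis surj_pair)
  have I: "(i, j) \<in> I2" "(k, l) \<in> I2" using assms xy by simp_all
  have o: "(1::complex) * 1 = 1" by simp
  have "co u k i l j = chi i k * (chi j l * co u i k j l)"
    using T11_flip(1)[OF u, of k i l j] T11_flip(2)[OF u, of i k l j] by simp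
  then show "B (e x * e y - tscale (psg x y) (e y * e x)) u = 0"
    unfolding xy B_diff B_scale B_ee[OF I o o u] B_ee[OF I(2,1) o o u]
    by (simp add: psg_def X_def chi_sym mult_ac)
qed

text \<open>Elements of \<open>T 1 1\<close> are symmetric in their upper indices, so the projection
  sees the order of these only through a sign. Modulo the relations of the Joseph ideal this becomes
  the rule for exchanging upper indices of adjacent letters.\<close>

lemma pj_swap:
  assumes "(i, j) \<in> I2" "(k, l) \<in> I2"
  shows "pj 1 1 (e (i, j) * e (k, l) - tscale (chi i k * chi j k * chi i j) (e (k, j) * e (i, l))) = 0"
proof (rule pj_zeroI)
  have I: "(k, j) \<in> I2" "(i, l) \<in> I2" using assms by (auto simp: I2_def)
  show "e (i, j) * e (k, l) - tscale (chi i k * chi j k * chi i j) (e (k, j) * e (i, l)) \<in> F2"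
    using assms I by (intro tv.subspace_diff[OF subspace_F2] tv.subspace_scale[OF subspace_F2] ee_F2)
  fix u assume u: "u \<in> T 1 1"
  have o: "(1::complex) * 1 = 1" by simp
  show "B (e (i, j) * e (k, l) - tscale (chi i k * chi j k * chi i j) (e (k, j) * e (i, l))) u = 0"
    unfolding B_diff B_scale B_ee[OF assms o o u] B_ee[OF I o o u] T11_flip(1)[OF u, of k i]
    by (simp add: chi_sym mult_ac)
qed

section \<open>The super symmetric ideal in degree two\<close>

definition SK :: "tensor set" where
  "SK = tv.span {e x * e y - tscale (psg x y) (e y * e x) | x y. x \<in> I2 \<and> y \<in> I2}"

lemma W_s: "tv.subspace W" using W_gmod by (simp add: gmod_def)

lemma SK_W: "SK \<subseteq> W"
  unfolding SK_def
proof (rule tv.span_minimal[OF _ W_s], rule subsetI)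
  fix t assume "t \<in> {e x * e y - tscale (psg x y) (e y * e x) | x y. x \<in> I2 \<and> y \<in> I2}"
  then obtain x y where xy: "x \<in> I2" "y \<in> I2" "t = e x * e y - tscale (psg x y) (e y * e x)" by blast
  then have "t \<in> tens m n 2"
    by (simp only:) (intro tv.subspace_diff[OF subspace_tens] tv.subspace_scale[OF subspace_tens] ee_tens2)
  then show "t \<in> W" using pj_skew[OF xy(1,2)] by (simp add: W_def xy(3))
qed

lemma ideal_tideal: assumes "tideal I" shows "ideal I TA"
proof (rule idealI[OF tensor_alg_ring])
  have I: "I \<subseteq> TT" "tv.subspace I" "\<And>a t. a \<in> TT \<Longrightarrow> t \<in> I \<Longrightarrow> a * t \<in> I \<and> t * a \<in> I"
    using assms by (auto simp: tideal_def)
  show "subgroup I (add_monoid TA)"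
  proof (rule subgroup.intro)
    fix x assume x: "x \<in> I"
    have "inv\<^bsub>add_monoid TA\<^esub> x = - x"
      unfolding a_inv_def[symmetric]
      by (rule abelian_group.minus_equality[OF ring.is_abelian_group[OF tensor_alg_ring]])
        (use x I(1) tv.subspace_neg[OF subspace_TT] in \<open>auto simp: TA_simps\<close>)
    then show "inv\<^bsub>add_monoid TA\<^esub> x \<in> I" using x tv.subspace_neg[OF I(2)] by simp
  qed (use I tv.subspace_add[OF I(2)] tv.subspace_0[OF I(2)] in \<open>auto simp: TA_simps\<close>)
  fix a x assume "a \<in> I" "x \<in> carrier TA"
  then show "x \<otimes>\<^bsub>TA\<^esub> a \<in> I" "a \<otimes>\<^bsub>TA\<^esub> x \<in> I" using I(3) by (auto simp: TA_simps)
qed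

lemma sym_rel_SK: "sym_rel m n \<subseteq> SK"
proof
  fix t assume "t \<in> sym_rel m n"
  then obtain A A' p q where A: "A \<in> sl_hom m n p" "A' \<in> sl_hom m n q"
    and t: "t = emb m n A * emb m n A' - tscale ((-1) ^ (p * q)) (emb m n A' * emb m n A)"
    unfolding sym_rel_def by blast
  show "t \<in> SK" unfolding t emb_hom_expand[OF A] SK_def
    by (intro tv.span_sum tv.span_scale) (auto intro!: tv.span_base)
qed

lemma SK_TT: "SK \<subseteq> TT"
  using SK_W tens_subset_TT by (auto simp: W_def)

definition SI :: "tensor set" where "SI = sym_ideal m n"

lemma SI: "tideal SI"
  unfolding SI_def sym_ideal_def
  by (rule tideal_ideal, rule ring.genideal_ideal[OF tensor_alg_ring]) (use sym_rel_SK SK_TT in \<open>auto simp: TA_simps\<close>)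

definition c2 :: "tensor \<Rightarrow> tensor" where
  "c2 = lin_ext (\<lambda>w. if length (letters w) = 2 then wd (letters w) else 0)"

lemma tlin_c2: "tlin c2" by (simp add: c2_def tlin_lin_ext)

lemma c2_wd: "c2 (wd v) = (if length v = 2 then wd v else 0)" by (simp add: c2_def)

lemma ew_homogeneous: "ew w \<in> tv.span {wd v | v. length v = length w}"
proof (induction w)
  case Nil then show ?case by (auto simp: wd_Nil[symmetric] intro!: tv.span_base)
next
  case (Cons y w)
  have l: "letter z * t \<in> tv.span {wd v | v. length v = length (y # w)}"
    if t: "t \<in> tv.span {wd v | v. length v = length w}" for z t
  proof (rule tlin_span[OF tlin_mult_left tv.subspace_span t])
    fix y' assume "y' \<in> {wd v | v. length v = length w}"
    then obtain v where v: "y' = wd v" "length v = length w" by blast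
    then have "letter z * y' = wd (z # v)" "length (z # v) = length (y # w)" by (simp_all add: wd_Cons)
    then show "letter z * y' \<in> tv.span {wd v | v. length v = length (y # w)}"
      by (intro tv.span_base CollectI exI[of _ "z # v"]) simp
  qed
  have lt: "letter z \<in> tv.span (range letter)" for z by (rule tv.span_base) simp
  have "idt \<in> tv.span (range letter)" unfolding idt_def by (rule tv.span_sum) (rule lt)
  then have ey: "e y \<in> tv.span (range letter)"
    unfolding e_def by (intro tv.span_diff lt) (simp add: tv.span_zero tv.span_scale)
  show ?case unfolding ew_Cons
  proof (rule tlin_span[OF tlin_mult_right tv.subspace_span ey])
    fix z assume "z \<in> range letter"
    then obtain z' where "z = letter z'" by blast
    then show "z * ew w \<in> tv.span {wd v | v. length v = length (y # w)}" using l[OF Cons] by (simp only:)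
  qed
qed

lemma c2_tens: assumes "t \<in> tens m n k" shows "c2 t = (if k = 2 then t else 0)"
proof -
  have "tv.span {ew w | w. set w \<subseteq> I2 \<and> length w = k} \<subseteq> tv.span {wd v | v. length v = k}"
    by (rule tv.span_minimal) (use ew_homogeneous in auto)
  then have t: "t \<in> tv.span {wd v | v. length v = k}" using assms by (auto simp: tens_ew)
  show ?thesis
  proof (cases "k = 2")
    case True
    have "c2 t = t" by (rule tlin_eq_span[OF tlin_c2 tlin_id t]) (use True in \<open>auto simp: c2_wd\<close>)
    then show ?thesis using True by simp
  next
    case False
    have "c2 t \<in> {0}" by (rule tlin_span[OF tlin_c2 _ t]) (use False in \<open>auto simp: c2_wd tv.subspace_def\<close>)
    then show ?thesis using False by simp
  qed
qed

lemma tens_mult: "t \<in> tens m n j \<Longrightarrow> u \<in> tens m n k \<Longrightarrow> t * u \<in> tens m n (j + k)"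
proof -
  assume t: "t \<in> tens m n j" and u: "u \<in> tens m n k"
  have 1: "ew v * u \<in> tens m n (length v + k)" if v: "set v \<subseteq> I2" for v
    by (rule tlin_span[OF tlin_mult_left subspace_tens u[unfolded tens_ew]])
      (use v ew_tens[of "v @ _"] in \<open>auto simp: ew_append[symmetric]\<close>)
  show ?thesis
    by (rule tlin_span[OF tlin_mult_right subspace_tens t[unfolded tens_ew]]) (use 1 in auto)
qed

text \<open>The ideal is contained in the span of products \<open>ew u * r * ew v\<close> with
  \<open>r\<close> in \<open>SK\<close>. As \<open>r\<close> has degree two, only those with
  \<open>u\<close> and \<open>v\<close> empty reach degree two.\<close>

lemma SI_c2: "t \<in> SI \<Longrightarrow> c2 t \<in> SK"
proof -
  let ?G = "{ew u * r * ew v | u r v. set u \<subseteq> I2 \<and> set v \<subseteq> I2 \<and> r \<in> SK}"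
  have sub: "?G \<subseteq> TT"
  proof
    fix y assume "y \<in> ?G"
    then obtain u r v where y: "y = ew u * r * ew v" "set u \<subseteq> I2" "set v \<subseteq> I2" "r \<in> SK" by blast
    show "y \<in> TT" unfolding y(1) by (intro TT_mult ew_TT y(2,3) subsetD[OF SK_TT y(4)])
  qed
  have l: "ew w * t \<in> tv.span ?G" "t * ew w \<in> tv.span ?G" if w: "set w \<subseteq> I2" and t: "t \<in> tv.span ?G" for w t
  proof -
    show "ew w * t \<in> tv.span ?G"
    proof (rule tlin_span[OF tlin_mult_left tv.subspace_span t])
      fix y assume "y \<in> ?G"
      then obtain u r v where y: "y = ew u * r * ew v" "set u \<subseteq> I2" "set v \<subseteq> I2" "r \<in> SK" by blast
      have "ew w * y = ew (w @ u) * r * ew v" by (simp add: y ew_append mult.assoc)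
      moreover have "set (w @ u) \<subseteq> I2" using w y(2) by simp
      ultimately have "ew w * y \<in> ?G" using y(3,4)
        by (intro CollectI exI[of _ "w @ u"] exI[of _ r] exI[of _ v]) simp
      then show "ew w * y \<in> tv.span ?G" by (rule tv.span_base)
    qed
    show "t * ew w \<in> tv.span ?G"
    proof (rule tlin_span[OF tlin_mult_right tv.subspace_span t])
      fix y assume "y \<in> ?G"
      then obtain u r v where y: "y = ew u * r * ew v" "set u \<subseteq> I2" "set v \<subseteq> I2" "r \<in> SK" by blast
      have "y * ew w = ew u * r * ew (v @ w)" by (simp add: y ew_append mult.assoc)
      moreover have "set (v @ w) \<subseteq> I2" using w y(3) by simp
      ultimately have "y * ew w \<in> ?G" using y(2,4)
        by (intro CollectI exI[of _ u] exI[of _ r] exI[of _ "v @ w"]) simp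
      then show "y * ew w \<in> tv.span ?G" by (rule tv.span_base)
    qed
  qed
  have "tideal (tv.span ?G)"
    unfolding tideal_def
  proof (intro conjI ballI tv.subspace_span)
    show "tv.span ?G \<subseteq> TT" by (rule tv.span_minimal[OF sub subspace_TT])
    fix a t assume a: "a \<in> TT" and t: "t \<in> tv.span ?G"
    show "a * t \<in> tv.span ?G"
      by (rule tlin_span[OF tlin_mult_right tv.subspace_span a[unfolded TT_def]]) (use l(1) t in auto)
    show "t * a \<in> tv.span ?G"
      by (rule tlin_span[OF tlin_mult_left tv.subspace_span a[unfolded TT_def]]) (use l(2) t in auto)
  qed
  then have id: "ideal (tv.span ?G) TA" by (rule ideal_tideal)
  have "sym_rel m n \<subseteq> tv.span ?G"
  proof
    fix t assume "t \<in> sym_rel m n"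
    then have "t \<in> SK" using sym_rel_SK by blast
    then have "t \<in> ?G" by (intro CollectI exI[of _ "[]"] exI[of _ t]) simp
    then show "t \<in> tv.span ?G" by (rule tv.span_base)
  qed
  then have "SI \<subseteq> tv.span ?G"
    unfolding SI_def sym_ideal_def by (rule ring.genideal_minimal[OF tensor_alg_ring id])
  moreover assume "t \<in> SI"
  ultimately have t: "t \<in> tv.span ?G" by blast
  have "c2 (ew u * r * ew v) \<in> SK" if "set u \<subseteq> I2" "set v \<subseteq> I2" and r: "r \<in> SK" for u r v
  proof -
    have "r \<in> tens m n 2" using r SK_W by (auto simp: W_def)
    then have "ew u * r * ew v \<in> tens m n (length u + 2 + length v)" using that by (intro tens_mult ew_tens)
    then have c: "c2 (ew u * r * ew v) = (if length u + 2 + length v = 2 then ew u * r * ew v else 0)" by (rule c2_tens)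
    show ?thesis
    proof (cases "u = [] \<and> v = []")
      case True then show ?thesis using c r by simp
    next
      case False
      then have "c2 (ew u * r * ew v) = 0" using c by auto
      then show ?thesis by (simp add: SK_def tv.span_zero)
    qed
  qed
  then show "c2 t \<in> SK"
    by (intro tlin_span[OF tlin_c2 _ t]) (auto simp: SK_def)
qed

lemma to_sym_coset: "to_sym m n t = SI +>\<^bsub>TA\<^esub> t" by (simp add: to_sym_def SI_def)

lemma to_sym_eq: "to_sym m n t = to_sym m n u \<longleftrightarrow> t - u \<in> SI"
  unfolding to_sym_coset by (rule coset_eq[OF SI])

lemma to_sym_hom: "to_sym m n \<in> Ring.ring_hom TA (sym_alg m n)"
proof -
  have "to_sym m n = a_r_coset TA SI" by (simp add: fun_eq_iff to_sym_coset)
  then show ?thesis using ideal.rcos_ring_hom[OF ideal_tideal[OF SI]] by (simp add: sym_alg_def SI_def)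
qed

lemma to_sym_add: "t \<in> TT \<Longrightarrow> u \<in> TT \<Longrightarrow> to_sym m n t \<oplus>\<^bsub>sym_alg m n\<^esub> to_sym m n u = to_sym m n (t + u)"
  using ring_hom_add[OF to_sym_hom, of t u] by (simp add: TA_simps)

lemma to_sym_zero: "\<zero>\<^bsub>sym_alg m n\<^esub> = to_sym m n 0"
proof -
  have "ring (sym_alg m n)"
    unfolding sym_alg_def SI_def[symmetric] by (rule ideal.quotient_is_ring[OF ideal_tideal[OF SI]])
  then show ?thesis using ring_hom_zero[OF to_sym_hom tensor_alg_ring] by (simp add: TA_simps)
qed

lemma set_add_mem: "x \<in> H <+>\<^bsub>R\<^esub> K \<longleftrightarrow> (\<exists>h\<in>H. \<exists>k\<in>K. x = h \<oplus>\<^bsub>R\<^esub> k)"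
  by (auto simp: set_add_def')

end

section \<open>The ideal of the theorem and its preimage in the tensor algebra\<close>

locale joseph = sl_super +
  fixes K :: "tensor set set"
  assumes K_ideal: "ideal K (env_alg m n)"
    and K_inf: "infinite_codim m n K"
    and K_tau: "tau m ` K = K"
    and gr_sum: "(gr m n K \<inter> sym_pow m n 2) <+>\<^bsub>sym_alg m n\<^esub> to_sym m n ` cartan_square m n = sym_pow m n 2"
    and gr_int: "(gr m n K \<inter> sym_pow m n 2) \<inter> to_sym m n ` cartan_square m n = {\<zero>\<^bsub>sym_alg m n\<^esub>}"
begin

definition Kt :: "tensor set" where "Kt = {t \<in> TT. to_env m n t \<in> K}"

lemma K_sub: "additive_subgroup K (env_alg m n)" using K_ideal by (rule ideal.axioms(1))

lemma Kt: "tideal Kt"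
proof -
  have m: "a * t \<in> Kt \<and> t * a \<in> Kt" if "a \<in> TT" "t \<in> Kt" for a t
  proof -
    have t: "t \<in> TT" "to_env m n t \<in> K" using that by (simp_all add: Kt_def)
    have c: "to_env m n a \<in> carrier (env_alg m n)" using that by (simp add: env_carrier)
    have "to_env m n a \<otimes>\<^bsub>env_alg m n\<^esub> to_env m n t \<in> K" by (rule ideal.I_l_closed[OF K_ideal t(2) c])
    moreover have "to_env m n t \<otimes>\<^bsub>env_alg m n\<^esub> to_env m n a \<in> K" by (rule ideal.I_r_closed[OF K_ideal t(2) c])
    ultimately show ?thesis using that t by (simp add: to_env_mult Kt_def TT_mult)
  qed
  have z: "0 \<in> Kt"
    using additive_subgroup.zero_closed[OF K_sub] by (simp add: Kt_def to_env_zero tv.subspace_0[OF subspace_TT])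
  have a: "t + u \<in> Kt" if "t \<in> Kt" "u \<in> Kt" for t u
    using additive_subgroup.a_closed[OF K_sub, of "to_env m n t" "to_env m n u"] that
    by (simp add: Kt_def to_env_add tv.subspace_add[OF subspace_TT])
  have "tscale c t \<in> Kt" if "t \<in> Kt" for c t
    using m[OF scalar_TT that, of c] by (simp add: tscale_mult_left)
  then show ?thesis unfolding tideal_def tv.subspace_def using m z a by (auto simp: Kt_def)
qed

lemma Kt_s: "tv.subspace Kt" and Kt_mult: "a \<in> TT \<Longrightarrow> t \<in> Kt \<Longrightarrow> a * t \<in> Kt" "a \<in> TT \<Longrightarrow> t \<in> Kt \<Longrightarrow> t * a \<in> Kt"
  and Kt_TT: "Kt \<subseteq> TT"
  using Kt by (auto simp: tideal_def)

lemma EI_Kt: "EI \<subseteq> Kt"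
proof
  fix t assume t: "t \<in> EI"
  then have "to_env m n t = to_env m n 0" by (simp add: to_env_eq)
  then show "t \<in> Kt" using t EI_TT additive_subgroup.zero_closed[OF K_sub] by (auto simp: Kt_def to_env_zero)
qed

lemma K_eq: "K = to_env m n ` Kt"
proof
  have "K \<subseteq> carrier (env_alg m n)" using additive_subgroup.a_subset[OF K_sub] .
  then show "K \<subseteq> to_env m n ` Kt" by (auto simp: env_carrier Kt_def)
qed (auto simp: Kt_def)

text \<open>Translates a finite spanning set modulo \<open>Kt\<close> into the dimension predicate
  of the quotient ring. That predicate grows by line extensions with vectors outside the space
  reached so far, so generators already in the span are dropped along the way.\<close>

lemma finite_codim_contradiction:
  assumes S: "finite S" "S \<subseteq> TT" and span: "\<And>t. t \<in> TT \<Longrightarrow> \<exists>u\<in>tv.span S. t - u \<in> Kt"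
  shows False
proof -
  let ?U = "env_alg m n" and ?Q = "env_alg m n Quot K"
  interpret U: ring ?U by (rule env_ring)
  interpret Q: ring ?Q by (rule ideal.quotient_is_ring[OF K_ideal])
  define q where "q = (\<lambda>t. K +>\<^bsub>?U\<^esub> to_env m n t)"
  have hK: "a_r_coset ?U K \<in> Ring.ring_hom ?U ?Q"
    using ideal.rcos_ring_hom[OF K_ideal] .
  have tU: "to_env m n t \<in> carrier ?U" if "t \<in> TT" for t using that by (simp add: env_carrier)
  have qc: "q t \<in> carrier ?Q" if "t \<in> TT" for t
    using ring_hom_closed[OF hK tU[OF that]] by (simp add: q_def)
  have qa: "q (t + u) = q t \<oplus>\<^bsub>?Q\<^esub> q u" if "t \<in> TT" "u \<in> TT" for t u
    using ring_hom_add[OF hK tU[OF that(1)] tU[OF that(2)]] that by (simp add: q_def to_env_add)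
  have qm: "q (t * u) = q t \<otimes>\<^bsub>?Q\<^esub> q u" if "t \<in> TT" "u \<in> TT" for t u
    using ring_hom_mult[OF hK tU[OF that(1)] tU[OF that(2)]] that by (simp add: q_def to_env_mult)
  have q0: "q 0 = \<zero>\<^bsub>?Q\<^esub>"
    using ring_hom_zero[OF hK U.ring_axioms Q.ring_axioms] by (simp add: q_def to_env_zero)
  have qK: "q t = \<zero>\<^bsub>?Q\<^esub>" if "t \<in> Kt" for t
  proof -
    have "to_env m n t \<in> K" using that by (simp add: Kt_def)
    then have "q t = K" unfolding q_def by (rule U.a_coset_join2[OF _ additive_subgroup.a_subgroup[OF K_sub], rotated])
        (use that Kt_TT tU in blast)
    then show ?thesis by (simp add: FactRing_def)
  qed
  define F where "F = {q (tscale c 1) | c. True}"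
  have le: "Q.line_extension F (q w) (q ` tv.span S) = q ` tv.span (insert w S)" if w: "w \<in> TT" and S: "S \<subseteq> TT" for w S
  proof -
    have sT: "tv.span S \<subseteq> TT" using S by (intro tv.span_minimal subspace_TT)
    have qs: "q (tscale c 1) \<otimes>\<^bsub>?Q\<^esub> q w \<oplus>\<^bsub>?Q\<^esub> q u = q (tscale c w + u)" if "u \<in> tv.span S" for c u
    proof -
      have "q (tscale c 1) \<otimes>\<^bsub>?Q\<^esub> q w = q (tscale c w)" using qm[OF scalar_TT w, of c] by (simp add: tscale_mult_left)
      then show ?thesis using qa[of "tscale c w" u] tv.subspace_scale[OF subspace_TT w] that sT by auto
    qed
    have "x \<in> Q.line_extension F (q w) (q ` tv.span S) \<longleftrightarrow> x \<in> q ` tv.span (insert w S)" for x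
    proof -
      have "x \<in> Q.line_extension F (q w) (q ` tv.span S) \<longleftrightarrow> (\<exists>c. \<exists>u\<in>tv.span S. x = q (tscale c 1) \<otimes>\<^bsub>?Q\<^esub> q w \<oplus>\<^bsub>?Q\<^esub> q u)"
        unfolding Q.line_extension_def set_add_mem r_coset_def F_def by blast
      also have "\<dots> \<longleftrightarrow> (\<exists>c. \<exists>u\<in>tv.span S. x = q (tscale c w + u))" using qs by auto
      also have "\<dots> \<longleftrightarrow> x \<in> q ` tv.span (insert w S)"
      proof
        assume "\<exists>c. \<exists>u\<in>tv.span S. x = q (tscale c w + u)"
        then obtain c u where cu: "u \<in> tv.span S" "x = q (tscale c w + u)" by blast
        have "tscale c w + u \<in> tv.span (insert w S)"
          using cu(1) tv.span_mono[of S "insert w S"] by (intro tv.span_add tv.span_scale) (auto intro: tv.span_base)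
        then show "x \<in> q ` tv.span (insert w S)" using cu by blast
      next
        assume "x \<in> q ` tv.span (insert w S)"
        then obtain y where y: "y \<in> tv.span (insert w S)" "x = q y" by blast
        then obtain c where "y - tscale c w \<in> tv.span S" using tv.span_breakdown_eq by blast
        moreover have "x = q (tscale c w + (y - tscale c w))" using y by simp
        ultimately show "\<exists>c. \<exists>u\<in>tv.span S. x = q (tscale c w + u)" by blast
      qed
      finally show ?thesis .
    qed
    then show ?thesis by blast
  qed
  have "\<exists>k. Q.dimension k F (q ` tv.span S)" using S
  proof (induction S rule: finite_induct)
    case empty
    have "q ` tv.span {} = {\<zero>\<^bsub>?Q\<^esub>}" using q0 by simp
    then show ?case using Q.dimension.intros(1) by metis
  next
    case (insert w S)
    then obtain k where k: "Q.dimension k F (q ` tv.span S)" by auto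
    have w: "w \<in> TT" "S \<subseteq> TT" using insert by auto
    show ?case
    proof (cases "q w \<in> q ` tv.span S")
      case False
      then have "Q.dimension (Suc k) F (Q.line_extension F (q w) (q ` tv.span S))"
        using qc[OF w(1)] k by (intro Q.dimension.intros(2))
      then show ?thesis unfolding le[OF w] by blast
    next
      case True
      then obtain v where v: "v \<in> tv.span S" "q w = q v" by blast
      have sT: "tv.span S \<subseteq> TT" using w by (intro tv.span_minimal subspace_TT)
      have "q x \<in> q ` tv.span S" if x: "x \<in> tv.span (insert w S)" for x
      proof -
        obtain c where c: "x - tscale c w \<in> tv.span S" using x tv.span_breakdown_eq by blast
        have T: "x - tscale c w \<in> TT" "v \<in> TT" using c v sT by auto
        have "q x = q ((tscale c 1) * w + (x - tscale c w))" by (simp add: tscale_mult_left)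
        also have "\<dots> = q (tscale c 1) \<otimes>\<^bsub>?Q\<^esub> q w \<oplus>\<^bsub>?Q\<^esub> q (x - tscale c w)"
          using T w by (simp add: qa qm scalar_TT TT_mult)
        also have "\<dots> = q ((tscale c 1) * v + (x - tscale c w))"
          unfolding v(2) using T by (simp add: qa qm scalar_TT TT_mult)
        finally have "q x = q (tscale c v + (x - tscale c w))" by (simp add: tscale_mult_left)
        moreover have "tscale c v + (x - tscale c w) \<in> tv.span S" using c v by (intro tv.span_add tv.span_scale)
        ultimately show ?thesis by blast
      qed
      moreover have "tv.span S \<subseteq> tv.span (insert w S)" by (intro tv.span_mono) auto
      ultimately have "q ` tv.span (insert w S) = q ` tv.span S" by blast
      then show ?thesis using k by metis
    qed
  qed
  moreover have "q ` tv.span S = carrier ?Q"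
  proof
    have sT: "tv.span S \<subseteq> TT" using S by (intro tv.span_minimal subspace_TT)
    then show "q ` tv.span S \<subseteq> carrier ?Q" using qc by blast
    show "carrier ?Q \<subseteq> q ` tv.span S"
    proof
      fix x assume "x \<in> carrier ?Q"
      then obtain c where c: "c \<in> carrier ?U" "x = K +>\<^bsub>?U\<^esub> c" by (auto simp: FactRing_def A_RCOSETS_def')
      then obtain t where t: "t \<in> TT" "x = q t" by (auto simp: env_carrier q_def)
      then obtain u where u: "u \<in> tv.span S" "t - u \<in> Kt" using span by blast
      have uT: "u \<in> TT" "t - u \<in> TT" using u sT Kt_TT by blast+
      have "q t = q ((t - u) + u)" by simp
      also have "\<dots> = q (t - u) \<oplus>\<^bsub>?Q\<^esub> q u" using uT by (intro qa)
      also have "\<dots> = q u" using qK[OF u(2)] qc[OF uT(1)] by simp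
      finally show "x \<in> q ` tv.span S" using t u by blast
    qed
  qed
  ultimately have "Q.finite_dimension F (carrier ?Q)" unfolding Q.finite_dimension_def by simp
  then show False using K_inf unfolding infinite_codim_def F_def q_def by simp
qed

lemma Kt_one: "1 \<notin> Kt"
proof
  assume "1 \<in> Kt"
  then have "t \<in> Kt" if "t \<in> TT" for t using Kt_mult(1)[OF that \<open>1 \<in> Kt\<close>] by simp
  then show False using finite_codim_contradiction[of "{}"] by (simp add: tv.span_empty)
qed

lemma tau_Kt:
  assumes "t \<in> Kt" shows "tau_tensor m t \<in> Kt" "\<exists>u\<in>Kt. t = tau_tensor m u"
proof -
  have t: "t \<in> TT" "to_env m n t \<in> K" using assms by (simp_all add: Kt_def)
  have tt: "t \<in> to_env m n t" by (simp add: to_env_mem tv.subspace_0[OF EI_s])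
  have memKt: "u \<in> Kt" if "u \<in> C" "C \<in> K" for u C
  proof -
    have "C \<in> to_env m n ` Kt" using that(2) by (subst K_eq[symmetric])
    then obtain v where v: "v \<in> Kt" "C = to_env m n v" by (elim imageE)
    then have "u - v \<in> EI" using that(1) by (simp only: to_env_mem)
    then have "(u - v) + v \<in> Kt" by (intro tv.subspace_add[OF Kt_s] subsetD[OF EI_Kt] v(1))
    then show ?thesis by simp
  qed
  have "tau m (to_env m n t) \<in> tau m ` K" using t(2) by (rule imageI)
  then have "tau m (to_env m n t) \<in> K" by (simp only: K_tau)
  moreover have "tau_tensor m t \<in> tau m (to_env m n t)" using tt by (simp add: tau_def)
  ultimately show "tau_tensor m t \<in> Kt" by (rule memKt[rotated])
  have "to_env m n t \<in> tau m ` K" using t(2) by (simp only: K_tau)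
  then obtain C where C: "C \<in> K" "to_env m n t = tau m C" by (elim imageE)
  then have "t \<in> tau_tensor m ` C" using tt by (simp only: tau_def)
  then obtain u where "u \<in> C" "t = tau_tensor m u" by (elim imageE)
  then show "\<exists>u\<in>Kt. t = tau_tensor m u" using memKt[OF _ C(1)] by (intro bexI)
qed

text \<open>Although \<open>Kt\<close> need not be a graded subspace for the parity, it is stable under the
  superderivations: the antiautomorphism supplies the sign in the supercommutator.\<close>

lemma Kt_D: assumes x: "x \<in> I2" and t: "t \<in> Kt" shows "D x t \<in> Kt"
proof -
  obtain u where u: "u \<in> Kt" "t = tau_tensor m u" using tau_Kt(2)[OF t] by blast
  have "tau_tensor m (e x * u) \<in> Kt" by (intro tau_Kt(1) Kt_mult(1) e_TT x u)
  then have "- (sgm (lpar m x) t * e x) \<in> Kt" by (simp add: tau_e_mult[OF x] u)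
  moreover have "e x * t \<in> Kt" by (intro Kt_mult(1) e_TT x t)
  moreover have "D x t - (e x * t - sgm (lpar m x) t * e x) \<in> Kt"
    using D_commutator[OF x] t Kt_TT EI_Kt by blast
  ultimately have "(D x t - (e x * t - sgm (lpar m x) t * e x)) + (e x * t + - (sgm (lpar m x) t * e x)) \<in> Kt"
    by (intro tv.subspace_add[OF Kt_s])
  then show ?thesis by simp
qed

lemma Kt_gmod: "gmod Kt" using Kt_D Kt_s by (simp add: gmod_def)

text \<open>By simplicity of the adjoint module, a nonzero element would bring all generators into
  \<open>Kt\<close>; the scalars would then span the quotient.\<close>

lemma Kt_tens1: assumes "x \<in> tens m n 1" "x \<in> Kt" shows "x = 0"
proof (rule ccontr)
  assume "x \<noteq> 0"
  then have "tens m n 1 \<inter> Kt \<noteq> {0}" using assms by blast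
  then have "tens m n 1 \<inter> Kt = tens m n 1"
    by (intro sl_simple gmod_Int gmod_tens Kt_gmod) auto
  then have e: "e x \<in> Kt" if "x \<in> I2" for x
    using ew_tens[of "[x]"] that by (auto simp: ew_Cons)
  have "\<exists>u\<in>tv.span {1}. t - u \<in> Kt" if t: "t \<in> TT" for t
  proof -
    have "tv.subspace {t. \<exists>u\<in>tv.span {1}. t - u \<in> Kt}"
      unfolding tv.subspace_def
    proof (intro conjI ballI allI)
      show "0 \<in> {t. \<exists>u\<in>tv.span {1}. t - u \<in> Kt}"
        using tv.span_zero[of "{1}"] tv.subspace_0[OF Kt_s] by force
      fix x y assume "x \<in> {t. \<exists>u\<in>tv.span {1}. t - u \<in> Kt}" "y \<in> {t. \<exists>u\<in>tv.span {1}. t - u \<in> Kt}"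
      then obtain u v where uv: "u \<in> tv.span {1}" "v \<in> tv.span {1}" "x - u \<in> Kt" "y - v \<in> Kt" by blast
      have "(x + y) - (u + v) = (x - u) + (y - v)" by simp
      then have "(x + y) - (u + v) \<in> Kt" using uv tv.subspace_add[OF Kt_s] by metis
      then show "x + y \<in> {t. \<exists>u\<in>tv.span {1}. t - u \<in> Kt}" using uv tv.span_add by blast
    next
      fix c x assume "x \<in> {t. \<exists>u\<in>tv.span {1}. t - u \<in> Kt}"
      then obtain u where u: "u \<in> tv.span {1}" "x - u \<in> Kt" by blast
      then have "tscale c x - tscale c u \<in> Kt" using tv.subspace_scale[OF Kt_s] by (metis tv.scale_right_diff_distrib)
      then show "tscale c x \<in> {t. \<exists>u\<in>tv.span {1}. t - u \<in> Kt}" using u tv.span_scale by blast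
    qed
    moreover have "\<exists>u\<in>tv.span {1}. ew w - u \<in> Kt" if "set w \<subseteq> I2" for w
    proof (cases w)
      case Nil
      then show ?thesis using tv.span_base[of 1 "{1}"] tv.subspace_0[OF Kt_s] by force
    next
      case (Cons y v)
      then have "ew w \<in> Kt" using that Kt_mult(2)[OF ew_TT e, of v y] by (simp add: ew_Cons)
      then show ?thesis using tv.span_zero[of "{1}"] by force
    qed
    ultimately have "TT \<subseteq> {t. \<exists>u\<in>tv.span {1}. t - u \<in> Kt}"
      unfolding TT_def by (intro tv.span_minimal) auto
    then show ?thesis using t by blast
  qed
  then show False using finite_codim_contradiction[of "{1}"] one_TT by auto
qed

definition P2 :: "tensor set" where "P2 = {t \<in> tens m n 2. \<exists>u\<in>Vb 2. t - u \<in> Kt}"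

lemma gr_rep_2: "gr_rep m n K 2 = P2"
proof
  have below: "env_below m n k = to_env m n ` Vb k" for k by (simp add: env_below_def Vb_def)
  show "gr_rep m n K 2 \<subseteq> P2"
  proof
    fix t assume t: "t \<in> gr_rep m n K 2"
    then have t2: "t \<in> tens m n 2" by (simp add: gr_rep_def)
    obtain a b where ab: "a \<in> K" "b \<in> env_below m n 2" "to_env m n t = a \<oplus>\<^bsub>env_alg m n\<^esub> b"
      using t by (auto simp: gr_rep_def set_add_mem)
    obtain a' where a': "a' \<in> Kt" "a = to_env m n a'" using ab K_eq by blast
    obtain u where u: "u \<in> Vb 2" "b = to_env m n u" using ab below by blast
    have "to_env m n t = to_env m n (a' + u)" using ab a' u Kt_TT Vb_TT to_env_add by blast
    then have "t - (a' + u) \<in> Kt" using to_env_eq EI_Kt by blast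
    then have "(t - (a' + u)) + a' \<in> Kt" using a' tv.subspace_add[OF Kt_s] by blast
    then have "t - u \<in> Kt" by (simp add: algebra_simps)
    then show "t \<in> P2" using t2 u by (auto simp: P2_def)
  qed
  show "P2 \<subseteq> gr_rep m n K 2"
  proof
    fix t assume "t \<in> P2"
    then obtain u where t: "t \<in> tens m n 2" "u \<in> Vb 2" "t - u \<in> Kt" by (auto simp: P2_def)
    have "t \<in> Vb (Suc 2)" "u \<in> Vb (Suc 2)" using t tens_Vb[of 2 "Suc 2"] Vb_mono[of 2 "Suc 2"] by auto
    then have "t - u \<in> Vb (Suc 2)" by (rule tv.subspace_diff[OF subspace_Vb])
    then have 1: "to_env m n (t - u) \<in> K \<inter> env_below m n (Suc 2)" using t by (auto simp: below Kt_def)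
    have 2: "to_env m n u \<in> env_below m n 2" using t by (auto simp: below)
    have "to_env m n t = to_env m n (t - u) \<oplus>\<^bsub>env_alg m n\<^esub> to_env m n u"
      using to_env_add[of "t - u" u] t Kt_TT Vb_TT[of 2] by auto
    then have "to_env m n t \<in> (K \<inter> env_below m n (Suc 2)) <+>\<^bsub>env_alg m n\<^esub> env_below m n 2"
      unfolding set_add_mem using 1 2 by blast
    then show "t \<in> gr_rep m n K 2" using t by (simp add: gr_rep_def)
  qed
qed

lemma P2_gmod: "gmod P2"
  unfolding gmod_def
proof (intro conjI ballI)
  show "tv.subspace P2"
    unfolding tv.subspace_def
  proof (intro conjI ballI allI)
    show "0 \<in> P2" using tv.subspace_0[OF subspace_tens] tv.subspace_0[OF subspace_Vb] tv.subspace_0[OF Kt_s]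
      by (force simp: P2_def)
    fix x y assume "x \<in> P2" "y \<in> P2"
    then obtain u v where uv: "x \<in> tens m n 2" "y \<in> tens m n 2" "u \<in> Vb 2" "v \<in> Vb 2" "x - u \<in> Kt" "y - v \<in> Kt"
      by (auto simp: P2_def)
    have "(x + y) - (u + v) = (x - u) + (y - v)" by simp
    then have "(x + y) - (u + v) \<in> Kt" using uv tv.subspace_add[OF Kt_s] by metis
    moreover have "u + v \<in> Vb 2" "x + y \<in> tens m n 2"
      using uv tv.subspace_add[OF subspace_Vb] tv.subspace_add[OF subspace_tens] by blast+
    ultimately show "x + y \<in> P2" unfolding P2_def by blast
  next
    fix c x assume "x \<in> P2"
    then obtain u where u: "x \<in> tens m n 2" "u \<in> Vb 2" "x - u \<in> Kt" by (auto simp: P2_def)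
    then have "tscale c x - tscale c u \<in> Kt" using tv.subspace_scale[OF Kt_s] by (metis tv.scale_right_diff_distrib)
    moreover have "tscale c u \<in> Vb 2" "tscale c x \<in> tens m n 2"
      using u tv.subspace_scale[OF subspace_Vb] tv.subspace_scale[OF subspace_tens] by blast+
    ultimately show "tscale c x \<in> P2" unfolding P2_def by blast
  qed
  fix x t assume x: "x \<in> I2" and "t \<in> P2"
  then obtain u where u: "t \<in> tens m n 2" "u \<in> Vb 2" "t - u \<in> Kt" by (auto simp: P2_def)
  have "D x t - D x u \<in> Kt" using Kt_D[OF x u(3)] by (simp add: tlin_diff[OF tlin_D])
  then show "D x t \<in> P2" unfolding P2_def using D_Vb[OF x u(2)] D_tens[OF x u(1)] by blast
qed

lemma SK_P2: "SK \<subseteq> P2"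
  unfolding SK_def
proof (rule tv.span_minimal)
  show "tv.subspace P2" using P2_gmod by (simp add: gmod_def)
  show "{e x * e y - tscale (psg x y) (e y * e x) | x y. x \<in> I2 \<and> y \<in> I2} \<subseteq> P2"
  proof
    fix t assume "t \<in> {e x * e y - tscale (psg x y) (e y * e x) | x y. x \<in> I2 \<and> y \<in> I2}"
    then obtain x y where xy: "x \<in> I2" "y \<in> I2" "t = e x * e y - tscale (psg x y) (e y * e x)" by blast
    have "t - br x y \<in> Kt" using EI_rel[OF xy(1,2)] EI_Kt xy(3) by auto
    moreover have "br x y \<in> Vb 2" using br_span[OF xy(1,2)] tens1 tens_Vb[of 1 2] by auto
    moreover have "t \<in> tens m n 2" unfolding xy(3)
      using xy by (intro tv.subspace_diff[OF subspace_tens] tv.subspace_scale[OF subspace_tens] ee_tens2)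
    ultimately show "t \<in> P2" by (auto simp: P2_def)
  qed
qed

text \<open>The hypothesis concerns classes in the super symmetric algebra. Lifting them to tensors
  costs elements of \<open>SI\<close>, whose degree two components lie in \<open>SK\<close>, and
  \<open>SK\<close> is contained in both \<open>P2\<close> and \<open>W\<close>. So
  \<open>P2\<close> is an invariant complement of \<open>T 1 1\<close> in the tensor square.\<close>

lemma P2_W: "P2 = W"
proof (rule complement_unique[OF P2_gmod])
  show "P2 \<subseteq> tens m n 2" by (auto simp: P2_def)
  have P2s: "tv.subspace P2" using P2_gmod by (simp add: gmod_def)
  have "y = 0" if "y \<in> P2 \<inter> T 1 1" for y
  proof -
    have y: "y \<in> P2" "y \<in> T 1 1" "y \<in> tens m n 2" using that T_tens2 by blast+
    have "y \<in> tv.span (\<Union>k. gr_rep m n K k)" using y(1) gr_rep_2 by (blast intro: tv.span_base)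
    then have "to_sym m n y \<in> gr m n K \<inter> sym_pow m n 2" using y by (auto simp: gr_def sym_pow_def)
    then have "to_sym m n y = to_sym m n 0"
      using gr_int y(2) unfolding cartan_square_eq to_sym_zero by blast
    then have "y \<in> SI" by (simp add: to_sym_eq)
    then have "c2 y \<in> SK" by (rule SI_c2)
    then have "y \<in> SK" using c2_tens[OF y(3)] by simp
    then show ?thesis using SK_W W_T11 y(2) by blast
  qed
  then show "P2 \<inter> T 1 1 = {0}" using tv.subspace_0[OF P2s] tv.subspace_0[OF subspace_T] by auto
  fix t assume t: "t \<in> tens m n 2"
  then have "to_sym m n t \<in> sym_pow m n 2" by (simp add: sym_pow_def)
  then have "to_sym m n t \<in> (gr m n K \<inter> sym_pow m n 2) <+>\<^bsub>sym_alg m n\<^esub> to_sym m n ` T 1 1"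
    using gr_sum cartan_square_eq by simp
  then obtain g y where gy: "g \<in> gr m n K" "y \<in> T 1 1" "to_sym m n t = g \<oplus>\<^bsub>sym_alg m n\<^esub> to_sym m n y"
    unfolding set_add_mem by blast
  then obtain h where h: "h \<in> tv.span (\<Union>k. gr_rep m n K k)" "g = to_sym m n h" by (auto simp: gr_def)
  have hT: "h \<in> TT"
  proof -
    have "gr_rep m n K k \<subseteq> TT" for k using tens_subset_TT by (auto simp: gr_rep_def)
    then have "tv.span (\<Union>k. gr_rep m n K k) \<subseteq> TT" by (intro tv.span_minimal subspace_TT) blast
    then show ?thesis using h by blast
  qed
  \<comment> \<open>The representative \<open>h\<close> may mix degrees; its degree two component is
    taken, which on \<open>gr_rep m n K k\<close> is the identity for \<open>k = 2\<close> and zero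
    otherwise.\<close>
  have ch: "c2 h \<in> P2"
  proof (rule tlin_span[OF tlin_c2 P2s h(1)])
    fix x assume "x \<in> (\<Union>k. gr_rep m n K k)"
    then obtain k where k: "x \<in> gr_rep m n K k" by blast
    then have "c2 x = (if k = 2 then x else 0)" by (intro c2_tens) (simp add: gr_rep_def)
    then show "c2 x \<in> P2" using k gr_rep_2 tv.subspace_0[OF P2s] by auto
  qed
  have yT: "y \<in> tens m n 2" using gy T_tens2 by blast
  have "y \<in> TT" using yT tens_subset_TT by blast
  then have "to_sym m n t = to_sym m n (h + y)" unfolding gy(3) h(2) by (rule to_sym_add[OF hT])
  then have "t - (h + y) \<in> SI" by (simp add: to_sym_eq)
  then have "c2 (t - (h + y)) \<in> P2" using SI_c2 SK_P2 by blast
  moreover have "c2 (t - (h + y)) = t - (c2 h + y)"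
    using c2_tens[OF t] c2_tens[OF yT] by (simp add: tlin_diff[OF tlin_c2] tlin_add[OF tlin_c2])
  ultimately have "t - (c2 h + y) \<in> P2" by (simp only:)
  then have "(t - (c2 h + y)) + c2 h \<in> P2" by (rule tv.subspace_add[OF P2s _ ch])
  then have "t - y \<in> P2" by (simp add: algebra_simps)
  then show "\<exists>y\<in>T 1 1. t - y \<in> P2" using gy by blast
qed

end

section \<open>The defining relations hold modulo the ideal\<close>

context sl_super
begin

text \<open>The Killing form as a functional on tensors of degree two (\<open>killing_kapt\<close>),
  so that its invariance is the vanishing on all \<open>D z t\<close>.\<close>

definition kapt :: "tensor \<Rightarrow> complex" where
  "kapt t = 2 * N * (\<Sum>i<d. \<Sum>j<d. s i * Poly_Mapping.lookup t (Word [(i, j), (j, i)]))"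

lemma kapt_add [simp]: "kapt (t + u) = kapt t + kapt u"
  and kapt_diff [simp]: "kapt (t - u) = kapt t - kapt u"
  and kapt_scale [simp]: "kapt (tscale c t) = c * kapt t"
  and kapt_zero [simp]: "kapt 0 = 0"
  by (simp_all add: kapt_def lookup_add lookup_minus algebra_simps sum.distrib sum_subtractf sum_distrib_left)

lemma kapt_sum: "kapt (sum f A) = (\<Sum>a\<in>A. kapt (f a))"
  by (induction A rule: infinite_finite_induct) simp_all

lemma kapt_wd: "(i, j) \<in> I2 \<Longrightarrow> (k, l) \<in> I2 \<Longrightarrow> kapt (wd [(i, j), (k, l)]) = 2 * N * (if j = k \<and> i = l then s i else 0)"
proof -
  assume ij: "(i, j) \<in> I2" and kl: "(k, l) \<in> I2"
  have "(\<Sum>p<d. \<Sum>q<d. s p * Poly_Mapping.lookup (wd [(i, j), (k, l)]) (Word [(p, q), (q, p)]))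
    = (\<Sum>p<d. \<Sum>q<d. if (j = k \<and> i = l) \<and> j = q then if i = p then s i else 0 else 0)"
    by (intro sum.cong refl) (auto simp: lookup_wd)
  also have "\<dots> = (\<Sum>p<d. if (j = k \<and> i = l) \<and> i = p then s i else 0)"
    by (intro sum.cong refl, subst delta_and) (use ij in \<open>auto simp: I2_def\<close>)
  also have "\<dots> = (if j = k \<and> i = l then s i else 0)"
    by (subst delta_and) (use ij in \<open>auto simp: I2_def\<close>)
  finally show ?thesis by (simp add: kapt_def)
qed

lemma killing_kapt: assumes "A \<in> sl m n" "A' \<in> sl m n" shows "killing m n A A' = kapt (emb m n A * emb m n A')"
proof -
  have lk: "Poly_Mapping.lookup (emb m n A * emb m n A') (Word [(i, j), (j, i)]) = A $$ (i, j) * A' $$ (j, i)"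
    if "i < d" "j < d" for i j
  proof -
    have "emb m n A * emb m n A' = (\<Sum>x\<in>I2. \<Sum>y\<in>I2. tscale (A $$ x * A' $$ y) (wd [x, y]))"
      unfolding emb_zero_outside sum_distrib_right sum_distrib_left
      by (subst sum.swap) (simp add: tscale_mult_left tscale_mult_right letter_wd wd_append[symmetric] mult.commute)
    then have "Poly_Mapping.lookup (emb m n A * emb m n A') (Word [(i, j), (j, i)])
       = (\<Sum>x\<in>I2. \<Sum>y\<in>I2. if x = (i, j) \<and> (j, i) = y then A $$ (i, j) * A' $$ (j, i) else 0)"
      by (simp add: lookup_sum) (intro sum.cong refl, auto simp: lookup_wd)
    also have "\<dots> = (\<Sum>x\<in>I2. if True \<and> (i, j) = x then A $$ (i, j) * A' $$ (j, i) else 0)"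
      by (intro sum.cong refl, subst delta_and) (use that in \<open>auto simp: I2_def\<close>)
    also have "\<dots> = A $$ (i, j) * A' $$ (j, i)"
      by (subst delta_and) (use that in \<open>auto simp: I2_def\<close>)
    finally show ?thesis .
  qed
  have "(\<Sum>i<d. \<Sum>j<d. (-1) ^ par m i * A $$ (i, j) * A' $$ (j, i))
     = (\<Sum>i<d. \<Sum>j<d. s i * Poly_Mapping.lookup (emb m n A * emb m n A') (Word [(i, j), (j, i)]))"
    by (intro sum.cong refl) (simp add: lk s_par)
  then show ?thesis by (simp add: killing_def kapt_def N_def)
qed

lemma kapt_D: assumes "z \<in> I2" "t \<in> F2" shows "kapt (D z t) = 0"
proof -
  obtain a b where z: "z = (a, b)" by (cases z)
  have ab: "(a, b) \<in> I2" using assms z by simp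
  have "kapt (D z (wd [(i, j), (k, l)])) = 0" if I: "(i, j) \<in> I2" "(k, l) \<in> I2" for i j k l
  proof -
    have r: "(a, j) \<in> I2" "(i, b) \<in> I2" "(a, l) \<in> I2" "(k, b) \<in> I2" using I ab by (auto simp: I2_def)
    have D: "D z (wd [(i, j), (k, l)]) =
      (if b = i then wd [(a, j), (k, l)] else 0) - (if j = a then tscale (psg (a, b) (i, j)) (wd [(i, b), (k, l)]) else 0)
      + ((if b = k then tscale (psg (a, b) (i, j)) (wd [(i, j), (a, l)]) else 0)
      - (if l = a then tscale (psg (a, b) (i, j) * psg (a, b) (k, l)) (wd [(i, j), (k, b)]) else 0))"
      unfolding z D_wd2[OF ab I] brl_def
      by (auto simp: letter_wd left_diff_distrib right_diff_distrib tscale_mult_left tscale_mult_right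
        wd_append[symmetric] tv.scale_right_diff_distrib)
    have 1: "(if b = i then kapt (wd [(a, j), (k, l)]) else 0) = 2 * N * (if b = i \<and> j = k \<and> a = l then s a else 0)"
      by (simp add: kapt_wd[OF r(1) I(2)])
    have 2: "(if j = a then psg (a, b) (i, j) * kapt (wd [(i, b), (k, l)]) else 0) = 2 * N * (if j = a \<and> b = k \<and> i = l then psg (a, b) (i, j) * s i else 0)"
      by (simp add: kapt_wd[OF r(2) I(2)])
    have 3: "(if b = k then psg (a, b) (i, j) * kapt (wd [(i, j), (a, l)]) else 0) = 2 * N * (if j = a \<and> b = k \<and> i = l then psg (a, b) (i, j) * s i else 0)"
      by (simp add: kapt_wd[OF I(1) r(3)])
    have "psg (a, b) (b, j) * psg (a, b) (j, a) * s b = s a" by (simp add: psg_def X_def s_def chi_def)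
    then have 4: "(if l = a then psg (a, b) (i, j) * psg (a, b) (k, l) * kapt (wd [(i, j), (k, b)]) else 0) = 2 * N * (if b = i \<and> j = k \<and> a = l then s a else 0)"
      by (auto simp: kapt_wd[OF I(1) r(4)] mult.assoc)
    have "kapt (D z (wd [(i, j), (k, l)])) = (if b = i then kapt (wd [(a, j), (k, l)]) else 0)
       - (if j = a then psg (a, b) (i, j) * kapt (wd [(i, b), (k, l)]) else 0)
       + ((if b = k then psg (a, b) (i, j) * kapt (wd [(i, j), (a, l)]) else 0)
       - (if l = a then psg (a, b) (i, j) * psg (a, b) (k, l) * kapt (wd [(i, j), (k, b)]) else 0))"
      unfolding D by (simp only: kapt_add kapt_diff) (auto simp only: kapt_scale kapt_zero split: if_split)
    then show ?thesis unfolding 1 2 3 4 by simp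
  qed
  then have "F2 \<subseteq> {t. kapt (D z t) = 0}"
    unfolding F2_def
    by (intro tv.span_minimal) (auto simp: tv.subspace_def tlin_0[OF tlin_D] tlin_add[OF tlin_D] tlin_scale[OF tlin_D])
  then show ?thesis using assms by blast
qed

lemma kapt_ee:
  assumes "(i, j) \<in> I2" "(k, l) \<in> I2"
  shows "kapt (e (i, j) * e (k, l)) = 2 * N * (if j = k \<and> i = l then s i else 0) - 2 * (if i = j \<and> k = l then s i * s k else 0)"
proof -
  have wds: "letter x * letter y = wd [x, y]" for x y by (simp add: letter_wd wd_append[symmetric])
  have a: "kapt (letter (i, j) * idt) = 2 * N * (if i = j then s i else 0)" if I: "(i, j) \<in> I2" for i j
  proof -
    have "kapt (letter (i, j) * idt) = (\<Sum>p<d. if i = j \<and> i = p then 2 * N * s i else 0)"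
      unfolding idt_def sum_distrib_left kapt_sum wds
      by (intro sum.cong refl) (use I in \<open>auto simp: kapt_wd I2_def\<close>)
    then show ?thesis using I by (auto simp: delta_and I2_def)
  qed
  have b: "kapt (idt * letter (i, j)) = 2 * N * (if i = j then s i else 0)" if I: "(i, j) \<in> I2" for i j
  proof -
    have "kapt (idt * letter (i, j)) = (\<Sum>p<d. if i = j \<and> i = p then 2 * N * s i else 0)"
      unfolding idt_def sum_distrib_right kapt_sum wds
      by (intro sum.cong refl) (use I in \<open>auto simp: kapt_wd I2_def\<close>)
    then show ?thesis using I by (auto simp: delta_and I2_def)
  qed
  have c: "kapt (idt * idt) = 2 * N * N"
  proof -
    have "kapt (idt * idt) = (\<Sum>p<d. kapt (letter (p, p) * idt))"
      using kapt_sum[of "\<lambda>p. letter (p, p) * idt" "{..<d}"] by (simp add: idt_def sum_distrib_right)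
    also have "\<dots> = (\<Sum>p<d. 2 * N * s p)" by (intro sum.cong refl) (use a in \<open>auto simp: I2_def\<close>)
    also have "\<dots> = 2 * N * N" by (simp add: sum_distrib_left[symmetric] sum_s)
    finally show ?thesis .
  qed
  have e: "e (i, j) = letter (i, j) - tscale (if i = j then s i / N else 0) idt" for i j by (simp add: e_def)
  have "kapt (e (i, j) * e (k, l)) = kapt (wd [(i, j), (k, l)])
     - (if k = l then s k / N else 0) * kapt (letter (i, j) * idt)
     - (if i = j then s i / N else 0) * kapt (idt * letter (k, l))
     + (if i = j then s i / N else 0) * (if k = l then s k / N else 0) * kapt (idt * idt)"
    unfolding e by (simp only: left_diff_distrib right_diff_distrib tscale_mult_left tscale_mult_right wds kapt_diff kapt_scale) (simp add: algebra_simps)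
  then have ex: "kapt (e (i, j) * e (k, l)) = 2 * N * (if j = k \<and> i = l then s i else 0)
     - (if k = l then s k / N else 0) * (2 * N * (if i = j then s i else 0))
     - (if i = j then s i / N else 0) * (2 * N * (if k = l then s k else 0))
     + (if i = j then s i / N else 0) * (if k = l then s k / N else 0) * (2 * N * N)"
    unfolding kapt_wd[OF assms] a[OF assms(1)] b[OF assms(2)] c .
  have N: "x / N * (2 * N * y) = 2 * (x * y)" "x / N * (y / N) * (2 * N * N) = 2 * (x * y)" for x y
    using N_nz(1) by simp_all
  show ?thesis unfolding ex by (cases "i = j"; cases "k = l") (simp_all add: N mult.commute[of "s k" "s i"] del: times_divide_eq_left times_divide_eq_right)
qed

lemma tau_tens1: "x \<in> tens m n 1 \<Longrightarrow> tau_tensor m x = - x"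
proof -
  assume "x \<in> tens m n 1"
  then have x: "x \<in> tv.span (e ` I2)" by (simp only: tens1)
  have "tlin (\<lambda>x. tscale (-1) x)" by (rule tlin_cmul[OF tlin_id])
  then have n: "tlin (\<lambda>x::tensor. - x)" by simp
  show ?thesis by (rule tlin_eq_span[OF tlin_tau n x]) (auto simp: tau_e)
qed

lemma span_ee: "tens m n 2 = tv.span {e x * e y | x y. x \<in> I2 \<and> y \<in> I2}"
proof -
  have "{ew w | w. set w \<subseteq> I2 \<and> length w = 2} = {e x * e y | x y. x \<in> I2 \<and> y \<in> I2}" (is "?A = ?B")
  proof
    show "?A \<subseteq> ?B"
    proof
      fix t assume "t \<in> ?A"
      then obtain w where w: "t = ew w" "set w \<subseteq> I2" "length w = 2" by blast
      then obtain x y where xy: "w = [x, y]" by (auto simp: length_Suc_conv numeral_2_eq_2)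
      show "t \<in> ?B" by (intro CollectI exI[of _ x] exI[of _ y]) (use w xy in \<open>simp add: ew_Cons\<close>)
    qed
    show "?B \<subseteq> ?A"
    proof
      fix t assume "t \<in> ?B"
      then obtain x y where "x \<in> I2" "y \<in> I2" "t = e x * e y" by blast
      then show "t \<in> ?A" by (intro CollectI exI[of _ "[x, y]"]) (simp add: ew_Cons)
    qed
  qed
  then show ?thesis unfolding tens_ew by (simp only:)
qed

text \<open>In degree two the two minus signs of the antiautomorphism cancel, and it becomes the
  super flip of the factors.\<close>

lemma skew_SK: "t \<in> tens m n 2 \<Longrightarrow> t - tau_tensor m t \<in> SK"
proof -
  assume t: "t \<in> tens m n 2"
  have l: "tlin (\<lambda>t. t - tau_tensor m t)" by (rule tlin_minus[OF tlin_id tlin_tau])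
  show ?thesis
  proof (rule tlin_span[OF l _ t[unfolded span_ee]])
    show "tv.subspace SK" by (simp add: SK_def)
    fix y assume "y \<in> {e x * e y | x y. x \<in> I2 \<and> y \<in> I2}"
    then obtain u v where uv: "u \<in> I2" "v \<in> I2" "y = e u * e v" by blast
    show "y - tau_tensor m y \<in> SK" unfolding uv(3) tau_ee[OF uv(1,2)] SK_def
      by (rule tv.span_base) (use uv in blast)
  qed
qed

lemma psg_sq: "psg x y * psg y x = 1"
  by (cases x; cases y) (simp add: psg_def X_def chi_def)

lemma tau_tau2: "t \<in> tens m n 2 \<Longrightarrow> tau_tensor m (tau_tensor m t) = t"
proof -
  assume t: "t \<in> tens m n 2"
  show ?thesis
    by (rule tlin_eq_span[OF tlin_comp[OF tlin_tau tlin_tau] tlin_id t[unfolded span_ee]])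
      (auto simp: tau_ee tlin_scale[OF tlin_tau] psg_sq)
qed

lemma tau_T11: assumes "t \<in> T 1 1" shows "tau_tensor m t = t"
proof -
  have F: "t \<in> F2" using assms by (rule T_F2)
  have tw: "tau_tensor m (wd [x, y]) = tscale (psg x y) (wd [y, x])" for x y
    by (simp add: tau_wd psg_lpar[symmetric] wpar_def letter_wd wd_append[symmetric])
  have "tau_tensor m u \<in> F2 \<and> co (tau_tensor m u) i k j l = chi i k * (chi j l * co u k i l j)" if u: "u \<in> F2" for u i k j l
  proof -
    let ?V = "{u. tau_tensor m u \<in> F2 \<and> co (tau_tensor m u) i k j l = chi i k * (chi j l * co u k i l j)}"
    have "tv.subspace ?V"
      unfolding tv.subspace_def
      using tv.subspace_0[OF subspace_F2] tv.subspace_add[OF subspace_F2] tv.subspace_scale[OF subspace_F2]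
      by (auto simp: tlin_0[OF tlin_tau] tlin_add[OF tlin_tau] tlin_scale[OF tlin_tau] distrib_left mult.left_commute)
    moreover have "wd [(p, q), (r, v)] \<in> ?V" if "(p, q) \<in> I2" "(r, v) \<in> I2" for p q r v
    proof -
      have "psg (p, q) (r, v) * chi v p = chi r p * (chi v q * chi q r)"
        by (simp add: psg_def X_def chi_def)
      then have "co (tau_tensor m (wd [(p, q), (r, v)])) i k j l = chi i k * (chi j l * co (wd [(p, q), (r, v)]) k i l j)"
        unfolding tw co_scale co_wd by auto
      moreover have "tau_tensor m (wd [(p, q), (r, v)]) \<in> F2"
        unfolding tw by (intro tv.subspace_scale[OF subspace_F2] wd_F2 that)
      ultimately show ?thesis by simp
    qed
    ultimately have "F2 \<subseteq> ?V" unfolding F2_def by (intro tv.span_minimal) auto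
    then show ?thesis using u by blast
  qed
  then have "tau_tensor m t \<in> F2" "\<And>i k j l. co (tau_tensor m t) i k j l = chi i k * (chi j l * co t k i l j)" using F by blast+
  moreover have "chi i k * (chi j l * co t k i l j) = co t i k j l" for i k j l
  proof -
    have q: "chi x y * (chi x y * z) = z" for x y z by (simp add: chi_def)
    have a: "co t k i l j = chi i k * co t i k l j" using T11_flip(1)[OF assms, of k i l j] by (simp add: chi_sym)
    have b: "co t i k l j = chi j l * co t i k j l" using T11_flip(2)[OF assms, of i k l j] by (simp add: chi_sym)
    have "chi i k * (chi j l * co t k i l j) = chi j l * (chi i k * (chi i k * (chi j l * co t i k j l)))"
      unfolding a b by (rule mult.left_commute)
    then show ?thesis unfolding q .
  qed
  ultimately show ?thesis using F by (intro F2_eqI) auto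
qed

lemma sgm_e': "y \<in> I2 \<Longrightarrow> sgm p (e y) = tscale ((-1) ^ (p * lpar m y)) (e y)"
proof -
  have l: "sgm p (letter y) = tscale ((-1) ^ (p * lpar m y)) (letter y)" for y
    by (simp add: letter_wd sgm_wd wpar_def)
  have "sgm p idt = idt"
    unfolding idt_def tlin_sum[OF tlin_sgm] by (intro sum.cong refl) (simp add: l lpar_def)
  then show ?thesis
    by (auto simp: e_def tlin_diff[OF tlin_sgm] tlin_scale[OF tlin_sgm] tlin_0[OF tlin_sgm] l tv.scale_right_diff_distrib lpar_def)
qed

lemma sgm_sgm: "sgm p (sgm q t) = sgm (p + q) t"
  by (rule tlin_eq_wd[OF tlin_comp[OF tlin_sgm tlin_sgm] tlin_sgm])
    (simp add: sgm_wd tlin_scale[OF tlin_sgm] distrib_right power_add)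

lemma lpar_power: "(-1::complex) ^ (p * lpar m x) = ((-1) ^ (p * par m (fst x))) * ((-1) ^ (p * par m (snd x)))"
  by (cases x) (auto simp: lpar_def par_def)

lemma sgm_D1:
  assumes z: "z \<in> I2" and x: "x \<in> tens m n 1"
  shows "sgm p (D z x) = tscale ((-1) ^ (p * lpar m z)) (D z (sgm p x))"
proof (rule tlin_eq_span[OF tlin_comp[OF tlin_sgm tlin_D] tlin_cmul[OF tlin_comp[OF tlin_D tlin_sgm]] x[unfolded tens1]])
  fix y assume "y \<in> e ` I2"
  then obtain w where w: "w \<in> I2" "y = e w" by blast
  obtain a b i j where ab: "z = (a, b)" "w = (i, j)" by (metis surj_pair)
  have I: "(a, j) \<in> I2" "(i, b) \<in> I2" using z w ab by (auto simp: I2_def)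
  have sq: "(-1::complex) ^ k * ((-1) ^ k * x) = x" for k x
    by (simp add: mult.assoc[symmetric] power_mult_distrib[symmetric])
  have "sgm p (br z w) = tscale ((-1) ^ (p * lpar m z) * (-1) ^ (p * lpar m w)) (br z w)"
    unfolding br_def ab lpar_power
    using I
    by (auto simp: tlin_diff[OF tlin_sgm] tlin_scale[OF tlin_sgm] tlin_0[OF tlin_sgm] sgm_e' lpar_power
      tv.scale_right_diff_distrib mult_ac sq)
  then show "sgm p (D z y) = tscale ((-1) ^ (p * lpar m z)) (D z (sgm p y))"
    using z w by (simp add: D_e sgm_e' tlin_scale[OF tlin_D])
qed

lemma emb_sbracket_expand:
  "emb m n (sbracket m n A A') = (\<Sum>x\<in>I2. \<Sum>y\<in>I2. tscale (A $$ x * A' $$ y) (br x y))"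
proof -
  have ex: "C $$ (u, v) = (\<Sum>x\<in>I2. C $$ x * unit_mat m n x $$ (u, v))" if "u < d" "v < d" for C :: "complex mat" and u v
  proof -
    have "(\<Sum>x\<in>I2. C $$ x * unit_mat m n x $$ (u, v)) = (\<Sum>x\<in>I2. if x = (u, v) then C $$ (u, v) else 0)"
      using that by (intro sum.cong refl) (auto simp: unit_mat_def)
    also have "\<dots> = C $$ (u, v)" using that by (subst sum.delta) (auto simp: I2_def)
    finally show ?thesis by simp
  qed
  have ent: "sbracket m n A A' $$ (i, j) = (\<Sum>x\<in>I2. \<Sum>y\<in>I2. A $$ x * A' $$ y * sbracket m n (unit_mat m n x) (unit_mat m n y) $$ (i, j))"
    if ij: "i < d" "j < d" for i j
  proof -
    let ?u = "\<lambda>x i j. unit_mat m n x $$ (i, j)"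
    have "sbracket m n A A' $$ (i, j) = (\<Sum>k<d. A $$ (i, k) * A' $$ (k, j) - psg (i, k) (k, j) * (A' $$ (i, k) * A $$ (k, j)))"
      using ij by (simp add: sbracket_def psg_lpar)
    also have "\<dots> = (\<Sum>k<d. \<Sum>x\<in>I2. \<Sum>y\<in>I2. A $$ x * A' $$ y * (?u x i k * ?u y k j - psg (i, k) (k, j) * (?u y i k * ?u x k j)))"
    proof (intro sum.cong refl)
      fix k assume "k \<in> {..<d}"
      then have k: "k < d" by simp
      have 1: "A $$ (i, k) * A' $$ (k, j) = (\<Sum>x\<in>I2. \<Sum>y\<in>I2. A $$ x * A' $$ y * (?u x i k * ?u y k j))"
        unfolding ex[OF ij(1) k, of A] ex[OF k ij(2), of A'] sum_product by (intro sum.cong refl) (simp add: mult_ac)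
      have 2: "A' $$ (i, k) * A $$ (k, j) = (\<Sum>x\<in>I2. \<Sum>y\<in>I2. A $$ x * A' $$ y * (?u y i k * ?u x k j))"
        unfolding ex[OF ij(1) k, of A'] ex[OF k ij(2), of A] sum_product by (subst sum.swap) (intro sum.cong refl, simp add: mult_ac)
      show "A $$ (i, k) * A' $$ (k, j) - psg (i, k) (k, j) * (A' $$ (i, k) * A $$ (k, j))
        = (\<Sum>x\<in>I2. \<Sum>y\<in>I2. A $$ x * A' $$ y * (?u x i k * ?u y k j - psg (i, k) (k, j) * (?u y i k * ?u x k j)))"
        unfolding 1 2 sum_distrib_left sum_subtractf[symmetric]
        by (intro sum.cong refl) (simp add: right_diff_distrib mult.left_commute)
    qed
    also have "\<dots> = (\<Sum>x\<in>I2. \<Sum>k<d. \<Sum>y\<in>I2. A $$ x * A' $$ y * (?u x i k * ?u y k j - psg (i, k) (k, j) * (?u y i k * ?u x k j)))"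
      by (rule sum.swap)
    also have "\<dots> = (\<Sum>x\<in>I2. \<Sum>y\<in>I2. \<Sum>k<d. A $$ x * A' $$ y * (?u x i k * ?u y k j - psg (i, k) (k, j) * (?u y i k * ?u x k j)))"
      by (intro sum.cong refl sum.swap)
    finally show ?thesis using ij by (simp add: sbracket_def psg_lpar sum_distrib_left)
  qed
  have "emb m n (sbracket m n A A') = (\<Sum>z\<in>I2. \<Sum>x\<in>I2. \<Sum>y\<in>I2. tscale (A $$ x * A' $$ y * sbracket m n (unit_mat m n x) (unit_mat m n y) $$ z) (letter z))"
    unfolding emb_zero_outside by (intro sum.cong refl) (auto simp: I2_def ent[unfolded I2_def] tv.scale_sum_left)
  also have "\<dots> = (\<Sum>x\<in>I2. \<Sum>z\<in>I2. \<Sum>y\<in>I2. tscale (A $$ x * A' $$ y * sbracket m n (unit_mat m n x) (unit_mat m n y) $$ z) (letter z))"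
    by (rule sum.swap)
  also have "\<dots> = (\<Sum>x\<in>I2. \<Sum>y\<in>I2. \<Sum>z\<in>I2. tscale (A $$ x * A' $$ y * sbracket m n (unit_mat m n x) (unit_mat m n y) $$ z) (letter z))"
    by (intro sum.cong refl sum.swap)
  also have "\<dots> = (\<Sum>x\<in>I2. \<Sum>y\<in>I2. tscale (A $$ x * A' $$ y) (emb m n (sbracket m n (unit_mat m n x) (unit_mat m n y))))"
    unfolding emb_zero_outside tv.scale_sum_right by simp
  also have "\<dots> = (\<Sum>x\<in>I2. \<Sum>y\<in>I2. tscale (A $$ x * A' $$ y) (br x y))"
    by (intro sum.cong refl) (simp add: emb_bracket_units br_brl)
  finally show ?thesis .
qed

lemma skew_bracket_EI:
  assumes "A \<in> sl m n" "A' \<in> sl m n"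
  shows "emb m n A * emb m n A' - tau_tensor m (emb m n A * emb m n A') - emb m n (sbracket m n A A') \<in> EI"
proof -
  have AA: "emb m n A * emb m n A' = (\<Sum>x\<in>I2. \<Sum>y\<in>I2. tscale (A $$ x * A' $$ y) (e x * e y))"
    unfolding emb_sl[OF assms(1)] emb_sl[OF assms(2)] sum_product
    by (intro sum.cong refl) (simp add: tscale_mult_left tscale_mult_right mult.commute)
  have "emb m n A * emb m n A' - tau_tensor m (emb m n A * emb m n A') - emb m n (sbracket m n A A')
     = (\<Sum>x\<in>I2. \<Sum>y\<in>I2. tscale (A $$ x * A' $$ y) (e x * e y - tscale (psg x y) (e y * e x) - br x y))"
    unfolding emb_sbracket_expand AA tlin_sum[OF tlin_tau] sum_subtractf[symmetric]
    by (intro sum.cong refl) (simp only: tlin_scale[OF tlin_tau] tau_ee tv.scale_right_diff_distrib)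
  also have "\<dots> \<in> EI"
    by (intro tv.subspace_sum[OF EI_s] tv.subspace_scale[OF EI_s] EI_rel)
  finally show ?thesis .
qed

end

context joseph
begin

text \<open>The antiautomorphism fixes scalars and negates degree one, so averaging leaves the
  scalar in \<open>Kt\<close>, and \<open>Kt\<close> does not contain 1.\<close>

lemma Kt_scalar: "tscale c 1 + x \<in> Kt \<Longrightarrow> x \<in> tens m n 1 \<Longrightarrow> c = 0"
proof -
  assume a: "tscale c 1 + x \<in> Kt" and x: "x \<in> tens m n 1"
  have "tau_tensor m (tscale c 1 + x) \<in> Kt" by (rule tau_Kt(1)[OF a])
  then have "tscale c 1 - x \<in> Kt" by (simp add: tlin_add[OF tlin_tau] tlin_scale[OF tlin_tau] tau_one tau_tens1[OF x])
  with a have "(tscale c 1 + x) + (tscale c 1 - x) \<in> Kt" by (rule tv.subspace_add[OF Kt_s])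
  then have "tscale (2 * c) 1 \<in> Kt" by (simp add: tv.scale_left_distrib[symmetric])
  then have 2: "tscale (1 / (2 * c)) (tscale (2 * c) 1) \<in> Kt" by (rule tv.subspace_scale[OF Kt_s])
  show "c = 0"
  proof (rule ccontr)
    assume "c \<noteq> 0"
    then have "1 \<in> Kt" using 2 by simp
    then show False using Kt_one by blast
  qed
qed

lemma tens0: "tens m n 0 = tv.span {1}"
  unfolding tens_ew by (rule arg_cong[where f="tv.span"]) (auto intro!: exI[of _ "[]"])

lemma Vb2: "u \<in> Vb 2 \<Longrightarrow> \<exists>c. \<exists>x\<in>tens m n 1. u = tscale c 1 + x"
proof -
  assume u: "u \<in> Vb 2"
  have "(\<Union>j<2. tens m n j) = tens m n 0 \<union> tens m n 1" by (auto simp: less_2_cases_iff)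
  then have "Vb 2 = tv.span (tens m n 0 \<union> tens m n 1)" by (simp add: Vb_def)
  then have "u \<in> {x + y | x y. x \<in> tv.span (tens m n 0) \<and> y \<in> tv.span (tens m n 1)}"
    using u unfolding tv.span_Un by blast
  then have "u \<in> {x + y | x y. x \<in> tv.span {1} \<and> y \<in> tens m n 1}"
    unfolding tens0 tv.span_span tv.span_eq_iff[THEN iffD2, OF subspace_tens] .
  then obtain a x where ax: "u = a + x" "a \<in> tv.span {1}" "x \<in> tens m n 1" by blast
  then obtain c where "a = tscale c 1" using tv.span_singleton by blast
  then show ?thesis using ax by blast
qed

text \<open>By \<open>P2_W\<close>, \<open>t\<close> is congruent to a scalar plus some
  \<open>x\<close> of degree one; the antiautomorphism changes only the sign of \<open>x\<close>. So
  \<open>x + x\<close> lies in \<open>Kt\<close>, and \<open>x\<close> is zero by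
  \<open>Kt_tens1\<close>.\<close>

lemma W_symmetric: assumes "t \<in> W" "tau_tensor m t = t" shows "\<exists>c. t - tscale c 1 \<in> Kt"
proof -
  obtain u where u: "u \<in> Vb 2" "t - u \<in> Kt" using assms P2_W by (auto simp: P2_def)
  then obtain c x where cx: "x \<in> tens m n 1" "u = tscale c 1 + x" using Vb2 by blast
  have "tau_tensor m (t - u) \<in> Kt" by (rule tau_Kt(1)[OF u(2)])
  then have "t - (tscale c 1 - x) \<in> Kt"
    by (simp add: cx tlin_diff[OF tlin_tau] tlin_add[OF tlin_tau] tlin_scale[OF tlin_tau] tau_one tau_tens1[OF cx(1)] assms(2))
  then have "(t - (tscale c 1 - x)) - (t - u) \<in> Kt" using u(2) by (rule tv.subspace_diff[OF Kt_s])
  then have "tscale 0 1 + (x + x) \<in> Kt" by (simp add: cx algebra_simps)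
  then have "x + x \<in> Kt" by simp
  moreover have "x + x \<in> tens m n 1" using cx tv.subspace_add[OF subspace_tens] by blast
  ultimately have "x + x = 0" by (intro Kt_tens1)
  then have "tscale 2 x = 0" by (simp add: tv.scale_left_distrib[of 1 1, simplified])
  then have "x = 0" by simp
  then show ?thesis using u cx by auto
qed

section \<open>The invariant form defined by the ideal\<close>

definition syp :: "tensor \<Rightarrow> tensor" where "syp t = tscale (1/2) (t + tau_tensor m t)"

lemma tlin_syp: "tlin syp" unfolding syp_def by (intro tlin_cmul tlin_plus tlin_id tlin_tau)

lemma syp_diff: "t - syp t = tscale (1/2) (t - tau_tensor m t)"
proof -
  have "t = tscale (1/2) t + tscale (1/2) t" by (simp add: tv.scale_left_distrib[symmetric])
  then have "t - tscale (1/2) t = tscale (1/2) t" by (metis add_diff_cancel_right')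
  then show ?thesis by (simp add: syp_def tv.scale_right_distrib tv.scale_right_diff_distrib)
qed

lemma sym_scalar: assumes "t \<in> tens m n 2" shows "\<exists>c. syp t - pj 1 1 t - tscale c 1 \<in> Kt"
proof (rule W_symmetric)
  have F: "t \<in> F2" using assms tens2_F2 by blast
  have p: "pj 1 1 t \<in> T 1 1" by (rule pj11(1)[OF F])
  have "tscale (1/2) (t - tau_tensor m t) \<in> W"
    using skew_SK[OF assms] SK_W by (intro tv.subspace_scale[OF W_s]) blast
  then have "(t - pj 1 1 t) - tscale (1/2) (t - tau_tensor m t) \<in> W"
    by (intro tv.subspace_diff[OF W_s] diff_pj_W assms)
  moreover have "(t - pj 1 1 t) - tscale (1/2) (t - tau_tensor m t) = syp t - pj 1 1 t"
    unfolding syp_diff[symmetric] by simp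
  ultimately show "syp t - pj 1 1 t \<in> W" by simp
  have "tau_tensor m (syp t) = syp t"
    by (simp add: syp_def tlin_scale[OF tlin_tau] tlin_add[OF tlin_tau] tau_tau2[OF assms] add.commute)
  then show "tau_tensor m (syp t - pj 1 1 t) = syp t - pj 1 1 t"
    by (simp add: tlin_diff[OF tlin_tau] tau_T11[OF p])
qed

definition cf :: "tensor \<Rightarrow> complex" where "cf t = (SOME c. syp t - pj 1 1 t - tscale c 1 \<in> Kt)"

lemma cf: "t \<in> tens m n 2 \<Longrightarrow> syp t - pj 1 1 t - tscale (cf t) 1 \<in> Kt"
  unfolding cf_def by (rule someI_ex, rule sym_scalar)

lemma cf_unique: assumes "t \<in> tens m n 2" "x \<in> tens m n 1" "syp t - pj 1 1 t - tscale c 1 - x \<in> Kt" shows "cf t = c"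
proof -
  have "(syp t - pj 1 1 t - tscale (cf t) 1) - (syp t - pj 1 1 t - tscale c 1 - x) \<in> Kt"
    using cf[OF assms(1)] assms(3) by (rule tv.subspace_diff[OF Kt_s])
  then have "tscale (c - cf t) 1 + x \<in> Kt" by (simp add: tv.scale_left_diff_distrib algebra_simps)
  then have "c - cf t = 0" using assms(2) by (rule Kt_scalar)
  then show ?thesis by simp
qed

lemma cf_add: assumes "t \<in> tens m n 2" "u \<in> tens m n 2" shows "cf (t + u) = cf t + cf u"
proof (rule cf_unique)
  have F: "t \<in> F2" "u \<in> F2" using assms tens2_F2 by blast+
  show "t + u \<in> tens m n 2" using assms tv.subspace_add[OF subspace_tens] by blast
  show "0 \<in> tens m n 1" by (rule tv.subspace_0[OF subspace_tens])
  have "(syp t - pj 1 1 t - tscale (cf t) 1) + (syp u - pj 1 1 u - tscale (cf u) 1) \<in> Kt"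
    using assms by (intro tv.subspace_add[OF Kt_s] cf)
  then show "syp (t + u) - pj 1 1 (t + u) - tscale (cf t + cf u) 1 - 0 \<in> Kt"
    using F by (simp add: tlin_add[OF tlin_syp] pj11 tv.scale_left_distrib algebra_simps)
qed

lemma cf_scale: assumes "t \<in> tens m n 2" shows "cf (tscale c t) = c * cf t"
proof (rule cf_unique)
  have F: "t \<in> F2" using assms tens2_F2 by blast
  show "tscale c t \<in> tens m n 2" using assms tv.subspace_scale[OF subspace_tens] by blast
  show "0 \<in> tens m n 1" by (rule tv.subspace_0[OF subspace_tens])
  have "tscale c (syp t - pj 1 1 t - tscale (cf t) 1) \<in> Kt"
    using assms by (intro tv.subspace_scale[OF Kt_s] cf)
  then show "syp (tscale c t) - pj 1 1 (tscale c t) - tscale (c * cf t) 1 - 0 \<in> Kt"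
    using F by (simp add: tlin_scale[OF tlin_syp] pj11 tv.scale_right_diff_distrib)
qed

lemma SK_tens1: "t \<in> SK \<Longrightarrow> \<exists>x\<in>tens m n 1. t - x \<in> Kt"
proof -
  assume t: "t \<in> SK"
  have "tv.subspace {t. \<exists>x\<in>tens m n 1. t - x \<in> Kt}" by (rule subspace_mod[OF subspace_tens Kt_s])
  moreover have "\<exists>z\<in>tens m n 1. e x * e y - tscale (psg x y) (e y * e x) - z \<in> Kt" if "x \<in> I2" "y \<in> I2" for x y
    using EI_rel[OF that] EI_Kt br_span[OF that] tens1 by blast
  ultimately have "SK \<subseteq> {t. \<exists>x\<in>tens m n 1. t - x \<in> Kt}"
    unfolding SK_def by (intro tv.span_minimal) auto
  then show ?thesis using t by blast
qed

text \<open>Whether symmetrising commutes with \<open>D z\<close> does not matter: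
  \<open>t - syp t\<close> is skew, hence of degree one modulo \<open>Kt\<close>, and so is the
  analogous difference for \<open>D z t\<close>. \<open>cf_unique\<close> ignores such terms, and
  \<open>D z\<close> kills the scalar \<open>cf t\<close>.\<close>

lemma cf_D: assumes z: "z \<in> I2" and t: "t \<in> tens m n 2" shows "cf (D z t) = 0"
proof -
  have F: "t \<in> F2" using t tens2_F2 by blast
  have Dt: "D z t \<in> tens m n 2" by (rule D_tens[OF z t])
  obtain x where x: "x \<in> tens m n 1" "(t - tau_tensor m t) - x \<in> Kt" using SK_tens1[OF skew_SK[OF t]] by blast
  obtain y where y: "y \<in> tens m n 1" "(D z t - tau_tensor m (D z t)) - y \<in> Kt" using SK_tens1[OF skew_SK[OF Dt]] by blast
  have 1: "D z (syp t - pj 1 1 t - tscale (cf t) 1) \<in> Kt" by (rule Kt_D[OF z cf[OF t]])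
  have 2: "D z (tscale (1/2) ((t - tau_tensor m t) - x)) \<in> Kt" by (intro Kt_D[OF z] tv.subspace_scale[OF Kt_s] x)
  have 3: "tscale (1/2) ((D z t - tau_tensor m (D z t)) - y) \<in> Kt" by (intro tv.subspace_scale[OF Kt_s] y)
  have "D z (syp t - pj 1 1 t - tscale (cf t) 1) = D z (syp t) - pj 1 1 (D z t)"
    using F z by (simp add: tlin_diff[OF tlin_D] tlin_scale[OF tlin_D] pj11 D_one)
  moreover have "D z (tscale (1/2) ((t - tau_tensor m t) - x)) = D z t - D z (syp t) - tscale (1/2) (D z x)"
    using syp_diff[of t] by (simp add: tlin_diff[OF tlin_D] tlin_scale[OF tlin_D] tv.scale_right_diff_distrib)
      (metis tlin_diff[OF tlin_D] tlin_scale[OF tlin_D] tv.scale_right_diff_distrib)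
  moreover have "tscale (1/2) ((D z t - tau_tensor m (D z t)) - y) = D z t - syp (D z t) - tscale (1/2) y"
    using syp_diff[of "D z t"] by (simp add: tv.scale_right_diff_distrib)
  ultimately have "(D z (syp t) - pj 1 1 (D z t)) + (D z t - D z (syp t) - tscale (1/2) (D z x)) - (D z t - syp (D z t) - tscale (1/2) y) \<in> Kt"
    using 1 2 3 tv.subspace_add[OF Kt_s] tv.subspace_diff[OF Kt_s] by metis
  then have k: "syp (D z t) - pj 1 1 (D z t) - tscale 0 1 - tscale (1/2) (D z x - y) \<in> Kt"
    by (simp add: algebra_simps tv.scale_right_diff_distrib)
  have "tscale (1/2) (D z x - y) \<in> tens m n 1"
    using x y D_tens[OF z x(1)] by (intro tv.subspace_scale[OF subspace_tens] tv.subspace_diff[OF subspace_tens])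
  then show ?thesis using k by (rule cf_unique[OF Dt])
qed

lemma mult_tens1: "x \<in> tens m n 1 \<Longrightarrow> y \<in> tens m n 1 \<Longrightarrow> x * y \<in> tens m n 2"
  using tens_mult[of x 1 y 1] by (simp add: numeral_2_eq_2)

lemma e_tens1: "x \<in> I2 \<Longrightarrow> e x \<in> tens m n 1"
  unfolding tens1 by (rule tv.span_base) simp

lemma br_tens1: "x \<in> I2 \<Longrightarrow> y \<in> I2 \<Longrightarrow> br x y \<in> tens m n 1"
  unfolding tens1 by (rule br_span)

lemma D_mult1:
  assumes z: "z \<in> I2" and x: "x \<in> tens m n 1"
  shows "D z (x * t) = D z x * t + sgm (lpar m z) x * D z t"
proof (rule tlin_eq_span[OF tlin_comp[OF tlin_D tlin_mult_right] _ x[unfolded tens1]])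
  show "tlin (\<lambda>x. D z x * t + sgm (lpar m z) x * D z t)"
    by (intro tlin_plus tlin_comp[OF tlin_mult_right tlin_D] tlin_comp[OF tlin_mult_right tlin_sgm])
  fix y assume "y \<in> e ` I2"
  then show "D z (y * t) = D z y * t + sgm (lpar m z) y * D z t"
    using z by (auto simp: D_e_mult D_e sgm_e tscale_mult_left)
qed

text \<open>The left radical of an invariant form is a submodule of the simple adjoint module, so a
  single off-diagonal generator in it suffices. This applies to the difference of \<open>cf\<close>
  and the matching multiple of the Killing form.\<close>

lemma invariant_form_unique:
  assumes add: "\<And>t u. t \<in> tens m n 2 \<Longrightarrow> u \<in> tens m n 2 \<Longrightarrow> phi (t + u) = phi t + phi u"
    and scale: "\<And>c t. t \<in> tens m n 2 \<Longrightarrow> phi (tscale c t) = c * phi t"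
    and inv: "\<And>z t. z \<in> I2 \<Longrightarrow> t \<in> tens m n 2 \<Longrightarrow> phi (D z t) = (0::complex)"
    and base: "phi (e (0, 1) * e (1, 0)) = 0"
    and t: "t \<in> tens m n 2"
  shows "phi t = 0"
proof -
  have z0: "phi 0 = 0" using scale[OF tv.subspace_0[OF subspace_tens], of 0] by simp
  \<comment> \<open>The parity twists are part of the radical because \<open>D z\<close> acts on the
    second factor only after twisting the first one.\<close>
  let ?I = "{x \<in> tens m n 1. \<forall>y\<in>tens m n 1. \<forall>p. phi (sgm p x * y) = 0}"
  have s1: "sgm p x \<in> tens m n 1" if "x \<in> tens m n 1" for p x
    by (rule tlin_span[OF tlin_sgm subspace_tens that[unfolded tens1]])
      (auto simp: sgm_e' simp del: One_nat_def intro!: tv.subspace_scale[OF subspace_tens] e_tens1)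
  have "gmod ?I"
    unfolding gmod_def
  proof (intro conjI ballI)
    show "tv.subspace ?I"
      unfolding tv.subspace_def
      using tv.subspace_0[OF subspace_tens] tv.subspace_add[OF subspace_tens] tv.subspace_scale[OF subspace_tens]
      by (auto simp: tlin_0[OF tlin_sgm] tlin_add[OF tlin_sgm] tlin_scale[OF tlin_sgm] z0 distrib_right tscale_mult_left
        add scale mult_tens1 s1 simp del: One_nat_def)
    fix z x assume z: "z \<in> I2" and x: "x \<in> ?I"
    have "phi (sgm p (D z x) * y) = 0" if y: "y \<in> tens m n 1" for y p
    proof -
      have sx: "sgm p x \<in> tens m n 1" using x s1 by blast
      have Dy: "D z y \<in> tens m n 1" by (rule D_tens[OF z y])
      have m: "D z (sgm p x) * y \<in> tens m n 2" "sgm (lpar m z) (sgm p x) * D z y \<in> tens m n 2"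
        by (rule mult_tens1[OF D_tens[OF z sx] y], rule mult_tens1[OF s1[OF sx] Dy])
      have "0 = phi (D z (sgm p x * y))" using inv[OF z mult_tens1[OF sx y]] by simp
      also have "\<dots> = phi (D z (sgm p x) * y) + phi (sgm (lpar m z) (sgm p x) * D z y)"
        unfolding D_mult1[OF z sx] using m by (rule add)
      also have "phi (sgm (lpar m z) (sgm p x) * D z y) = 0" unfolding sgm_sgm using x Dy by blast
      finally have "phi (D z (sgm p x) * y) = 0" by simp
      moreover have "sgm p (D z x) * y = tscale ((-1) ^ (p * lpar m z)) (D z (sgm p x) * y)"
        using sgm_D1[OF z, of x p] x by (simp add: tscale_mult_left)
      ultimately show ?thesis using scale[OF m(1)] by simp
    qed
    then show "D z x \<in> ?I" using D_tens[OF z] x by blast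
  qed
  moreover have I01: "(0, 1) \<in> I2" "(1, 0) \<in> I2" using idx by (auto simp: I2_def)
  moreover have "e (0, 1) \<in> ?I"
  proof -
    \<comment> \<open>Invariance under the diagonal units leaves only products of total weight zero,
      and for the first letter \<open>(0, 1)\<close> the second must then be
      \<open>(1, 0)\<close>.\<close>
    have y0: "phi (e (0, 1) * e y) = 0" if y: "y \<in> I2" for y
    proof (cases "\<exists>a<d. wtw a [(0, 1), y] \<noteq> 0")
      case True
      then obtain a where a: "a < d" "wtw a [(0, 1), y] \<noteq> 0" by blast
      have ew2: "ew [(0, 1), y] = e (0, 1) * e y" by (simp add: ew_Cons)
      have "D (a, a) (e (0, 1) * e y) = tscale (of_int (wtw a [(0, 1), y])) (e (0, 1) * e y)"
        using D_diag_ew[OF a(1), of "[(0, 1), y]"] I01 y unfolding ew2 by simp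
      moreover have "phi (D (a, a) (e (0, 1) * e y)) = 0"
        using a(1) by (intro inv ee_tens2 I01 y) (simp add: I2_def)
      ultimately show ?thesis using scale[OF ee_tens2[OF I01(1) y]] a(2) by simp
    next
      case False
      obtain i j where ij: "y = (i, j)" by (cases y)
      have "wtw 0 [(0, 1), y] = 0" "wtw 1 [(0, 1), y] = 0" using False idx by auto
      then have "j = 0" "i = 1" by (auto simp: wtw_def ij split: if_splits)
      then show ?thesis using base ij by simp
    qed
    have "phi (sgm p (e (0, 1)) * y) = 0" if y: "y \<in> tens m n 1" for y p
    proof -
      let ?V = "{y \<in> tens m n 1. phi (e (0, 1) * y) = 0}"
      have "tv.subspace ?V"
        unfolding tv.subspace_def
        using tv.subspace_0[OF subspace_tens] tv.subspace_add[OF subspace_tens] tv.subspace_scale[OF subspace_tens]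
        by (auto simp: z0 distrib_left tscale_mult_right add scale mult_tens1 e_tens1[OF I01(1)] simp del: One_nat_def)
      then have "tv.span (e ` I2) \<subseteq> ?V" by (intro tv.span_minimal) (use y0 e_tens1 in auto)
      then have "phi (e (0, 1) * y) = 0" using y tens1 by blast
      then show ?thesis
        using scale[OF mult_tens1[OF e_tens1[OF I01(1)] y]] unfolding sgm_e'[OF I01(1)] tscale_mult_left by simp
    qed
    then show ?thesis using e_tens1[OF I01(1)] by blast
  qed
  ultimately have eI: "e x \<in> ?I" if "x \<in> I2" for x using sl_generated[of ?I 0 1 x] that by auto
  have s0: "sgm 0 x = x" for x by (rule tlin_eq_wd[OF tlin_sgm tlin_id]) (simp add: sgm_wd)
  have ee: "phi (e x * e y) = 0" if xy: "x \<in> I2" "y \<in> I2" for x y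
  proof -
    have "phi (sgm 0 (e x) * e y) = 0" using eI[OF xy(1)] e_tens1[OF xy(2)] by blast
    then show ?thesis by (simp add: s0)
  qed
  have "tv.subspace {t \<in> tens m n 2. phi t = 0}"
    unfolding tv.subspace_def
    using tv.subspace_0[OF subspace_tens] tv.subspace_add[OF subspace_tens] tv.subspace_scale[OF subspace_tens]
    by (auto simp: z0 add scale)
  then have "tens m n 2 \<subseteq> {t \<in> tens m n 2. phi t = 0}"
    by (subst span_ee, intro tv.span_minimal) (auto simp: ee ee_tens2)
  then show ?thesis using t by blast
qed

definition lam :: complex where "lam = cf (e (0, 1) * e (1, 0)) / kapt (e (0, 1) * e (1, 0))"

lemma cf_kapt: assumes "t \<in> tens m n 2" shows "cf t = lam * kapt t"
proof -
  have I: "(0, 1) \<in> I2" "(1, 0) \<in> I2" using idx by (auto simp: I2_def)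
  have nz: "kapt (e (0, 1) * e (1, 0)) \<noteq> 0" unfolding kapt_ee[OF I] using N_nz by (simp add: s_def)
  have base: "cf (e (0, 1) * e (1, 0)) - lam * kapt (e (0, 1) * e (1, 0)) = 0"
    unfolding lam_def using nz by (simp del: One_nat_def)
  have inv: "cf (D z t) - lam * kapt (D z t) = 0" if "z \<in> I2" "t \<in> tens m n 2" for z t
  proof -
    have "t \<in> F2" using that tens2_F2 by blast
    then show ?thesis using cf_D[OF that] kapt_D[OF that(1)] by simp
  qed
  have "cf t - lam * kapt t = 0"
    by (rule invariant_form_unique[of "\<lambda>t. cf t - lam * kapt t", OF _ _ inv base assms])
      (simp_all add: cf_add cf_scale algebra_simps)
  then show ?thesis by simp
qed

section \<open>The relations of the Joseph ideal and the value of the parameter\<close>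

definition jgen :: "complex mat \<Rightarrow> complex mat \<Rightarrow> tensor" where
  "jgen A A' = emb m n A * emb m n A' - cartan_product m n A A' - tscale (1/2) (emb m n (sbracket m n A A'))
        - tscale (lam * killing m n A A') 1"

lemma jgen_Kt: assumes A: "A \<in> sl m n" "A' \<in> sl m n" shows "jgen A A' \<in> Kt"
proof -
  let ?t = "emb m n A * emb m n A'"
  have t: "?t \<in> tens m n 2" by (rule emb_mult_tens2[OF A])
  have 1: "syp ?t - pj 1 1 ?t - tscale (lam * killing m n A A') 1 \<in> Kt"
    using cf[OF t] unfolding cf_kapt[OF t] killing_kapt[OF A] .
  have 2: "tscale (1/2) (?t - tau_tensor m ?t - emb m n (sbracket m n A A')) \<in> Kt"
    using skew_bracket_EI[OF A] EI_Kt by (intro tv.subspace_scale[OF Kt_s]) blast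
  have "tscale (1/2) (?t - tau_tensor m ?t - emb m n (sbracket m n A A')) = ?t - syp ?t - tscale (1/2) (emb m n (sbracket m n A A'))"
    unfolding syp_diff by (rule tv.scale_right_diff_distrib)
  then have "(syp ?t - pj 1 1 ?t - tscale (lam * killing m n A A') 1) + (?t - syp ?t - tscale (1/2) (emb m n (sbracket m n A A'))) \<in> Kt"
    using 1 2 tv.subspace_add[OF Kt_s] by metis
  then show ?thesis unfolding jgen_def cartan_product_eq[OF A] by (simp add: algebra_simps)
qed

lemma J_tensor_Kt: "J_tensor m n lam \<subseteq> Kt"
  unfolding J_tensor_def
proof (rule ring.genideal_minimal[OF tensor_alg_ring ideal_tideal[OF Kt]])
  show "{emb m n X * emb m n Y - cartan_product m n X Y - tscale (1 / 2) (emb m n (sbracket m n X Y)) -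
     tscale (lam * killing m n X Y) 1 |X Y. X \<in> sl m n \<and> Y \<in> sl m n} \<subseteq> Kt"
    using jgen_Kt unfolding jgen_def by blast
qed

text \<open>Both products have the same Cartan product, since the sign in \<open>pj_swap\<close> is
  1 for even \<open>i\<close>, \<open>k\<close>, \<open>j\<close>. Subtracting their two relations
  removes it and leaves an explicit quadratic relation.\<close>

lemma swap_even:
  assumes I: "(i, j) \<in> I2" "(k, l) \<in> I2" and ev: "i < m" "k < m" "j < m"
  shows "e (i, j) * e (k, l) - e (k, j) * e (i, l) - tscale (1/2) (br (i, j) (k, l) - br (k, j) (i, l))
     - tscale (lam * (kapt (e (i, j) * e (k, l)) - kapt (e (k, j) * e (i, l)))) 1 \<in> Kt"
proof -
  have I': "(k, j) \<in> I2" "(i, l) \<in> I2" using I by (auto simp: I2_def)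
  have g: "e x * e y - pj 1 1 (e x * e y) - tscale (1/2) (br x y) - tscale (lam * kapt (e x * e y)) 1 \<in> Kt"
    if xy: "x \<in> I2" "y \<in> I2" for x y
    using jgen_Kt[OF emat_sl[OF xy(1)] emat_sl[OF xy(2)]] xy
    by (simp add: jgen_def cartan_product_eq emat_sl killing_kapt emb_emat sbracket_sl)
  have "chi i k * chi j k * chi i j = 1" using ev by (simp add: chi_def)
  then have "pj 1 1 (e (i, j) * e (k, l) - e (k, j) * e (i, l)) = 0" using pj_swap[OF I] by simp
  then have p: "pj 1 1 (e (i, j) * e (k, l)) = pj 1 1 (e (k, j) * e (i, l))"
    using pj11_diff[OF ee_F2[OF I] ee_F2[OF I']] by simp
  have "(e (i, j) * e (k, l) - pj 1 1 (e (i, j) * e (k, l)) - tscale (1/2) (br (i, j) (k, l)) - tscale (lam * kapt (e (i, j) * e (k, l))) 1)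
    - (e (k, j) * e (i, l) - pj 1 1 (e (k, j) * e (i, l)) - tscale (1/2) (br (k, j) (i, l)) - tscale (lam * kapt (e (k, j) * e (i, l))) 1) \<in> Kt"
    by (intro tv.subspace_diff[OF Kt_s] g I I')
  then show ?thesis
    unfolding p by (simp add: algebra_simps tv.scale_right_diff_distrib tv.scale_left_diff_distrib)
qed

text \<open>The product \<open>e\<^sub>2\<^sub>0 e\<^sub>0\<^sub>1 e\<^sub>1\<^sub>0\<close> is reduced in two ways; the results agree only if \<open>lam\<close>
  has the stated value.\<close>

lemma lam_eq: "lam = lambda_c m n"
proof -
  \<comment> \<open>The scalar term in exchanging the upper indices of \<open>?b * ?c\<close>: the
    Killing values are \<open>2 * N\<close> and \<open>-2\<close>, and \<open>lam\<close> times
    their difference is \<open>mu\<close>. In the other two exchanges below the Killing values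
    vanish.\<close>
  define mu where "mu = 2 * lam * (N + 1)"
  let ?a = "e (2, 0)" and ?b = "e (0, 1)" and ?c = "e (1, 0)" and ?A = "e (0, 0)" and ?C = "e (1, 1)" and ?f = "e (2, 1)"
  have I: "(2, 0) \<in> I2" "(0, 1) \<in> I2" "(1, 0) \<in> I2" "(0, 0) \<in> I2" "(1, 1) \<in> I2" "(2, 1) \<in> I2"
    using idx by (auto simp: I2_def)
  have ps: "psg (i, j) (k, l) = 1" if "i < m" "j < m" for i j k l using that by (simp add: psg_def X_def chi_def)
  have s1: "s 0 = 1" "s 1 = 1" using idx by (simp_all add: s_def)
  have m3: "0 < m" "1 < m" "2 < m" using idx by auto
  have r1: "?a * ?b - ?A * ?f - tscale (1/2) ?f \<in> Kt"
    using swap_even[OF I(1) I(2)] m3 unfolding kapt_ee[OF I(1,2)] kapt_ee[OF I(4,6)] by (simp add: br_def)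
  have r2: "?f * ?c - ?C * ?a - tscale (1/2) ?a \<in> Kt"
    using swap_even[OF I(6) I(3)] m3 unfolding kapt_ee[OF I(6,3)] kapt_ee[OF I(5,1)] by (simp add: br_def)
  have mu': "lam * (2 * N - - 2) = mu" by (simp add: mu_def algebra_simps)
  have r3: "?b * ?c - ?C * ?A - tscale (1/2) (?A - ?C) - tscale mu 1 \<in> Kt"
    using swap_even[OF I(2) I(3)] m3 s1 ps[of 0 1 1 0] mu' unfolding kapt_ee[OF I(2,3)] kapt_ee[OF I(5,4)]
    by (simp add: br_def)
  have er: "e x * e y - tscale (psg x y) (e y * e x) - br x y \<in> Kt" if "x \<in> I2" "y \<in> I2" for x y
    using EI_rel[OF that] EI_Kt by blast
  have r4: "?a * ?C - ?C * ?a \<in> Kt"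
    using er[OF I(1) I(5)] idx ps[of 2 0 1 1] by (simp add: br_def)
  have r5: "?a * ?A - ?A * ?a - ?a \<in> Kt"
    using er[OF I(1) I(4)] idx ps[of 2 0 0 0] by (simp add: br_def)
  have r6: "?A * ?C - ?C * ?A \<in> Kt"
    using er[OF I(4) I(5)] idx ps[of 0 0 1 1] by (simp add: br_def)
  \<comment> \<open>\<open>r1\<close> and \<open>r2\<close> reduce \<open>?a * ?b\<close> times
    \<open>?c\<close>, and \<open>r3\<close> reduces \<open>?a\<close> times \<open>?b * ?c\<close>;
    \<open>r4\<close> to \<open>r6\<close> bring the results into a common order. All products
    cancel, and this multiple of \<open>?a\<close> is left over.\<close>
  have "tscale (1/4 + mu) ?a = (?a * ?b - ?A * ?f - tscale (1/2) ?f) * ?c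
     + (?A * (?f * ?c - ?C * ?a - tscale (1/2) ?a) + tscale (1/2) (?f * ?c - ?C * ?a - tscale (1/2) ?a))
     - ?a * (?b * ?c - ?C * ?A - tscale (1/2) (?A - ?C) - tscale mu 1)
     - (?a * ?C - ?C * ?a) * ?A - ?C * (?a * ?A - ?A * ?a - ?a) + (?A * ?C - ?C * ?A) * ?a
     - tscale (1/2) (?a * ?A - ?A * ?a - ?a) + tscale (1/2) (?a * ?C - ?C * ?a)" (is "_ = ?R")
    by (rule poly_mapping_eqI)
      (simp add: lookup_add lookup_minus left_diff_distrib right_diff_distrib tscale_mult_left tscale_mult_right mult.assoc
        distrib_left distrib_right algebra_simps)
  moreover have "?R \<in> Kt"
  proof -
    note ad = tv.subspace_add[OF Kt_s] and di = tv.subspace_diff[OF Kt_s] and sc = tv.subspace_scale[OF Kt_s]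
    note eI = e_TT[OF I(1)] e_TT[OF I(2)] e_TT[OF I(3)] e_TT[OF I(4)] e_TT[OF I(5)] e_TT[OF I(6)]
    show ?thesis
      by (rule ad[OF di[OF ad[OF di[OF di[OF di[OF ad[OF Kt_mult(2)[OF eI(3) r1] ad[OF Kt_mult(1)[OF eI(4) r2] sc[OF r2]]]
        Kt_mult(1)[OF eI(1) r3]] Kt_mult(2)[OF eI(4) r4]] Kt_mult(1)[OF eI(5) r5]] Kt_mult(2)[OF eI(1) r6]] sc[OF r5]] sc[OF r4]])
  qed
  ultimately have "tscale (1/4 + mu) ?a \<in> Kt" by simp
  then have z: "tscale (1/4 + mu) ?a = 0"
    using e_tens1[OF I(1)] by (intro Kt_tens1 tv.subspace_scale[OF subspace_tens])
  have "?a \<noteq> 0"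
  proof
    assume "?a = 0"
    moreover have "Poly_Mapping.lookup ?a (Word [(2, 0)]) = 1" by (simp add: e_def letter_wd lookup_wd)
    ultimately show False by simp
  qed
  then have "1/4 + mu = 0" using z by simp
  then have "mu = - (1/4)" by (rule add_eq_0_iff[THEN iffD1])
  moreover have "lam * (8 * (N + 1)) = 4 * mu" by (simp add: mu_def algebra_simps)
  ultimately have "lam * (8 * (N + 1)) = -1" by simp
  moreover have "8 * (N + 1) \<noteq> 0" unfolding mult_eq_0_iff using N_nz(2) by simp
  ultimately have "lam = - 1 / (8 * (N + 1))" by (subst nonzero_eq_divide_eq)
  then show ?thesis by (simp only: lambda_c_def N_def)
qed

end

section \<open>Leading terms\<close>

context sl_super
begin

text \<open>\<open>I\<close> together with the degrees below \<open>L\<close>. A tensor of degree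
  \<open>L\<close> lies in it iff it is the leading term of an element of \<open>I\<close>.\<close>

definition md :: "tensor set \<Rightarrow> nat \<Rightarrow> tensor set" where
  "md I L = {t + v | t v. t \<in> I \<and> v \<in> Vb L}"

lemma mdI: "t \<in> I \<Longrightarrow> v \<in> Vb L \<Longrightarrow> t + v \<in> md I L"
  unfolding md_def by blast

lemma md_mono: "I \<subseteq> I' \<Longrightarrow> md I L \<subseteq> md I' L"
  unfolding md_def by blast

lemma md_s: assumes "tideal I" shows "tv.subspace (md I L)"
proof -
  have Is: "tv.subspace I" using assms by (simp add: tideal_def)
  show ?thesis
    unfolding tv.subspace_def
  proof (intro conjI ballI allI)
    show "0 \<in> md I L" using mdI[OF tv.subspace_0[OF Is] tv.subspace_0[OF subspace_Vb]] by simp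
    fix x y assume "x \<in> md I L" "y \<in> md I L"
    then obtain t v t' v' where "x = t + v" "t \<in> I" "v \<in> Vb L" "y = t' + v'" "t' \<in> I" "v' \<in> Vb L"
      unfolding md_def by blast
    moreover from this have "(t + t') + (v + v') \<in> md I L"
      by (intro mdI tv.subspace_add[OF Is] tv.subspace_add[OF subspace_Vb])
    ultimately show "x + y \<in> md I L" by (simp add: ac_simps)
  next
    fix c x assume "x \<in> md I L"
    then obtain t v where "x = t + v" "t \<in> I" "v \<in> Vb L" unfolding md_def by blast
    moreover from this have "tscale c t + tscale c v \<in> md I L"
      by (intro mdI tv.subspace_scale[OF Is] tv.subspace_scale[OF subspace_Vb])
    ultimately show "tscale c x \<in> md I L" by (simp add: tv.scale_right_distrib)
  qed
qed

lemma Vb_mult: assumes "set w \<subseteq> I2" "v \<in> Vb L" shows "ew w * v \<in> Vb (L + length w)" "v * ew w \<in> Vb (L + length w)"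
proof -
  have *: "ew w * y \<in> Vb (L + length w) \<and> y * ew w \<in> Vb (L + length w)" if y: "y \<in> (\<Union>j<L. tens m n j)" for y
  proof -
    obtain j where j: "j < L" "y \<in> tens m n j" using y by blast
    have "ew w * y \<in> tens m n (length w + j)" "y * ew w \<in> tens m n (j + length w)"
      using tens_mult ew_tens[OF assms(1)] j by blast+
    moreover have "tens m n (length w + j) \<subseteq> Vb (L + length w)" "tens m n (j + length w) \<subseteq> Vb (L + length w)"
      using j by (simp_all add: tens_Vb)
    ultimately show ?thesis by blast
  qed
  show "ew w * v \<in> Vb (L + length w)"
    using tlin_span[OF tlin_mult_left subspace_Vb assms(2)[unfolded Vb_def]] * by blast
  show "v * ew w \<in> Vb (L + length w)"
    using tlin_span[OF tlin_mult_right subspace_Vb assms(2)[unfolded Vb_def]] * by blast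
qed

lemma md_mult:
  assumes "tideal I" "set w \<subseteq> I2" "t \<in> md I L"
  shows "ew w * t \<in> md I (L + length w)" "t * ew w \<in> md I (L + length w)"
proof -
  obtain a v where av: "t = a + v" "a \<in> I" "v \<in> Vb L" using assms(3) unfolding md_def by blast
  have "ew w * a \<in> I" "a * ew w \<in> I" using assms(1) ew_TT[OF assms(2)] av(2) by (auto simp: tideal_def)
  then show "ew w * t \<in> md I (L + length w)" "t * ew w \<in> md I (L + length w)"
    using mdI Vb_mult[OF assms(2) av(3)] by (simp_all add: av(1) distrib_left distrib_right)
qed

lemma md_D:
  assumes "\<And>t. t \<in> I \<Longrightarrow> D x t \<in> I" "x \<in> I2" "t \<in> md I L"
  shows "D x t \<in> md I L"
proof -
  obtain a v where av: "t = a + v" "a \<in> I" "v \<in> Vb L" using assms(3) unfolding md_def by blast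
  then show ?thesis using mdI[OF assms(1)[OF av(2)] D_Vb[OF assms(2) av(3)]] by (simp add: tlin_add[OF tlin_D])
qed

end

context joseph
begin

section \<open>Words modulo the Joseph ideal and lower degree\<close>

definition Jt :: "tensor set" where "Jt = {a + b | a b. a \<in> J_tensor m n lam \<and> b \<in> EI}"

lemma jgen_TT: assumes "A \<in> sl m n" "A' \<in> sl m n" shows "jgen A A' \<in> TT"
  using jgen_Kt[OF assms] Kt_TT by blast

lemma J_tensor_ideal: "ideal (J_tensor m n lam) TA" and jgen_J: "A \<in> sl m n \<Longrightarrow> A' \<in> sl m n \<Longrightarrow> jgen A A' \<in> J_tensor m n lam"
proof -
  have sub: "{jgen A A' | A A'. A \<in> sl m n \<and> A' \<in> sl m n} \<subseteq> carrier TA" using jgen_TT by (auto simp: TA_simps)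
  have J: "J_tensor m n lam = Idl\<^bsub>TA\<^esub> {jgen A A' | A A'. A \<in> sl m n \<and> A' \<in> sl m n}" by (simp add: J_tensor_def jgen_def)
  show "ideal (J_tensor m n lam) TA" unfolding J by (rule ring.genideal_ideal[OF tensor_alg_ring sub])
  show "jgen A A' \<in> J_tensor m n lam" if "A \<in> sl m n" "A' \<in> sl m n"
    unfolding J using ring.genideal_self[OF tensor_alg_ring sub] that by blast
qed

lemma J_tideal: "tideal (J_tensor m n lam)" by (rule tideal_ideal[OF J_tensor_ideal])

lemma Jt_incl: "J_tensor m n lam \<subseteq> Jt" "EI \<subseteq> Jt"
proof -
  have z: "0 \<in> J_tensor m n lam" "0 \<in> EI" using J_tideal EI tv.subspace_0 by (auto simp: tideal_def)
  show "J_tensor m n lam \<subseteq> Jt"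
  proof
    fix x assume "x \<in> J_tensor m n lam"
    then show "x \<in> Jt" unfolding Jt_def by (intro CollectI exI[of _ x] exI[of _ 0]) (simp add: z)
  qed
  show "EI \<subseteq> Jt"
  proof
    fix x assume "x \<in> EI"
    then show "x \<in> Jt" unfolding Jt_def by (intro CollectI exI[of _ 0] exI[of _ x]) (simp add: z)
  qed
qed

lemma Jt: "tideal Jt"
proof -
  have sJ: "tv.subspace (J_tensor m n lam)" using J_tideal by (simp add: tideal_def)
  have Jt': "Jt = {a + b | a b. a \<in> J_tensor m n lam \<and> b \<in> EI}" by (rule Jt_def)
  have "tv.subspace Jt" unfolding Jt' by (rule tv.subspace_sums[OF sJ EI_s])
  moreover have "Jt \<subseteq> TT"
    using J_tideal EI tv.subspace_add[OF subspace_TT] unfolding Jt' tideal_def by blast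
  moreover have "a * t \<in> Jt \<and> t * a \<in> Jt" if a: "a \<in> TT" and t: "t \<in> Jt" for a t
  proof -
    obtain u v where uv: "t = u + v" "u \<in> J_tensor m n lam" "v \<in> EI" using t unfolding Jt' by blast
    have "a * u \<in> J_tensor m n lam" "u * a \<in> J_tensor m n lam" "a * v \<in> EI" "v * a \<in> EI"
      using J_tideal EI uv a by (auto simp: tideal_def)
    then show ?thesis unfolding uv(1) Jt' distrib_left distrib_right by blast
  qed
  ultimately show ?thesis by (simp add: tideal_def)
qed

lemma Jt_s: "tv.subspace Jt" using Jt by (simp add: tideal_def)

lemma Jt_Kt: "Jt \<subseteq> Kt"
  unfolding Jt_def using J_tensor_Kt EI_Kt tv.subspace_add[OF Kt_s] by blast

abbreviation JJ :: "nat \<Rightarrow> tensor set" where "JJ \<equiv> md Jt"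
abbreviation KK :: "nat \<Rightarrow> tensor set" where "KK \<equiv> md Kt"

lemma JJ_s: "tv.subspace (JJ L)" by (rule md_s[OF Jt])
lemma KK_s: "tv.subspace (KK L)" by (rule md_s[OF Kt])
lemma JJ_KK: "JJ L \<subseteq> KK L" by (rule md_mono[OF Jt_Kt])

text \<open>The scalar may be zero, so this is not symmetric: membership passes from
  \<open>u\<close> to \<open>t\<close> only (\<open>eqm_JJ\<close>, \<open>eqm_KK\<close>). In
  exchange, no sign has to be tracked.\<close>

definition eqm :: "nat \<Rightarrow> tensor \<Rightarrow> tensor \<Rightarrow> bool" where
  "eqm L t u \<longleftrightarrow> (\<exists>c. t - tscale c u \<in> JJ L)"

lemma eqm_refl: "eqm L t t"
  unfolding eqm_def by (rule exI[of _ 1]) (simp add: tv.subspace_0[OF JJ_s])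

lemma eqm_trans: assumes "eqm L t u" "eqm L u v" shows "eqm L t v"
proof -
  obtain a b where ab: "t - tscale a u \<in> JJ L" "u - tscale b v \<in> JJ L" using assms unfolding eqm_def by blast
  have "(t - tscale a u) + tscale a (u - tscale b v) \<in> JJ L"
    by (rule tv.subspace_add[OF JJ_s ab(1) tv.subspace_scale[OF JJ_s ab(2)]])
  then have "t - tscale (a * b) v \<in> JJ L" by (simp add: tv.scale_right_diff_distrib)
  then show ?thesis unfolding eqm_def by blast
qed

lemma eqm_JJ: assumes "eqm L t u" "u \<in> JJ L" shows "t \<in> JJ L"
proof -
  obtain a where a: "t - tscale a u \<in> JJ L" using assms unfolding eqm_def by blast
  have "(t - tscale a u) + tscale a u \<in> JJ L"
    by (rule tv.subspace_add[OF JJ_s a tv.subspace_scale[OF JJ_s assms(2)]])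
  then show ?thesis by simp
qed

lemma eqm_KK: assumes "eqm L t u" "u \<in> KK L" shows "t \<in> KK L"
proof -
  obtain a where a: "t - tscale a u \<in> KK L" using assms JJ_KK unfolding eqm_def by blast
  have "(t - tscale a u) + tscale a u \<in> KK L"
    by (rule tv.subspace_add[OF KK_s a tv.subspace_scale[OF KK_s assms(2)]])
  then show ?thesis by simp
qed

lemma eqm_mult:
  assumes "eqm L t u" "set w \<subseteq> I2"
  shows "eqm (L + length w) (ew w * t) (ew w * u)" "eqm (L + length w) (t * ew w) (u * ew w)"
proof -
  obtain a where a: "t - tscale a u \<in> JJ L" using assms unfolding eqm_def by blast
  show "eqm (L + length w) (ew w * t) (ew w * u)" "eqm (L + length w) (t * ew w) (u * ew w)"
    unfolding eqm_def using md_mult[OF Jt assms(2) a]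
    by (auto simp: left_diff_distrib right_diff_distrib tscale_mult_left tscale_mult_right)
qed

lemma eqm_Cons: "eqm (length w) (ew v) (ew w) \<Longrightarrow> x \<in> I2 \<Longrightarrow> eqm (length (x # w)) (ew (x # v)) (ew (x # w))"
  using eqm_mult(1)[of "length w" "ew v" "ew w" "[x]"] by (simp add: ew_Cons)

lemma tens1_Vb2: "tens m n 1 \<subseteq> Vb 2" by (rule tens_Vb) simp

lemma one_Vb: "0 < L \<Longrightarrow> 1 \<in> Vb L"
  using tens_Vb[of 0 L] ew_tens[of "[]"] by auto

lemma swap_letters: assumes "x \<in> I2" "y \<in> I2" shows "eqm 2 (e x * e y) (e y * e x)"
proof -
  have "e x * e y - tscale (psg x y) (e y * e x) - br x y \<in> Jt" using EI_rel[OF assms] Jt_incl(2) by blast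
  moreover have "br x y \<in> Vb 2" using br_tens1[OF assms] tens1_Vb2 by blast
  ultimately have "(e x * e y - tscale (psg x y) (e y * e x) - br x y) + br x y \<in> JJ 2" by (rule mdI)
  then show ?thesis unfolding eqm_def by (auto intro!: exI[of _ "psg x y"])
qed

lemma jgen_e:
  assumes xy: "x \<in> I2" "y \<in> I2"
  shows "e x * e y - pj 1 1 (e x * e y) - tscale (1/2) (br x y) - tscale (lam * kapt (e x * e y)) 1 \<in> Jt"
  using subsetD[OF Jt_incl(1) jgen_J[OF emat_sl[OF xy(1)] emat_sl[OF xy(2)]]] xy
  by (simp add: jgen_def cartan_product_eq emat_sl killing_kapt emb_emat sbracket_sl)

text \<open>\<open>pj_swap\<close> turned into a congruence: the two relations differ by terms of
  degree at most one. The sign is kept here because the vanishing of odd repetitions depends on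
  it.\<close>

lemma swap_upper_exact:
  assumes I: "(i, j) \<in> I2" "(k, l) \<in> I2"
  shows "e (i, j) * e (k, l) - tscale (chi i k * chi j k * chi i j) (e (k, j) * e (i, l)) \<in> JJ 2"
proof -
  have I': "(k, j) \<in> I2" "(i, l) \<in> I2" using I by (auto simp: I2_def)
  define q where "q = chi i k * chi j k * chi i j"
  define a where "a = tscale (1/2) (br (i, j) (k, l)) + tscale (lam * kapt (e (i, j) * e (k, l))) 1"
  define b where "b = tscale (1/2) (br (k, j) (i, l)) + tscale (lam * kapt (e (k, j) * e (i, l))) 1"
  have V: "a \<in> Vb 2" "b \<in> Vb 2"
    unfolding a_def b_def using br_tens1[OF I] br_tens1[OF I'] tens1_Vb2 one_Vb[of 2]
    by (auto intro!: tv.subspace_add[OF subspace_Vb] tv.subspace_scale[OF subspace_Vb])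
  have p: "pj 1 1 (e (i, j) * e (k, l)) = tscale q (pj 1 1 (e (k, j) * e (i, l)))"
  proof -
    have "tscale q (e (k, j) * e (i, l)) \<in> F2" by (intro tv.subspace_scale[OF subspace_F2] ee_F2 I')
    then have "pj 1 1 (e (i, j) * e (k, l)) - pj 1 1 (tscale q (e (k, j) * e (i, l))) = 0"
      using pj_swap[OF I] pj11_diff[OF ee_F2[OF I]] by (simp add: q_def)
    then show ?thesis using pj11 ee_F2[OF I'] by simp
  qed
  have 1: "e (i, j) * e (k, l) - pj 1 1 (e (i, j) * e (k, l)) - a \<in> Jt"
    using jgen_e[OF I] by (simp add: a_def algebra_simps)
  have "e (k, j) * e (i, l) - pj 1 1 (e (k, j) * e (i, l)) - b \<in> Jt"
    using jgen_e[OF I'] by (simp add: b_def algebra_simps)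
  then have 2: "tscale q (e (k, j) * e (i, l) - pj 1 1 (e (k, j) * e (i, l)) - b) \<in> Jt"
    by (rule tv.subspace_scale[OF Jt_s])
  have V': "a - tscale q b \<in> Vb 2" by (rule tv.subspace_diff[OF subspace_Vb V(1) tv.subspace_scale[OF subspace_Vb V(2)]])
  have "((e (i, j) * e (k, l) - pj 1 1 (e (i, j) * e (k, l)) - a)
     - tscale q (e (k, j) * e (i, l) - pj 1 1 (e (k, j) * e (i, l)) - b)) + (a - tscale q b) \<in> JJ 2"
    by (rule mdI[OF tv.subspace_diff[OF Jt_s 1 2] V'])
  then show ?thesis unfolding p q_def[symmetric] by (simp add: tv.scale_right_diff_distrib algebra_simps)
qed

lemma swap_upper: "(i, j) \<in> I2 \<Longrightarrow> (k, l) \<in> I2 \<Longrightarrow> eqm 2 (e (i, j) * e (k, l)) (e (k, j) * e (i, l))"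
  using swap_upper_exact unfolding eqm_def by blast

text \<open>Exchanging two equal odd upper indices reproduces the product with the sign -1, so twice
  the product is of lower degree.\<close>

lemma odd_square_upper:
  assumes "(i, j) \<in> I2" "(i, l) \<in> I2" "\<not> i < m"
  shows "e (i, j) * e (i, l) \<in> JJ 2"
proof -
  have "chi i i * chi j i * chi i j = -1" using assms(3) chi_sym[of j i] by (simp add: s_def mult.assoc)
  then have "e (i, j) * e (i, l) + e (i, j) * e (i, l) \<in> JJ 2" using swap_upper_exact[OF assms(1,2)] by simp
  then have "tscale (1/2) (e (i, j) * e (i, l) + e (i, j) * e (i, l)) \<in> JJ 2" by (rule tv.subspace_scale[OF JJ_s])
  then show ?thesis by (simp add: tv.scale_right_distrib tv.scale_left_distrib[symmetric])
qed

text \<open>Exchange the upper indices and then the two letters: the same product returns, and for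
  an odd common lower index the signs multiply to -1.\<close>

lemma odd_square_lower:
  assumes I: "(i, j) \<in> I2" "(k, j) \<in> I2" and j: "\<not> j < m"
  shows "e (i, j) * e (k, j) \<in> JJ 2"
proof -
  let ?q = "chi i k * chi j k * chi i j" and ?p = "psg (k, j) (i, j)"
  have 1: "e (i, j) * e (k, j) - tscale ?q (e (k, j) * e (i, j)) \<in> JJ 2" by (rule swap_upper_exact[OF I])
  have "e (k, j) * e (i, j) - tscale ?p (e (i, j) * e (k, j)) - br (k, j) (i, j) \<in> Jt"
    using EI_rel[OF I(2,1)] Jt_incl(2) by blast
  moreover have "br (k, j) (i, j) \<in> Vb 2" using br_tens1[OF I(2,1)] tens1_Vb2 by blast
  ultimately have "(e (k, j) * e (i, j) - tscale ?p (e (i, j) * e (k, j)) - br (k, j) (i, j)) + br (k, j) (i, j) \<in> JJ 2" by (rule mdI)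
  then have 2: "tscale ?q (e (k, j) * e (i, j) - tscale ?p (e (i, j) * e (k, j))) \<in> JJ 2"
    by (intro tv.subspace_scale[OF JJ_s]) simp
  have pq: "?q * ?p = -1" using j by (simp add: psg_def X_def chi_def s_def)
  have "(e (i, j) * e (k, j) - tscale ?q (e (k, j) * e (i, j))) + tscale ?q (e (k, j) * e (i, j) - tscale ?p (e (i, j) * e (k, j))) \<in> JJ 2"
    by (rule tv.subspace_add[OF JJ_s 1 2])
  then have "e (i, j) * e (k, j) - tscale (?q * ?p) (e (i, j) * e (k, j)) \<in> JJ 2"
    by (simp add: tv.scale_right_diff_distrib)
  then have "e (i, j) * e (k, j) + e (i, j) * e (k, j) \<in> JJ 2" unfolding pq by simp
  then have "tscale (1/2) (e (i, j) * e (k, j) + e (i, j) * e (k, j)) \<in> JJ 2" by (rule tv.subspace_scale[OF JJ_s])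
  then show ?thesis by (simp add: tv.scale_right_distrib tv.scale_left_distrib[symmetric])
qed

lemma move_front:
  "set w \<subseteq> I2 \<Longrightarrow> x \<in> set w \<Longrightarrow> \<exists>u. mset w = add_mset x (mset u) \<and> eqm (length w) (ew w) (ew (x # u))"
proof (induction w)
  case Nil then show ?case by simp
next
  case (Cons y w)
  show ?case
  proof (cases "x = y")
    case True
    then show ?thesis using eqm_refl by (intro exI[of _ w]) simp
  next
    case False
    then obtain u where u: "mset w = add_mset x (mset u)" "eqm (length w) (ew w) (ew (x # u))" using Cons by auto
    have su: "set u \<subseteq> I2" "x \<in> I2" "y \<in> I2" "length w = Suc (length u)"
      using Cons.prems mset_eq_setD[of w "x # u"] mset_eq_length[of w "x # u"] u(1) by auto
    have 1: "eqm (length (y # w)) (ew (y # w)) (ew (y # x # u))"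
      using eqm_Cons[of "x # u" w y] u su by simp
    have 2: "eqm (length (y # w)) (ew (y # x # u)) (ew (x # y # u))"
      using eqm_mult(2)[OF swap_letters[OF su(3,2)] su(1)] su(4) by (simp add: ew_Cons mult.assoc)
    show ?thesis using eqm_trans[OF 1 2] u(1) by (intro exI[of _ "y # u"]) simp
  qed
qed

definition ixs :: "(nat \<times> nat) list \<Rightarrow> nat multiset \<times> nat multiset" where
  "ixs w = (image_mset fst (mset w), image_mset snd (mset w))"

lemma move_front_I2:
  assumes "set w \<subseteq> I2" "mset w = add_mset x (mset u)"
  shows "set u \<subseteq> I2" "x \<in> I2" "length w = Suc (length u)"
  using assms mset_eq_setD[of w "x # u"] mset_eq_length[of w "x # u"] by auto

text \<open>If the letters carrying upper index \<open>i\<close> and lower index \<open>j\<close>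
  differ, both are moved to the front and exchange their upper indices; the resulting letter
  \<open>(i, j)\<close> is then put first.\<close>

lemma front_type:
  assumes w: "set w \<subseteq> I2" and i: "i \<in> fst ` set w" and j: "j \<in> snd ` set w"
  shows "\<exists>v. set v \<subseteq> I2 \<and> ixs w = ixs ((i, j) # v) \<and> eqm (length w) (ew w) (ew ((i, j) # v))"
proof -
  obtain l where l: "(i, l) \<in> set w" using i by auto
  obtain u where u: "mset w = add_mset (i, l) (mset u)" "eqm (length w) (ew w) (ew ((i, l) # u))"
    using move_front[OF w l] by blast
  note su = move_front_I2[OF w u(1)]
  show ?thesis
  proof (cases "l = j")
    case True
    then show ?thesis using u su by (intro exI[of _ u]) (simp add: ixs_def)
  next
    case False
    have "set w = insert (i, l) (set u)" using mset_eq_setD[of w "(i, l) # u"] u(1) by simp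
    then obtain k where k: "(k, j) \<in> set u" using j False by auto
    obtain v where v: "mset u = add_mset (k, j) (mset v)" "eqm (length u) (ew u) (ew ((k, j) # v))"
      using move_front[OF su(1) k] by blast
    note sv = move_front_I2[OF su(1) v(1)]
    have I: "(k, l) \<in> I2" "(i, j) \<in> I2" using su(2) sv(2) by (auto simp: I2_def)
    have 1: "eqm (length w) (ew ((i, l) # u)) (ew ((i, l) # (k, j) # v))"
      using eqm_Cons[of "(k, j) # v" u "(i, l)"] v su sv by simp
    have 2: "eqm (length w) (ew ((i, l) # (k, j) # v)) (ew ((k, l) # (i, j) # v))"
      using eqm_mult(2)[OF swap_upper[OF su(2) sv(2)] sv(1)] su sv by (simp add: ew_Cons mult.assoc)
    have 3: "eqm (length w) (ew ((k, l) # (i, j) # v)) (ew ((i, j) # (k, l) # v))"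
      using eqm_mult(2)[OF swap_letters[OF I] sv(1)] su sv by (simp add: ew_Cons mult.assoc)
    have "eqm (length w) (ew w) (ew ((i, j) # (k, l) # v))"
      using eqm_trans[OF eqm_trans[OF eqm_trans[OF u(2) 1] 2] 3] .
    moreover have "ixs w = ixs ((i, j) # (k, l) # v)" using u(1) v(1) by (simp add: ixs_def add_mset_commute)
    ultimately show ?thesis using sv I by (intro exI[of _ "(k, l) # v"]) simp
  qed
qed

lemma ixs_length: "ixs w = ixs v \<Longrightarrow> length w = length v"
  by (metis ixs_def Pair_inject size_image_mset size_mset)

text \<open>How upper and lower indices are paired into letters, and in which order, is immaterial
  modulo lower degree: by \<open>front_type\<close> the first letter of \<open>w\<close> can be
  formed at the front of \<open>w'\<close>, and induction handles the rest.\<close>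

lemma ixs_eqm: "set w \<subseteq> I2 \<Longrightarrow> set w' \<subseteq> I2 \<Longrightarrow> ixs w' = ixs w \<Longrightarrow> eqm (length w) (ew w') (ew w)"
proof (induction w arbitrary: w')
  case Nil
  then have "w' = []" using ixs_length[of w' "[]"] by simp
  then show ?case by (simp add: eqm_refl)
next
  case (Cons x w)
  obtain i j where x: "x = (i, j)" by (cases x)
  have "fst x \<in># fst (ixs w')" "snd x \<in># snd (ixs w')" unfolding Cons.prems(3) by (simp_all add: ixs_def)
  then have "i \<in> fst ` set w'" "j \<in> snd ` set w'" by (auto simp: ixs_def x)
  then obtain v where v: "set v \<subseteq> I2" "ixs w' = ixs ((i, j) # v)" "eqm (length w') (ew w') (ew ((i, j) # v))"
    using front_type[OF Cons.prems(2)] by blast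
  have "ixs v = ixs w" using v(2) Cons.prems(3) by (simp add: ixs_def x)
  then have "eqm (length w) (ew v) (ew w)" using Cons v by simp
  then have "eqm (length (x # w)) (ew (x # v)) (ew (x # w))" using eqm_Cons Cons.prems(1) by simp
  moreover have "length w' = length (x # w)" using ixs_length[OF Cons.prems(3)] .
  ultimately show ?case using v(3) x eqm_trans by simp
qed

lemma front2:
  assumes w: "set w \<subseteq> I2" and P: "length (filter P w) \<ge> 2"
  shows "\<exists>x y v. P x \<and> P y \<and> mset w = add_mset x (add_mset y (mset v)) \<and> eqm (length w) (ew w) (ew (x # y # v))"
proof -
  have "filter P w \<noteq> []" using P by auto
  then obtain x where x: "x \<in> set w" "P x" by (auto simp: filter_empty_conv)
  obtain u where u: "mset w = add_mset x (mset u)" "eqm (length w) (ew w) (ew (x # u))"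
    using move_front[OF w x(1)] by blast
  note su = move_front_I2[OF w u(1)]
  have "size (filter_mset P (mset w)) = Suc (size (filter_mset P (mset u)))" using u(1) x(2) by simp
  then have "length (filter P w) = Suc (length (filter P u))" by (simp only: mset_filter[symmetric] size_mset)
  then have "filter P u \<noteq> []" using P by auto
  then obtain y where y: "y \<in> set u" "P y" by (auto simp: filter_empty_conv)
  obtain v where v: "mset u = add_mset y (mset v)" "eqm (length u) (ew u) (ew (y # v))"
    using move_front[OF su(1) y(1)] by blast
  note sv = move_front_I2[OF su(1) v(1)]
  have "eqm (length w) (ew (x # u)) (ew (x # y # v))"
    using eqm_Cons[of "y # v" u x] v su sv by simp
  then have "eqm (length w) (ew w) (ew (x # y # v))" by (rule eqm_trans[OF u(2)])
  moreover have "mset w = add_mset x (add_mset y (mset v))" using u(1) v(1) by simp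
  ultimately show ?thesis using x(2) y(2) by (intro exI[of _ x] exI[of _ y] exI[of _ v] conjI)
qed

lemma repeat_JJ:
  assumes w: "set w \<subseteq> I2" and P: "length (filter P w) \<ge> 2"
    and sq: "\<And>x y. P x \<Longrightarrow> P y \<Longrightarrow> x \<in> I2 \<Longrightarrow> y \<in> I2 \<Longrightarrow> e x * e y \<in> JJ 2"
  shows "ew w \<in> JJ (length w)"
proof -
  obtain x y v where v: "P x" "P y" "mset w = add_mset x (add_mset y (mset v))" "eqm (length w) (ew w) (ew (x # y # v))"
    using front2[OF w P] by blast
  have I: "x \<in> I2" "y \<in> I2" "set v \<subseteq> I2" and l: "length w = length v + 2"
    using mset_eq_setD[of w "x # y # v"] mset_eq_length[of w "x # y # v"] w v(3) by auto
  have "ew (x # y # v) \<in> JJ (length w)"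
    using md_mult(2)[OF Jt I(3) sq[OF v(1,2) I(1,2)]] l by (simp add: ew_Cons mult.assoc add.commute)
  then show ?thesis using eqm_JJ v(4) by blast
qed

text \<open>No odd index occurs twice above or twice below. Words violating this are of lower degree
  modulo the Joseph ideal (\<open>not_nr_JJ\<close>).\<close>

definition nr :: "(nat \<times> nat) list \<Rightarrow> bool" where
  "nr w \<longleftrightarrow> (\<forall>a\<ge>m. length (filter (\<lambda>y. fst y = a) w) \<le> 1 \<and> length (filter (\<lambda>y. snd y = a) w) \<le> 1)"

lemma not_nr_JJ: assumes "set w \<subseteq> I2" "\<not> nr w" shows "ew w \<in> JJ (length w)"
proof -
  obtain a where a: "\<not> a < m" "length (filter (\<lambda>y. fst y = a) w) \<ge> 2 \<or> length (filter (\<lambda>y. snd y = a) w) \<ge> 2"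
  proof -
    obtain a where "a \<ge> m" "\<not> (length (filter (\<lambda>y. fst y = a) w) \<le> 1 \<and> length (filter (\<lambda>y. snd y = a) w) \<le> 1)"
      using assms(2) unfolding nr_def by blast
    then show thesis using that[of a] by linarith
  qed
  from a(2) show ?thesis
  proof
    assume "length (filter (\<lambda>y. fst y = a) w) \<ge> 2"
    then show ?thesis by (rule repeat_JJ[OF assms(1)]) (use a(1) odd_square_upper in auto)
  next
    assume "length (filter (\<lambda>y. snd y = a) w) \<ge> 2"
    then show ?thesis by (rule repeat_JJ[OF assms(1)]) (use a(1) odd_square_lower in auto)
  qed
qed

end

context sl_super
begin

text \<open>If \<open>D x\<close> replaces the letters satisfying \<open>P\<close> by multiples of their images under \<open>r\<close> and
  annihilates all others, then its highest power not vanishing on \<open>ew w\<close> replaces all of them.\<close>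

lemma D_power_ew:
  assumes x: "x \<in> I2" and S: "S \<subseteq> I2"
    and P: "\<And>y. y \<in> S \<Longrightarrow> P y \<Longrightarrow> D x (e y) = tscale (k y) (e (r y))" "\<And>y. y \<in> S \<Longrightarrow> P y \<Longrightarrow> k y \<noteq> 0"
    and Q: "\<And>y. y \<in> S \<Longrightarrow> \<not> P y \<Longrightarrow> D x (e y) = 0"
    and R: "\<And>y. y \<in> S \<Longrightarrow> P y \<Longrightarrow> r y \<in> I2 \<and> D x (e (r y)) = 0"
  shows "set w \<subseteq> S \<Longrightarrow> (\<forall>y. psg x y = 1) \<or> length (filter P w) \<le> 1 \<Longrightarrow>
    (\<exists>c. c \<noteq> 0 \<and> (D x ^^ length (filter P w)) (ew w) = tscale c (ew (map (\<lambda>y. if P y then r y else y) w)))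
    \<and> (\<forall>q>length (filter P w). (D x ^^ q) (ew w) = 0)"
proof (induction w)
  case Nil
  have "(D x ^^ q) 1 = 0" if q: "q > 0" for q
  proof -
    obtain p where "q = Suc p" using q by (cases q) auto
    moreover have "(D x ^^ p) 0 = 0" for p by (induction p) (simp_all add: tlin_0[OF tlin_D])
    ultimately show ?thesis by (simp add: funpow_Suc_right D_one[OF x] del: funpow.simps)
  qed
  then show ?case by (intro conjI exI[of _ 1]) auto
next
  case (Cons y w)
  have y: "y \<in> S" "y \<in> I2" "set w \<subseteq> S" using Cons.prems S by auto
  have De: "D x (e z * t) = D x (e z) * t + tscale (psg x z) (e z * D x t)" if "z \<in> I2" for z t
    using D_e_mult[OF x that] D_e[OF x that] by simp
  have le: "length (filter P w) \<le> length (filter P (y # w))" by simp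
  obtain c where c: "c \<noteq> 0" "(D x ^^ length (filter P w)) (ew w) = tscale c (ew (map (\<lambda>y. if P y then r y else y) w))"
    and v: "\<And>q. q > length (filter P w) \<Longrightarrow> (D x ^^ q) (ew w) = 0"
  proof -
    have "(\<forall>y. psg x y = 1) \<or> length (filter P w) \<le> 1" using Cons.prems(2) le le_trans by blast
    from Cons.IH[OF y(3) this] show thesis using that by blast
  qed
  have pz: "psg x y \<noteq> 0" by (simp add: psg_def)
  show ?case
  proof (cases "P y")
    case False
    have D: "(D x ^^ q) (e y * t) = tscale (psg x y ^ q) (e y * (D x ^^ q) t)" for q t
      by (induction q) (simp_all add: De[OF y(2)] Q[OF y(1) False] tlin_scale[OF tlin_D] mult.commute)
    show ?thesis
      using False c v pz
      by (auto simp: ew_Cons D tscale_mult_right intro!: exI[of _ "psg x y ^ length (filter P w) * c"])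
  next
    case True
    note r = R[OF y(1) True]
    have Dr: "(D x ^^ q) (e (r y) * t) = tscale (psg x (r y) ^ q) (e (r y) * (D x ^^ q) t)" for q t
      by (induction q) (simp_all add: De r tlin_scale[OF tlin_D] mult.commute)
    let ?l = "length (filter P w)"
    have lin: "(D x ^^ q) (t + u) = (D x ^^ q) t + (D x ^^ q) u" "(D x ^^ q) (tscale b t) = tscale b ((D x ^^ q) t)" for q t u b
      by (induction q arbitrary: t u) (simp_all add: tlin_add[OF tlin_D] tlin_scale[OF tlin_D])
    have Suc: "(D x ^^ Suc q) (e y * t) = tscale (k y) ((D x ^^ q) (e (r y) * t)) + tscale (psg x y) ((D x ^^ q) (e y * D x t))" for q t
      unfolding funpow_Suc_right comp_def De[OF y(2)] P(1)[OF y(1) True] by (simp add: lin tscale_mult_left)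
    show ?thesis
    proof (cases "\<forall>y. psg x y = 1")
      case ev: True
      have ps: "psg x z = 1" for z using ev by blast
      \<comment> \<open>Leibniz rule: \<open>D x\<close> kills the replaced letter, so at most one
        of the \<open>Suc q\<close> applications hits \<open>e y\<close>, and there are
        \<open>Suc q\<close> choices for it. This positive integer keeps the final coefficient
        nonzero.\<close>
      have D: "(D x ^^ Suc q) (e y * t) = tscale (of_nat (Suc q) * k y) (e (r y) * (D x ^^ q) t) + e y * (D x ^^ Suc q) t" for q t
      proof (induction q arbitrary: t)
        case 0 then show ?case by (simp add: ps De[OF y(2)] P(1)[OF y(1) True] tscale_mult_left)
      next
        case (Suc q)
        have "(D x ^^ Suc (Suc q)) (e y * t) = D x ((D x ^^ Suc q) (e y * t))" by simp
        also have "\<dots> = tscale (of_nat (Suc q) * k y) (e (r y) * (D x ^^ Suc q) t)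
            + (tscale (k y) (e (r y) * (D x ^^ Suc q) t) + e y * (D x ^^ Suc (Suc q)) t)"
          unfolding Suc using r
          by (simp add: ps tlin_add[OF tlin_D] tlin_scale[OF tlin_D] De[OF y(2)] De r P(1)[OF y(1) True] tscale_mult_left)
        also have "\<dots> = tscale (of_nat (Suc (Suc q)) * k y) (e (r y) * (D x ^^ Suc q) t) + e y * (D x ^^ Suc (Suc q)) t"
        proof -
          have "(of_nat (Suc (Suc q)) :: complex) * k y = of_nat (Suc q) * k y + k y" by (simp add: algebra_simps)
          then show ?thesis by (simp only: tv.scale_left_distrib add.assoc)
        qed
        finally show ?case .
      qed
      have nz: "of_nat (Suc ?l) * k y * c \<noteq> 0" using P(2)[OF y(1) True] c(1) by (simp del: of_nat_Suc)
      have "(D x ^^ Suc ?l) (ew (y # w)) = tscale (of_nat (Suc ?l) * k y * c) (ew (map (\<lambda>y. if P y then r y else y) (y # w)))"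
      proof -
        have "(D x ^^ Suc ?l) (ew w) = 0" by (rule v) simp
        then show ?thesis unfolding ew_Cons D c(2) using True by (simp add: tscale_mult_right ew_Cons)
      qed
      moreover have "(D x ^^ q) (ew (y # w)) = 0" if q: "q > Suc ?l" for q
      proof -
        obtain p where p: "q = Suc p" "p > ?l" using q by (cases q) auto
        show ?thesis unfolding p(1) ew_Cons D using v[OF p(2)] v[of "Suc p"] p(2) by simp
      qed
      moreover have "length (filter P (y # w)) = Suc ?l" using True by simp
      ultimately show ?thesis using nz by (simp only:) blast
    next
      case False
      \<comment> \<open>With signs present the choices need not add up, but here \<open>y\<close> is
        the only letter to be replaced, so a single application suffices.\<close>
      then have "length (filter P (y # w)) \<le> 1" using Cons.prems(2) by blast
      then have l0: "?l = 0" using True by simp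
      have t0: "D x (ew w) = 0" using v[of 1] l0 by simp
      have z: "(D x ^^ q) 0 = 0" for q by (induction q) (simp_all add: tlin_0[OF tlin_D])
      have D: "(D x ^^ Suc q) (e y * ew w) = tscale (k y) ((D x ^^ q) (e (r y) * ew w))" for q
        unfolding Suc t0 by (simp add: z)
      have "(D x ^^ q) (ew (y # w)) = 0" if q: "q > 1" for q
      proof -
        obtain p where p: "q = Suc p" "p > 0" using q by (cases q) auto
        show ?thesis unfolding p(1) ew_Cons D Dr using v[of p] p(2) l0 by simp
      qed
      moreover have "(D x ^^ 1) (ew (y # w)) = tscale (k y * c) (ew (map (\<lambda>y. if P y then r y else y) (y # w)))"
        using D[of 0] c(2) l0 True by (simp add: ew_Cons tscale_mult_right)
      moreover have "length (filter P (y # w)) = 1" using True l0 by simp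
      moreover have "k y * c \<noteq> 0" using P(2)[OF y(1) True] c(1) by simp
      ultimately show ?thesis by (simp only:) blast
    qed
  qed
qed

lemma span_words:
  assumes "t \<in> tv.span (ew ` A)"
  obtains F c where "finite F" "F \<subseteq> A" "t = (\<Sum>w\<in>F. tscale (c w) (ew w))"
proof -
  obtain E r where E: "finite E" "E \<subseteq> ew ` A" "t = (\<Sum>a\<in>E. tscale (r a) a)"
    using assms unfolding tv.span_explicit by blast
  obtain F where F: "F \<subseteq> A" "inj_on ew F" "E = ew ` F" using E(2) unfolding subset_image_inj by blast
  have "finite F" using E(1) F(2,3) finite_image_iff by blast
  moreover have "t = (\<Sum>w\<in>F. tscale (r (ew w)) (ew w))" unfolding E(3) F(3) by (simp add: sum.reindex[OF F(2)])
  ultimately show ?thesis using F(1) by (intro that[of F "\<lambda>w. r (ew w)"])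
qed

lemma wtw_filter: "wtw i w = int (length (filter (\<lambda>y. fst y = i) w)) - int (length (filter (\<lambda>y. snd y = i) w))"
  by (induction w) (simp_all add: wtw_def)

lemma wtw_total: "set w \<subseteq> I2 \<Longrightarrow> (\<Sum>a<d. wtw a w) = 0"
proof (induction w)
  case Nil then show ?case by (simp add: wtw_def)
next
  case (Cons y w)
  have "(\<Sum>a<d. wtw a (y # w)) = (\<Sum>a<d. if fst y = a then 1 else 0) - (\<Sum>a<d. if snd y = a then 1 else 0) + (\<Sum>a<d. wtw a w)"
    by (simp add: wtw_def sum.distrib sum_subtractf)
  then show ?case using Cons by (cases y) (simp add: I2_def)
qed

end

context joseph
begin

lemma filter_ixs:
  assumes "ixs w = ixs v"
  shows "length (filter (\<lambda>y. fst y = i) w) = length (filter (\<lambda>y. fst y = i) v)"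
    and "length (filter (\<lambda>y. snd y = i) w) = length (filter (\<lambda>y. snd y = i) v)"
proof -
  have f: "length (filter (\<lambda>y. fst y = i) w) = count (image_mset fst (mset w)) i"
     "length (filter (\<lambda>y. snd y = i) w) = count (image_mset snd (mset w)) i" for w :: "(nat \<times> nat) list"
    by (induction w) auto
  show "length (filter (\<lambda>y. fst y = i) w) = length (filter (\<lambda>y. fst y = i) v)"
    and "length (filter (\<lambda>y. snd y = i) w) = length (filter (\<lambda>y. snd y = i) v)"
    unfolding f using assms by (simp_all add: ixs_def)
qed

text \<open>A word of nonnegative weight in \<open>i\<close> can be rewritten without lower index \<open>i\<close>, because
  \<open>e\<^sub>i\<^sub>i\<close> is minus the sum of the other diagonal generators.\<close>

definition nolow :: "nat \<Rightarrow> nat \<Rightarrow> (nat \<times> nat) list set" where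
  "nolow i L = {w. set w \<subseteq> I2 \<and> length w = L \<and> i \<notin> snd ` set w}"

lemma reducible_s: "tv.subspace {t. \<exists>q\<in>tv.span (ew ` nolow i L). t - q \<in> JJ L}"
  by (rule subspace_mod[OF tv.subspace_span JJ_s])

lemma remove_lower:
  assumes i: "i < d"
  shows "length (filter (\<lambda>y. snd y = i) w) = p \<Longrightarrow> set w \<subseteq> I2 \<Longrightarrow> length w = L \<Longrightarrow> wtw i w \<ge> 0 \<Longrightarrow>
    \<exists>q\<in>tv.span (ew ` nolow i L). ew w - q \<in> JJ L"
proof (induction p arbitrary: w)
  case 0
  then have "w \<in> nolow i L" by (auto simp: nolow_def filter_empty_conv)
  then show ?case using tv.span_base[of "ew w" "ew ` nolow i L"] tv.subspace_0[OF JJ_s] by force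
next
  case (Suc p)
  let ?R = "{t. \<exists>q\<in>tv.span (ew ` nolow i L). t - q \<in> JJ L}"
  have "filter (\<lambda>y. snd y = i) w \<noteq> []" using Suc.prems(1) by force
  then have "\<exists>y\<in>set w. snd y = i" by (auto simp: filter_empty_conv)
  then have lo: "i \<in> snd ` set w" by force
  \<comment> \<open>Nonnegative weight provides an upper \<open>i\<close> for a lower one, so that
    \<open>front_type\<close> can form the letter \<open>(i, i)\<close>.\<close>
  have "length (filter (\<lambda>y. fst y = i) w) > 0" using Suc.prems(1,4) wtw_filter[of i w] by linarith
  then have "\<exists>y\<in>set w. fst y = i" by (auto simp: filter_empty_conv)
  then have up: "i \<in> fst ` set w" by force
  obtain v where v: "set v \<subseteq> I2" "ixs w = ixs ((i, i) # v)" "eqm (length w) (ew w) (ew ((i, i) # v))"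
    using front_type[OF Suc.prems(2) up lo] by blast
  have L: "L = Suc (length v)" using ixs_length[OF v(2)] Suc.prems(3) by simp
  have fv: "length (filter (\<lambda>y. snd y = i) v) = p" "wtw i v \<ge> 0"
    using filter_ixs[OF v(2), of i] Suc.prems(1,4) by (simp_all add: wtw_filter)
  have R: "ew ((a, a) # v) \<in> ?R" if a: "a < d" "a \<noteq> i" for a
  proof -
    have "wtw i ((a, a) # v) \<ge> 0" using fv(2) by (simp add: wtw_def)
    then show ?thesis using Suc.IH[of "(a, a) # v"] fv v(1) a L by (simp add: I2_def)
  qed
  have "(\<Sum>a<d. ew ((a, a) # v)) = 0"
    using sum_distrib_right[of "\<lambda>a. e (a, a)" "{..<d}" "ew v"] by (simp add: ew_Cons sum_e_diag)
  then have "ew ((i, i) # v) + (\<Sum>a\<in>{..<d} - {i}. ew ((a, a) # v)) = 0" using i by (simp add: sum.remove[of _ i])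
  then have "ew ((i, i) # v) = - (\<Sum>a\<in>{..<d} - {i}. ew ((a, a) # v))" by (simp add: eq_neg_iff_add_eq_0)
  moreover have "(\<Sum>a\<in>{..<d} - {i}. ew ((a, a) # v)) \<in> ?R" by (rule tv.subspace_sum[OF reducible_s]) (use R in blast)
  ultimately have iv: "ew ((i, i) # v) \<in> ?R" by (simp only: tv.subspace_neg[OF reducible_s])
  obtain c where c: "ew w - tscale c (ew ((i, i) # v)) \<in> JJ L" using v(3) Suc.prems(3) unfolding eqm_def by blast
  have "ew w - tscale c (ew ((i, i) # v)) \<in> ?R" using c tv.span_zero[of "ew ` nolow i L"] by force
  then have "(ew w - tscale c (ew ((i, i) # v))) + tscale c (ew ((i, i) # v)) \<in> ?R"
    by (rule tv.subspace_add[OF reducible_s _ tv.subspace_scale[OF reducible_s iv]])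
  then show ?case by simp
qed

text \<open>Some weight component stays outside \<open>JJ L\<close>. If all its even weights were
  negative, the weights of the \<open>n\<close> odd indices would sum to at least \<open>m\<close>,
  which exceeds \<open>n\<close>, so one of them would be at least 2. That odd index would repeat
  above, putting all words into \<open>JJ L\<close>. Hence some even weight is nonnegative and
  \<open>remove_lower\<close> applies.\<close>

lemma exists_nolow:
  assumes g: "g \<in> tens m n L" "g \<in> KK L" "g \<notin> JJ L"
  shows "\<exists>i<m. \<exists>q\<in>tv.span (ew ` nolow i L). q \<in> KK L \<and> q \<notin> JJ L"
proof -
  have "g \<in> tv.span (ew ` {w. set w \<subseteq> I2 \<and> length w = L})" using g(1) unfolding tens_ew by (simp only: image_Collect)
  then obtain F c where F: "finite F" "F \<subseteq> {w. set w \<subseteq> I2 \<and> length w = L}" and gs: "g = (\<Sum>w\<in>F. tscale (c w) (ew w))"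
    by (rule span_words)
  \<comment> \<open>Cut off at \<open>d\<close>, so that equality of these functions means equality
    of all weights.\<close>
  define h where "h = (\<lambda>w a. if a < d then wtw a w else 0)"
  let ?C = "\<lambda>v. \<Sum>w\<in>{w\<in>F. h w = v}. tscale (c w) (ew w)"
  have "g = (\<Sum>v\<in>h ` F. ?C v)" unfolding gs by (rule sum.image_gen[OF F(1)])
  moreover have "(\<Sum>v\<in>h ` F. ?C v) \<in> JJ L" if "\<forall>v\<in>h ` F. ?C v \<in> JJ L"
    by (rule tv.subspace_sum[OF JJ_s]) (use that in blast)
  ultimately obtain v where v: "v \<in> h ` F" "?C v \<notin> JJ L" using g(3) by auto
  have eq: "{w\<in>F. h w = v} = {w\<in>F. \<forall>a<d. wtw a w = v a}"
    using v(1) by (auto simp: h_def fun_eq_iff)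
  have K: "?C v \<in> KK L"
    unfolding eq
  proof (rule weights_split[OF F(1) _ KK_s])
    show "set w \<subseteq> I2" if "w \<in> F" for w using F(2) that by blast
    show "D (a, a) t \<in> KK L" if "t \<in> KK L" "a < d" for t a
      using that by (intro md_D Kt_D) (auto simp: I2_def)
    show "(\<Sum>w\<in>F. tscale (c w) (ew w)) \<in> KK L" using g(2) gs by simp
  qed simp
  show ?thesis
  proof (cases "\<exists>i<m. v i \<ge> 0")
    case True
    then obtain i where i: "i < m" "v i \<ge> 0" by blast
    let ?R = "{t. \<exists>q\<in>tv.span (ew ` nolow i L). t - q \<in> JJ L}"
    have "ew w \<in> ?R" if "w \<in> {w\<in>F. h w = v}" for w
    proof -
      have w: "set w \<subseteq> I2" "length w = L" "wtw i w \<ge> 0" using that F(2) i by (auto simp: h_def)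
      show ?thesis using remove_lower[OF _ refl w] i(1) by simp
    qed
    then have "?C v \<in> ?R" by (intro tv.subspace_sum[OF reducible_s] tv.subspace_scale[OF reducible_s])
    then obtain q where q: "q \<in> tv.span (ew ` nolow i L)" "?C v - q \<in> JJ L" by blast
    have "?C v - (?C v - q) \<in> KK L" by (rule tv.subspace_diff[OF KK_s K subsetD[OF JJ_KK q(2)]])
    moreover have "q \<notin> JJ L"
    proof
      assume "q \<in> JJ L"
      then have "(?C v - q) + q \<in> JJ L" by (rule tv.subspace_add[OF JJ_s q(2)])
      then show False using v(2) by simp
    qed
    ultimately show ?thesis using i(1) q(1) by auto
  next
    case False
    have "ew w \<in> JJ L" if w: "w \<in> {w\<in>F. h w = v}" for w
    proof -
      have wI: "set w \<subseteq> I2" "length w = L" using w F(2) by auto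
      have neg: "wtw a w \<le> -1" if "a < m" for a
      proof -
        have "h w a = v a" using w by simp
        then show ?thesis using False that by (auto simp: h_def not_le)
      qed
      have "(\<Sum>a<m. wtw a w) \<le> (\<Sum>a<m. -1)" by (rule sum_mono) (use neg in simp)
      moreover have "(\<Sum>a<d. wtw a w) = (\<Sum>a<m. wtw a w) + (\<Sum>a\<in>{m..<d}. wtw a w)"
        using sum.atLeastLessThan_concat[of 0 m d "\<lambda>a. wtw a w"] by (simp add: lessThan_atLeast0)
      ultimately have "(\<Sum>a\<in>{m..<d}. wtw a w) \<ge> int m" using wtw_total[OF wI(1)] by simp
      have "\<not> (\<forall>a\<in>{m..<d}. wtw a w \<le> 1)"
      proof
        assume "\<forall>a\<in>{m..<d}. wtw a w \<le> 1"
        then have "(\<Sum>a\<in>{m..<d}. wtw a w) \<le> (\<Sum>a\<in>{m..<d}. 1)" by (intro sum_mono) simp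
        then show False using \<open>(\<Sum>a\<in>{m..<d}. wtw a w) \<ge> int m\<close> mn by simp
      qed
      then obtain a where "a \<ge> m" "wtw a w \<ge> 2" by force
      then have "length (filter (\<lambda>y. fst y = a) w) \<ge> 2" by (simp add: wtw_filter)
      then have "\<not> nr w" unfolding nr_def using \<open>a \<ge> m\<close> by fastforce
      then show ?thesis using not_nr_JJ[OF wI(1)] wI(2) by simp
    qed
    then have "?C v \<in> JJ L" by (intro tv.subspace_sum[OF JJ_s] tv.subspace_scale[OF JJ_s])
    then show ?thesis using v(2) by blast
  qed
qed

text \<open>A formal linear combination, lying in \<open>KK L\<close>, of words that are pairwise inequivalent.\<close>

definition fam :: "nat \<Rightarrow> (nat \<times> nat) list set \<Rightarrow> ((nat \<times> nat) list \<Rightarrow> complex) \<Rightarrow> bool" where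
  "fam L F c \<longleftrightarrow> finite F \<and> F \<noteq> {} \<and> (\<forall>w\<in>F. c w \<noteq> 0 \<and> set w \<subseteq> I2 \<and> length w = L \<and> nr w) \<and> inj_on ixs F
     \<and> (\<Sum>w\<in>F. tscale (c w) (ew w)) \<in> KK L"

text \<open>Among the combinations in \<open>KK L\<close> outside \<open>JJ L\<close>, take one with
  the fewest words. A word that is of lower degree could be dropped, and two words with the same
  indices could be merged, so neither occurs.\<close>

lemma exists_fam:
  assumes q: "q \<in> tv.span (ew ` nolow i L)" "q \<in> KK L" "q \<notin> JJ L"
  shows "\<exists>F c. fam L F c \<and> F \<subseteq> nolow i L"
proof -
  let ?g = "\<lambda>F c. \<Sum>w\<in>F. tscale (c w) (ew w)"
  let ?P = "\<lambda>k. \<exists>F c. finite F \<and> card F = k \<and> F \<subseteq> nolow i L \<and> ?g F c \<in> KK L \<and> ?g F c \<notin> JJ L"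
  have "\<exists>k. ?P k"
  proof -
    obtain F c where "finite F" "F \<subseteq> nolow i L" "q = ?g F c" by (rule span_words[OF q(1)])
    then show ?thesis using q(2,3) by blast
  qed
  then have P: "?P (LEAST k. ?P k)" by (rule LeastI_ex)
  then obtain F c where F: "finite F" "card F = (LEAST k. ?P k)" "F \<subseteq> nolow i L" "?g F c \<in> KK L" "?g F c \<notin> JJ L" by blast
  have minimal: "card F \<le> card F'" if "finite F'" "F' \<subseteq> nolow i L" "?g F' c' \<in> KK L" "?g F' c' \<notin> JJ L" for F' c'
    unfolding F(2) by (rule Least_le) (use that in blast)
  have sub: "?g F c - t \<in> KK L \<and> ?g F c - t \<notin> JJ L" if t: "t \<in> JJ L" for t
  proof
    show "?g F c - t \<in> KK L" by (rule tv.subspace_diff[OF KK_s F(4) subsetD[OF JJ_KK t]])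
    show "?g F c - t \<notin> JJ L"
    proof
      assume "?g F c - t \<in> JJ L"
      then have "(?g F c - t) + t \<in> JJ L" by (rule tv.subspace_add[OF JJ_s _ t])
      then show False using F(5) by simp
    qed
  qed
  have rm: "?g F c = tscale (c w) (ew w) + ?g (F - {w}) c" if "w \<in> F" for w by (rule sum.remove[OF F(1) that])
  have less: "card (F - {w}) < card F" if "w \<in> F" for w using F(1) that by (rule card_Diff1_less)
  have nJ: "tscale (c w) (ew w) \<notin> JJ L" if w: "w \<in> F" for w
  proof
    assume "tscale (c w) (ew w) \<in> JJ L"
    then have "?g (F - {w}) c \<in> KK L \<and> ?g (F - {w}) c \<notin> JJ L" using sub[of "tscale (c w) (ew w)"] rm[OF w] by simp
    then have "card F \<le> card (F - {w})" using F by (intro minimal[of "F - {w}" c]) auto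
    then show False using less[OF w] by simp
  qed
  have wF: "set w \<subseteq> I2" "length w = L" if "w \<in> F" for w using F(3) that by (auto simp: nolow_def)
  have c: "c w \<noteq> 0" "nr w" if w: "w \<in> F" for w
  proof -
    show "c w \<noteq> 0" using nJ[OF w] tv.subspace_0[OF JJ_s] by force
    show "nr w" using nJ[OF w] not_nr_JJ[OF wF(1)[OF w]] wF(2)[OF w] tv.subspace_scale[OF JJ_s] by blast
  qed
  have "inj_on ixs F"
  proof (rule inj_onI, rule ccontr)
    fix w v assume w: "w \<in> F" and v: "v \<in> F" and eq: "ixs w = ixs v" and ne: "w \<noteq> v"
    have "eqm L (ew w) (ew v)" using ixs_eqm[OF wF(1)[OF v] wF(1)[OF w] eq] wF(2)[OF v] by simp
    then obtain b where b: "ew w - tscale b (ew v) \<in> JJ L" unfolding eqm_def by blast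
    let ?c = "c(v := c v + c w * b)"
    have vF: "v \<in> F - {w}" using v ne by blast
    have "?g (F - {w}) ?c = tscale (?c v) (ew v) + ?g (F - {w} - {v}) ?c" by (rule sum.remove[OF _ vF]) (use F(1) in simp)
    also have "?g (F - {w} - {v}) ?c = ?g (F - {w} - {v}) c" by (rule sum.cong) auto
    finally have 1: "?g (F - {w}) ?c = tscale (c v + c w * b) (ew v) + ?g (F - {w} - {v}) c" by simp
    have 2: "?g (F - {w}) c = tscale (c v) (ew v) + ?g (F - {w} - {v}) c" by (rule sum.remove[OF _ vF]) (use F(1) in simp)
    have "?g (F - {w}) ?c = ?g F c - tscale (c w) (ew w - tscale b (ew v))"
      unfolding 1 rm[OF w] 2 by (simp add: tv.scale_left_distrib tv.scale_right_diff_distrib)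
    then have "?g (F - {w}) ?c \<in> KK L \<and> ?g (F - {w}) ?c \<notin> JJ L" using sub[OF tv.subspace_scale[OF JJ_s b]] by simp
    then have "card F \<le> card (F - {w})" using F by (intro minimal[of "F - {w}" ?c]) auto
    then show False using less[OF w] by simp
  qed
  moreover have "F \<noteq> {}" using F(5) tv.subspace_0[OF JJ_s] by auto
  ultimately have "fam L F c" unfolding fam_def using F c wF by blast
  then show ?thesis using F(3) by blast
qed

text \<open>Applying \<open>D x\<close> as often as the largest number of replaceable letters in a
  word of the family kills the words with fewer of them and replaces all such letters in the others.
  These keep nonzero coefficients and stay inequivalent by the last hypothesis, so the new family is
  again nonempty and without cancellation.\<close>

lemma fam_step:
  assumes fam: "fam L F c" and x: "x \<in> I2" and S: "S \<subseteq> I2" "\<And>w. w \<in> F \<Longrightarrow> set w \<subseteq> S"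
    and P: "\<And>y. y \<in> S \<Longrightarrow> P y \<Longrightarrow> D x (e y) = tscale (k y) (e (r y))" "\<And>y. y \<in> S \<Longrightarrow> P y \<Longrightarrow> k y \<noteq> 0"
    and Q: "\<And>y. y \<in> S \<Longrightarrow> \<not> P y \<Longrightarrow> D x (e y) = 0"
    and R: "\<And>y. y \<in> S \<Longrightarrow> P y \<Longrightarrow> r y \<in> I2 \<and> D x (e (r y)) = 0"
    and ev: "(\<forall>y. psg x y = 1) \<or> (\<forall>w\<in>F. length (filter P w) \<le> 1)"
    and nr: "\<And>w. w \<in> F \<Longrightarrow> nr (map (\<lambda>y. if P y then r y else y) w)"
    and inj: "\<And>w v. w \<in> F \<Longrightarrow> v \<in> F \<Longrightarrow> length (filter P w) = length (filter P v) \<Longrightarrow>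
      ixs (map (\<lambda>y. if P y then r y else y) w) = ixs (map (\<lambda>y. if P y then r y else y) v) \<Longrightarrow> ixs w = ixs v"
  shows "\<exists>F' c'. fam L F' c' \<and> F' \<subseteq> map (\<lambda>y. if P y then r y else y) ` F"
proof -
  let ?r = "map (\<lambda>y. if P y then r y else y)" and ?n = "\<lambda>w. length (filter P w)"
  have F: "finite F" "F \<noteq> {}" "\<And>w. w \<in> F \<Longrightarrow> c w \<noteq> 0 \<and> set w \<subseteq> I2 \<and> length w = L" "inj_on ixs F"
    "(\<Sum>w\<in>F. tscale (c w) (ew w)) \<in> KK L"
    using fam by (auto simp: fam_def)
  \<comment> \<open>The maximum, so that the sum over \<open>F\<close> collapses to the words in
    \<open>G\<close>.\<close>
  define M where "M = Max (?n ` F)"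
  define G where "G = {w\<in>F. ?n w = M}"
  have "M \<in> ?n ` F" unfolding M_def by (rule Max_in) (use F in auto)
  then have Gne: "G \<noteq> {}" by (auto simp: G_def)
  have le: "?n w \<le> M" if "w \<in> F" for w unfolding M_def using F(1) that by simp
  have fG: "finite G" "G \<subseteq> F" using F(1) by (auto simp: G_def)
  have D: "(\<exists>b. b \<noteq> 0 \<and> (D x ^^ ?n w) (ew w) = tscale b (ew (?r w))) \<and> (\<forall>q>?n w. (D x ^^ q) (ew w) = 0)" if w: "w \<in> F" for w
    by (rule D_power_ew[OF x S(1) P Q R S(2)[OF w]]) (use ev w in blast)+
  then have "\<forall>w. \<exists>b. w \<in> F \<longrightarrow> b \<noteq> 0 \<and> (D x ^^ ?n w) (ew w) = tscale b (ew (?r w))" by blast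
  from choice[OF this] obtain b where "\<forall>w. w \<in> F \<longrightarrow> b w \<noteq> 0 \<and> (D x ^^ ?n w) (ew w) = tscale (b w) (ew (?r w))" by blast
  then have b: "\<And>w. w \<in> F \<Longrightarrow> b w \<noteq> 0 \<and> (D x ^^ ?n w) (ew w) = tscale (b w) (ew (?r w))" by blast
  have injr: "inj_on ?r G"
  proof (rule inj_onI)
    fix w v assume w: "w \<in> G" and v: "v \<in> G" and eq: "?r w = ?r v"
    have "ixs w = ixs v" by (rule inj) (use w v eq in \<open>simp_all add: G_def\<close>)
    then show "w = v" using F(4) w v fG(2) by (meson inj_onD subsetD)
  qed
  define c' where "c' = (\<lambda>u. c (the_inv_into G ?r u) * b (the_inv_into G ?r u))"
  have c': "c' (?r w) = c w * b w" if "w \<in> G" for w unfolding c'_def by (simp add: the_inv_into_f_f[OF injr that])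
  have lin: "(D x ^^ q) (\<Sum>w\<in>A. tscale (c w) (ew w)) = (\<Sum>w\<in>A. tscale (c w) ((D x ^^ q) (ew w)))" for q A
    by (induction q) (simp_all add: tlin_sum[OF tlin_D] tlin_scale[OF tlin_D])
  have DK: "(D x ^^ q) t \<in> KK L" if "t \<in> KK L" for q t
  proof (induction q)
    case (Suc q)
    have "D x ((D x ^^ q) t) \<in> KK L" by (rule md_D[OF Kt_D[OF x] x Suc])
    then show ?case by simp
  qed (use that in simp)
  have "(\<Sum>u\<in>?r ` G. tscale (c' u) (ew u)) = (\<Sum>w\<in>G. tscale (c w * b w) (ew (?r w)))"
    by (subst sum.reindex[OF injr]) (simp add: c')
  also have "\<dots> = (\<Sum>w\<in>G. tscale (c w) ((D x ^^ M) (ew w)))"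
  proof (rule sum.cong[OF refl])
    fix w assume "w \<in> G"
    then have "(D x ^^ M) (ew w) = tscale (b w) (ew (?r w))" using b[of w] by (simp add: G_def)
    then show "tscale (c w * b w) (ew (?r w)) = tscale (c w) ((D x ^^ M) (ew w))" by simp
  qed
  also have "\<dots> = (\<Sum>w\<in>F. tscale (c w) ((D x ^^ M) (ew w)))"
  proof (rule sum.mono_neutral_left[OF F(1) fG(2)], rule ballI)
    fix w assume w: "w \<in> F - G"
    then have "?n w < M" using le[of w] by (auto simp: G_def)
    then show "tscale (c w) ((D x ^^ M) (ew w)) = 0" using D[of w] w by simp
  qed
  also have "\<dots> \<in> KK L" unfolding lin[symmetric] by (rule DK[OF F(5)])
  finally have K: "(\<Sum>u\<in>?r ` G. tscale (c' u) (ew u)) \<in> KK L" .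
  have "inj_on ixs (?r ` G)"
  proof (rule inj_onI)
    fix u u' assume "u \<in> ?r ` G" "u' \<in> ?r ` G" and eq: "ixs u = ixs u'"
    then obtain w v where wv: "w \<in> G" "v \<in> G" "u = ?r w" "u' = ?r v" by blast
    have "ixs w = ixs v" by (rule inj) (use wv eq in \<open>simp_all add: G_def\<close>)
    then have "w = v" using F(4) wv fG(2) by (meson inj_onD subsetD)
    then show "u = u'" using wv by simp
  qed
  moreover have "c' u \<noteq> 0 \<and> set u \<subseteq> I2 \<and> length u = L \<and> nr u" if u: "u \<in> ?r ` G" for u
  proof -
    obtain w where w: "w \<in> G" "u = ?r w" using u by blast
    have wF: "w \<in> F" using w fG by blast
    have "set u \<subseteq> I2" using S(1) S(2)[OF wF] R w(2) by auto
    then show ?thesis using c'[OF w(1)] b[OF wF] F(3)[OF wF] nr[OF wF] w(2) by simp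
  qed
  ultimately have "fam L (?r ` G) c'" unfolding fam_def using K Gne fG(1) by blast
  moreover have "?r ` G \<subseteq> ?r ` F" using fG(2) by blast
  ultimately show ?thesis by blast
qed

end

text \<open>Renaming \<open>q\<close> to \<open>i\<close> loses only how many copies of
  \<open>i\<close> came from \<open>q\<close>, and the second hypothesis supplies this number. It
  yields the injectivity required by \<open>fam_step\<close>, where all surviving words have the
  same number of replaced letters.\<close>

lemma merge_inj:
  assumes "image_mset (\<lambda>a. if a = q then i else a) A = image_mset (\<lambda>a. if a = q then i else a) B"
    and "count A q = count B q"
  shows "A = B"
proof (cases "i = q")
  case True
  then have "(\<lambda>a. if a = q then i else a) = (\<lambda>a. a)" by auto
  then show ?thesis using assms(1) by simp
next
  case False
  have c: "count (image_mset (\<lambda>a. if a = q then i else a) M) a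
      = (if a = i then count M i + count M q else if a = q then 0 else count M a)" for M a
    using False by (induction M) auto
  show ?thesis
  proof (rule multiset_eqI)
    fix a
    show "count A a = count B a"
      using c[of A a] c[of B a] assms by (cases "a = q"; cases "a = i") auto
  qed
qed

lemma set_replicate_subset: "set (replicate L y) \<subseteq> {y}" by auto

lemma length_filter_mono:
  assumes "\<And>y. P y \<Longrightarrow> Q y"
  shows "length (filter P w) \<le> length (filter Q w)"
proof (induction w)
  case (Cons y w)
  then show ?case using assms[of y] by simp
qed simp

lemma filter_count:
  "length (filter (\<lambda>y. fst y = i) w) = count (image_mset fst (mset w)) i"
  "length (filter (\<lambda>y. snd y = i) w) = count (image_mset snd (mset w)) i"
  by (induction w) auto

context joseph
begin

section \<open>Making all upper and all lower indices equal\<close>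

lemma psg_even: "a < m \<Longrightarrow> b < m \<Longrightarrow> psg (a, b) y = 1"
  by (simp add: psg_def X_def chi_def)

lemma nr_map:
  assumes "nr w" and "\<And>y. \<not> fst (f y) < m \<Longrightarrow> fst (f y) = fst y" "\<And>y. \<not> snd (f y) < m \<Longrightarrow> snd (f y) = snd y"
  shows "nr (map f w)"
  unfolding nr_def
proof (intro allI impI conjI)
  fix a assume a: "m \<le> a"
  have "length (filter (\<lambda>y. fst y = a) (map f w)) \<le> length (filter (\<lambda>y. fst y = a) w)"
    unfolding filter_map length_map using assms(2) a by (intro length_filter_mono) (auto simp: not_less)
  then show "length (filter (\<lambda>y. fst y = a) (map f w)) \<le> 1" using assms(1) a unfolding nr_def by (meson order_trans)
  have "length (filter (\<lambda>y. snd y = a) (map f w)) \<le> length (filter (\<lambda>y. snd y = a) w)"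
    unfolding filter_map length_map using assms(3) a by (intro length_filter_mono) (auto simp: not_less)
  then show "length (filter (\<lambda>y. snd y = a) (map f w)) \<le> 1" using assms(1) a unfolding nr_def by (meson order_trans)
qed

lemma fam_nr: "fam L F c \<Longrightarrow> w \<in> F \<Longrightarrow> nr w \<and> set w \<subseteq> I2 \<and> length w = L"
  by (simp add: fam_def)

text \<open>One index \<open>q\<close> at a time is turned into \<open>i\<close> by
  \<open>D (i, q)\<close>. Because \<open>i\<close> never occurs below, this operator acts on upper
  indices only; for odd \<open>q\<close> at most one letter is affected, by
  \<open>nr\<close>.\<close>

lemma uppers_equal:
  assumes i: "i < m" and fam: "fam L F c" "F \<subseteq> nolow i L"
  shows "q \<le> d \<Longrightarrow> \<exists>F c. fam L F c \<and> (\<forall>w\<in>F. \<forall>y\<in>set w. snd y \<noteq> i \<and> (fst y < q \<longrightarrow> fst y = i))"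
proof (induction q)
  case 0
  show ?case using fam by (intro exI[of _ F] exI[of _ c]) (force simp: nolow_def)
next
  case (Suc q)
  then obtain F c where F: "fam L F c" "\<forall>w\<in>F. \<forall>y\<in>set w. snd y \<noteq> i \<and> (fst y < q \<longrightarrow> fst y = i)" by auto
  show ?case
  proof (cases "q = i")
    case True
    then show ?thesis using F by (intro exI[of _ F] exI[of _ c]) (auto simp: less_Suc_eq)
  next
    case False
    let ?S = "{y \<in> I2. snd y \<noteq> i \<and> (fst y < q \<longrightarrow> fst y = i)}" and ?r = "\<lambda>y::nat \<times> nat. (i, snd y)"
    let ?f = "\<lambda>y. if fst y = q then (i, snd y) else y"
    have x: "(i, q) \<in> I2" using i Suc.prems by (simp add: I2_def)
    have "\<exists>F' c'. fam L F' c' \<and> F' \<subseteq> map ?f ` F"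
    proof (rule fam_step[OF F(1) x, of ?S "\<lambda>y. fst y = q" "\<lambda>_. 1"])
      show "set w \<subseteq> ?S" if w: "w \<in> F" for w using F w fam_nr[OF F(1) w] by auto
      show "D (i, q) (e y) = tscale 1 (e (i, snd y))" if "y \<in> ?S" "fst y = q" for y
        using D_e[OF x, of y] that by (simp add: br_def)
      show "D (i, q) (e y) = 0" if "y \<in> ?S" "fst y \<noteq> q" for y
        using D_e[OF x, of y] that by (simp add: br_def)
      show "(i, snd y) \<in> I2 \<and> D (i, q) (e (i, snd y)) = 0" if "y \<in> ?S" "fst y = q" for y
      proof -
        have "(i, snd y) \<in> I2" using that i by (auto simp: I2_def)
        then show ?thesis using D_e[OF x, of "(i, snd y)"] that False by (simp add: br_def)
      qed
      show "(\<forall>y. psg (i, q) y = 1) \<or> (\<forall>w\<in>F. length (filter (\<lambda>y. fst y = q) w) \<le> 1)"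
      proof (cases "q < m")
        case True
        then show ?thesis using psg_even[OF i] by blast
      next
        case False
        then show ?thesis using fam_nr[OF F(1)] unfolding nr_def by (simp add: not_less)
      qed
      show "nr (map ?f w)" if w: "w \<in> F" for w
        by (rule nr_map) (use fam_nr[OF F(1) w] i in \<open>auto split: if_splits\<close>)
      show "ixs w = ixs v" if wv: "w \<in> F" "v \<in> F" "length (filter (\<lambda>y. fst y = q) w) = length (filter (\<lambda>y. fst y = q) v)"
        "ixs (map ?f w) = ixs (map ?f v)" for w v
      proof -
        have f: "fst (?f y) = (if fst y = q then i else fst y)" "snd (?f y) = snd y" for y by simp_all
        have u: "image_mset (\<lambda>a. if a = q then i else a) (image_mset fst (mset w)) = image_mset (\<lambda>a. if a = q then i else a) (image_mset fst (mset v))"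
          and s: "image_mset snd (mset w) = image_mset snd (mset v)"
          using wv(4) by (simp_all add: ixs_def image_mset.compositionality comp_def f)
        show ?thesis using merge_inj[OF u wv(3)[unfolded filter_count]] s by (simp add: ixs_def)
      qed
    qed auto
    then obtain F' c' where F': "fam L F' c'" "F' \<subseteq> map ?f ` F" by blast
    have "snd y \<noteq> i \<and> (fst y < Suc q \<longrightarrow> fst y = i)" if w: "w \<in> F'" and y: "y \<in> set w" for w y
    proof -
      obtain v where v: "v \<in> F" "w = map ?f v" using F'(2) w by blast
      have "y \<in> ?f ` set v" using y unfolding v(2) set_map .
      then obtain z where z: "z \<in> set v" "y = ?f z" by blast
      then show ?thesis using F(2) v(1) by (auto simp: less_Suc_eq)
    qed
    then show ?thesis using F'(1) by blast
  qed
qed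

text \<open>Now \<open>D (q, i')\<close> turns lower indices \<open>q\<close> into
  \<open>i'\<close>. It does not touch the upper indices, all of which are \<open>i\<close> and
  differ from \<open>i'\<close>.\<close>

lemma lowers_equal:
  assumes i: "i < m" "i' < m" "i \<noteq> i'" and fam: "fam L F c" "\<forall>w\<in>F. \<forall>y\<in>set w. fst y = i \<and> snd y \<noteq> i"
  shows "q \<le> d \<Longrightarrow> \<exists>F c. fam L F c \<and> (\<forall>w\<in>F. \<forall>y\<in>set w. fst y = i \<and> snd y \<noteq> i \<and> (snd y < q \<longrightarrow> snd y = i'))"
proof (induction q)
  case 0
  show ?case using fam by (intro exI[of _ F] exI[of _ c]) simp
next
  case (Suc q)
  then obtain F c where F: "fam L F c" "\<forall>w\<in>F. \<forall>y\<in>set w. fst y = i \<and> snd y \<noteq> i \<and> (snd y < q \<longrightarrow> snd y = i')" by auto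
  show ?case
  proof (cases "q = i'")
    case True
    then show ?thesis using F by (intro exI[of _ F] exI[of _ c]) (auto simp: less_Suc_eq)
  next
    case False
    let ?S = "{y \<in> I2. fst y = i \<and> snd y \<noteq> i \<and> (snd y < q \<longrightarrow> snd y = i')}"
    let ?f = "\<lambda>y. if snd y = q then (fst y, i') else y"
    have x: "(q, i') \<in> I2" using i Suc.prems by (simp add: I2_def)
    have "\<exists>F' c'. fam L F' c' \<and> F' \<subseteq> map ?f ` F"
    proof (rule fam_step[OF F(1) x, of ?S "\<lambda>y. snd y = q" "\<lambda>y. - psg (q, i') y"])
      show "set w \<subseteq> ?S" if w: "w \<in> F" for w using F w fam_nr[OF F(1) w] by auto
      show "D (q, i') (e y) = tscale (- psg (q, i') y) (e (fst y, i'))" if "y \<in> ?S" "snd y = q" for y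
        using D_e[OF x, of y] that i by (simp add: br_def)
      show "D (q, i') (e y) = 0" if "y \<in> ?S" "snd y \<noteq> q" for y
        using D_e[OF x, of y] that i by (simp add: br_def)
      show "- psg (q, i') y \<noteq> 0" for y by (simp add: psg_def)
      show "(fst y, i') \<in> I2 \<and> D (q, i') (e (fst y, i')) = 0" if "y \<in> ?S" "snd y = q" for y
      proof -
        have "(fst y, i') \<in> I2" using that i by (auto simp: I2_def)
        then show ?thesis using D_e[OF x, of "(fst y, i')"] that False i by (simp add: br_def)
      qed
      show "(\<forall>y. psg (q, i') y = 1) \<or> (\<forall>w\<in>F. length (filter (\<lambda>y. snd y = q) w) \<le> 1)"
      proof (cases "q < m")
        case True
        then show ?thesis using psg_even[OF _ i(2)] by blast
      next
        case False
        then show ?thesis using fam_nr[OF F(1)] unfolding nr_def by (simp add: not_less)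
      qed
      show "nr (map ?f w)" if w: "w \<in> F" for w
        by (rule nr_map) (use fam_nr[OF F(1) w] i in \<open>auto split: if_splits\<close>)
      show "ixs w = ixs v" if wv: "w \<in> F" "v \<in> F" "length (filter (\<lambda>y. snd y = q) w) = length (filter (\<lambda>y. snd y = q) v)"
        "ixs (map ?f w) = ixs (map ?f v)" for w v
      proof -
        have f: "snd (?f y) = (if snd y = q then i' else snd y)" "fst (?f y) = fst y" for y by simp_all
        have u: "image_mset (\<lambda>a. if a = q then i' else a) (image_mset snd (mset w)) = image_mset (\<lambda>a. if a = q then i' else a) (image_mset snd (mset v))"
          and s: "image_mset fst (mset w) = image_mset fst (mset v)"
          using wv(4) by (simp_all add: ixs_def image_mset.compositionality comp_def f)
        show ?thesis using merge_inj[OF u wv(3)[unfolded filter_count]] s by (simp add: ixs_def)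
      qed
    qed auto
    then obtain F' c' where F': "fam L F' c'" "F' \<subseteq> map ?f ` F" by blast
    have "fst y = i \<and> snd y \<noteq> i \<and> (snd y < Suc q \<longrightarrow> snd y = i')" if w: "w \<in> F'" and y: "y \<in> set w" for w y
    proof -
      obtain v where v: "v \<in> F" "w = map ?f v" using F'(2) w by blast
      have "y \<in> ?f ` set v" using y unfolding v(2) set_map .
      then obtain z where z: "z \<in> set v" "y = ?f z" by blast
      then show ?thesis using F(2) v(1) i by (auto simp: less_Suc_eq)
    qed
    then show ?thesis using F'(1) by blast
  qed
qed

text \<open>When all upper and all lower indices agree, only one word of length \<open>L\<close> is
  left, so the family shrinks to a single power.\<close>

lemma exists_power:
  assumes "g \<in> tens m n L" "g \<in> KK L" "g \<notin> JJ L"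
  shows "\<exists>i<m. \<exists>i'<m. i \<noteq> i' \<and> ew (replicate L (i, i')) \<in> KK L"
proof -
  obtain i q where i: "i < m" and q: "q \<in> tv.span (ew ` nolow i L)" "q \<in> KK L" "q \<notin> JJ L"
    using exists_nolow[OF assms] by blast
  obtain F c where F: "fam L F c" "F \<subseteq> nolow i L" using exists_fam[OF q] by blast
  obtain F1 c1 where F1: "fam L F1 c1" "\<forall>w\<in>F1. \<forall>y\<in>set w. snd y \<noteq> i \<and> (fst y < d \<longrightarrow> fst y = i)"
    using uppers_equal[OF i F le_refl] by blast
  have F1': "\<forall>w\<in>F1. \<forall>y\<in>set w. fst y = i \<and> snd y \<noteq> i"
  proof (intro ballI)
    fix w y assume wy: "w \<in> F1" "y \<in> set w"
    then have "y \<in> I2" using fam_nr[OF F1(1)] by blast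
    then have "fst y < d" by (auto simp: I2_def)
    then show "fst y = i \<and> snd y \<noteq> i" using F1(2) wy by blast
  qed
  define i' where "i' = (if i = 0 then 1 else 0 :: nat)"
  have i': "i' < m" "i \<noteq> i'" using idx by (auto simp: i'_def)
  obtain F2 c2 where F2: "fam L F2 c2" "\<forall>w\<in>F2. \<forall>y\<in>set w. fst y = i \<and> snd y \<noteq> i \<and> (snd y < d \<longrightarrow> snd y = i')"
    using lowers_equal[OF i i' F1(1) F1' le_refl] by blast
  have rep: "w = replicate L (i, i')" if w: "w \<in> F2" for w
  proof (rule replicate_eqI)
    show "length w = L" using fam_nr[OF F2(1) w] by blast
    fix y assume y: "y \<in> set w"
    then have "y \<in> I2" using fam_nr[OF F2(1) w] by blast
    then have "snd y < d" by (auto simp: I2_def)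
    then show "y = (i, i')" using F2(2) w y by (simp add: prod_eq_iff)
  qed
  have "F2 \<noteq> {}" using F2(1) by (simp add: fam_def)
  then have E: "F2 = {replicate L (i, i')}" using rep by blast
  have c: "c2 (replicate L (i, i')) \<noteq> 0" "tscale (c2 (replicate L (i, i'))) (ew (replicate L (i, i'))) \<in> KK L"
    using F2(1) unfolding E by (simp_all add: fam_def)
  have "tscale (1 / c2 (replicate L (i, i'))) (tscale (c2 (replicate L (i, i'))) (ew (replicate L (i, i')))) \<in> KK L"
    by (rule tv.subspace_scale[OF KK_s c(2)])
  then have "ew (replicate L (i, i')) \<in> KK L" using c(1) by simp
  then show ?thesis using i i' by blast
qed

section \<open>Moving the power to every even root vector\<close>

lemma KK_D: "x \<in> I2 \<Longrightarrow> t \<in> KK L \<Longrightarrow> D x t \<in> KK L"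
  using md_D[of Kt x t L] Kt_D by blast

lemma power_move:
  assumes K: "ew (replicate L y) \<in> KK L" and x: "x \<in> I2" and y: "y \<in> I2" and z: "z \<in> I2" and ev: "\<forall>y. psg x y = 1"
    and D: "D x (e y) = tscale k (e z)" "k \<noteq> 0" "D x (e z) = 0"
  shows "ew (replicate L z) \<in> KK L"
proof -
  have "\<exists>c. c \<noteq> 0 \<and> (D x ^^ length (filter (\<lambda>_. True) (replicate L y))) (ew (replicate L y))
      = tscale c (ew (map (\<lambda>y. if True then z else y) (replicate L y)))"
    using D_power_ew[OF x, of "{y}" "\<lambda>_. True" "\<lambda>_. k" "\<lambda>_. z" "replicate L y"] y z D ev set_replicate_subset[of L y] by auto
  then obtain c where c: "c \<noteq> 0" "(D x ^^ L) (ew (replicate L y)) = tscale c (ew (replicate L z))"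
    by auto
  have "(D x ^^ q) (ew (replicate L y)) \<in> KK L" for q
    by (induction q) (use K KK_D[OF x] in simp_all)
  then have "tscale c (ew (replicate L z)) \<in> KK L" unfolding c(2)[symmetric] .
  then have "tscale (1 / c) (tscale c (ew (replicate L z))) \<in> KK L" by (rule tv.subspace_scale[OF KK_s])
  then show ?thesis using c(1) by simp
qed

lemma power_move_upper:
  assumes "ew (replicate L (i, i')) \<in> KK L" "i < m" "i' < m" "a < m" "i \<noteq> i'" "a \<noteq> i" "a \<noteq> i'"
  shows "ew (replicate L (a, i')) \<in> KK L"
proof -
  have I: "(a, i) \<in> I2" "(i, i') \<in> I2" "(a, i') \<in> I2" using assms by (auto simp: I2_def)
  show ?thesis
    by (rule power_move[OF assms(1) I, of 1]) (use assms psg_even D_e[OF I(1,2)] D_e[OF I(1,3)] in \<open>auto simp: br_def\<close>)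
qed

lemma power_move_lower:
  assumes "ew (replicate L (i, i')) \<in> KK L" "i < m" "i' < m" "b < m" "i \<noteq> i'" "b \<noteq> i" "b \<noteq> i'"
  shows "ew (replicate L (i, b)) \<in> KK L"
proof -
  have I: "(i', b) \<in> I2" "(i, i') \<in> I2" "(i, b) \<in> I2" using assms by (auto simp: I2_def)
  show ?thesis
    by (rule power_move[OF assms(1) I, of "-1"])
      (use assms psg_even D_e[OF I(1,2)] D_e[OF I(1,3)] in \<open>auto simp: br_def\<close>)
qed

lemma all_powers:
  assumes K: "ew (replicate L (i, i')) \<in> KK L" "i < m" "i' < m" "i \<noteq> i'" and ab: "a < m" "b < m" "a \<noteq> b"
  shows "ew (replicate L (a, b)) \<in> KK L"
proof -
  note U = power_move_upper and V = power_move_lower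
  have bi: "ew (replicate L (i, c)) \<in> KK L" if "c < m" "c \<noteq> i" for c
    using V[OF K(1-3) that(1) K(4) that(2)] K(1) by (cases "c = i'") auto
  consider "b \<noteq> i" | "b = i" "a \<noteq> i'" | "b = i" "a = i'" by blast
  then show ?thesis
  proof cases
    case 1
    show ?thesis using U[OF bi[OF ab(2) 1] K(2) ab(2) ab(1) 1[symmetric]] ab(3) bi[OF ab(2) 1] by (cases "a = i") auto
  next
    case 2
    have "ew (replicate L (a, i')) \<in> KK L" by (rule U[OF K(1-3) ab(1) K(4)]) (use 2 ab in auto)
    then show ?thesis using V[of L a i' i] K 2 ab by auto
  next
    case 3
    \<comment> \<open>The pair cannot be reversed by changing one index at a time without making
      both equal, so the way leads through a third even index.\<close>
    have "\<exists>c<m. c \<noteq> i \<and> c \<noteq> i'"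
    proof -
      have "c \<in> {0, 1, 2} \<longrightarrow> c < m" for c using idx by auto
      moreover have "\<exists>c\<in>{0, 1, 2}. c \<noteq> i \<and> c \<noteq> i'" by auto
      ultimately show ?thesis by blast
    qed
    then obtain c where c: "c < m" "c \<noteq> i" "c \<noteq> i'" by blast
    have 1: "ew (replicate L (c, i')) \<in> KK L" by (rule U[OF K(1-3) c(1) K(4)]) (use c in auto)
    have 2: "ew (replicate L (c, i)) \<in> KK L" by (rule V[OF 1 c(1) K(3) K(2)]) (use c K in auto)
    have "ew (replicate L (i', i)) \<in> KK L" by (rule U[OF 2 c(1) K(2) K(3)]) (use c K in auto)
    then show ?thesis using 3 by simp
  qed
qed

section \<open>Long words and finite codimension\<close>

lemma front_many:
  "set w \<subseteq> I2 \<Longrightarrow> k \<le> length (filter ((=) x) w) \<Longrightarrow>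
    \<exists>v. set v \<subseteq> I2 \<and> length w = k + length v \<and> eqm (length w) (ew w) (ew (replicate k x @ v))"
proof (induction k arbitrary: w)
  case 0 then show ?case using eqm_refl by (intro exI[of _ w]) simp
next
  case (Suc k)
  then have "filter ((=) x) w \<noteq> []" by auto
  then have "x \<in> set w" by (auto simp: filter_empty_conv)
  then obtain u where u: "mset w = add_mset x (mset u)" "eqm (length w) (ew w) (ew (x # u))"
    using move_front[OF Suc.prems(1)] by blast
  note su = move_front_I2[OF Suc.prems(1) u(1)]
  have "size (filter_mset ((=) x) (mset w)) = Suc (size (filter_mset ((=) x) (mset u)))" using u(1) by simp
  then have "length (filter ((=) x) w) = Suc (length (filter ((=) x) u))" by (simp only: mset_filter[symmetric] size_mset)
  then have "k \<le> length (filter ((=) x) u)" using Suc.prems(2) by simp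
  then obtain v where v: "set v \<subseteq> I2" "length u = k + length v" "eqm (length u) (ew u) (ew (replicate k x @ v))"
    using Suc.IH[OF su(1)] by blast
  have "eqm (length w) (ew (x # u)) (ew (replicate (Suc k) x @ v))"
    using eqm_Cons[of "replicate k x @ v" u x] v su by simp
  then have "eqm (length w) (ew w) (ew (replicate (Suc k) x @ v))" by (rule eqm_trans[OF u(2)])
  then show ?case using v(1,2) su(3) by (intro exI[of _ v]) simp
qed

text \<open>With both indices even, the equal letters contain the \<open>k\<close>-th power.
  Otherwise an odd index repeats above or below; the surplus 2 in the hypothesis guarantees a
  repetition there even for \<open>k = 0\<close>.\<close>

lemma offdiag_KK:
  assumes pw: "\<And>a b. a < m \<Longrightarrow> b < m \<Longrightarrow> a \<noteq> b \<Longrightarrow> ew (replicate k (a, b)) \<in> KK k"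
    and w: "set w \<subseteq> I2" and x: "x = (a, b)" "a \<noteq> b" and k: "k + 2 \<le> length (filter ((=) x) w)"
  shows "ew w \<in> KK (length w)"
proof (cases "a < m \<and> b < m")
  case True
  have "k \<le> length (filter ((=) x) w)" using k by simp
  then obtain v where v: "set v \<subseteq> I2" "length w = k + length v" "eqm (length w) (ew w) (ew (replicate k x @ v))"
    using front_many[OF w] by blast
  have "ew (replicate k x) * ew v \<in> KK (length w)" unfolding v(2) x(1)
    using True x(2) by (intro md_mult[OF Kt v(1)] pw) auto
  then show ?thesis using eqm_KK[OF v(3)] by (simp add: ew_append)
next
  case False
  have "length (filter ((=) x) w) \<le> length (filter (\<lambda>y. fst y = a) w)" "length (filter ((=) x) w) \<le> length (filter (\<lambda>y. snd y = b) w)"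
    by (intro length_filter_mono; use x in auto)+
  then have "\<not> length (filter (\<lambda>y. fst y = a) w) \<le> 1" "\<not> length (filter (\<lambda>y. snd y = b) w) \<le> 1" using k by simp_all
  then have "\<not> nr w" unfolding nr_def using False by (auto simp: not_less)
  then show ?thesis using not_nr_JJ[OF w] JJ_KK by blast
qed

text \<open>Two equal diagonal letters can be traded for off-diagonal ones, as \<open>e\<^sub>a\<^sub>a\<close> is minus the sum of the other
  \<open>e\<^sub>p\<^sub>p\<close> and \<open>e\<^sub>a\<^sub>a e\<^sub>p\<^sub>p\<close> is equivalent to \<open>e\<^sub>a\<^sub>p e\<^sub>p\<^sub>a\<close>.\<close>

lemma long_word_KK:
  assumes pw: "\<And>a b. a < m \<Longrightarrow> b < m \<Longrightarrow> a \<noteq> b \<Longrightarrow> ew (replicate k (a, b)) \<in> KK k"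
  shows "set w \<subseteq> I2 \<Longrightarrow> length w > d * d * (k + 1) \<Longrightarrow> ew w \<in> KK (length w)"
proof (induction "length (filter (\<lambda>y. fst y = snd y) w)" arbitrary: w rule: less_induct)
  case less
  \<comment> \<open>Pigeonhole: there are \<open>d * d\<close> letters, so a word longer than
    \<open>d * d * (k + 1)\<close> uses one of them at least \<open>k + 2\<close> times.\<close>
  have "\<exists>x\<in>I2. k + 2 \<le> length (filter ((=) x) w)"
  proof (rule ccontr)
    assume a: "\<not> (\<exists>x\<in>I2. k + 2 \<le> length (filter ((=) x) w))"
    have "length w = (\<Sum>x\<in>I2. count_list w x)" by (rule sum_count_set[symmetric]) (use less.prems in simp_all)
    also have "\<dots> \<le> (\<Sum>x\<in>I2. k + 1)"
      by (rule sum_mono) (use a in \<open>force simp: count_list_eq_length_filter\<close>)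
    also have "\<dots> = d * d * (k + 1)" by (simp add: I2_def card_cartesian_product)
    finally show False using less.prems(2) by simp
  qed
  then obtain a b where x: "(a, b) \<in> I2" "k + 2 \<le> length (filter ((=) (a, b)) w)" by auto
  show ?case
  proof (cases "a = b")
    case False
    then show ?thesis using offdiag_KK[OF pw less.prems(1) refl _ x(2)] by blast
  next
    case True
    have "2 \<le> length (filter ((=) (a, a)) w)" using x(2) True by simp
    then obtain v where v: "mset w = add_mset (a, a) (add_mset (a, a) (mset v))"
        "eqm (length w) (ew w) (ew ((a, a) # (a, a) # v))"
      using front2[OF less.prems(1), of "(=) (a, a)"] by auto
    have sv: "set v \<subseteq> I2" "length w = Suc (Suc (length v))"
      using mset_eq_setD[of w "(a, a) # (a, a) # v"] mset_eq_length[of w "(a, a) # (a, a) # v"] v(1) less.prems(1) by auto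
    have a: "a < d" using x(1) True by (simp add: I2_def)
    have fw: "length (filter (\<lambda>y. fst y = snd y) w) = Suc (Suc (length (filter (\<lambda>y. fst y = snd y) v)))"
    proof -
      have "size (filter_mset (\<lambda>y. fst y = snd y) (mset w)) = Suc (Suc (size (filter_mset (\<lambda>y. fst y = snd y) (mset v))))"
        using v(1) by simp
      then show ?thesis by (simp only: mset_filter[symmetric] size_mset)
    qed
    have p: "ew ((a, a) # (p, p) # v) \<in> KK (length w)" if p: "p < d" "p \<noteq> a" for p
    proof -
      have I: "set ((a, p) # (p, a) # v) \<subseteq> I2" "set ((a, a) # (p, p) # v) \<subseteq> I2" using sv a p by (auto simp: I2_def)
      have "length (filter (\<lambda>y. fst y = snd y) ((a, p) # (p, a) # v)) < length (filter (\<lambda>y. fst y = snd y) w)"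
        using p fw by simp
      then have "ew ((a, p) # (p, a) # v) \<in> KK (length ((a, p) # (p, a) # v))"
        using less.prems(2) sv(2) by (intro less.hyps I) simp_all
      then have "ew ((a, p) # (p, a) # v) \<in> KK (length w)" using sv(2) by simp
      moreover have "ixs ((a, a) # (p, p) # v) = ixs ((a, p) # (p, a) # v)" by (simp add: ixs_def add_mset_commute)
      then have "eqm (length w) (ew ((a, a) # (p, p) # v)) (ew ((a, p) # (p, a) # v))"
        using ixs_eqm[OF I] sv(2) by simp
      ultimately show ?thesis using eqm_KK by blast
    qed
    have "(\<Sum>p<d. ew ((a, a) # (p, p) # v)) = e (a, a) * ((\<Sum>p<d. e (p, p)) * ew v)"
      by (simp add: ew_Cons sum_distrib_left sum_distrib_right mult.assoc)
    then have "(\<Sum>p<d. ew ((a, a) # (p, p) # v)) = 0" by (simp add: sum_e_diag)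
    then have "ew ((a, a) # (a, a) # v) + (\<Sum>p\<in>{..<d} - {a}. ew ((a, a) # (p, p) # v)) = 0"
      using a by (simp add: sum.remove[of _ a])
    then have eq: "ew ((a, a) # (a, a) # v) = - (\<Sum>p\<in>{..<d} - {a}. ew ((a, a) # (p, p) # v))"
      by (simp add: eq_neg_iff_add_eq_0)
    have "(\<Sum>p\<in>{..<d} - {a}. ew ((a, a) # (p, p) # v)) \<in> KK (length w)"
      by (rule tv.subspace_sum[OF KK_s]) (use p in blast)
    then have "ew ((a, a) # (a, a) # v) \<in> KK (length w)" unfolding eq by (rule tv.subspace_neg[OF KK_s])
    then show ?thesis using eqm_KK[OF v(2)] by blast
  qed
qed

text \<open>By induction on length every word reduces modulo \<open>Kt\<close> to words of bounded
  length, of which there are finitely many.\<close>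

lemma powers_contradiction:
  assumes pw: "\<And>a b. a < m \<Longrightarrow> b < m \<Longrightarrow> a \<noteq> b \<Longrightarrow> ew (replicate k (a, b)) \<in> KK k"
  shows False
proof -
  let ?W = "{w. set w \<subseteq> I2 \<and> length w \<le> d * d * (k + 1)}"
  let ?R = "{t. \<exists>u\<in>tv.span (ew ` ?W). t - u \<in> Kt}"
  have R: "tv.subspace ?R" by (rule subspace_mod[OF tv.subspace_span Kt_s])
  have KR: "t \<in> ?R" if "t \<in> Kt" for t
    using that tv.span_zero[of "ew ` ?W"] by force
  have word: "set w \<subseteq> I2 \<Longrightarrow> ew w \<in> ?R" for w
  proof (induction "length w" arbitrary: w rule: less_induct)
    case less
    show ?case
    proof (cases "length w \<le> d * d * (k + 1)")
      case True
      then have "ew w \<in> tv.span (ew ` ?W)" using less.prems by (intro tv.span_base) blast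
      then show ?thesis using tv.subspace_0[OF Kt_s] by force
    next
      case False
      then have "ew w \<in> KK (length w)" using long_word_KK[OF pw less.prems] by simp
      then obtain t v where tv: "ew w = t + v" "t \<in> Kt" "v \<in> Vb (length w)" unfolding md_def by blast
      have "tens m n j \<subseteq> ?R" if "j < length w" for j
        unfolding tens_ew by (intro tv.span_minimal[OF _ R]) (use less.hyps that in blast)
      then have "Vb (length w) \<subseteq> ?R" unfolding Vb_def by (intro tv.span_minimal[OF _ R]) blast
      then have "t + v \<in> ?R" using KR[OF tv(2)] tv(3) by (intro tv.subspace_add[OF R]) blast+
      then show ?thesis unfolding tv(1) .
    qed
  qed
  have "TT \<subseteq> ?R" unfolding TT_def by (rule tv.span_minimal[OF _ R]) (use word in blast)
  moreover have "finite (ew ` ?W)" by (intro finite_imageI finite_lists_length_le finite_I2)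
  moreover have "ew ` ?W \<subseteq> TT" using ew_TT by blast
  ultimately show False using finite_codim_contradiction[of "ew ` ?W"] by blast
qed

text \<open>An element of \<open>Kt\<close> outside \<open>Jt\<close> in the smallest possible
  filtration step has a leading term that is no leading term of \<open>Jt\<close>; this is what
  \<open>exists_power\<close> needs.\<close>

lemma Kt_eq: "Kt = Jt"
proof (rule ccontr)
  assume "Kt \<noteq> Jt"
  then obtain t where t: "t \<in> Kt" "t \<notin> Jt" using Jt_Kt by blast
  let ?P = "\<lambda>k. \<exists>f. f \<in> Kt \<and> f \<in> Vb k \<and> f \<notin> Jt"
  have "TT \<subseteq> (\<Union>k. Vb k)"
  proof -
    have u: "tv.subspace (\<Union>k. Vb k)"
      unfolding tv.subspace_def
    proof (intro conjI ballI allI)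
      show "0 \<in> (\<Union>k. Vb k)" using tv.subspace_0[OF subspace_Vb] by blast
      fix x y assume "x \<in> (\<Union>k. Vb k)" "y \<in> (\<Union>k. Vb k)"
      then obtain k l where "x \<in> Vb k" "y \<in> Vb l" by blast
      then have "x \<in> Vb (max k l)" "y \<in> Vb (max k l)" using Vb_mono[of k "max k l"] Vb_mono[of l "max k l"] by auto
      then show "x + y \<in> (\<Union>k. Vb k)" using tv.subspace_add[OF subspace_Vb] by blast
    next
      fix c x assume "x \<in> (\<Union>k. Vb k)"
      then show "tscale c x \<in> (\<Union>k. Vb k)" using tv.subspace_scale[OF subspace_Vb] by blast
    qed
    have "ew w \<in> (\<Union>k. Vb k)" if "set w \<subseteq> I2" for w
      using ew_tens[OF that] tens_Vb[of "length w" "Suc (length w)"] by blast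
    then show ?thesis unfolding TT_def by (intro tv.span_minimal[OF _ u]) blast
  qed
  then have "\<exists>k. ?P k" using t Kt_TT by blast
  then have P: "?P (LEAST k. ?P k)" by (rule LeastI_ex)
  \<comment> \<open>\<open>Vb k1\<close> contains only degrees below \<open>k1\<close>, so the
    leading term of \<open>f\<close> has degree \<open>k1 - 1\<close>, called \<open>k\<close> from
    here on.\<close>
  define k1 where "k1 = (LEAST k. ?P k)"
  obtain f where f: "f \<in> Kt" "f \<in> Vb k1" "f \<notin> Jt" using P unfolding k1_def by blast
  have minimal: "g \<in> Jt" if "g \<in> Kt" "g \<in> Vb k" "k < k1" for g k
    using not_less_Least[of k ?P] that unfolding k1_def by blast
  have "k1 \<noteq> 0"
  proof
    assume "k1 = 0"
    then have "f = 0" using f(2) by (simp add: Vb_def)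
    then show False using f(3) tv.subspace_0[OF Jt_s] by simp
  qed
  then obtain k where k: "k1 = Suc k" by (cases k1) auto
  have "Vb (Suc k) = tv.span ((\<Union>j<k. tens m n j) \<union> tens m n k)"
    unfolding Vb_def lessThan_Suc by (simp add: Un_commute)
  then have "f \<in> {x + y | x y. x \<in> Vb k \<and> y \<in> tv.span (tens m n k)}"
    using f(2) unfolding k tv.span_Un Vb_def by simp
  then obtain v g where vg: "f = v + g" "v \<in> Vb k" "g \<in> tens m n k"
    unfolding tv.span_eq_iff[THEN iffD2, OF subspace_tens] by blast
  have "f + (- v) \<in> KK k" by (rule mdI[OF f(1) tv.subspace_neg[OF subspace_Vb vg(2)]])
  then have gK: "g \<in> KK k" by (simp add: vg(1))
  \<comment> \<open>If the leading term came from \<open>j\<close> in \<open>Jt\<close>, then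
    \<open>f - j\<close> would lie one filtration step lower, hence in \<open>Jt\<close> by
    minimality, and with it \<open>f\<close>.\<close>
  have gJ: "g \<notin> JJ k"
  proof
    assume "g \<in> JJ k"
    then obtain j u where ju: "g = j + u" "j \<in> Jt" "u \<in> Vb k" unfolding md_def by blast
    have "f - j = v + u" by (simp add: vg(1) ju(1))
    then have V: "f - j \<in> Vb k" using tv.subspace_add[OF subspace_Vb vg(2) ju(3)] by simp
    have "f - j \<in> Kt" by (rule tv.subspace_diff[OF Kt_s f(1) subsetD[OF Jt_Kt ju(2)]])
    then have "f - j \<in> Jt" using minimal[OF _ V] k by simp
    then have "(f - j) + j \<in> Jt" using ju(2) by (rule tv.subspace_add[OF Jt_s])
    then show False using f(3) by simp
  qed
  obtain i i' where i: "i < m" "i' < m" "i \<noteq> i'" "ew (replicate k (i, i')) \<in> KK k"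
    using exists_power[OF vg(3) gK gJ] by blast
  show False by (rule powers_contradiction[OF all_powers[OF i(4) i(1-3)]])
qed

lemma K_joseph: "K = J_env m n (lambda_c m n)"
proof -
  \<comment> \<open>The summand \<open>EI\<close> of \<open>Jt\<close> disappears in the enveloping
    algebra.\<close>
  have "to_env m n ` Jt = to_env m n ` J_tensor m n lam"
  proof
    show "to_env m n ` J_tensor m n lam \<subseteq> to_env m n ` Jt" by (rule image_mono[OF Jt_incl(1)])
    show "to_env m n ` Jt \<subseteq> to_env m n ` J_tensor m n lam"
    proof
      fix u assume "u \<in> to_env m n ` Jt"
      then obtain a b where "u = to_env m n (a + b)" "a \<in> J_tensor m n lam" "b \<in> EI" unfolding Jt_def by blast
      moreover from this have "to_env m n (a + b) = to_env m n a" unfolding to_env_eq by simp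
      ultimately show "u \<in> to_env m n ` J_tensor m n lam" by simp
    qed
  qed
  then have "to_env m n ` Kt = J_env m n lam" by (simp only: Kt_eq J_env_def)
  then have "K = J_env m n lam" by (rule trans[OF K_eq])
  then show ?thesis by (simp only: lam_eq)
qed

end

theorem theorem3p2:
  fixes m n :: nat and K :: "tensor set set"
  assumes "m > n + 2"
    and "ideal K (env_alg m n)"
    and "infinite_codim m n K"
    and "tau m ` K = K"
    and "(gr m n K \<inter> sym_pow m n 2) <+>\<^bsub>sym_alg m n\<^esub> to_sym m n ` cartan_square m n = sym_pow m n 2"
    and "(gr m n K \<inter> sym_pow m n 2) \<inter> to_sym m n ` cartan_square m n = {\<zero>\<^bsub>sym_alg m n\<^esub>}"
  shows "K = J_env m n (lambda_c m n)"
proof -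
  interpret joseph m n K
    by (intro joseph.intro sl_super.intro joseph_axioms.intro assms)
  show ?thesis by (rule K_joseph)
qed

end
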